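(* Consider the asymmetric auto-regressive model on a Galton-Watson tree described in the context, assumed super-critical ($m=2p_{1,0}+p_0+p_1>1$) and with $p_0,p_1>0$, and let $W=\lim_{q\to\infty}m^{-q}|\mathbb{G}_q^*|$ (limit a.s. and in $L^2$). Assume that the distribution of the ancestor $X_\emptyset$ has finite moments of all orders. Then, as $n\to\infty$, $$\mathbf{1}_{\{|\mathbb{G}_n^*|>0\}}|\mathbb{T}_n^*|^{1/2}(\hat\theta^n-\theta)\quad\text{converges in law to}\quad\mathbf{1}_{\{W\ne0\}}G_{11},$$ where $G_{11}$ is an $11$-dimensional random vector, independent of $W$, with law $\mathcal{N}(0,\Sigma)$, where $$\Sigma=\begin{pmatrix}\sigma^2K/p_{1,0}&\rho\sigma^2K/p_{1,0}&0&0&0\\ \rho\sigma^2K/p_{1,0}&\sigma^2K/p_{1,0}&0&0&0\\0&0&\sigma_0^2K/p_0&0&0\\0&0&0&\sigma_1^2K/p_1&0\\0&0&0&0&\Gamma\end{pmatrix}$$ with $$K=(\mu_2-\mu_1^2)^{-1}\begin{pmatrix}1&-\mu_1\\-\mu_1&\mu_2\end{pmatrix},\qquad\Gamma=\begin{pmatrix}p_{1,0}(1-p_{1,0})&-p_0p_{1,0}&-p_1p_{1,0}\\-p_0p_{1,0}&p_0(1-p_0)&-p_0p_1\\-p_1p_{1,0}&-p_0p_1&p_1(1-p_1)\end{pmatrix}.$$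
   Context: Tree: $\mathbb{G}_0=\{\emptyset\}$, $\mathbb{G}_k=\{0,1\}^k$ for $k\ge1$, $\mathbb{T}_r=\bigcup_{0\le k\le r}\mathbb{G}_k$, $\mathbb{T}=\bigcup_{k\ge0}\mathbb{G}_k$; the daughters of $i\in\mathbb{T}$ are $i0$ and $i1$. Model: $S=\mathbb{R}$, $\bar S=\mathbb{R}\cup\{\partial\}$, $\partial$ being the value of dead or non-existing cells. Parameters: $\alpha_0,\alpha_1,\alpha_0',\alpha_1'\in(-1,1)$; $\beta_0,\beta_1,\beta_0',\beta_1'\in\mathbb{R}$; $\sigma,\sigma_0,\sigma_1>0$; $\rho\in(-1,1)$; $p_{1,0},p_0,p_1\ge0$ with $p_{1,0}+p_0+p_1\le1$. $(X_i,i\in\mathbb{T})$ is a $\bar S$-valued process with $X_\emptyset\in\mathbb{R}$ such that, for each $k\ge 0$, conditionally on $(X_j)_{j\in\mathbb{T}_k}$, the pairs $(X_{i0},X_{i1})$, $i\in\mathbb{G}_k$, are independent, $(X_{i0},X_{i1})$ having law $P^*(X_i,\cdot)$, where $P^*(\partial,\cdot)=\delta_{(\partial,\partial)}$ and, for $x\in\mathbb{R}$, $P^*(x,\cdot)$ is the law of: with probability $p_{1,0}$, $(\alpha_0x+\beta_0+\varepsilon_0,\ \alpha_1x+\beta_1+\varepsilon_1)$ with $(\varepsilon_0,\varepsilon_1)$ centered bivariate Gaussian with covariance matrix $\sigma^2\begin{pmatrix}1&\rho\\\rho&1\end{pmatrix}$; with probability $p_0$, $(\alpha_0'x+\beta_0'+\varepsilon_0',\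 \partial)$ with $\varepsilon_0'\sim\mathcal{N}(0,\sigma_0^2)$; with probability $p_1$, $(\partial,\ \alpha_1'x+\beta_1'+\varepsilon_1')$ with $\varepsilon_1'\sim\mathcal{N}(0,\sigma_1^2)$; with probability $1-p_{1,0}-p_0-p_1$, $(\partial,\partial)$. Let $\mathbb{T}^*=\{i:X_i\ne\partial\}$, $J^*=J\cap\mathbb{T}^*$, $|J|$ the cardinality of $J$, and $\theta=(\alpha_0,\beta_0,\alpha_1,\beta_1,\alpha_0',\beta_0',\alpha_1',\beta_1',p_{1,0},p_0,p_1)$. Estimators (maximum likelihood from $\mathbb{T}_{n+1}^*$): let $\mathbb{T}_n^{1,0}$, $\mathbb{T}_n^0$, $\mathbb{T}_n^1$ be the sets of $i\in\mathbb{T}_n^*$ such that, respectively, both daughters are alive, only $i0$ is alive, only $i1$ is alive. For a finite set $J$ and numbers $(a_i)$ write $\langle a\rangle_J=|J|^{-1}\sum_{i\in J}a_i$. For $\delta\in\{0,1\}$, with $J=\mathbb{T}_n^{1,0}$, $$\hat\alpha_\delta^n=\frac{\langle X_iX_{i\delta}\rangle_J-\langle X_i\rangle_J\langle X_{i\delta}\rangle_J}{\langle X_i^2\rangle_J-\langle X_i\rangle_J^2},\qquad\hat\beta_\delta^n=\langle X_{i\delta}\rangle_J-\hat\alpha_\delta^n\langle X_i\rangle_J;$$ $\hat\alpha_\delta'^n,\hat\beta_\delta'^n$ are given by the same formulas with $J=\mathbb{T}_n^\delta$; $\hat p_{1,0}^n=|\mathbb{T}_n^{1,0}|/|\mathbb{T}_n^*|$,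 $\hat p_\delta^n=|\mathbb{T}_n^\delta|/|\mathbb{T}_n^*|$. $\hat\theta^n=(\hat\alpha_0^n,\hat\beta_0^n,\hat\alpha_1^n,\hat\beta_1^n,\hat\alpha_0'^n,\hat\beta_0'^n,\hat\alpha_1'^n,\hat\beta_1'^n,\hat p_{1,0}^n,\hat p_0^n,\hat p_1^n)$. An estimator whose formula is undefined (empty index set or zero denominator) is given the value $0$. Constants: with $m=2p_{1,0}+p_0+p_1$, put $\bar\alpha=\frac1m[p_{1,0}(\alpha_0+\alpha_1)+p_0\alpha_0'+p_1\alpha_1']$, $\bar\beta=\frac1m[p_{1,0}(\beta_0+\beta_1)+p_0\beta_0'+p_1\beta_1']$, $\overline{\alpha^2}=\frac1m[p_{1,0}(\alpha_0^2+\alpha_1^2)+p_0\alpha_0'^2+p_1\alpha_1'^2]$, $\overline{\beta^2}=\frac1m[p_{1,0}(\beta_0^2+\beta_1^2)+p_0\beta_0'^2+p_1\beta_1'^2]$, $\overline{\alpha\beta}=\frac1m[p_{1,0}(\alpha_0\beta_0+\alpha_1\beta_1)+p_0\alpha_0'\beta_0'+p_1\alpha_1'\beta_1']$, $\overline{\sigma^2}=\frac1m[2p_{1,0}\sigma^2+p_0\sigma_0^2+p_1\sigma_1^2]$, and $$\mu_1=\frac{\bar\beta}{1-\bar\alpha},\qquad\mu_2=\frac{2\overline{\alpha\beta}\,\bar\beta/(1-\bar\alpha)+\overline{\beta^2}+\overline{\sigma^2}}{1-\overline{\alpha^2}}.$$ In $\Sigma$, $K$ is a $2\times2$ block and $\Gamma$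 a $3\times3$ block. *)

theory Defs
  imports "HOL-Probability.Probability"
begin

section \<open>The binary tree and the state space\<close>

text \<open>The node \<open>i\<close> is a word over \<open>{0,1}\<close>, with \<open>False\<close> for 0 and \<open>True\<close> for 1. Its daughters are
  \<open>i @ [False]\<close> and \<open>i @ [True]\<close>.\<close>

definition gen :: "nat \<Rightarrow> bool list set" where
  "gen k = {i. length i = k}"

definition tree_upto :: "nat \<Rightarrow> bool list set" where
  "tree_upto r = {i. length i \<le> r}"

text \<open>The state space is the real line with a cemetery point, which is \<open>None\<close>. A set is measurable
  iff its real part is Borel.\<close>

definition Sbar :: "real option measure" where
  "Sbar = sigma UNIV {A. Some -` A \<in> sets borel}"

text \<open>Real value of a cell. The value at the cemetery point is junk: the estimators below evaluate
  \<open>cell_val\<close> only at living cells.\<close>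

definition cell_val :: "real option \<Rightarrow> real" where
  "cell_val s = (case s of None \<Rightarrow> 0 | Some x \<Rightarrow> x)"


section \<open>The asymmetric bifurcating auto-regressive model\<close>

text \<open>A pair of parameters indexed by \<open>\<delta> \<in> {0,1}\<close> is a function on \<open>bool\<close>. The primed fields are the
  parameters used when exactly one daughter survives: \<open>sd'\<close> is \<open>(\<sigma>\<^sub>0, \<sigma>\<^sub>1)\<close>, whereas \<open>sd\<close> is \<open>\<sigma>\<close>.
  \<open>p_both\<close> is \<open>p\<^sub>1\<^sub>,\<^sub>0\<close>, and \<open>p_only\<close> is \<open>(p\<^sub>0, p\<^sub>1)\<close>.\<close>

record bar_params =
  alpha :: "bool \<Rightarrow> real"
  beta :: "bool \<Rightarrow> real"
  alpha' :: "bool \<Rightarrow> real"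
  beta' :: "bool \<Rightarrow> real"
  sd :: real
  sd' :: "bool \<Rightarrow> real"
  rho :: real
  p_both :: real
  p_only :: "bool \<Rightarrow> real"

definition admissible :: "bar_params \<Rightarrow> bool" where
  "admissible P \<longleftrightarrow>
     (\<forall>\<delta>. alpha P \<delta> \<in> {-1<..<1} \<and> alpha' P \<delta> \<in> {-1<..<1}) \<and>
     sd P > 0 \<and> (\<forall>\<delta>. sd' P \<delta> > 0) \<and> rho P \<in> {-1<..<1} \<and>
     p_both P \<ge> 0 \<and> (\<forall>\<delta>. p_only P \<delta> \<ge> 0) \<and>
     p_both P + p_only P False + p_only P True \<le> 1"

text \<open>The centered Gaussian law on the plane with covariance matrix
  \<open>s\<^sup>2 * ((1, r), (r, 1))\<close>, for \<open>s > 0\<close> and \<open>-1 < r < 1\<close>, given by its density.\<close>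

definition bivariate_normal :: "real \<Rightarrow> real \<Rightarrow> (real \<times> real) measure" where
  "bivariate_normal s r =
     density lborel (\<lambda>(x, y). ennreal
       (1 / (2 * pi * s\<^sup>2 * sqrt (1 - r\<^sup>2)) *
        exp (- (x\<^sup>2 - 2 * r * x * y + y\<^sup>2) / (2 * s\<^sup>2 * (1 - r\<^sup>2)))))"

abbreviation centered_normal :: "real \<Rightarrow> real measure" where
  "centered_normal s \<equiv> density lborel (\<lambda>x. ennreal (normal_density 0 s x))"

fun Pstar :: "bar_params \<Rightarrow> real option \<Rightarrow> (real option \<times> real option) set \<Rightarrow> real" where
  "Pstar P None A = indicator A (None, None)"
| "Pstar P (Some x) A =
     p_both P * measure (bivariate_normal (sd P) (rho P))
       {(e0, e1). (Some (alpha P False * x + beta P False + e0),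
                   Some (alpha P True * x + beta P True + e1)) \<in> A}
   + p_only P False * measure (centered_normal (sd' P False))
       {e. (Some (alpha' P False * x + beta' P False + e), None) \<in> A}
   + p_only P True * measure (centered_normal (sd' P True))
       {e. (None, Some (alpha' P True * x + beta' P True + e)) \<in> A}
   + (1 - p_both P - p_only P False - p_only P True) * indicator A (None, None)"

text \<open>The sigma-algebra generated by the cells of the first generations, up to \<open>k\<close>.\<close>

definition past :: "'a measure \<Rightarrow> (bool list \<Rightarrow> 'a \<Rightarrow> real option) \<Rightarrow> nat \<Rightarrow> 'a measure" where
  "past M X k =
     sigma (space M) (\<Union>j\<in>tree_upto k. {X j -` A \<inter> space M | A. A \<in> sets Sbar})"

text \<open>The last clause is the Markov property: given the past up to generation \<open>k\<close>, the pairs of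
  daughters of the cells of generation \<open>k\<close> are independent, with laws \<open>P*(X\<^sub>i, .)\<close>.\<close>

definition bar_process ::
    "bar_params \<Rightarrow> 'a measure \<Rightarrow> (bool list \<Rightarrow> 'a \<Rightarrow> real option) \<Rightarrow> bool" where
  "bar_process P M X \<longleftrightarrow>
     (\<forall>i. X i \<in> measurable M Sbar) \<and>
     (AE \<omega> in M. X [] \<omega> \<noteq> None) \<and>
     (\<forall>k A. (\<forall>i\<in>gen k. A i \<in> sets (Sbar \<Otimes>\<^sub>M Sbar)) \<longrightarrow>
        (AE \<omega> in M.
           real_cond_exp M (past M X k)
             (\<lambda>\<omega>. \<Prod>i\<in>gen k. indicator (A i) (X (i @ [False]) \<omega>, X (i @ [True]) \<omega>)) \<omega>
           = (\<Prod>i\<in>gen k. Pstar P (X i \<omega>) (A i))))"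


section \<open>Estimators\<close>

text \<open>Here \<open>x\<close> is a realisation of the whole process.\<close>

definition gen_alive :: "(bool list \<Rightarrow> real option) \<Rightarrow> nat \<Rightarrow> bool list set" where
  "gen_alive x k = {i \<in> gen k. x i \<noteq> None}"

definition tree_alive :: "(bool list \<Rightarrow> real option) \<Rightarrow> nat \<Rightarrow> bool list set" where
  "tree_alive x n = {i \<in> tree_upto n. x i \<noteq> None}"

definition tree_both :: "(bool list \<Rightarrow> real option) \<Rightarrow> nat \<Rightarrow> bool list set" where
  "tree_both x n = {i \<in> tree_alive x n. x (i @ [False]) \<noteq> None \<and> x (i @ [True]) \<noteq> None}"

definition tree_only :: "bool \<Rightarrow> (bool list \<Rightarrow> real option) \<Rightarrow> nat \<Rightarrow> bool list set" where
  "tree_only \<delta> x n = {i \<in> tree_alive x n. x (i @ [\<delta>]) \<noteq> None \<and> x (i @ [\<not> \<delta>]) = None}"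

definition avg :: "'i set \<Rightarrow> ('i \<Rightarrow> real) \<Rightarrow> real" where
  "avg J a = (\<Sum>i\<in>J. a i) / real (card J)"

text \<open>Undefined estimators are 0. Wherever this is not spelled out, it comes from \<open>a / 0 = 0\<close>:
  \<open>slope_est\<close> is 0 if \<open>J\<close> is empty or its denominator vanishes, and \<open>intercept_est\<close> is 0 if \<open>J\<close> is
  empty. If only the denominator of the slope vanishes, \<open>intercept_est\<close> uses the slope 0.\<close>

definition slope_est :: "(bool list \<Rightarrow> real option) \<Rightarrow> bool \<Rightarrow> bool list set \<Rightarrow> real" where
  "slope_est x \<delta> J =
     (avg J (\<lambda>i. cell_val (x i) * cell_val (x (i @ [\<delta>])))
        - avg J (\<lambda>i. cell_val (x i)) * avg J (\<lambda>i. cell_val (x (i @ [\<delta>]))))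
     / (avg J (\<lambda>i. (cell_val (x i))\<^sup>2) - (avg J (\<lambda>i. cell_val (x i)))\<^sup>2)"

definition intercept_est :: "(bool list \<Rightarrow> real option) \<Rightarrow> bool \<Rightarrow> bool list set \<Rightarrow> real" where
  "intercept_est x \<delta> J =
     avg J (\<lambda>i. cell_val (x (i @ [\<delta>]))) - slope_est x \<delta> J * avg J (\<lambda>i. cell_val (x i))"

definition theta_hat :: "(bool list \<Rightarrow> real option) \<Rightarrow> nat \<Rightarrow> real ^ 11" where
  "theta_hat x n = vector
     [slope_est x False (tree_both x n), intercept_est x False (tree_both x n),
      slope_est x True (tree_both x n), intercept_est x True (tree_both x n),
      slope_est x False (tree_only False x n), intercept_est x False (tree_only False x n),
      slope_est x True (tree_only True x n), intercept_est x True (tree_only True x n),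
      real (card (tree_both x n)) / real (card (tree_alive x n)),
      real (card (tree_only False x n)) / real (card (tree_alive x n)),
      real (card (tree_only True x n)) / real (card (tree_alive x n))]"

definition theta :: "bar_params \<Rightarrow> real ^ 11" where
  "theta P = vector
     [alpha P False, beta P False, alpha P True, beta P True,
      alpha' P False, beta' P False, alpha' P True, beta' P True,
      p_both P, p_only P False, p_only P True]"


section \<open>Constants and the asymptotic covariance matrix\<close>

definition mean_offspring :: "bar_params \<Rightarrow> real" where
  "mean_offspring P = 2 * p_both P + p_only P False + p_only P True"

definition offspring_avg :: "bar_params \<Rightarrow> (bool \<Rightarrow> real) \<Rightarrow> (bool \<Rightarrow> real) \<Rightarrow> real" where
  "offspring_avg P f g =
     (p_both P * (f False + f True) + p_only P False * g False + p_only P True * g True)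
     / mean_offspring P"

definition alpha_bar :: "bar_params \<Rightarrow> real" where
  "alpha_bar P = offspring_avg P (alpha P) (alpha' P)"

definition beta_bar :: "bar_params \<Rightarrow> real" where
  "beta_bar P = offspring_avg P (beta P) (beta' P)"

definition alpha2_bar :: "bar_params \<Rightarrow> real" where
  "alpha2_bar P = offspring_avg P (\<lambda>\<delta>. (alpha P \<delta>)\<^sup>2) (\<lambda>\<delta>. (alpha' P \<delta>)\<^sup>2)"

definition beta2_bar :: "bar_params \<Rightarrow> real" where
  "beta2_bar P = offspring_avg P (\<lambda>\<delta>. (beta P \<delta>)\<^sup>2) (\<lambda>\<delta>. (beta' P \<delta>)\<^sup>2)"

definition alphabeta_bar :: "bar_params \<Rightarrow> real" where
  "alphabeta_bar P = offspring_avg P (\<lambda>\<delta>. alpha P \<delta> * beta P \<delta>) (\<lambda>\<delta>. alpha' P \<delta> * beta' P \<delta>)"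

definition sigma2_bar :: "bar_params \<Rightarrow> real" where
  "sigma2_bar P = offspring_avg P (\<lambda>\<delta>. (sd P)\<^sup>2) (\<lambda>\<delta>. (sd' P \<delta>)\<^sup>2)"

definition mu1 :: "bar_params \<Rightarrow> real" where
  "mu1 P = beta_bar P / (1 - alpha_bar P)"

definition mu2 :: "bar_params \<Rightarrow> real" where
  "mu2 P = (2 * alphabeta_bar P * beta_bar P / (1 - alpha_bar P) + beta2_bar P + sigma2_bar P)
           / (1 - alpha2_bar P)"

definition asym_cov :: "bar_params \<Rightarrow> real ^ 11 ^ 11" where
  "asym_cov P =
    (let d = mu2 P - (mu1 P)\<^sup>2;
         k11 = 1 / d; k12 = - mu1 P / d; k22 = mu2 P / d;
         s = (sd P)\<^sup>2 / p_both P; r = rho P * s;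
         u = (sd' P False)\<^sup>2 / p_only P False;
         v = (sd' P True)\<^sup>2 / p_only P True;
         p = p_both P; p0 = p_only P False; p1 = p_only P True
     in vector
      [vector [s * k11, s * k12, r * k11, r * k12, 0, 0, 0, 0, 0, 0, 0],
       vector [s * k12, s * k22, r * k12, r * k22, 0, 0, 0, 0, 0, 0, 0],
       vector [r * k11, r * k12, s * k11, s * k12, 0, 0, 0, 0, 0, 0, 0],
       vector [r * k12, r * k22, s * k12, s * k22, 0, 0, 0, 0, 0, 0, 0],
       vector [0, 0, 0, 0, u * k11, u * k12, 0, 0, 0, 0, 0],
       vector [0, 0, 0, 0, u * k12, u * k22, 0, 0, 0, 0, 0],
       vector [0, 0, 0, 0, 0, 0, v * k11, v * k12, 0, 0, 0],
       vector [0, 0, 0, 0, 0, 0, v * k12, v * k22, 0, 0, 0],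
       vector [0, 0, 0, 0, 0, 0, 0, 0, p * (1-p), -p0 * p, -p1 * p],
       vector [0, 0, 0, 0, 0, 0, 0, 0, -p0 * p, p0 * (1-p0), -p0 * p1],
       vector [0, 0, 0, 0, 0, 0, 0, 0, -p1 * p, -p0 * p1, p1 * (1-p1)]])"


section \<open>The limit of the population size, Gaussian vectors, convergence in law\<close>

definition pop_ratio ::
    "bar_params \<Rightarrow> (bool list \<Rightarrow> 'a \<Rightarrow> real option) \<Rightarrow> nat \<Rightarrow> 'a \<Rightarrow> real" where
  "pop_ratio P X q \<omega> = real (card (gen_alive (\<lambda>i. X i \<omega>) q)) / mean_offspring P ^ q"

definition pop_limit :: "bar_params \<Rightarrow> (bool list \<Rightarrow> 'a \<Rightarrow> real option) \<Rightarrow> 'a \<Rightarrow> real" where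
  "pop_limit P X \<omega> = lim (\<lambda>q. pop_ratio P X q \<omega>)"

text \<open>\<open>G\<close> is a centered Gaussian vector with covariance matrix \<open>S\<close>: every linear combination
  \<open>t \<bullet> G\<close> is centered normal with variance \<open>t \<bullet> (S *v t)\<close>. The matrix may be singular, so the
  normal law may degenerate to the point mass at 0.\<close>

definition gaussian_vector :: "'a measure \<Rightarrow> ('a \<Rightarrow> real ^ 'n) \<Rightarrow> real ^ 'n ^ 'n \<Rightarrow> bool" where
  "gaussian_vector N G S \<longleftrightarrow>
     transpose S = S \<and> G \<in> borel_measurable N \<and>
     (\<forall>t. let v = t \<bullet> (S *v t) in
        (v = 0 \<and> (AE \<omega> in N. t \<bullet> G \<omega> = 0)) \<or>
        (v > 0 \<and> distributed N lborel (\<lambda>\<omega>. t \<bullet> G \<omega>) (normal_density 0 (sqrt v))))"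

text \<open>Independence of two random variables. The library's \<open>indep_var\<close> needs them to have values in
  the same type.\<close>

definition independent_rvs ::
    "'a measure \<Rightarrow> ('a \<Rightarrow> 'b::topological_space) \<Rightarrow> ('a \<Rightarrow> 'c::topological_space) \<Rightarrow> bool" where
  "independent_rvs N U V \<longleftrightarrow>
     U \<in> borel_measurable N \<and> V \<in> borel_measurable N \<and>
     prob_space.indep_set N
       {U -` A \<inter> space N | A. A \<in> sets borel} {V -` B \<inter> space N | B. B \<in> sets borel}"

definition converges_in_law ::
    "'a measure \<Rightarrow> (nat \<Rightarrow> 'a \<Rightarrow> real ^ 'n) \<Rightarrow> 'b measure \<Rightarrow> ('b \<Rightarrow> real ^ 'n) \<Rightarrow> bool" where
  "converges_in_law M Z N Y \<longleftrightarrow>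
     (\<forall>n. Z n \<in> borel_measurable M) \<and> Y \<in> borel_measurable N \<and>
     (\<forall>f :: real ^ 'n \<Rightarrow> real. continuous_on UNIV f \<longrightarrow> bounded (range f) \<longrightarrow>
        (\<lambda>n. \<integral>\<omega>. f (Z n \<omega>) \<partial>M) \<longlonglongrightarrow> (\<integral>\<omega>. f (Y \<omega>) \<partial>N))"

text \<open>\<open>N\<close> extends the probability space \<open>M\<close>: it may carry further randomness, and random variables
  on \<open>M\<close> are read on \<open>N\<close> through \<open>fst\<close>.\<close>

definition prob_extension :: "'a measure \<Rightarrow> ('a \<times> 'b) measure \<Rightarrow> bool" where
  "prob_extension M N \<longleftrightarrow> prob_space N \<and> fst \<in> measurable N M \<and> distr N M fst = M"

end

theory Submission
  imports Defs
begin

text \<open>Write \<open>V i\<close> for the pair of daughters of the cell \<open>i\<close>. Given the past, the \<open>V i\<close> of one generation are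
  independent functions of Gaussian noise, so sums over a generation of functions of \<open>X i, V i\<close> with conditional mean 0
  are martingale increments whose second moments grow like \<open>m ^ k\<close>. Borel--Cantelli-type summation turns the
  recursions for the sums of \<open>1\<close>, \<open>x\<close> and \<open>x\<^sup>2\<close> into the a.s. limits \<open>W\<close>, \<open>\<mu>\<^sub>1 W\<close> and \<open>\<mu>\<^sub>2 W\<close> of the normalised sums,
  and a fixed point argument for generating functions identifies \<open>{W = 0}\<close> with extinction.

  For the fluctuations, compute characteristic functions generation by generation: on the event that generation \<open>l\<close>
  has at least \<open>\<delta> m ^ l\<close> cells, normalise by the size of that generation, which belongs to the past of the
  generations \<open>l, \<dots>, l + r\<close>. Each of them contributes asymptotically a deterministic Gaussian factor, and the
  generations before \<open>l\<close> are negligible in \<open>L\<^sup>2\<close> when \<open>r\<close> is large. The errors of the least squares estimators are,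
  up to coefficients converging on \<open>{W \<noteq> 0}\<close>, such martingale sums, and Slutsky's argument reduces every linear
  combination of them to one score function. Its limiting variance is the quadratic form of \<open>\<Sigma>\<close>. Convergence of the
  characteristic functions suffices for bounded continuous test functions by trigonometric approximation.\<close>

section \<open>The model as a function of Gaussian noise\<close>

text \<open>The obstacle is the random norming: the size of the tree is known only after the last
  generation, so it cannot stay inside a conditional characteristic function. Put
  \<open>n = l + r\<close>. The size of generation \<open>l\<close> belongs to every later past, and
  for fixed \<open>r\<close> the generations before \<open>l\<close> keep a share of order
  \<open>m\<close> to the power \<open>-r\<close> of the variance; hence \<open>r\<close> is chosen
  large before \<open>l\<close> tends to infinity. The cut-off at \<open>\<delta> * m ^ l\<close>
  bounds the norming factor, and asymptotically it misses only survivors with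
  \<open>0 < W \<le> \<delta>\<close>, an event of small probability. That \<open>W = 0\<close>
  means extinction is used twice: the indicator of a living generation \<open>n\<close> converges to
  that of \<open>W \<noteq> 0\<close>, and the cut-off event fails eventually where no norming
  exists. The limit meets \<open>W\<close> only through this indicator, so the target characteristic
  function is the mixture of 1 on \<open>W = 0\<close> and a Gaussian one on
  \<open>W \<noteq> 0\<close>, which a product extension represents. Fourth moments of the cells pay
  for the squares of quadratic increments and for the Taylor remainders.\<close>

lemma sets_Sbar: "sets Sbar = {A. Some -` A \<in> sets borel}"
proof -
  have "sigma_algebra UNIV {A. Some -` A \<in> sets (borel::real measure)}"
    unfolding sigma_algebra_iff2
    by (auto simp: vimage_UN vimage_Diff intro!: sets.countable_UN)
  then show ?thesis
    unfolding Sbar_def by (subst sets_measure_of) (auto simp: sigma_algebra.sigma_sets_eq)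
qed

lemma space_Sbar [simp]: "space Sbar = UNIV"
  by (simp add: Sbar_def)

text \<open>Measurability in \<open>Sbar\<close> is decided by the real part alone; at the cemetery
  point the map only has to land in the target space.\<close>

lemma measurable_SbarI:
  assumes "(\<lambda>x. f (Some x)) \<in> measurable borel N" "f None \<in> space N"
  shows "f \<in> measurable Sbar N"
proof (rule measurableI)
  fix x assume "x \<in> space Sbar"
  show "f x \<in> space N"
    using assms(2) measurable_space[OF assms(1)] by (cases x) auto
next
  fix A assume "A \<in> sets N"
  then have "(\<lambda>x. f (Some x)) -` A \<inter> space borel \<in> sets borel"
    using assms(1) by (rule measurable_sets[rotated])
  then show "f -` A \<inter> space Sbar \<in> sets Sbar"
    by (simp add: sets_Sbar vimage_def)
qed

lemma measurable_cell_val [measurable]: "cell_val \<in> borel_measurable Sbar"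
  by (rule measurable_SbarI) (auto simp: cell_val_def)

lemma measurable_Some_Sbar [measurable]: "Some \<in> measurable borel Sbar"
  by (rule measurableI) (auto simp: sets_Sbar)

lemma measurable_is_None [measurable]: "(\<lambda>s. s = None) \<in> measurable Sbar (count_space UNIV)"
  by (rule measurable_SbarI) auto

section \<open>Survival patterns and a Gaussian representation of the kernel\<close>

definition surv_pmf :: "bar_params \<Rightarrow> (bool \<times> bool) pmf" where
  "surv_pmf P = embed_pmf (\<lambda>b. if fst b \<and> snd b then p_both P
     else if fst b then p_only P False else if snd b then p_only P True
     else 1 - p_both P - p_only P False - p_only P True)"

lemma UNIV_bool_pair: "(UNIV :: (bool \<times> bool) set) = {(True, True), (True, False), (False, True), (False, False)}"
  by auto

lemma sum_bool_pair:
  "(\<Sum>b\<in>UNIV. f b) = f (True, True) + f (True, False) + f (False, True) + f (False, False)"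
  for f :: "bool \<times> bool \<Rightarrow> 'b::comm_monoid_add"
  by (simp add: UNIV_bool_pair add.assoc)

text \<open>\<open>embed_pmf\<close> returns the prescribed masses once they are nonnegative and sum
  to 1; this is where admissibility enters.\<close>

lemma pmf_surv:
  assumes "admissible P"
  shows "pmf (surv_pmf P) b = (if fst b \<and> snd b then p_both P
     else if fst b then p_only P False else if snd b then p_only P True
     else 1 - p_both P - p_only P False - p_only P True)"
  unfolding surv_pmf_def
proof (rule pmf_embed_pmf)
  have nn: "p_both P \<ge> 0" "p_only P False \<ge> 0" "p_only P True \<ge> 0"
    "p_both P + p_only P False + p_only P True \<le> 1"
    using assms by (auto simp: admissible_def)
  then show "0 \<le> (if fst x \<and> snd x then p_both P
     else if fst x then p_only P False else if snd x then p_only P True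
     else 1 - p_both P - p_only P False - p_only P True)" for x by auto
  show "(\<integral>\<^sup>+ x. ennreal (if fst x \<and> snd x then p_both P
     else if fst x then p_only P False else if snd x then p_only P True
     else 1 - p_both P - p_only P False - p_only P True) \<partial>count_space UNIV) = 1"
    using nn by (subst nn_integral_count_space_finite)
      (auto simp: sum_bool_pair ennreal_plus[symmetric] simp del: ennreal_plus)
qed

abbreviation gauss2 :: "(real \<times> real) measure" where
  "gauss2 \<equiv> std_normal_distribution \<Otimes>\<^sub>M std_normal_distribution"

lemma prob_space_std_normal: "prob_space std_normal_distribution"
  by (rule prob_space_normal_density) simp

lemma prob_space_gauss2: "prob_space gauss2"
  by (intro prob_space_pair prob_space_std_normal)

lemma sets_gauss2 [measurable_cong]: "sets gauss2 = sets (borel \<Otimes>\<^sub>M borel)"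
  by (intro sets_pair_measure_cong) auto

lemma space_gauss2 [simp]: "space gauss2 = UNIV"
  by (simp add: space_pair_measure)

text \<open>Triangular factorisation of the covariance: for independent standard normals
  \<open>z1\<close> and \<open>z2\<close>, the sum \<open>r * z1 + sqrt (1 - r\<^sup>2) * z2\<close>
  has unit variance and correlation \<open>r\<close> with \<open>z1\<close>. The densities are
  compared by one-dimensional affine substitutions, one coordinate at a time.\<close>

lemma bivariate_normal_eq_distr:
  assumes s: "s > 0" and r: "-1 < r" "r < 1"
  shows "bivariate_normal s r =
    distr gauss2 borel (\<lambda>z. (s * fst z, s * (r * fst z + sqrt (1 - r\<^sup>2) * snd z)))"
proof (rule measure_eqI)
  show "sets (bivariate_normal s r) =
    sets (distr gauss2 borel (\<lambda>z. (s * fst z, s * (r * fst z + sqrt (1 - r\<^sup>2) * snd z))))"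
    by (simp add: bivariate_normal_def)
next
  define c where "c = sqrt (1 - r\<^sup>2)"
  have r2: "r\<^sup>2 < 1" using r by (simp add: abs_square_less_1 abs_if)
  have c: "c > 0" "c\<^sup>2 = 1 - r\<^sup>2" using r2 by (auto simp: c_def)
  define f where "f x y = 1 / (2 * pi * s\<^sup>2 * c) *
        exp (- (x\<^sup>2 - 2 * r * x * y + y\<^sup>2) / (2 * s\<^sup>2 * (1 - r\<^sup>2)))" for x y :: real
  have [measurable]: "case_prod f \<in> borel_measurable (borel \<Otimes>\<^sub>M borel)"
    unfolding f_def by measurable
  have fm: "case_prod f \<in> borel_measurable borel"
    by (simp add: borel_prod[symmetric])
  fix A assume "A \<in> sets (bivariate_normal s r)"
  then have A: "A \<in> sets borel" by (simp add: bivariate_normal_def)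
  then have A' [measurable]: "A \<in> sets (borel \<Otimes>\<^sub>M borel)" by (simp only: borel_prod)
  have T: "(\<lambda>z. (s * fst z, s * (r * fst z + c * snd z))) \<in> measurable gauss2 borel"
    by measurable
  have nn: "f x y \<ge> 0" for x y unfolding f_def using s c(1) by simp
  \<comment> \<open>The Jacobian is \<open>s\<close> from the first substitution and
    \<open>s * c\<close> from the second; after completing the square the exponent separates into
    the two variables.\<close>
  have key: "s * (s * c) * f (s * x) (s * r * x + s * c * y) = std_normal_density x * std_normal_density y" for x y
  proof -
    have e: "(s * x)\<^sup>2 - 2 * r * (s * x) * (s * r * x + s * c * y) + (s * r * x + s * c * y)\<^sup>2
      = s\<^sup>2 * ((1 - r\<^sup>2) * x\<^sup>2 + c\<^sup>2 * y\<^sup>2)" by algebra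
    have "- ((s * x)\<^sup>2 - 2 * r * (s * x) * (s * r * x + s * c * y) + (s * r * x + s * c * y)\<^sup>2) / (2 * s\<^sup>2 * (1 - r\<^sup>2))
      = - x\<^sup>2 / 2 + - y\<^sup>2 / 2"
      unfolding e c(2) using s r2 by (simp add: field_simps)
    then have "f (s * x) (s * r * x + s * c * y) = 1 / (2 * pi * s\<^sup>2 * c) * (exp (- x\<^sup>2 / 2) * exp (- y\<^sup>2 / 2))"
      unfolding f_def exp_add[symmetric] by simp
    then show ?thesis
      using s c(1) by (simp add: std_normal_density_def power2_eq_square field_simps)
  qed
  have "emeasure (bivariate_normal s r) A = (\<integral>\<^sup>+z. ennreal (f (fst z) (snd z)) * indicator A z \<partial>lborel)"
    unfolding bivariate_normal_def f_def c_def using A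
    by (subst emeasure_density) (auto simp: split_beta' borel_prod[symmetric])
  also have "\<dots> = (\<integral>\<^sup>+x. \<integral>\<^sup>+y. ennreal (f x y) * indicator A (x, y) \<partial>lborel \<partial>lborel)"
    unfolding lborel_prod[symmetric] by (subst lborel.nn_integral_fst[symmetric]) auto
  also have "\<dots> = ennreal s * (\<integral>\<^sup>+x. \<integral>\<^sup>+y. ennreal (f (s * x) y) * indicator A (s * x, y) \<partial>lborel \<partial>lborel)"
    using s by (subst nn_integral_real_affine[where c = s and t = 0]) (auto)
  also have "\<dots> = ennreal s * (\<integral>\<^sup>+x. ennreal (s * c) *
     (\<integral>\<^sup>+y. ennreal (f (s * x) (s * r * x + s * c * y)) * indicator A (s * x, s * r * x + s * c * y) \<partial>lborel) \<partial>lborel)"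
    using s c(1)
    by (intro arg_cong2[where f="(*)"] refl nn_integral_cong, subst nn_integral_real_affine[where c = "s*c" and t = "s*r*x" for x]) auto
  also have "\<dots> = (\<integral>\<^sup>+x. \<integral>\<^sup>+y. ennreal (s * (s * c) * f (s * x) (s * r * x + s * c * y)) * indicator A (s * x, s * r * x + s * c * y) \<partial>lborel \<partial>lborel)"
    using s c(1) nn by (simp add: nn_integral_cmult[symmetric] ennreal_mult mult.assoc)
  also have "\<dots> = (\<integral>\<^sup>+x. ennreal (std_normal_density x) * (\<integral>\<^sup>+y. ennreal (std_normal_density y) * indicator A (s * x, s * r * x + s * c * y) \<partial>lborel) \<partial>lborel)"
    unfolding key by (simp add: nn_integral_cmult[symmetric] ennreal_mult mult.assoc)
  also have "\<dots> = (\<integral>\<^sup>+x. (\<integral>\<^sup>+y. indicator A (s * x, s * r * x + s * c * y) \<partial>std_normal_distribution) \<partial>std_normal_distribution)"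
    by (simp add: nn_integral_density)
  also have "\<dots> = (\<integral>\<^sup>+z. indicator A (s * fst z, s * (r * fst z + c * snd z)) \<partial>gauss2)"
    by (subst prob_space_imp_sigma_finite[OF prob_space_std_normal, THEN sigma_finite_measure.nn_integral_fst[symmetric]])
       (auto simp: algebra_simps)
  also have "\<dots> = (\<integral>\<^sup>+z. indicator ((\<lambda>z. (s * fst z, s * (r * fst z + c * snd z))) -` A \<inter> space gauss2) z \<partial>gauss2)"
    by (intro nn_integral_cong) (auto simp: indicator_def)
  also have "\<dots> = emeasure (distr gauss2 borel (\<lambda>z. (s * fst z, s * (r * fst z + c * snd z)))) A"
    using A measurable_sets[OF T A] by (subst emeasure_distr[OF T A]) (rule nn_integral_indicator)
  finally show "emeasure (bivariate_normal s r) A = emeasure (distr gauss2 borel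
     (\<lambda>z. (s * fst z, s * (r * fst z + sqrt (1 - r\<^sup>2) * snd z)))) A" unfolding c_def .
qed

text \<open>Stated over \<open>gauss2\<close>, so that all survival patterns draw on one noise
  space.\<close>

lemma centered_normal_eq_distr:
  assumes "s > 0"
  shows "centered_normal s = distr gauss2 borel (\<lambda>z. s * fst z)"
proof -
  interpret S: prob_space std_normal_distribution by (rule prob_space_std_normal)
  have "distributed std_normal_distribution lborel (\<lambda>x. x) std_normal_density"
    by (auto simp: distributed_def distr_id2)
  then have "distributed std_normal_distribution lborel (\<lambda>x. 0 + s * x) (normal_density (0 + s * 0) (\<bar>s\<bar> * 1))"
    using assms by (intro S.normal_density_affine) auto
  then have "distr std_normal_distribution lborel (\<lambda>x. s * x) = centered_normal s"
    using assms by (simp add: distributed_def)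
  moreover have "distr gauss2 borel (\<lambda>z. s * fst z) = distr (distr gauss2 std_normal_distribution fst) borel (\<lambda>x. s * x)"
    by (subst distr_distr) (auto simp: comp_def)
  moreover have "distr gauss2 std_normal_distribution fst = std_normal_distribution"
    by (rule prob_space.distr_pair_fst[OF prob_space_std_normal])
  moreover have "distr std_normal_distribution borel (\<lambda>x. s * x) = distr std_normal_distribution lborel (\<lambda>x. s * x)"
    by (rule distr_cong) auto
  ultimately show ?thesis by simp
qed

text \<open>A sample consists of the survival pattern of the two daughters and two independent standard normals.\<close>

definition noise :: "bar_params \<Rightarrow> ((bool \<times> bool) \<times> real \<times> real) measure" where
  "noise P = measure_pmf (surv_pmf P) \<Otimes>\<^sub>M gauss2"

definition slope :: "bar_params \<Rightarrow> bool \<times> bool \<Rightarrow> bool \<Rightarrow> real" where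
  "slope P b \<delta> = (if fst b \<and> snd b then alpha P \<delta> else alpha' P \<delta>)"

definition icpt :: "bar_params \<Rightarrow> bool \<times> bool \<Rightarrow> bool \<Rightarrow> real" where
  "icpt P b \<delta> = (if fst b \<and> snd b then beta P \<delta> else beta' P \<delta>)"

text \<open>Different patterns share the same two normals: patterns exclude each other, so only the
  law within each pattern matters.\<close>

definition eps :: "bar_params \<Rightarrow> bool \<times> bool \<Rightarrow> real \<times> real \<Rightarrow> bool \<Rightarrow> real" where
  "eps P b z \<delta> = (if fst b \<and> snd b
     then sd P * (if \<delta> then rho P * fst z + sqrt (1 - (rho P)\<^sup>2) * snd z else fst z)
     else sd' P \<delta> * fst z)"

definition survives :: "bool \<times> bool \<Rightarrow> bool \<Rightarrow> bool" where
  "survives b \<delta> = (if \<delta> then snd b else fst b)"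

definition daughter :: "bar_params \<Rightarrow> real option \<Rightarrow> (bool \<times> bool) \<times> real \<times> real \<Rightarrow> bool \<Rightarrow> real option" where
  "daughter P s e \<delta> = (if s = None \<or> \<not> survives (fst e) \<delta> then None
     else Some (slope P (fst e) \<delta> * cell_val s + icpt P (fst e) \<delta> + eps P (fst e) (snd e) \<delta>))"

definition offspring :: "bar_params \<Rightarrow> real option \<Rightarrow> (bool \<times> bool) \<times> real \<times> real \<Rightarrow> real option \<times> real option" where
  "offspring P s e = (daughter P s e False, daughter P s e True)"

lemma prob_space_noise: "prob_space (noise P)"
  unfolding noise_def by (intro prob_space_pair prob_space_gauss2 prob_space_measure_pmf)

lemma sets_noise [measurable_cong]: "sets (noise P) = sets (count_space UNIV \<Otimes>\<^sub>M (borel \<Otimes>\<^sub>M borel))"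
  unfolding noise_def by (intro sets_pair_measure_cong sets_gauss2) simp

lemma space_noise [simp]: "space (noise P) = UNIV"
  by (simp add: noise_def space_pair_measure)

lemma measurable_slope [measurable]: "(\<lambda>b. slope P b \<delta>) \<in> borel_measurable (count_space UNIV)"
  and measurable_icpt [measurable]: "(\<lambda>b. icpt P b \<delta>) \<in> borel_measurable (count_space UNIV)"
  and measurable_survives [measurable]: "(\<lambda>b. survives b \<delta>) \<in> measurable (count_space UNIV) (count_space UNIV)"
  by simp_all

lemma measurable_eps [measurable]: "(\<lambda>e. eps P (fst e) (snd e) \<delta>) \<in> borel_measurable (count_space UNIV \<Otimes>\<^sub>M (borel \<Otimes>\<^sub>M borel))"
proof -
  have "(\<lambda>(b, z). eps P b z \<delta>) \<in> borel_measurable (count_space UNIV \<Otimes>\<^sub>M (borel \<Otimes>\<^sub>M borel))"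
    unfolding eps_def by (intro measurable_pair_measure_countable1) auto
  then show ?thesis by (simp add: split_beta')
qed

lemma measurable_daughter [measurable]:
  "(\<lambda>(s, e). daughter P s e \<delta>) \<in> measurable (Sbar \<Otimes>\<^sub>M (count_space UNIV \<Otimes>\<^sub>M (borel \<Otimes>\<^sub>M borel))) Sbar"
  unfolding daughter_def split_beta' by measurable

lemma measurable_offspring [measurable]:
  "(\<lambda>(s, e). offspring P s e) \<in> measurable (Sbar \<Otimes>\<^sub>M (count_space UNIV \<Otimes>\<^sub>M (borel \<Otimes>\<^sub>M borel))) (Sbar \<Otimes>\<^sub>M Sbar)"
  unfolding offspring_def split_beta' by measurable

lemma offspring_None: "offspring P None e = (None, None)"
  by (simp add: offspring_def daughter_def)

lemma measurable_noiseI: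
  fixes g :: "(bool \<times> bool) \<times> real \<times> real \<Rightarrow> 'b::{second_countable_topology,banach}"
  assumes "\<And>b. (\<lambda>z. g (b, z)) \<in> borel_measurable (borel \<Otimes>\<^sub>M borel)"
  shows "g \<in> borel_measurable (noise P)"
proof -
  have "(\<lambda>(b, z). g (b, z)) \<in> borel_measurable (count_space UNIV \<Otimes>\<^sub>M (borel \<Otimes>\<^sub>M borel))"
    using assms by (intro measurable_pair_measure_countable1) auto
  then show ?thesis by (simp cong: measurable_cong_sets add: sets_noise)
qed

text \<open>Fubini with a four-point first factor. Conditional means and variances are computed
  through this finite sum, pattern by pattern.\<close>

lemma noise_integral:
  fixes g :: "(bool \<times> bool) \<times> real \<times> real \<Rightarrow> 'b::{second_countable_topology,banach}"
  assumes "\<And>b. integrable gauss2 (\<lambda>z. g (b, z))"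
  shows "integrable (noise P) g"
    and "integral\<^sup>L (noise P) g = (\<Sum>b\<in>UNIV. pmf (surv_pmf P) b *\<^sub>R (\<integral>z. g (b, z) \<partial>gauss2))"
proof -
  interpret G: prob_space gauss2 by (rule prob_space_gauss2)
  interpret PG: pair_prob_space "measure_pmf (surv_pmf P)" gauss2 ..
  have gm: "(\<lambda>z. g (b, z)) \<in> borel_measurable (borel \<Otimes>\<^sub>M borel)" for b
    using borel_measurable_integrable[OF assms] by (simp cong: measurable_cong_sets add: sets_gauss2)
  have m: "g \<in> borel_measurable (measure_pmf (surv_pmf P) \<Otimes>\<^sub>M gauss2)"
    using measurable_noiseI[OF gm, of P] by (simp add: noise_def)
  have "integrable (measure_pmf (surv_pmf P) \<Otimes>\<^sub>M gauss2) g"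
    using m assms by (intro PG.Fubini_integrable) (auto intro!: integrable_measure_pmf_finite)
  then show i: "integrable (noise P) g" by (simp add: noise_def)
  have "integral\<^sup>L (noise P) g = (\<integral>b. (\<integral>z. g (b, z) \<partial>gauss2) \<partial>measure_pmf (surv_pmf P))"
    using PG.integral_fst'[of g] i by (simp add: noise_def)
  also have "\<dots> = (\<Sum>b\<in>UNIV. pmf (surv_pmf P) b *\<^sub>R (\<integral>z. g (b, z) \<partial>gauss2))"
    by (rule integral_measure_pmf) auto
  finally show "integral\<^sup>L (noise P) g = (\<Sum>b\<in>UNIV. pmf (surv_pmf P) b *\<^sub>R (\<integral>z. g (b, z) \<partial>gauss2))" .
qed

text \<open>The bridge from the kernel to the noise: it lets conditional laws of daughters be
  handled as images of the fixed measure \<open>noise P\<close>.\<close>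

lemma measure_offspring:
  assumes adm: "admissible P" and A [measurable]: "A \<in> sets (Sbar \<Otimes>\<^sub>M Sbar)"
  shows "measure (noise P) {e. offspring P s e \<in> A} = Pstar P s A"
proof (cases s)
  case None
  interpret prob_space "noise P" by (rule prob_space_noise)
  show ?thesis
  proof (cases "(None, None) \<in> A")
    case True
    then have "{e. offspring P s e \<in> A} = space (noise P)" by (auto simp: None offspring_None)
    then show ?thesis using True by (simp only: prob_space) (simp add: None)
  qed (auto simp: None offspring_None)
next
  case (Some x)
  interpret prob_space "noise P" by (rule prob_space_noise)
  interpret G: prob_space gauss2 by (rule prob_space_gauss2)
  let ?S = "\<lambda>b. {z. offspring P s (b, z) \<in> A}"
  have ms: "?S b \<in> sets gauss2" for b
  proof -
    have "(\<lambda>z. offspring P s (b, z)) \<in> measurable (borel \<Otimes>\<^sub>M borel) (Sbar \<Otimes>\<^sub>M Sbar)"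
      by (rule measurable_compose[OF _ measurable_offspring, of "\<lambda>z. (s, (b, z))", simplified]) (auto intro!: measurable_Pair)
    from measurable_sets[OF this A] show ?thesis
      by (simp add: sets_gauss2 vimage_def space_pair_measure)
  qed
  have "(\<lambda>e. offspring P s e) \<in> measurable (noise P) (Sbar \<Otimes>\<^sub>M Sbar)"
    by (rule measurable_compose[OF _ measurable_offspring, of "\<lambda>e. (s, e)", simplified])
      (auto intro!: measurable_Pair simp: measurable_ident_sets[OF sets_noise])
  from measurable_sets[OF this A] have mn: "{e. offspring P s e \<in> A} \<in> sets (noise P)"
    by (simp add: vimage_def)
  have "measure (noise P) {e. offspring P s e \<in> A} = (\<integral>e. indicator {e. offspring P s e \<in> A} e \<partial>noise P)"
    using mn by simp
  also have "\<dots> = (\<Sum>b\<in>UNIV. pmf (surv_pmf P) b *\<^sub>R (\<integral>z. indicator (?S b) z \<partial>gauss2))"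
  proof -
    have e: "(\<lambda>z. indicator {e. offspring P s e \<in> A} (b, z)) = (indicator (?S b) :: _ \<Rightarrow> real)" for b
      by (auto simp: indicator_def)
    show ?thesis
      using ms by (subst noise_integral(2)) (auto simp: e intro!: integrable_real_indicator simp: G.emeasure_eq_measure simp del: space_gauss2)
  qed
  also have "\<dots> = (\<Sum>b\<in>UNIV. pmf (surv_pmf P) b * measure gauss2 (?S b))"
    using ms by simp
  also have "\<dots> = p_both P * measure gauss2 (?S (True, True)) + p_only P False * measure gauss2 (?S (True, False))
     + p_only P True * measure gauss2 (?S (False, True))
     + (1 - p_both P - p_only P False - p_only P True) * measure gauss2 (?S (False, False))"
    using adm by (simp add: sum_bool_pair pmf_surv)
  also have "measure gauss2 (?S (False, False)) = indicator A (None, None)"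
    using G.prob_space by (auto simp: Some offspring_def daughter_def survives_def)
  also have "measure gauss2 (?S (True, True)) = measure (bivariate_normal (sd P) (rho P))
       {(e0, e1). (Some (alpha P False * x + beta P False + e0),
                   Some (alpha P True * x + beta P True + e1)) \<in> A}"
    (is "_ = measure _ ?B")
  proof -
    have s: "sd P > 0" "-1 < rho P" "rho P < 1" using adm by (auto simp: admissible_def)
    have "(\<lambda>e. (Some (alpha P False * x + beta P False + fst e), Some (alpha P True * x + beta P True + snd e)))
      \<in> measurable (borel \<Otimes>\<^sub>M borel) (Sbar \<Otimes>\<^sub>M Sbar)" by measurable
    from measurable_sets[OF this A] have "?B \<in> sets (borel \<Otimes>\<^sub>M borel)"
      by (simp add: vimage_def space_pair_measure split_beta')
    then have B: "?B \<in> sets borel" by (simp only: borel_prod)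
    show ?thesis
      unfolding bivariate_normal_eq_distr[OF s] using B
      by (subst measure_distr) (auto simp: borel_prod[symmetric] Some offspring_def daughter_def survives_def
          slope_def icpt_def eps_def cell_val_def vimage_def algebra_simps)
  qed
  also have "measure gauss2 (?S (True, False)) = measure (centered_normal (sd' P False))
       {e. (Some (alpha' P False * x + beta' P False + e), None) \<in> A}"
    (is "_ = measure _ ?B")
  proof -
    have s: "sd' P False > 0" using adm by (auto simp: admissible_def)
    have "(\<lambda>e. (Some (alpha' P False * x + beta' P False + e), None)) \<in> measurable borel (Sbar \<Otimes>\<^sub>M Sbar)" by measurable
    from measurable_sets[OF this A] have B: "?B \<in> sets borel" by (simp add: vimage_def)
    show ?thesis
      unfolding centered_normal_eq_distr[OF s] using B
      by (subst measure_distr) (auto simp: Some offspring_def daughter_def survives_def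
          slope_def icpt_def eps_def cell_val_def vimage_def)
  qed
  also have "measure gauss2 (?S (False, True)) = measure (centered_normal (sd' P True))
       {e. (None, Some (alpha' P True * x + beta' P True + e)) \<in> A}"
    (is "_ = measure _ ?B")
  proof -
    have s: "sd' P True > 0" using adm by (auto simp: admissible_def)
    have "(\<lambda>e. (None, Some (alpha' P True * x + beta' P True + e))) \<in> measurable borel (Sbar \<Otimes>\<^sub>M Sbar)" by measurable
    from measurable_sets[OF this A] have B: "?B \<in> sets borel" by (simp add: vimage_def)
    show ?thesis
      unfolding centered_normal_eq_distr[OF s] using B
      by (subst measure_distr) (auto simp: Some offspring_def daughter_def survives_def
          slope_def icpt_def eps_def cell_val_def vimage_def)
  qed
  finally show ?thesis unfolding Some Pstar.simps .
qed

lemma finite_gen [simp]: "finite (gen k)"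
  using finite_lists_length_eq[of "UNIV :: bool set" k] by (simp add: gen_def)

section \<open>Conditional laws of the daughters of a generation\<close>

locale bar_model = prob_space M for M :: "'a measure" +
  fixes X :: "bool list \<Rightarrow> 'a \<Rightarrow> real option" and P :: bar_params
  assumes adm: "admissible P" and proc: "bar_process P M X"
begin

abbreviation "F k \<equiv> past M X k"
abbreviation "Q k \<equiv> PiM (gen k) (\<lambda>_. Sbar \<Otimes>\<^sub>M Sbar)"
abbreviation "V i \<omega> \<equiv> (X (i @ [False]) \<omega>, X (i @ [True]) \<omega>)"
abbreviation "NS k \<equiv> PiM (gen k) (\<lambda>_. noise P)"

lemma measurable_X [measurable]: "X i \<in> measurable M Sbar"
  using proc by (auto simp: bar_process_def)

lemma past_gen_subset: "(\<Union>j\<in>tree_upto k. {X j -` A \<inter> space M | A. A \<in> sets Sbar}) \<subseteq> sets M"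
  by auto

lemma space_past [simp]: "space (F k) = space M"
  unfolding past_def by (simp add: space_measure_of_conv)

lemma space_in_past [simp]: "space M \<in> sets (F k)"
  using sets.top[of "F k"] by simp

lemma sets_past: "sets (F k) = sigma_sets (space M) (\<Union>j\<in>tree_upto k. {X j -` A \<inter> space M | A. A \<in> sets Sbar})"
  unfolding past_def by (rule sets_measure_of) auto

lemma subalg: "subalgebra M (F k)"
  unfolding subalgebra_def sets_past using sets.sigma_sets_subset[OF past_gen_subset] by simp

lemma X_measurable_past:
  assumes "length i \<le> k" shows "X i \<in> measurable (F k) Sbar"
proof (rule measurableI)
  fix A assume "A \<in> sets Sbar"
  then show "X i -` A \<inter> space (F k) \<in> sets (F k)"
    unfolding sets_past space_past using assms by (intro sigma_sets.Basic) (auto simp: tree_upto_def)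
qed auto

lemma X_measurable_gen [measurable]: "i \<in> gen k \<Longrightarrow> X i \<in> measurable (F k) Sbar"
  by (rule X_measurable_past) (simp add: gen_def)

lemma past_measurable: "f \<in> measurable (F k) N \<Longrightarrow> f \<in> measurable M N"
  by (rule measurable_from_subalg[OF subalg])

lemma prob_space_subalg: "prob_space (restr_to_subalg M (F k))"
  by (rule prob_space_restr_to_subalg[OF subalg prob_space_axioms])

text \<open>Integrates the conditional expectation of the process axiom over an event
  \<open>Z\<close> of the past. The result is an identity between plain integrals, free of
  exceptional null sets, that a generator argument can extend.\<close>

lemma prob_daughters:
  assumes Z: "Z \<in> sets (F k)" and A: "\<And>i. i \<in> gen k \<Longrightarrow> A i \<in> sets (Sbar \<Otimes>\<^sub>M Sbar)"
  shows "prob (Z \<inter> {\<omega>\<in>space M. \<forall>i\<in>gen k. V i \<omega> \<in> A i})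
    = (\<integral>\<omega>. indicator Z \<omega> * (\<Prod>i\<in>gen k. Pstar P (X i \<omega>) (A i)) \<partial>M)"
proof -
  interpret S: sigma_finite_subalgebra M "F k"
    by (rule finite_measure_subalgebra_is_sigma_finite) (simp add: finite_measure_subalgebra_def finite_measure_axioms finite_measure_subalgebra_axioms_def subalg)
  let ?f = "\<lambda>\<omega>. \<Prod>i\<in>gen k. indicator (A i) (V i \<omega>) :: real"
  have Zm [measurable]: "Z \<in> sets M" using Z subalg by (auto simp: subalgebra_def)
  have fm [measurable]: "?f \<in> borel_measurable M"
  proof (intro borel_measurable_prod)
    fix i assume "i \<in> gen k"
    then have [measurable]: "A i \<in> sets (Sbar \<Otimes>\<^sub>M Sbar)" by (rule A)
    show "(\<lambda>\<omega>. indicator (A i) (V i \<omega>) :: real) \<in> borel_measurable M" by measurable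
  qed
  have sm: "{\<omega>\<in>space M. \<forall>i\<in>gen k. V i \<omega> \<in> A i} \<in> sets M"
  proof (intro sets.sets_Collect_finite_All)
    fix i assume "i \<in> gen k"
    then have [measurable]: "A i \<in> sets (Sbar \<Otimes>\<^sub>M Sbar)" by (rule A)
    show "{\<omega>\<in>space M. V i \<omega> \<in> A i} \<in> sets M" by measurable
  qed simp
  have "integrable M ?f"
    by (rule integrable_const_bound[where B = 1]) (auto simp: abs_prod intro!: prod_le_1 AE_I2)
  then have "(\<integral>\<omega>\<in>Z. ?f \<omega> \<partial>M) = (\<integral>\<omega>\<in>Z. real_cond_exp M (F k) ?f \<omega> \<partial>M)"
    using Z by (rule S.real_cond_exp_intA)
  also have "\<dots> = (\<integral>\<omega>\<in>Z. (\<Prod>i\<in>gen k. Pstar P (X i \<omega>) (A i)) \<partial>M)"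
  proof -
    have ae: "AE \<omega> in M. real_cond_exp M (F k) ?f \<omega> = (\<Prod>i\<in>gen k. Pstar P (X i \<omega>) (A i))"
      using proc A by (auto simp: bar_process_def)
    \<comment> \<open>Measurability of the kernel in the state is obtained by writing it as a noise
      probability.\<close>
    have "(\<lambda>\<omega>. \<Prod>i\<in>gen k. Pstar P (X i \<omega>) (A i)) \<in> borel_measurable M"
    proof (intro borel_measurable_prod)
      fix i assume i: "i \<in> gen k"
      interpret N: prob_space "noise P" by (rule prob_space_noise)
      have [measurable]: "A i \<in> sets (Sbar \<Otimes>\<^sub>M Sbar)" using A i .
      have "(\<lambda>\<omega>. measure (noise P) {e\<in>space (noise P). offspring P (X i \<omega>) e \<in> A i}) \<in> borel_measurable M"
        by (rule N.measurable_measure) measurable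
      then show "(\<lambda>\<omega>. Pstar P (X i \<omega>) (A i)) \<in> borel_measurable M"
        using A[OF i] by (simp add: measure_offspring[OF adm])
    qed
    then show ?thesis unfolding set_lebesgue_integral_def
      using ae by (intro integral_cong_AE) auto
  qed
  also have "(\<integral>\<omega>\<in>Z. ?f \<omega> \<partial>M) = (\<integral>\<omega>. indicator (Z \<inter> {\<omega>\<in>space M. \<forall>i\<in>gen k. V i \<omega> \<in> A i}) \<omega> \<partial>M)"
    unfolding set_lebesgue_integral_def
  proof (intro Bochner_Integration.integral_cong refl)
    fix \<omega> assume "\<omega> \<in> space M"
    then show "indicator Z \<omega> *\<^sub>R ?f \<omega> = indicator (Z \<inter> {\<omega>\<in>space M. \<forall>i\<in>gen k. V i \<omega> \<in> A i}) \<omega>"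
      by (auto simp: indicator_def prod_eq_1_iff)
  qed
  also have "\<dots> = prob (Z \<inter> {\<omega>\<in>space M. \<forall>i\<in>gen k. V i \<omega> \<in> A i})"
    using sm by simp
  finally show ?thesis by (simp add: set_lebesgue_integral_def)
qed

abbreviation "Vr k \<omega> \<equiv> (\<lambda>i\<in>gen k. V i \<omega>)"
abbreviation "Or k \<omega> e \<equiv> (\<lambda>i\<in>gen k. offspring P (X i \<omega>) (e i))"

lemma measurable_Vr: "(\<lambda>\<omega>. (\<omega>, Vr k \<omega>)) \<in> measurable M (F k \<Otimes>\<^sub>M Q k)"
  by (intro measurable_Pair measurable_restrict measurable_from_subalg[OF subalg measurable_ident[unfolded id_def]])
    simp_all

lemma measurable_Or: "(\<lambda>(\<omega>, e). (\<omega>, Or k \<omega> e)) \<in> measurable (F k \<Otimes>\<^sub>M NS k) (F k \<Otimes>\<^sub>M Q k)"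
proof -
  have [measurable]: "(\<lambda>w. offspring P (X i (fst w)) (snd w i)) \<in> measurable (F k \<Otimes>\<^sub>M NS k) (Sbar \<Otimes>\<^sub>M Sbar)"
    if i [measurable]: "i \<in> gen k" for i
    by measurable
  show ?thesis
    unfolding split_beta' by (intro measurable_Pair measurable_restrict) auto
qed

lemma sets_restr [measurable_cong]: "sets (restr_to_subalg M (F k)) = sets (F k)"
  by (rule sets_restr_to_subalg[OF subalg])

text \<open>A coupling in law: given everything known up to generation \<open>k\<close>, the
  daughters may be replaced by \<open>offspring\<close> of fresh i.i.d. noise. The sample point
  itself is kept as first component, so integrands may depend on the past in any measurable way. The
  measure \<open>F k\<close> carries no mass, being just a generated sigma-algebra;
  \<open>restr_to_subalg\<close> supplies the probability.\<close>

lemma law_past: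
  "distr M (F k \<Otimes>\<^sub>M Q k) (\<lambda>\<omega>. (\<omega>, Vr k \<omega>)) =
   distr (restr_to_subalg M (F k) \<Otimes>\<^sub>M NS k) (F k \<Otimes>\<^sub>M Q k) (\<lambda>(\<omega>, e). (\<omega>, Or k \<omega> e))" (is "?L = ?R")
proof -
  let ?Rk = "restr_to_subalg M (F k)"
  interpret R: prob_space ?Rk by (rule prob_space_subalg)
  interpret N: prob_space "noise P" by (rule prob_space_noise)
  interpret PN: product_prob_space "\<lambda>_::bool list. noise P" "gen k" ..
  interpret NS: prob_space "NS k" by (intro prob_space_PiM prob_space_noise)
  have sf: "sigma_finite_measure (NS k)"
    by (intro prob_space_imp_sigma_finite prob_space_PiM prob_space_noise)
  interpret RN: pair_prob_space ?Rk "NS k" ..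
  have measR: "measurable (?Rk \<Otimes>\<^sub>M NS k) N = measurable (F k \<Otimes>\<^sub>M NS k) N" for N :: "'c measure"
    by (intro measurable_cong_sets sets_pair_measure_cong sets_restr refl)
  \<comment> \<open>Products of an event of the past with a box of measurable sets form an
    intersection-stable generator; on it the identity reduces to
    \<open>prob_daughters\<close>.\<close>
  let ?A = "{\<Pi>\<^sub>E i\<in>gen k. A i | A. A \<in> (\<Pi> i\<in>gen k. sets (Sbar \<Otimes>\<^sub>M Sbar))}"
  let ?E = "{Z \<times> B | Z B. Z \<in> sets (F k) \<and> B \<in> ?A}"
  have A: "prod_algebra (gen k) (\<lambda>_. Sbar \<Otimes>\<^sub>M Sbar) = ?A"
    by (rule prod_algebra_eq_finite) simp
  have subs: "?E \<subseteq> Pow (space (F k) \<times> space (Q k))"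
    using sets.sets_into_space[of _ "F k"] prod_algebra_sets_into_space[of "gen k" "\<lambda>_. Sbar \<Otimes>\<^sub>M Sbar"]
    unfolding A space_PiM by blast
  have spA: "space (Q k) \<in> ?A"
    by (auto simp: space_PiM intro!: exI[of _ "\<lambda>_. space (Sbar \<Otimes>\<^sub>M Sbar)"])
  have "sets (F k \<Otimes>\<^sub>M Q k) = sets (sigma (space (F k) \<times> space (Q k)) ?E)"
  proof (rule sets_pair_eq)
    show "sets (F k) = sigma_sets (space (F k)) (sets (F k))" by (simp only: sets.sigma_sets_eq)
    show "sets (F k) \<subseteq> Pow (space (F k))" by (rule sets.space_closed)
    show "countable {space (F k)}" "{space (F k)} \<subseteq> sets (F k)" "\<Union>{space (F k)} = space (F k)"
      by (auto intro: sets.top[of "F k"])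
    show "?A \<subseteq> Pow (space (Q k))"
      using prod_algebra_sets_into_space[of "gen k" "\<lambda>_. Sbar \<Otimes>\<^sub>M Sbar"] unfolding A space_PiM .
    show "sets (Q k) = sigma_sets (space (Q k)) ?A"
      unfolding sets_PiM A space_PiM ..
    show "countable {space (Q k)}" "{space (Q k)} \<subseteq> ?A" "\<Union>{space (Q k)} = space (Q k)"
      using spA by auto
  qed
  then have gen: "sets (F k \<Otimes>\<^sub>M Q k) = sigma_sets (space (F k) \<times> space (Q k)) ?E"
    using subs by simp
  show ?thesis
  proof (rule measure_eqI_generator_eq[where A = "\<lambda>_. space (F k) \<times> space (Q k)"])
    show "Int_stable ?E"
    proof (rule Int_stableI)
      fix a b assume "a \<in> ?E" "b \<in> ?E"
      then obtain Z B Z' B' where ab: "a = Z \<times> B" "b = Z' \<times> B'" "Z \<in> sets (F k)" "Z' \<in> sets (F k)" "B \<in> ?A" "B' \<in> ?A"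
        by blast
      have "B \<inter> B' \<in> ?A"
        using Int_stable_prod_algebra[of "gen k" "\<lambda>_. Sbar \<Otimes>\<^sub>M Sbar"] ab(5,6) unfolding A Int_stable_def by blast
      moreover have "a \<inter> b = (Z \<inter> Z') \<times> (B \<inter> B')" unfolding ab by auto
      moreover have "Z \<inter> Z' \<in> sets (F k)" using ab by auto
      ultimately show "a \<inter> b \<in> ?E" by blast
    qed
    show "?E \<subseteq> Pow (space (F k) \<times> space (Q k))" by (rule subs)
    show "sets ?L = sigma_sets (space (F k) \<times> space (Q k)) ?E"
      "sets ?R = sigma_sets (space (F k) \<times> space (Q k)) ?E" by (simp_all add: gen)
    show "range (\<lambda>_. space (F k) \<times> space (Q k)) \<subseteq> ?E"
      using spA sets.top[of "F k"] by blast
    show "(\<Union>i. space (F k) \<times> space (Q k)) = space (F k) \<times> space (Q k)" by simp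
    show "emeasure ?L (space (F k) \<times> space (Q k)) \<noteq> \<infinity>" for i :: nat
    proof -
      interpret L: prob_space ?L by (rule prob_space_distr[OF measurable_Vr])
      show ?thesis by simp
    qed
    fix a assume "a \<in> ?E"
    then obtain Z A where a: "a = Z \<times> (\<Pi>\<^sub>E i\<in>gen k. A i)" and Z: "Z \<in> sets (F k)"
      and A: "\<And>i. i \<in> gen k \<Longrightarrow> A i \<in> sets (Sbar \<Otimes>\<^sub>M Sbar)" by blast
    have Zs: "Z \<subseteq> space M" using sets.sets_into_space[OF Z] by simp
    have am: "a \<in> sets (F k \<Otimes>\<^sub>M Q k)"
      unfolding a using Z A by (intro pair_measureI sets_PiM_I_finite) auto
    have Or: "(\<lambda>(\<omega>, e). (\<omega>, Or k \<omega> e)) \<in> measurable (?Rk \<Otimes>\<^sub>M NS k) (F k \<Otimes>\<^sub>M Q k)"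
      unfolding measR by (rule measurable_Or)
    have ps: "Pstar P s (A i) = measure (noise P) {e. offspring P s e \<in> A i}" if "i \<in> gen k" for s i
      using measure_offspring[OF adm A[OF that]] by simp
    have ms: "{e. offspring P s e \<in> A i} \<in> sets (noise P)" if i: "i \<in> gen k" for s i
    proof -
      have "(\<lambda>e. offspring P s e) \<in> measurable (noise P) (Sbar \<Otimes>\<^sub>M Sbar)"
        by (rule measurable_compose[OF _ measurable_offspring, of "\<lambda>e. (s, e)", simplified])
          (auto intro!: measurable_Pair simp: measurable_ident_sets[OF sets_noise])
      from measurable_sets[OF this A[OF i]] show ?thesis by (simp add: vimage_def)
    qed
    have "emeasure ?L a = prob (Z \<inter> {\<omega>\<in>space M. \<forall>i\<in>gen k. V i \<omega> \<in> A i})"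
      using Zs by (subst emeasure_distr[OF measurable_Vr am]) (auto simp: a emeasure_eq_measure PiE_iff intro!: arg_cong[where f=prob])
    also have "\<dots> = (\<integral>\<omega>. indicator Z \<omega> * (\<Prod>i\<in>gen k. Pstar P (X i \<omega>) (A i)) \<partial>M)"
      by (subst prob_daughters[OF Z A]) auto
    \<comment> \<open>The integrand is a function of the past, so the integral moves to the
      restricted measure, where Fubini with the noise applies.\<close>
    also have "\<dots> = ennreal (\<integral>\<omega>. indicator Z \<omega> * (\<Prod>i\<in>gen k. Pstar P (X i \<omega>) (A i)) \<partial>?Rk)"
    proof (intro arg_cong[where f = ennreal], rule integral_subalgebra2[symmetric, OF subalg])
      have "(\<lambda>\<omega>. Pstar P (X i \<omega>) (A i)) \<in> borel_measurable (F k)" if i [measurable]: "i \<in> gen k" for i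
      proof -
        have [measurable]: "A i \<in> sets (Sbar \<Otimes>\<^sub>M Sbar)" using A i .
        have "(\<lambda>\<omega>. measure (noise P) {e\<in>space (noise P). offspring P (X i \<omega>) e \<in> A i}) \<in> borel_measurable (F k)"
          by (rule N.measurable_measure) measurable
        then show ?thesis using ps[OF i] by simp
      qed
      then show "(\<lambda>\<omega>. indicator Z \<omega> * (\<Prod>i\<in>gen k. Pstar P (X i \<omega>) (A i))) \<in> borel_measurable (F k)"
        using Z by (intro borel_measurable_times borel_measurable_prod) auto
    qed
    also have "\<dots> = (\<integral>\<^sup>+\<omega>. indicator Z \<omega> * (\<Prod>i\<in>gen k. emeasure (noise P) {e. offspring P (X i \<omega>) e \<in> A i}) \<partial>?Rk)"
    proof (subst nn_integral_eq_integral[symmetric])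
      have le: "(\<Prod>i\<in>gen k. Pstar P (X i \<omega>) (A i)) \<le> 1" "0 \<le> (\<Prod>i\<in>gen k. Pstar P (X i \<omega>) (A i))" for \<omega>
        by (auto simp: ps intro!: prod_le_1 prod_nonneg)
      have "(\<lambda>\<omega>. Pstar P (X i \<omega>) (A i)) \<in> borel_measurable (F k)" if i [measurable]: "i \<in> gen k" for i
      proof -
        have [measurable]: "A i \<in> sets (Sbar \<Otimes>\<^sub>M Sbar)" using A i .
        have "(\<lambda>\<omega>. measure (noise P) {e\<in>space (noise P). offspring P (X i \<omega>) e \<in> A i}) \<in> borel_measurable (F k)"
          by (rule N.measurable_measure) measurable
        then show ?thesis using ps[OF i] by simp
      qed
      then have "(\<lambda>\<omega>. indicator Z \<omega> * (\<Prod>i\<in>gen k. Pstar P (X i \<omega>) (A i))) \<in> borel_measurable ?Rk"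
        using Z by (intro borel_measurable_times borel_measurable_prod) (auto cong: measurable_cong_sets simp: sets_restr)
      then show "integrable ?Rk (\<lambda>\<omega>. indicator Z \<omega> * (\<Prod>i\<in>gen k. Pstar P (X i \<omega>) (A i)))"
        using le by (intro R.integrable_const_bound[where B = 1]) (auto simp: indicator_def intro!: AE_I2)
      show "AE x in ?Rk. 0 \<le> indicator Z x * (\<Prod>i\<in>gen k. Pstar P (X i x) (A i))"
        using le by auto
      show "(\<integral>\<^sup>+ x. ennreal (indicator Z x * (\<Prod>i\<in>gen k. Pstar P (X i x) (A i))) \<partial>?Rk)
        = (\<integral>\<^sup>+\<omega>. indicator Z \<omega> * (\<Prod>i\<in>gen k. emeasure (noise P) {e. offspring P (X i \<omega>) e \<in> A i}) \<partial>?Rk)"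
        by (intro nn_integral_cong) (auto simp: indicator_def ps N.emeasure_eq_measure prod_ennreal)
    qed
    also have "\<dots> = (\<integral>\<^sup>+\<omega>. \<integral>\<^sup>+e. indicator a (\<omega>, Or k \<omega> e) \<partial>NS k \<partial>?Rk)"
    proof (intro nn_integral_cong)
      fix \<omega>
      have "(\<integral>\<^sup>+e. indicator a (\<omega>, Or k \<omega> e) \<partial>NS k) =
        (\<integral>\<^sup>+e. indicator Z \<omega> * indicator (\<Pi>\<^sub>E i\<in>gen k. {e. offspring P (X i \<omega>) e \<in> A i}) e \<partial>NS k)"
        by (intro nn_integral_cong) (auto simp: a indicator_def space_PiM PiE_iff)
      also have "\<dots> = indicator Z \<omega> * emeasure (NS k) (\<Pi>\<^sub>E i\<in>gen k. {e. offspring P (X i \<omega>) e \<in> A i})"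
        using ms by (intro nn_integral_cmult_indicator sets_PiM_I_finite) auto
      also have "emeasure (NS k) (\<Pi>\<^sub>E i\<in>gen k. {e. offspring P (X i \<omega>) e \<in> A i}) =
         (\<Prod>i\<in>gen k. emeasure (noise P) {e. offspring P (X i \<omega>) e \<in> A i})"
        using ms by (intro PN.emeasure_PiM) auto
      finally show "indicator Z \<omega> * (\<Prod>i\<in>gen k. emeasure (noise P) {e. offspring P (X i \<omega>) e \<in> A i})
        = (\<integral>\<^sup>+e. indicator a (\<omega>, Or k \<omega> e) \<partial>NS k)" by (rule sym)
    qed
    also have "\<dots> = (\<integral>\<^sup>+w. indicator a ((\<lambda>(\<omega>, e). (\<omega>, Or k \<omega> e)) w) \<partial>(?Rk \<Otimes>\<^sub>M NS k))"
      by (subst sigma_finite_measure.nn_integral_fst[OF sf, symmetric])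
        (auto intro!: measurable_compose[OF Or] borel_measurable_indicator am)
    also have "\<dots> = emeasure ?R a"
      using am by (subst nn_integral_distr[symmetric, OF Or]) auto
    finally show "emeasure ?L a = emeasure ?R a" .
  qed
qed

end

context bar_model
begin

lemma measurable_prod_Q:
  fixes g :: "bool list \<Rightarrow> 'a \<Rightarrow> real option \<times> real option \<Rightarrow> 'b"
  assumes "i \<in> gen k" "case_prod (g i) \<in> measurable (F k \<Otimes>\<^sub>M (Sbar \<Otimes>\<^sub>M Sbar)) N"
  shows "(\<lambda>w. g i (fst w) (snd w i)) \<in> measurable (F k \<Otimes>\<^sub>M Q k) N"
proof -
  have "(\<lambda>w. (fst w, snd w i)) \<in> measurable (F k \<Otimes>\<^sub>M Q k) (F k \<Otimes>\<^sub>M (Sbar \<Otimes>\<^sub>M Sbar))"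
    using assms(1) by measurable
  from measurable_compose[OF this assms(2)] show ?thesis by simp
qed

lemma measurable_noise_arg:
  fixes g :: "'a \<Rightarrow> real option \<times> real option \<Rightarrow> 'b"
  assumes "i \<in> gen k" "case_prod g \<in> measurable (F k \<Otimes>\<^sub>M (Sbar \<Otimes>\<^sub>M Sbar)) N"
  shows "(\<lambda>w. g (fst w) (offspring P (X i (fst w)) (snd w))) \<in> measurable (F k \<Otimes>\<^sub>M noise P) N"
proof -
  have "(\<lambda>w. (fst w, offspring P (X i (fst w)) (snd w))) \<in> measurable (F k \<Otimes>\<^sub>M noise P) (F k \<Otimes>\<^sub>M (Sbar \<Otimes>\<^sub>M Sbar))"
    using assms(1) by measurable
  from measurable_compose[OF this assms(2)] show ?thesis by simp
qed

text \<open>Transport through \<open>law_past\<close> and independence of the noise over the cells: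
  given the past, a product over a generation integrates factor by factor.\<close>

lemma nn_integral_prod_past:
  fixes g :: "bool list \<Rightarrow> 'a \<Rightarrow> real option \<times> real option \<Rightarrow> ennreal"
  assumes g: "\<And>i. i \<in> gen k \<Longrightarrow> case_prod (g i) \<in> borel_measurable (F k \<Otimes>\<^sub>M (Sbar \<Otimes>\<^sub>M Sbar))"
    and Z [measurable]: "Z \<in> borel_measurable (F k)"
  shows "(\<integral>\<^sup>+\<omega>. Z \<omega> * (\<Prod>i\<in>gen k. g i \<omega> (V i \<omega>)) \<partial>M)
    = (\<integral>\<^sup>+\<omega>. Z \<omega> * (\<Prod>i\<in>gen k. \<integral>\<^sup>+e. g i \<omega> (offspring P (X i \<omega>) e) \<partial>noise P) \<partial>M)"
proof -
  let ?Rk = "restr_to_subalg M (F k)"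
  interpret R: prob_space ?Rk by (rule prob_space_subalg)
  interpret N: prob_space "noise P" by (rule prob_space_noise)
  interpret PN: product_prob_space "\<lambda>_::bool list. noise P" "gen k" ..
  interpret NS: prob_space "NS k" by (intro prob_space_PiM prob_space_noise)
  have sf: "sigma_finite_measure (NS k)"
    by (intro prob_space_imp_sigma_finite prob_space_PiM prob_space_noise)
  let ?H = "\<lambda>w. Z (fst w) * (\<Prod>i\<in>gen k. g i (fst w) (snd w i))"
  have Zm: "(\<lambda>w. Z (fst w)) \<in> borel_measurable (F k \<Otimes>\<^sub>M Q k)" by measurable
  have H: "?H \<in> borel_measurable (F k \<Otimes>\<^sub>M Q k)"
    by (intro borel_measurable_times_ennreal[OF Zm] borel_measurable_prod_ennreal measurable_prod_Q g)
  have Or: "(\<lambda>(\<omega>, e). (\<omega>, Or k \<omega> e)) \<in> measurable (?Rk \<Otimes>\<^sub>M NS k) (F k \<Otimes>\<^sub>M Q k)"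
    using measurable_Or[of k] by (simp cong: measurable_cong_sets add: sets_pair_measure_cong[OF sets_restr refl])
  have "(\<integral>\<^sup>+\<omega>. Z \<omega> * (\<Prod>i\<in>gen k. g i \<omega> (V i \<omega>)) \<partial>M) = (\<integral>\<^sup>+\<omega>. ?H (\<omega>, Vr k \<omega>) \<partial>M)"
    by (intro nn_integral_cong) simp
  also have "\<dots> = integral\<^sup>N (distr M (F k \<Otimes>\<^sub>M Q k) (\<lambda>\<omega>. (\<omega>, Vr k \<omega>))) ?H"
    using H by (subst nn_integral_distr[OF measurable_Vr]) auto
  also have "\<dots> = (\<integral>\<^sup>+w. ?H ((\<lambda>(\<omega>, e). (\<omega>, Or k \<omega> e)) w) \<partial>(?Rk \<Otimes>\<^sub>M NS k))"
    unfolding law_past using H by (subst nn_integral_distr[OF Or]) auto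
  also have "\<dots> = (\<integral>\<^sup>+\<omega>. \<integral>\<^sup>+e. ?H ((\<lambda>(\<omega>, e). (\<omega>, Or k \<omega> e)) (\<omega>, e)) \<partial>NS k \<partial>?Rk)"
    by (rule sigma_finite_measure.nn_integral_fst[OF sf, symmetric]) (rule measurable_compose[OF Or H])
  also have "\<dots> = (\<integral>\<^sup>+\<omega>. \<integral>\<^sup>+e. Z \<omega> * (\<Prod>i\<in>gen k. g i \<omega> (offspring P (X i \<omega>) (e i))) \<partial>NS k \<partial>?Rk)"
    by (intro nn_integral_cong) simp
  also have "\<dots> = (\<integral>\<^sup>+\<omega>. Z \<omega> * (\<Prod>i\<in>gen k. \<integral>\<^sup>+e. g i \<omega> (offspring P (X i \<omega>) e) \<partial>noise P) \<partial>?Rk)"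
  proof (intro nn_integral_cong)
    fix \<omega> assume w: "\<omega> \<in> space ?Rk"
    then have w': "\<omega> \<in> space (F k)" using subalg by (simp add: space_restr_to_subalg)
    have m: "(\<lambda>e. g i \<omega> (offspring P (X i \<omega>) e)) \<in> borel_measurable (noise P)" if "i \<in> gen k" for i
      using measurable_compose[OF measurable_Pair1'[OF w'] measurable_noise_arg[OF that g[OF that]]] by simp
    have mp: "(\<lambda>e. \<Prod>i\<in>gen k. g i \<omega> (offspring P (X i \<omega>) (e i))) \<in> borel_measurable (NS k)"
    proof (intro borel_measurable_prod_ennreal)
      fix i assume i: "i \<in> gen k"
      show "(\<lambda>e. g i \<omega> (offspring P (X i \<omega>) (e i))) \<in> borel_measurable (NS k)"
        by (rule measurable_compose[OF measurable_component_singleton[OF i] m[OF i]])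
    qed
    show "(\<integral>\<^sup>+e. Z \<omega> * (\<Prod>i\<in>gen k. g i \<omega> (offspring P (X i \<omega>) (e i))) \<partial>NS k)
      = Z \<omega> * (\<Prod>i\<in>gen k. \<integral>\<^sup>+e. g i \<omega> (offspring P (X i \<omega>) e) \<partial>noise P)"
      using m by (subst nn_integral_cmult[OF mp], subst PN.product_nn_integral_prod) auto
  qed
  also have "\<dots> = (\<integral>\<^sup>+\<omega>. Z \<omega> * (\<Prod>i\<in>gen k. \<integral>\<^sup>+e. g i \<omega> (offspring P (X i \<omega>) e) \<partial>noise P) \<partial>M)"
  proof (rule nn_integral_subalgebra2[OF subalg])
    show "(\<lambda>\<omega>. Z \<omega> * (\<Prod>i\<in>gen k. \<integral>\<^sup>+e. g i \<omega> (offspring P (X i \<omega>) e) \<partial>noise P)) \<in> borel_measurable (F k)"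
    proof (intro borel_measurable_times_ennreal borel_measurable_prod_ennreal Z)
      fix i assume i: "i \<in> gen k"
      show "(\<lambda>\<omega>. \<integral>\<^sup>+e. g i \<omega> (offspring P (X i \<omega>) e) \<partial>noise P) \<in> borel_measurable (F k)"
        using measurable_noise_arg[OF i g[OF i]] by (intro N.borel_measurable_nn_integral) (simp add: split_beta')
    qed
  qed
  finally show ?thesis .
qed

text \<open>The same factorisation for signed or complex values, as characteristic functions
  require; here joint and cellwise integrability have to be supplied.\<close>

lemma integral_prod_past:
  fixes g :: "bool list \<Rightarrow> 'a \<Rightarrow> real option \<times> real option \<Rightarrow> 'b::{real_normed_field,banach,second_countable_topology}"
  assumes g: "\<And>i. i \<in> gen k \<Longrightarrow> case_prod (g i) \<in> borel_measurable (F k \<Otimes>\<^sub>M (Sbar \<Otimes>\<^sub>M Sbar))"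
    and Z [measurable]: "Z \<in> borel_measurable (F k)"
    and int: "integrable M (\<lambda>\<omega>. Z \<omega> * (\<Prod>i\<in>gen k. g i \<omega> (V i \<omega>)))"
    and intn: "\<And>i \<omega>. i \<in> gen k \<Longrightarrow> \<omega> \<in> space M \<Longrightarrow> integrable (noise P) (\<lambda>e. g i \<omega> (offspring P (X i \<omega>) e))"
  shows "(\<integral>\<omega>. Z \<omega> * (\<Prod>i\<in>gen k. g i \<omega> (V i \<omega>)) \<partial>M)
    = (\<integral>\<omega>. Z \<omega> * (\<Prod>i\<in>gen k. \<integral>e. g i \<omega> (offspring P (X i \<omega>) e) \<partial>noise P) \<partial>M)"
proof -
  let ?Rk = "restr_to_subalg M (F k)"
  interpret R: prob_space ?Rk by (rule prob_space_subalg)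
  interpret N: prob_space "noise P" by (rule prob_space_noise)
  interpret PN: product_prob_space "\<lambda>_::bool list. noise P" "gen k" ..
  interpret NS: prob_space "NS k" by (intro prob_space_PiM prob_space_noise)
  have sf: "sigma_finite_measure (NS k)"
    by (intro prob_space_imp_sigma_finite prob_space_PiM prob_space_noise)
  interpret RN: pair_prob_space ?Rk "NS k" ..
  let ?H = "\<lambda>w. Z (fst w) * (\<Prod>i\<in>gen k. g i (fst w) (snd w i))"
  have Zm: "(\<lambda>w. Z (fst w)) \<in> borel_measurable (F k \<Otimes>\<^sub>M Q k)" by measurable
  have H: "?H \<in> borel_measurable (F k \<Otimes>\<^sub>M Q k)"
    by (intro borel_measurable_times[OF Zm] borel_measurable_prod measurable_prod_Q g)
  have Or: "(\<lambda>(\<omega>, e). (\<omega>, Or k \<omega> e)) \<in> measurable (?Rk \<Otimes>\<^sub>M NS k) (F k \<Otimes>\<^sub>M Q k)"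
    using measurable_Or[of k] by (simp cong: measurable_cong_sets add: sets_pair_measure_cong[OF sets_restr refl])
  have i1: "(\<integral>\<omega>. Z \<omega> * (\<Prod>i\<in>gen k. g i \<omega> (V i \<omega>)) \<partial>M) = (\<integral>\<omega>. ?H (\<omega>, Vr k \<omega>) \<partial>M)"
    by (intro Bochner_Integration.integral_cong refl) simp
  have i2: "\<dots> = integral\<^sup>L (distr M (F k \<Otimes>\<^sub>M Q k) (\<lambda>\<omega>. (\<omega>, Vr k \<omega>))) ?H"
    by (rule integral_distr[symmetric, OF measurable_Vr H])
  have i3: "\<dots> = (\<integral>w. ?H ((\<lambda>(\<omega>, e). (\<omega>, Or k \<omega> e)) w) \<partial>(?Rk \<Otimes>\<^sub>M NS k))"
    unfolding law_past by (rule integral_distr[OF Or H])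
  have "integrable M (\<lambda>\<omega>. ?H (\<omega>, Vr k \<omega>))"
    using int by (simp cong: prod.cong)
  then have "integrable (distr M (F k \<Otimes>\<^sub>M Q k) (\<lambda>\<omega>. (\<omega>, Vr k \<omega>))) ?H"
    by (subst integrable_distr_eq[OF measurable_Vr H])
  then have ii: "integrable (?Rk \<Otimes>\<^sub>M NS k) (\<lambda>w. ?H ((\<lambda>(\<omega>, e). (\<omega>, Or k \<omega> e)) w))"
    unfolding law_past by (subst (asm) integrable_distr_eq[OF Or H])
  have i4: "(\<integral>w. ?H ((\<lambda>(\<omega>, e). (\<omega>, Or k \<omega> e)) w) \<partial>(?Rk \<Otimes>\<^sub>M NS k)) =
    (\<integral>\<omega>. \<integral>e. ?H ((\<lambda>(\<omega>, e). (\<omega>, Or k \<omega> e)) (\<omega>, e)) \<partial>NS k \<partial>?Rk)"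
    by (rule RN.integral_fst'[symmetric, OF ii])
  have i5: "\<dots> = (\<integral>\<omega>. Z \<omega> * (\<Prod>i\<in>gen k. \<integral>e. g i \<omega> (offspring P (X i \<omega>) e) \<partial>noise P) \<partial>?Rk)"
  proof (intro Bochner_Integration.integral_cong refl)
    fix \<omega> assume w: "\<omega> \<in> space ?Rk"
    then have "\<omega> \<in> space M" by (simp add: space_restr_to_subalg)
    then show "(\<integral>e. ?H ((\<lambda>(\<omega>, e). (\<omega>, Or k \<omega> e)) (\<omega>, e)) \<partial>NS k)
      = Z \<omega> * (\<Prod>i\<in>gen k. \<integral>e. g i \<omega> (offspring P (X i \<omega>) e) \<partial>noise P)"
      using intn PN.product_integral_prod[of "gen k" "\<lambda>i e. g i \<omega> (offspring P (X i \<omega>) e)"]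
      by (simp cong: prod.cong)
  qed
  have i6: "\<dots> = (\<integral>\<omega>. Z \<omega> * (\<Prod>i\<in>gen k. \<integral>e. g i \<omega> (offspring P (X i \<omega>) e) \<partial>noise P) \<partial>M)"
  proof (rule integral_subalgebra2[OF subalg])
    show "(\<lambda>\<omega>. Z \<omega> * (\<Prod>i\<in>gen k. \<integral>e. g i \<omega> (offspring P (X i \<omega>) e) \<partial>noise P)) \<in> borel_measurable (F k)"
    proof (intro borel_measurable_times borel_measurable_prod Z)
      fix i assume i: "i \<in> gen k"
      show "(\<lambda>\<omega>. \<integral>e. g i \<omega> (offspring P (X i \<omega>) e) \<partial>noise P) \<in> borel_measurable (F k)"
        using measurable_noise_arg[OF i g[OF i]] by (intro N.borel_measurable_lebesgue_integral) (simp add: split_beta')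
    qed
  qed
  show ?thesis unfolding i1 i2 i3 i4 i5 i6 ..
qed

text \<open>All cells other than \<open>i\<close> receive the constant factor 1, whose noise
  integral is 1.\<close>

lemma nn_integral_past:
  fixes g :: "'a \<Rightarrow> real option \<times> real option \<Rightarrow> ennreal"
  assumes i: "i \<in> gen k" and g: "case_prod g \<in> borel_measurable (F k \<Otimes>\<^sub>M (Sbar \<Otimes>\<^sub>M Sbar))"
  shows "(\<integral>\<^sup>+\<omega>. g \<omega> (V i \<omega>) \<partial>M) = (\<integral>\<^sup>+\<omega>. \<integral>\<^sup>+e. g \<omega> (offspring P (X i \<omega>) e) \<partial>noise P \<partial>M)"
proof -
  interpret N: prob_space "noise P" by (rule prob_space_noise)
  let ?g = "\<lambda>j \<omega> v. if j = i then g \<omega> v else 1"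
  have one: "(\<Prod>j\<in>gen k. if j = i then h j else 1) = h i" for h :: "bool list \<Rightarrow> ennreal"
    using i by (simp add: prod.delta)
  have e: "(\<integral>\<^sup>+e. ?g j \<omega> (offspring P (X j \<omega>) e) \<partial>noise P)
    = (if j = i then \<integral>\<^sup>+e. g \<omega> (offspring P (X j \<omega>) e) \<partial>noise P else 1)" for j \<omega>
    using N.emeasure_space_1 by auto
  have "(\<integral>\<^sup>+\<omega>. 1 * (\<Prod>j\<in>gen k. ?g j \<omega> (V j \<omega>)) \<partial>M)
    = (\<integral>\<^sup>+\<omega>. 1 * (\<Prod>j\<in>gen k. \<integral>\<^sup>+e. ?g j \<omega> (offspring P (X j \<omega>) e) \<partial>noise P) \<partial>M)"
    using g by (intro nn_integral_prod_past) (auto intro: measurable_const)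
  then show ?thesis unfolding e one by simp
qed

text \<open>Orthogonality within a generation: given the past, distinct cells are independent, and
  one vanishing conditional mean annihilates the product.\<close>

lemma integral_pair_past_eq_0:
  fixes g h :: "'a \<Rightarrow> real option \<times> real option \<Rightarrow> real"
  assumes ij: "i \<in> gen k" "j \<in> gen k" "i \<noteq> j"
    and g: "case_prod g \<in> borel_measurable (F k \<Otimes>\<^sub>M (Sbar \<Otimes>\<^sub>M Sbar))"
    and h: "case_prod h \<in> borel_measurable (F k \<Otimes>\<^sub>M (Sbar \<Otimes>\<^sub>M Sbar))"
    and int: "integrable M (\<lambda>\<omega>. g \<omega> (V i \<omega>) * h \<omega> (V j \<omega>))"
    and ig: "\<And>\<omega>. \<omega> \<in> space M \<Longrightarrow> integrable (noise P) (\<lambda>e. g \<omega> (offspring P (X i \<omega>) e))"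
    and ih: "\<And>\<omega>. \<omega> \<in> space M \<Longrightarrow> integrable (noise P) (\<lambda>e. h \<omega> (offspring P (X j \<omega>) e))"
    and 0: "\<And>\<omega>. \<omega> \<in> space M \<Longrightarrow> (\<integral>e. g \<omega> (offspring P (X i \<omega>) e) \<partial>noise P) = 0"
  shows "(\<integral>\<omega>. g \<omega> (V i \<omega>) * h \<omega> (V j \<omega>) \<partial>M) = 0"
proof -
  interpret N: prob_space "noise P" by (rule prob_space_noise)
  let ?f = "\<lambda>l \<omega> v. if l = i then g \<omega> v else if l = j then h \<omega> v else 1"
  have two: "(\<Prod>l\<in>gen k. ?f l \<omega> (V l \<omega>)) = g \<omega> (V i \<omega>) * h \<omega> (V j \<omega>)" for \<omega>
  proof -
    have "(\<Prod>l\<in>gen k. ?f l \<omega> (V l \<omega>)) = (\<Prod>l\<in>{i, j}. ?f l \<omega> (V l \<omega>))"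
      using ij by (intro prod.mono_neutral_right) auto
    then show ?thesis using ij by simp
  qed
  have "(\<integral>\<omega>. 1 * (\<Prod>l\<in>gen k. ?f l \<omega> (V l \<omega>)) \<partial>M)
    = (\<integral>\<omega>. 1 * (\<Prod>l\<in>gen k. \<integral>e. ?f l \<omega> (offspring P (X l \<omega>) e) \<partial>noise P) \<partial>M)"
  proof (rule integral_prod_past)
    show "integrable M (\<lambda>\<omega>. 1 * (\<Prod>l\<in>gen k. ?f l \<omega> (V l \<omega>)))" unfolding two using int by simp
    show "integrable (noise P) (\<lambda>e. ?f l \<omega> (offspring P (X l \<omega>) e))" if "\<omega> \<in> space M" for l \<omega>
      using ig[OF that] ih[OF that] by (cases "l = i"; cases "l = j") auto
    show "case_prod (?f l) \<in> borel_measurable (F k \<Otimes>\<^sub>M (Sbar \<Otimes>\<^sub>M Sbar))" for l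
      using g h by (cases "l = i"; cases "l = j") auto
  qed simp
  also have "\<dots> = (\<integral>\<omega>. 0 \<partial>M)"
    using 0 ij by (intro Bochner_Integration.integral_cong refl) (auto intro!: prod_zero bexI[of _ i])
  finally show ?thesis unfolding two by simp
qed

end

section \<open>Moments and laws of large numbers on the tree\<close>

lemma std_normal_integral_power:
  "integrable std_normal_distribution (\<lambda>x. x ^ k)"
  "(\<integral>x. x ^ 0 \<partial>std_normal_distribution) = 1"
  "(\<integral>x. x \<partial>std_normal_distribution) = 0"
  "(\<integral>x. x ^ 2 \<partial>std_normal_distribution) = 1"
proof -
  interpret S: prob_space std_normal_distribution by (rule prob_space_std_normal)
  show "integrable std_normal_distribution (\<lambda>x. x ^ k)" by (rule integrable_std_normal_distribution_moment)
  show "(\<integral>x. x ^ 0 \<partial>std_normal_distribution) = 1" using S.prob_space by simp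
  show "(\<integral>x. x \<partial>std_normal_distribution) = 0"
    using integral_std_normal_distribution_moment_odd[of 1] by simp
  show "(\<integral>x. x ^ 2 \<partial>std_normal_distribution) = 1"
    using std_normal_distribution_even_moments[of 1] by (simp add: fact_numeral)
qed

lemma gauss2_moment:
  "integrable gauss2 (\<lambda>z. fst z ^ a * snd z ^ b)"
  "(\<integral>z. fst z ^ a * snd z ^ b \<partial>gauss2) =
    (\<integral>x. x ^ a \<partial>std_normal_distribution) * (\<integral>x. x ^ b \<partial>std_normal_distribution)"
proof -
  interpret S: prob_space std_normal_distribution by (rule prob_space_std_normal)
  interpret SS: pair_prob_space std_normal_distribution std_normal_distribution ..
  have [measurable]: "(\<lambda>z. fst z ^ a * snd z ^ b) \<in> borel_measurable gauss2" by measurable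
  show i: "integrable gauss2 (\<lambda>z. fst z ^ a * snd z ^ b)"
  proof (rule SS.Fubini_integrable)
    have "integrable std_normal_distribution (\<lambda>x. \<bar>x ^ a\<bar> * (\<integral>y. \<bar>y ^ b\<bar> \<partial>std_normal_distribution))"
      by (intro integrable_mult_left integrable_abs std_normal_integral_power)
    then show "integrable std_normal_distribution (\<lambda>x. \<integral>y. norm (fst (x, y) ^ a * snd (x, y) ^ b) \<partial>std_normal_distribution)"
      by (simp add: abs_mult)
    show "AE x in std_normal_distribution. integrable std_normal_distribution (\<lambda>y. fst (x, y) ^ a * snd (x, y) ^ b)"
      using std_normal_integral_power by simp
  qed measurable
  show "(\<integral>z. fst z ^ a * snd z ^ b \<partial>gauss2) =
    (\<integral>x. x ^ a \<partial>std_normal_distribution) * (\<integral>x. x ^ b \<partial>std_normal_distribution)"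
    using SS.integral_fst'[OF i] by simp
qed

text \<open>The daughters are affine in the noise, so quadratic polynomials in the two normals cover
  their conditional means and variances.\<close>

lemma gauss2_quadratic:
  fixes c0 c1 c2 c3 c4 c5 :: real
  shows "integrable gauss2 (\<lambda>z. c0 + c1 * fst z + c2 * snd z + c3 * (fst z)\<^sup>2 + c4 * (fst z * snd z) + c5 * (snd z)\<^sup>2)"
    and "(\<integral>z. c0 + c1 * fst z + c2 * snd z + c3 * (fst z)\<^sup>2 + c4 * (fst z * snd z) + c5 * (snd z)\<^sup>2 \<partial>gauss2) = c0 + c3 + c5"
proof -
  interpret G: prob_space gauss2 by (rule prob_space_gauss2)
  note m = gauss2_moment[of 1 0] gauss2_moment[of 0 1] gauss2_moment[of 2 0] gauss2_moment[of 1 1] gauss2_moment[of 0 2]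
  have i: "integrable gauss2 (\<lambda>z. fst z)" "integrable gauss2 (\<lambda>z. snd z)" "integrable gauss2 (\<lambda>z. (fst z)\<^sup>2)"
    "integrable gauss2 (\<lambda>z. fst z * snd z)" "integrable gauss2 (\<lambda>z. (snd z)\<^sup>2)"
    using m by simp_all
  have v: "(\<integral>z. fst z \<partial>gauss2) = 0" "(\<integral>z. snd z \<partial>gauss2) = 0" "(\<integral>z. (fst z)\<^sup>2 \<partial>gauss2) = 1"
    "(\<integral>z. fst z * snd z \<partial>gauss2) = 0" "(\<integral>z. (snd z)\<^sup>2 \<partial>gauss2) = 1"
    using m std_normal_integral_power by simp_all
  show "integrable gauss2 (\<lambda>z. c0 + c1 * fst z + c2 * snd z + c3 * (fst z)\<^sup>2 + c4 * (fst z * snd z) + c5 * (snd z)\<^sup>2)"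
    using i by simp
  show "(\<integral>z. c0 + c1 * fst z + c2 * snd z + c3 * (fst z)\<^sup>2 + c4 * (fst z * snd z) + c5 * (snd z)\<^sup>2 \<partial>gauss2) = c0 + c3 + c5"
    using i v G.prob_space by simp
qed

text \<open>An integrable envelope for the noise. The summand 1 makes its powers increasing, so a
  bound by a lower power is also a bound by the fourth.\<close>

definition nsize :: "(bool \<times> bool) \<times> real \<times> real \<Rightarrow> real" where
  "nsize e = 1 + \<bar>fst (snd e)\<bar> + \<bar>snd (snd e)\<bar>"

lemma nsize_ge_1: "nsize e \<ge> 1"
  by (simp add: nsize_def)

lemma measurable_nsize [measurable]: "nsize \<in> borel_measurable (count_space UNIV \<Otimes>\<^sub>M (borel \<Otimes>\<^sub>M borel))"
  unfolding nsize_def by measurable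

lemma nsize_pow4_le: "nsize e ^ 4 \<le> 27 * (1 + fst (snd e) ^ 4 + snd (snd e) ^ 4)"
proof -
  have sq: "(a + b + c)\<^sup>2 \<le> 3 * (a\<^sup>2 + b\<^sup>2 + c\<^sup>2)" for a b c :: real
    using sum_squares_ge_zero[of "a - b" "b - c"] zero_le_power2[of "a - c"]
    by (simp add: power2_eq_square algebra_simps)
  let ?a = "\<bar>fst (snd e)\<bar>" and ?b = "\<bar>snd (snd e)\<bar>"
  have "nsize e ^ 4 = ((1 + ?a + ?b)\<^sup>2)\<^sup>2" by (simp add: nsize_def)
  also have "\<dots> \<le> (3 * (1\<^sup>2 + ?a\<^sup>2 + ?b\<^sup>2))\<^sup>2" by (rule power_mono[OF sq]) simp
  also have "\<dots> = 9 * (1 + ?a\<^sup>2 + ?b\<^sup>2)\<^sup>2" by (subst power_mult_distrib) simp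
  also have "\<dots> \<le> 9 * (3 * (1\<^sup>2 + (?a\<^sup>2)\<^sup>2 + (?b\<^sup>2)\<^sup>2))" using sq[of 1 "?a\<^sup>2" "?b\<^sup>2"] by simp
  finally show ?thesis by simp
qed

lemma integrable_nsize_pow4: "integrable gauss2 (\<lambda>z. nsize (b, z) ^ 4)"
proof (rule Bochner_Integration.integrable_bound)
  interpret G: prob_space gauss2 by (rule prob_space_gauss2)
  show "integrable gauss2 (\<lambda>z. 27 * (1 + fst z ^ 4 + snd z ^ 4))"
    using gauss2_moment(1)[of 4 0] gauss2_moment(1)[of 0 4] by simp
  show "(\<lambda>z. nsize (b, z) ^ 4) \<in> borel_measurable gauss2" unfolding nsize_def fst_conv snd_conv by measurable
  show "AE z in gauss2. norm (nsize (b, z) ^ 4) \<le> norm (27 * (1 + fst z ^ 4 + snd z ^ 4))"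
    using nsize_pow4_le[of "(b, _)"] nsize_ge_1 by (auto intro!: AE_I2 order_trans[OF _ abs_ge_self])
qed

text \<open>The pattern \<open>(True, True)\<close> is a dummy, as \<open>nsize\<close> looks at the
  Gaussian part only.\<close>

definition nmoment :: real where
  "nmoment = (\<integral>z. nsize ((True, True), z) ^ 4 \<partial>gauss2)"

lemma nmoment_eq: "(\<integral>z. nsize (b, z) ^ 4 \<partial>gauss2) = nmoment"
  by (simp add: nmoment_def nsize_def)

lemma nmoment_ge_1: "nmoment \<ge> 1"
proof -
  interpret G: prob_space gauss2 by (rule prob_space_gauss2)
  have "(\<integral>z. 1 \<partial>gauss2) \<le> nmoment"
    unfolding nmoment_def using integrable_nsize_pow4 nsize_ge_1 by (intro integral_mono) (auto intro: one_le_power)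
  then show ?thesis using G.prob_space by simp
qed

lemma noise_integral_weight_nsize:
  fixes w :: "bool \<times> bool \<Rightarrow> real"
  shows "integrable (noise P) (\<lambda>e. w (fst e) * nsize e ^ 4)"
    and "(\<integral>e. w (fst e) * nsize e ^ 4 \<partial>noise P) = (\<Sum>b\<in>UNIV. pmf (surv_pmf P) b * w b) * nmoment"
  using integrable_nsize_pow4 nmoment_eq
  by (auto intro!: noise_integral(1) simp: noise_integral(2) sum_distrib_right mult.assoc)

lemma noise_integral_weight:
  fixes w :: "bool \<times> bool \<Rightarrow> real"
  shows "integrable (noise P) (\<lambda>e. w (fst e))"
    and "(\<integral>e. w (fst e) \<partial>noise P) = (\<Sum>b\<in>UNIV. pmf (surv_pmf P) b * w b)"
proof -
  interpret G: prob_space gauss2 by (rule prob_space_gauss2)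
  show "integrable (noise P) (\<lambda>e. w (fst e))" "(\<integral>e. w (fst e) \<partial>noise P) = (\<Sum>b\<in>UNIV. pmf (surv_pmf P) b * w b)"
    using G.prob_space by (auto intro!: noise_integral(1) simp: noise_integral(2))
qed

lemma integrable_noise_bounded:
  fixes g :: "(bool \<times> bool) \<times> real \<times> real \<Rightarrow> 'b::{banach,second_countable_topology}"
  assumes "g \<in> borel_measurable (noise P)" "\<And>e. norm (g e) \<le> C * nsize e ^ 4"
  shows "integrable (noise P) g"
proof (rule Bochner_Integration.integrable_bound)
  show "integrable (noise P) (\<lambda>e. C * nsize e ^ 4)"
    using noise_integral_weight_nsize(1)[of P "\<lambda>_. 1"] by simp
  show "AE e in noise P. norm (g e) \<le> norm (C * nsize e ^ 4)"
    using assms(2) by (auto intro!: AE_I2 order_trans[OF _ abs_ge_self])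
qed fact

definition eps1 :: "bar_params \<Rightarrow> bool \<times> bool \<Rightarrow> bool \<Rightarrow> real" where
  "eps1 P b \<delta> = (if fst b \<and> snd b then sd P * (if \<delta> then rho P else 1) else sd' P \<delta>)"

definition eps2 :: "bar_params \<Rightarrow> bool \<times> bool \<Rightarrow> bool \<Rightarrow> real" where
  "eps2 P b \<delta> = (if fst b \<and> snd b \<and> \<delta> then sd P * sqrt (1 - (rho P)\<^sup>2) else 0)"

lemma eps_eq: "eps P b z \<delta> = eps1 P b \<delta> * fst z + eps2 P b \<delta> * snd z"
  by (simp add: eps_def eps1_def eps2_def algebra_simps)

text \<open>The value 0 at the cemetery point lets sums run over the deterministic set
  \<open>gen k\<close> while counting living cells only.\<close>

definition ext :: "(real \<Rightarrow> 'b::zero) \<Rightarrow> real option \<Rightarrow> 'b" where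
  "ext f s = (case s of None \<Rightarrow> 0 | Some x \<Rightarrow> f x)"

lemma ext_simps [simp]: "ext f None = 0" "ext f (Some x) = f x"
  by (simp_all add: ext_def)

lemma measurable_ext [measurable]: "f \<in> borel_measurable borel \<Longrightarrow> ext f \<in> borel_measurable Sbar"
  unfolding ext_def by (intro measurable_SbarI) auto

lemma gen_0: "gen 0 = {[]}"
  by (auto simp: gen_def)

lemma gen_Suc: "gen (Suc k) = (\<lambda>i. i @ [False]) ` gen k \<union> (\<lambda>i. i @ [True]) ` gen k"
proof -
  have "i \<in> (\<lambda>i. i @ [False]) ` gen k \<union> (\<lambda>i. i @ [True]) ` gen k" if "length i = Suc k" for i :: "bool list"
  proof -
    obtain j d where "i = j @ [d]" using \<open>length i = Suc k\<close> by (cases i rule: rev_cases) auto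
    then show ?thesis using that by (cases d) (auto simp: gen_def)
  qed
  then show ?thesis by (auto simp: gen_def)
qed

lemma sum_gen_Suc: "(\<Sum>j\<in>gen (Suc k). h j) = (\<Sum>i\<in>gen k. h (i @ [False]) + h (i @ [True]))"
  for h :: "bool list \<Rightarrow> 'b::comm_monoid_add"
proof -
  have "(\<Sum>j\<in>gen (Suc k). h j) = (\<Sum>j\<in>(\<lambda>i. i @ [False]) ` gen k. h j) + (\<Sum>j\<in>(\<lambda>i. i @ [True]) ` gen k. h j)"
    unfolding gen_Suc by (rule sum.union_disjoint) auto
  also have "\<dots> = (\<Sum>i\<in>gen k. h (i @ [False]) + h (i @ [True]))"
    by (simp add: sum.reindex inj_on_def sum.distrib)
  finally show ?thesis .
qed

text \<open>Convexity of the fourth power with weights \<open>\<kappa>\<close> and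
  \<open>1 - \<kappa>\<close>, the second point being \<open>u / (1 - \<kappa>)\<close>. The
  coefficient of \<open>x ^ 4\<close> stays below 1, which makes the moment recursion
  contract.\<close>

lemma power4_convex_le:
  assumes "0 \<le> \<kappa>" "\<kappa> < 1" "0 \<le> u" "0 \<le> (x::real)"
  shows "(\<kappa> * x + u) ^ 4 \<le> \<kappa> * x ^ 4 + u ^ 4 / (1 - \<kappa>) ^ 3"
proof -
  let ?v = "u / (1 - \<kappa>)"
  have "((1 - \<kappa>) * ?v + \<kappa> * x) ^ 4 \<le> (1 - \<kappa>) * ?v ^ 4 + \<kappa> * x ^ 4"
    using convex_onD[OF convex_power_even[of 4], of \<kappa> ?v x] assms by simp
  also have "(1 - \<kappa>) * ?v ^ 4 = u ^ 4 / (1 - \<kappa>) ^ 3"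
  proof -
    have "t * (u / t) ^ 4 = u ^ 4 / t ^ 3" if "t \<noteq> 0" for t
      using that by (simp add: power_divide divide_simps eval_nat_numeral)
    then show ?thesis using assms by simp
  qed
  finally show ?thesis using assms by (simp add: add.commute)
qed

section \<open>Moment bounds in the super-critical case\<close>

locale bar_super = bar_model +
  assumes super: "mean_offspring P > 1"
    and moment4: "integrable M (\<lambda>\<omega>. \<bar>cell_val (X [] \<omega>)\<bar> ^ 4)"
begin

abbreviation "m \<equiv> mean_offspring P"

lemma m_gt_1: "m > 1" by (rule super)
lemma m_pos [simp]: "m > 0" "m \<noteq> 0" "0 \<le> m" using super by auto

lemma pmf_surv': "pmf (surv_pmf P) b = (if fst b \<and> snd b then p_both P
     else if fst b then p_only P False else if snd b then p_only P True
     else 1 - p_both P - p_only P False - p_only P True)"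
  by (rule pmf_surv[OF adm])

definition \<kappa> :: real where
  "\<kappa> = Max {\<bar>alpha P False\<bar>, \<bar>alpha P True\<bar>, \<bar>alpha' P False\<bar>, \<bar>alpha' P True\<bar>}"

lemma \<kappa>: "0 \<le> \<kappa>" "\<kappa> < 1" "\<bar>slope P b \<delta>\<bar> \<le> \<kappa>"
proof -
  have "\<bar>alpha P \<delta>\<bar> < 1" "\<bar>alpha' P \<delta>\<bar> < 1" for \<delta> using adm by (auto simp: admissible_def abs_less_iff)
  then show "\<kappa> < 1" "0 \<le> \<kappa>" unfolding \<kappa>_def by (auto simp: le_max_iff_disj)
  show "\<bar>slope P b \<delta>\<bar> \<le> \<kappa>" unfolding \<kappa>_def slope_def by (cases \<delta>) (auto simp: le_max_iff_disj)
qed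

definition noiseC :: real where
  "noiseC = (\<Sum>b\<in>UNIV. \<Sum>\<delta>\<in>UNIV. \<bar>icpt P b \<delta>\<bar> + \<bar>eps1 P b \<delta>\<bar> + \<bar>eps2 P b \<delta>\<bar>)"

lemma noiseC_nonneg: "noiseC \<ge> 0"
  unfolding noiseC_def by (intro sum_nonneg) auto

lemma noiseC_ge: "\<bar>icpt P b \<delta>\<bar> + \<bar>eps1 P b \<delta>\<bar> + \<bar>eps2 P b \<delta>\<bar> \<le> noiseC"
proof -
  have "\<bar>icpt P b \<delta>\<bar> + \<bar>eps1 P b \<delta>\<bar> + \<bar>eps2 P b \<delta>\<bar> \<le> (\<Sum>\<delta>\<in>UNIV. \<bar>icpt P b \<delta>\<bar> + \<bar>eps1 P b \<delta>\<bar> + \<bar>eps2 P b \<delta>\<bar>)"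
    by (rule member_le_sum) auto
  also have "\<dots> \<le> noiseC"
    unfolding noiseC_def by (rule member_le_sum[where f = "\<lambda>b. \<Sum>\<delta>\<in>UNIV. \<bar>icpt P b \<delta>\<bar> + \<bar>eps1 P b \<delta>\<bar> + \<bar>eps2 P b \<delta>\<bar>"]) (auto intro!: sum_nonneg)
  finally show ?thesis .
qed

lemma eps_bound: "\<bar>icpt P (fst e) \<delta>\<bar> + \<bar>eps P (fst e) (snd e) \<delta>\<bar> \<le> noiseC * nsize e"
proof -
  let ?a = "\<bar>fst (snd e)\<bar>" and ?b = "\<bar>snd (snd e)\<bar>" and ?i = "\<bar>icpt P (fst e) \<delta>\<bar>" and ?x = "\<bar>eps1 P (fst e) \<delta>\<bar>"
    and ?y = "\<bar>eps2 P (fst e) \<delta>\<bar>"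
  have "?i + \<bar>eps P (fst e) (snd e) \<delta>\<bar> \<le> ?i + ?x * ?a + ?y * ?b"
    unfolding eps_eq using abs_triangle_ineq[of "eps1 P (fst e) \<delta> * fst (snd e)" "eps2 P (fst e) \<delta> * snd (snd e)"]
    by (simp add: abs_mult)
  also have "\<dots> \<le> (?i + ?x + ?y) * nsize e"
    unfolding nsize_def by (simp add: algebra_simps)
  also have "\<dots> \<le> noiseC * nsize e"
    using noiseC_ge[of "fst e" \<delta>] nsize_ge_1[of e] by (intro mult_right_mono) auto
  finally show ?thesis .
qed

lemma daughter_bound:
  assumes "daughter P (Some x) e \<delta> = Some y"
  shows "\<bar>y\<bar> \<le> \<kappa> * \<bar>x\<bar> + noiseC * nsize e"
proof -
  have y: "y = slope P (fst e) \<delta> * x + icpt P (fst e) \<delta> + eps P (fst e) (snd e) \<delta>"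
    using assms by (auto simp: daughter_def cell_val_def split: if_splits)
  have "\<bar>y\<bar> \<le> \<bar>slope P (fst e) \<delta>\<bar> * \<bar>x\<bar> + (\<bar>icpt P (fst e) \<delta>\<bar> + \<bar>eps P (fst e) (snd e) \<delta>\<bar>)"
    unfolding y by (simp add: abs_mult[symmetric])
  also have "\<dots> \<le> \<kappa> * \<bar>x\<bar> + noiseC * nsize e"
    using \<kappa>(3) eps_bound by (intro add_mono mult_right_mono) auto
  finally show ?thesis .
qed

lemma daughter_None_iff: "daughter P (Some x) e \<delta> = None \<longleftrightarrow> \<not> survives (fst e) \<delta>"
  by (simp add: daughter_def)

definition nsurv :: "bool \<times> bool \<Rightarrow> real" where
  "nsurv b = of_bool (survives b False) + of_bool (survives b True)"

lemma mean_nsurv: "(\<Sum>b\<in>UNIV. pmf (surv_pmf P) b * nsurv b) = m"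
  by (simp add: sum_bool_pair pmf_surv' nsurv_def survives_def mean_offspring_def)

lemma nn_integral_gen_Suc:
  fixes \<phi> :: "real \<Rightarrow> ennreal"
  assumes [measurable]: "\<phi> \<in> borel_measurable borel"
  shows "(\<integral>\<^sup>+\<omega>. (\<Sum>j\<in>gen (Suc k). ext \<phi> (X j \<omega>)) \<partial>M) =
    (\<integral>\<^sup>+\<omega>. (\<Sum>i\<in>gen k. ext (\<lambda>x. \<integral>\<^sup>+e. ext \<phi> (daughter P (Some x) e False) + ext \<phi> (daughter P (Some x) e True) \<partial>noise P) (X i \<omega>)) \<partial>M)"
proof -
  interpret N: prob_space "noise P" by (rule prob_space_noise)
  let ?g = "\<lambda>(\<omega>::'a) v. ext \<phi> (fst v) + ext \<phi> (snd v)"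
  let ?L = "\<lambda>x. \<integral>\<^sup>+e. ext \<phi> (daughter P (Some x) e False) + ext \<phi> (daughter P (Some x) e True) \<partial>noise P"
  have L: "(\<integral>\<^sup>+e. ?g \<omega> (offspring P s e) \<partial>noise P) = ext ?L s" for s \<omega>
    by (cases s) (auto simp: offspring_None, simp add: offspring_def)
  have "(\<lambda>s. \<integral>\<^sup>+e. ?g undefined (offspring P s e) \<partial>noise P) \<in> borel_measurable Sbar"
    by measurable
  then have Lm [measurable]: "ext ?L \<in> borel_measurable Sbar" unfolding L .
  have "(\<integral>\<^sup>+\<omega>. (\<Sum>j\<in>gen (Suc k). ext \<phi> (X j \<omega>)) \<partial>M) = (\<Sum>i\<in>gen k. \<integral>\<^sup>+\<omega>. ?g \<omega> (V i \<omega>) \<partial>M)"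
    unfolding sum_gen_Suc by (subst nn_integral_sum) auto
  also have "\<dots> = (\<Sum>i\<in>gen k. \<integral>\<^sup>+\<omega>. ext ?L (X i \<omega>) \<partial>M)"
  proof (intro sum.cong refl)
    fix i assume i: "i \<in> gen k"
    have "case_prod ?g \<in> borel_measurable (F k \<Otimes>\<^sub>M (Sbar \<Otimes>\<^sub>M Sbar))" by measurable
    from nn_integral_past[OF i this]
    show "(\<integral>\<^sup>+\<omega>. ?g \<omega> (V i \<omega>) \<partial>M) = (\<integral>\<^sup>+\<omega>. ext ?L (X i \<omega>) \<partial>M)" unfolding L .
  qed
  also have "\<dots> = (\<integral>\<^sup>+\<omega>. (\<Sum>i\<in>gen k. ext ?L (X i \<omega>)) \<partial>M)"
    by (subst nn_integral_sum) auto
  finally show ?thesis .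
qed

text \<open>The expected number of living daughters gives the factor \<open>m\<close>, whatever the
  value of the mother; \<open>h\<close> carries the dependence on the mother and \<open>c\<close>
  that on the noise. Pattern and normals are independent, hence the plain factor
  \<open>nmoment\<close>.\<close>

lemma nn_integral_gen_Suc_le:
  fixes f h :: "real \<Rightarrow> real"
  assumes [measurable]: "f \<in> borel_measurable borel" "h \<in> borel_measurable borel" and f: "\<And>x. f x \<ge> 0"
    and c: "c \<ge> 0" and h: "\<And>x. h x \<ge> 0"
    and le: "\<And>x e \<delta> y. daughter P (Some x) e \<delta> = Some y \<Longrightarrow> f y \<le> h x + c * nsize e ^ 4"
  shows "(\<integral>\<^sup>+\<omega>. (\<Sum>j\<in>gen (Suc k). ext (\<lambda>x. ennreal (f x)) (X j \<omega>)) \<partial>M) \<le>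
    ennreal m * (\<integral>\<^sup>+\<omega>. (\<Sum>i\<in>gen k. ext (\<lambda>x. ennreal (h x + c * nmoment)) (X i \<omega>)) \<partial>M)"
proof -
  have "(\<integral>\<^sup>+e. ext (\<lambda>x. ennreal (f x)) (daughter P (Some x) e False) + ext (\<lambda>x. ennreal (f x)) (daughter P (Some x) e True) \<partial>noise P)
    \<le> ennreal (m * (h x + c * nmoment))" for x
  proof -
    have "(\<integral>\<^sup>+e. ext (\<lambda>x. ennreal (f x)) (daughter P (Some x) e False) + ext (\<lambda>x. ennreal (f x)) (daughter P (Some x) e True) \<partial>noise P)
      \<le> (\<integral>\<^sup>+e. ennreal (h x * nsurv (fst e) + c * nsurv (fst e) * nsize e ^ 4) \<partial>noise P)"
    proof (intro nn_integral_mono)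
      fix e
      have 1: "ext (\<lambda>x. ennreal (f x)) (daughter P (Some x) e \<delta>) \<le> ennreal (of_bool (survives (fst e) \<delta>) * (h x + c * nsize e ^ 4))" for \<delta>
        using le[of x e \<delta>] daughter_None_iff[of x e \<delta>]
        by (cases "daughter P (Some x) e \<delta>") (auto intro!: ennreal_leI)
      have nn: "0 \<le> h x + c * nsize e ^ 4" using h c nsize_ge_1[of e] by simp
      have "ext (\<lambda>x. ennreal (f x)) (daughter P (Some x) e False) + ext (\<lambda>x. ennreal (f x)) (daughter P (Some x) e True)
        \<le> ennreal (of_bool (survives (fst e) False) * (h x + c * nsize e ^ 4)) + ennreal (of_bool (survives (fst e) True) * (h x + c * nsize e ^ 4))"
        using 1 by (intro add_mono)
      also have "\<dots> = ennreal (h x * nsurv (fst e) + c * nsurv (fst e) * nsize e ^ 4)"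
        using nn by (subst ennreal_plus[symmetric]) (auto simp: nsurv_def algebra_simps)
      finally show "ext (\<lambda>x. ennreal (f x)) (daughter P (Some x) e False) + ext (\<lambda>x. ennreal (f x)) (daughter P (Some x) e True)
        \<le> ennreal (h x * nsurv (fst e) + c * nsurv (fst e) * nsize e ^ 4)" .
    qed
    also have "\<dots> = ennreal (\<integral>e. h x * nsurv (fst e) + c * nsurv (fst e) * nsize e ^ 4 \<partial>noise P)"
      using noise_integral_weight(1)[of P "\<lambda>b. h x * nsurv b"] noise_integral_weight_nsize(1)[of P "\<lambda>b. c * nsurv b"]
        h c nsize_ge_1
      by (intro nn_integral_eq_integral) (auto simp: nsurv_def intro!: AE_I2 add_nonneg_nonneg mult_nonneg_nonneg)
    also have "(\<integral>e. h x * nsurv (fst e) + c * nsurv (fst e) * nsize e ^ 4 \<partial>noise P) = m * (h x + c * nmoment)"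
      using noise_integral_weight[of P "\<lambda>b. h x * nsurv b"] noise_integral_weight_nsize[of P "\<lambda>b. c * nsurv b"]
      by (simp add: mean_nsurv[symmetric] sum_distrib_left sum_distrib_right sum.distrib algebra_simps)
    finally show ?thesis .
  qed
  then have "ext (\<lambda>x. \<integral>\<^sup>+e. ext (\<lambda>x. ennreal (f x)) (daughter P (Some x) e False) + ext (\<lambda>x. ennreal (f x)) (daughter P (Some x) e True) \<partial>noise P) s
    \<le> ennreal m * ext (\<lambda>x. ennreal (h x + c * nmoment)) s" for s
    using h c nmoment_ge_1 by (cases s) (auto simp: ennreal_mult)
  then show ?thesis
    by (subst nn_integral_gen_Suc, simp, subst nn_integral_cmult[symmetric], simp)
       (auto simp: sum_distrib_left intro!: nn_integral_mono sum_mono)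
qed

definition S :: "(real \<Rightarrow> real) \<Rightarrow> nat \<Rightarrow> 'a \<Rightarrow> real" where
  "S f k \<omega> = (\<Sum>i\<in>gen k. ext f (X i \<omega>))"

lemma measurable_S [measurable]: "f \<in> borel_measurable borel \<Longrightarrow> S f k \<in> borel_measurable M"
  unfolding S_def by (intro borel_measurable_sum measurable_compose[OF measurable_X measurable_ext])

lemma measurable_S_past: "f \<in> borel_measurable borel \<Longrightarrow> k \<le> l \<Longrightarrow> S f k \<in> borel_measurable (F l)"
  unfolding S_def by (intro borel_measurable_sum measurable_compose[OF X_measurable_past measurable_ext]) (auto simp: gen_def)

text \<open>Let \<open>a k\<close> be the integral. One generation gives
  \<open>a (Suc k) \<le> m * (\<kappa> * a k + c' * m ^ k)\<close>: the autoregression contracts by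
  \<open>\<kappa>\<close> while the population grows by \<open>m\<close>, so the growth rate remains
  that of the population.\<close>

lemma nn_integral_pow4_bound: "\<exists>K\<ge>1. \<forall>k. (\<integral>\<^sup>+\<omega>. (\<Sum>i\<in>gen k. ext (\<lambda>x. ennreal (1 + x ^ 4)) (X i \<omega>)) \<partial>M) \<le> ennreal (K * m ^ k)"
proof -
  define c where "c = noiseC ^ 4 / (1 - \<kappa>) ^ 3"
  have c: "c \<ge> 0" using \<kappa>(2) by (simp add: c_def)
  define c' where "c' = (1 + c) * nmoment"
  have c': "c' \<ge> 0" using c nmoment_ge_1 by (simp add: c'_def)
  \<comment> \<open>The first entry dominates the ancestor; the second is the fixed point of
    \<open>K \<mapsto> \<kappa> * K + c'\<close>, so any larger \<open>K\<close> is preserved by the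
    recursion.\<close>
  define K where "K = max (1 + (\<integral>\<omega>. \<bar>cell_val (X [] \<omega>)\<bar> ^ 4 \<partial>M)) (c' / (1 - \<kappa>))"
  have K: "K \<ge> 1" "K \<ge> 0" "\<kappa> * K + c' \<le> K"
  proof -
    show K1: "K \<ge> 1" unfolding K_def by (auto simp: le_max_iff_disj)
    then show "K \<ge> 0" by simp
    have "c' / (1 - \<kappa>) \<le> K" by (simp add: K_def)
    then show "\<kappa> * K + c' \<le> K" using \<kappa>(2) by (simp add: field_simps)
  qed
  \<comment> \<open>The additive constant of the recursion is charged to each living mother, so the
    expected population is bounded alongside.\<close>
  have one: "(\<integral>\<^sup>+\<omega>. (\<Sum>i\<in>gen k. ext (\<lambda>x. ennreal 1) (X i \<omega>)) \<partial>M) \<le> ennreal (m ^ k)" for k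
  proof (induction k)
    case 0
    have "ext (\<lambda>x. ennreal 1) s \<le> 1" for s by (cases s) auto
    then have "(\<integral>\<^sup>+\<omega>. (\<Sum>i\<in>gen 0. ext (\<lambda>x. ennreal 1) (X i \<omega>)) \<partial>M) \<le> (\<integral>\<^sup>+\<omega>. 1 \<partial>M)"
      by (intro nn_integral_mono) (simp add: gen_0)
    then show ?case by (simp add: emeasure_space_1)
  next
    case (Suc k)
    have "(\<integral>\<^sup>+\<omega>. (\<Sum>i\<in>gen (Suc k). ext (\<lambda>x. ennreal 1) (X i \<omega>)) \<partial>M) \<le>
      ennreal m * (\<integral>\<^sup>+\<omega>. (\<Sum>i\<in>gen k. ext (\<lambda>x. ennreal (1 + 0 * nmoment)) (X i \<omega>)) \<partial>M)"
      by (rule nn_integral_gen_Suc_le) auto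
    also have "\<dots> \<le> ennreal m * ennreal (m ^ k)" using Suc by (intro mult_left_mono) auto
    finally show ?case by (simp add: ennreal_mult)
  qed
  have "(\<integral>\<^sup>+\<omega>. (\<Sum>i\<in>gen k. ext (\<lambda>x. ennreal (1 + x ^ 4)) (X i \<omega>)) \<partial>M) \<le> ennreal (K * m ^ k)" for k
  proof (induction k)
    case 0
    have "ext (\<lambda>x. ennreal (1 + x ^ 4)) s \<le> ennreal (1 + \<bar>cell_val s\<bar> ^ 4)" for s
      by (cases s) (auto simp: cell_val_def intro!: ennreal_leI)
    then have "(\<integral>\<^sup>+\<omega>. (\<Sum>i\<in>gen 0. ext (\<lambda>x. ennreal (1 + x ^ 4)) (X i \<omega>)) \<partial>M) \<le> (\<integral>\<^sup>+\<omega>. ennreal (1 + \<bar>cell_val (X [] \<omega>)\<bar> ^ 4) \<partial>M)"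
      by (intro nn_integral_mono) (simp add: gen_0)
    also have "\<dots> = ennreal (1 + (\<integral>\<omega>. \<bar>cell_val (X [] \<omega>)\<bar> ^ 4 \<partial>M))"
      using moment4 by (subst nn_integral_eq_integral) (auto simp: prob_space)
    also have "\<dots> \<le> ennreal (K * m ^ 0)" by (intro ennreal_leI) (simp add: K_def)
    finally show ?case .
  next
    case (Suc k)
    have "(\<integral>\<^sup>+\<omega>. (\<Sum>i\<in>gen (Suc k). ext (\<lambda>x. ennreal (1 + x ^ 4)) (X i \<omega>)) \<partial>M) \<le>
      ennreal m * (\<integral>\<^sup>+\<omega>. (\<Sum>i\<in>gen k. ext (\<lambda>x. ennreal (\<kappa> * x ^ 4 + (1 + c) * nmoment)) (X i \<omega>)) \<partial>M)"
    proof (rule nn_integral_gen_Suc_le)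
      fix x e \<delta> y assume y: "daughter P (Some x) e \<delta> = Some y"
      have "y ^ 4 = \<bar>y\<bar> ^ 4" by simp
      also have "\<dots> \<le> (\<kappa> * \<bar>x\<bar> + noiseC * nsize e) ^ 4"
        by (rule power_mono[OF daughter_bound[OF y]]) simp
      also have "\<dots> \<le> \<kappa> * \<bar>x\<bar> ^ 4 + (noiseC * nsize e) ^ 4 / (1 - \<kappa>) ^ 3"
        using \<kappa> noiseC_nonneg nsize_ge_1[of e] by (intro power4_convex_le) auto
      also have "\<dots> = \<kappa> * x ^ 4 + c * nsize e ^ 4" by (simp add: c_def power_mult_distrib)
      finally show "1 + y ^ 4 \<le> \<kappa> * x ^ 4 + (1 + c) * nsize e ^ 4"
        using one_le_power[OF nsize_ge_1[of e], of 4] by (simp add: algebra_simps)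
    qed (use \<kappa> c in auto)
    also have "\<dots> \<le> ennreal m * (ennreal \<kappa> * (\<integral>\<^sup>+\<omega>. (\<Sum>i\<in>gen k. ext (\<lambda>x. ennreal (1 + x ^ 4)) (X i \<omega>)) \<partial>M)
       + ennreal c' * (\<integral>\<^sup>+\<omega>. (\<Sum>i\<in>gen k. ext (\<lambda>x. ennreal 1) (X i \<omega>)) \<partial>M))"
    proof -
      have "ext (\<lambda>x. ennreal (\<kappa> * x ^ 4 + c')) s \<le> ennreal \<kappa> * ext (\<lambda>x. ennreal (1 + x ^ 4)) s + ennreal c' * ext (\<lambda>x. ennreal 1) s" for s
        using \<kappa>(1) c' by (cases s) (auto simp: ennreal_mult[symmetric] ennreal_plus[symmetric] simp del: ennreal_plus intro!: ennreal_leI simp: algebra_simps)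
      then show ?thesis unfolding c'_def[symmetric]
        by (intro mult_left_mono, subst (1 2) nn_integral_cmult[symmetric], simp, simp, subst nn_integral_add[symmetric])
          (auto simp: sum_distrib_left sum.distrib[symmetric] intro!: nn_integral_mono sum_mono)
    qed
    also have "\<dots> \<le> ennreal m * (ennreal \<kappa> * ennreal (K * m ^ k) + ennreal c' * ennreal (m ^ k))"
      using Suc one by (intro mult_left_mono add_mono) auto
    also have "\<dots> = ennreal (m * (\<kappa> * K + c') * m ^ k)"
      using \<kappa>(1) c' K by (simp add: ennreal_mult[symmetric] ennreal_plus[symmetric] algebra_simps del: ennreal_plus)
    also have "\<dots> \<le> ennreal (K * m ^ Suc k)"
      using K(3) by (intro ennreal_leI) simp
    finally show ?case .
  qed
  with K(1) show ?thesis by blast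
qed

end

section \<open>Tools: recursions, averages and elementary inequalities\<close>

lemma AE_summable_of_nn_integral:
  fixes f :: "nat \<Rightarrow> 'a \<Rightarrow> real"
  assumes [measurable]: "\<And>k. f k \<in> borel_measurable M" and nn: "\<And>k x. 0 \<le> f k x"
    and le: "\<And>k. (\<integral>\<^sup>+x. ennreal (f k x) \<partial>M) \<le> ennreal (c k)" and c: "summable c" "\<And>k. 0 \<le> c k"
  shows "AE x in M. summable (\<lambda>k. f k x)"
proof -
  \<comment> \<open>Expectations are summed first: a series with finite expectation is finite almost
    surely, which does the work of Markov's inequality and Borel-Cantelli at once.\<close>
  have "(\<integral>\<^sup>+x. (\<Sum>k. ennreal (f k x)) \<partial>M) = (\<Sum>k. \<integral>\<^sup>+x. ennreal (f k x) \<partial>M)"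
    by (rule nn_integral_suminf) simp
  also have "\<dots> \<le> (\<Sum>k. ennreal (c k))" by (intro suminf_le le) auto
  also have "\<dots> = ennreal (\<Sum>k. c k)" by (rule suminf_ennreal2[OF c(2) c(1)])
  finally have "(\<integral>\<^sup>+x. (\<Sum>k. ennreal (f k x)) \<partial>M) < \<infinity>" by (simp add: le_less_trans[OF _ ennreal_less_top])
  then have "AE x in M. (\<Sum>k. ennreal (f k x)) \<noteq> \<infinity>" by (intro nn_integral_noteq_infinite) auto
  then show ?thesis
  proof eventually_elim
    case (elim x)
    then show ?case using nn by (intro summable_suminf_not_top) auto
  qed
qed

text \<open>The factor \<open>\<bar>r\<bar> < 1\<close> forgets the initial value, and an input
  eventually below \<open>\<eta>\<close> keeps the sequence asymptotically within
  \<open>\<eta> / (1 - \<bar>r\<bar>)\<close>.\<close>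

lemma linear_recursion_tendsto_0:
  fixes a d :: "nat \<Rightarrow> real"
  assumes r: "\<bar>r\<bar> < 1" and rec: "\<And>k. a (Suc k) = r * a k + d k" and d: "d \<longlonglongrightarrow> 0"
  shows "a \<longlonglongrightarrow> 0"
proof (rule LIMSEQ_I)
  fix e :: real assume e: "e > 0"
  define \<eta> where "\<eta> = e * (1 - \<bar>r\<bar>) / 2"
  have \<eta>: "\<eta> > 0" using e r by (simp add: \<eta>_def)
  obtain N where N: "\<And>k. k \<ge> N \<Longrightarrow> \<bar>d k\<bar> < \<eta>"
    using LIMSEQ_D[OF d \<eta>] by auto
  have b: "\<bar>a (N + j)\<bar> \<le> \<bar>r\<bar> ^ j * \<bar>a N\<bar> + e / 2" for j
  proof (induction j)
    case (Suc j)
    have "\<bar>a (N + Suc j)\<bar> \<le> \<bar>r\<bar> * \<bar>a (N + j)\<bar> + \<bar>d (N + j)\<bar>"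
      using rec[of "N + j"] abs_triangle_ineq[of "r * a (N + j)" "d (N + j)"] by (simp add: abs_mult)
    also have "\<dots> \<le> \<bar>r\<bar> * (\<bar>r\<bar> ^ j * \<bar>a N\<bar> + e / 2) + \<eta>"
      using N[of "N + j"] Suc by (intro add_mono mult_left_mono) auto
    also have "\<dots> \<le> \<bar>r\<bar> ^ Suc j * \<bar>a N\<bar> + e / 2" by (simp add: \<eta>_def field_simps)
    finally show ?case .
  qed (use e in simp)
  have "(\<lambda>j. \<bar>r\<bar> ^ j * \<bar>a N\<bar>) \<longlonglongrightarrow> 0 * \<bar>a N\<bar>"
    using r by (intro tendsto_mult LIMSEQ_power_zero tendsto_const) auto
  then obtain J where J: "\<And>j. j \<ge> J \<Longrightarrow> \<bar>r\<bar> ^ j * \<bar>a N\<bar> < e / 2"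
    using LIMSEQ_D[of "\<lambda>j. \<bar>r\<bar> ^ j * \<bar>a N\<bar>" 0 "e / 2"] e by (auto simp: abs_mult)
  show "\<exists>no. \<forall>n\<ge>no. norm (a n - 0) < e"
  proof (intro exI allI impI)
    fix n assume n: "n \<ge> N + J"
    show "norm (a n - 0) < e"
    proof -
      have "J \<le> n - N" "N + (n - N) = n" using n by auto
      then show ?thesis using b[of "n - N"] J[of "n - N"] by simp
    qed
  qed
qed

text \<open>The averages obey a linear recursion with factor \<open>1 / m\<close>, whose fixed point
  for constant input \<open>L\<close> is \<open>L * m / (m - 1)\<close>. This turns limits per
  generation into limits over the tree.\<close>

lemma geometric_average_tendsto:
  fixes x :: "nat \<Rightarrow> real"
  assumes m: "m > 1" and x: "x \<longlonglongrightarrow> L"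
  shows "(\<lambda>n. (\<Sum>k\<le>n. m ^ k * x k) / m ^ n) \<longlonglongrightarrow> L * m / (m - 1)"
proof -
  let ?t = "\<lambda>n. (\<Sum>k\<le>n. m ^ k * x k) / m ^ n"
  have "(\<lambda>n. ?t n - L * m / (m - 1)) \<longlonglongrightarrow> 0"
  proof (rule linear_recursion_tendsto_0)
    show "\<bar>1 / m\<bar> < 1" using m by simp
    show "?t (Suc k) - L * m / (m - 1) = 1 / m * (?t k - L * m / (m - 1)) + (x (Suc k) - L)" for k
      using m by (simp add: divide_simps) (simp add: algebra_simps)
    show "(\<lambda>k. x (Suc k) - L) \<longlonglongrightarrow> 0"
      using LIMSEQ_Suc[OF x] by (simp add: LIM_zero)
  qed
  then show ?thesis by (rule LIM_zero_cancel)
qed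

text \<open>Geometric weights will be inserted, so that sums over many generations cost only a
  constant factor.\<close>

lemma weighted_Cauchy_Schwarz:
  fixes x w :: "'i \<Rightarrow> real"
  assumes "\<And>i. i \<in> A \<Longrightarrow> w i > 0"
  shows "(\<Sum>i\<in>A. x i)\<^sup>2 \<le> (\<Sum>i\<in>A. w i) * (\<Sum>i\<in>A. (x i)\<^sup>2 / w i)"
proof -
  have "(\<Sum>i\<in>A. x i)\<^sup>2 = (\<Sum>i\<in>A. sqrt (w i) * (x i / sqrt (w i)))\<^sup>2"
  proof (intro arg_cong[where f = "\<lambda>t. t\<^sup>2"] sum.cong refl)
    show "x i = sqrt (w i) * (x i / sqrt (w i))" if "i \<in> A" for i using assms[OF that] by simp
  qed
  also have "\<dots> \<le> (\<Sum>i\<in>A. (sqrt (w i))\<^sup>2) * (\<Sum>i\<in>A. (x i / sqrt (w i))\<^sup>2)"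
    by (rule Cauchy_Schwarz_ineq_sum)
  also have "\<dots> = (\<Sum>i\<in>A. w i) * (\<Sum>i\<in>A. (x i)\<^sup>2 / w i)"
    using assms by (intro arg_cong2[where f = "(*)"] sum.cong) (auto simp: power_divide less_imp_le)
  finally show ?thesis .
qed

text \<open>This is \<open>t \<le> t\<^sup>2 + 1\<close> for \<open>t = u * d\<close>, divided by
  \<open>u\<close>. It converts weighted summability of squares into summability of absolute
  values.\<close>

lemma le_mult_square_add_inverse:
  fixes u d :: real
  assumes "u > 0" "d \<ge> 0"
  shows "d \<le> u * d\<^sup>2 + 1 / u"
proof -
  have "0 \<le> u * d" using assms by simp
  then have "u * d \<le> (u * d)\<^sup>2 + 1" using sum_squares_bound[of "u * d" 1] by simp
  then have "(u * d) / u \<le> ((u * d)\<^sup>2 + 1) / u" using assms by (intro divide_right_mono) auto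
  then show ?thesis using assms by (simp add: add_divide_distrib power2_eq_square mult.left_commute mult.commute)
qed

text \<open>The analogue of \<open>ext\<close> with a second argument, usually the pair of
  daughters; dead mothers contribute 0.\<close>

definition gext :: "(real \<Rightarrow> 'v \<Rightarrow> 'b::zero) \<Rightarrow> real option \<Rightarrow> 'v \<Rightarrow> 'b" where
  "gext g s v = (case s of None \<Rightarrow> 0 | Some x \<Rightarrow> g x v)"

lemma gext_simps [simp]: "gext g None v = 0" "gext g (Some x) v = g x v"
  by (simp_all add: gext_def)

lemma measurable_gext:
  assumes [measurable]: "(\<lambda>(x, v). g x v) \<in> borel_measurable (borel \<Otimes>\<^sub>M N)"
  shows "(\<lambda>(s, v). gext g s v) \<in> borel_measurable (Sbar \<Otimes>\<^sub>M N)"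
proof -
  have "gext g s v = (if s = None then 0 else g (cell_val s) v)" for s v
    by (cases s) (auto simp: cell_val_def)
  moreover have "(\<lambda>(s, v). if s = None then 0 else g (cell_val s) v) \<in> borel_measurable (Sbar \<Otimes>\<^sub>M N)"
    unfolding split_beta' by measurable
  ultimately show ?thesis by simp
qed

section \<open>Martingale increments\<close>

context bar_super
begin

definition K4 :: real where
  "K4 = (SOME K. K \<ge> 1 \<and> (\<forall>k. (\<integral>\<^sup>+\<omega>. (\<Sum>i\<in>gen k. ext (\<lambda>x. ennreal (1 + x ^ 4)) (X i \<omega>)) \<partial>M) \<le> ennreal (K * m ^ k)))"

lemma K4: "K4 \<ge> 1" "(\<integral>\<^sup>+\<omega>. (\<Sum>i\<in>gen k. ext (\<lambda>x. ennreal (1 + x ^ 4)) (X i \<omega>)) \<partial>M) \<le> ennreal (K4 * m ^ k)"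
  using someI_ex[OF nn_integral_pow4_bound[unfolded Bex_def]] unfolding K4_def by blast+

text \<open>Admissible summands of martingale increments. Growth is quadratic in \<open>x\<close>
  and in the noise, so that squares are controlled by the fourth moment bound. The mean is
  prescribed at living mothers; the dead contribute 0 through \<open>gext\<close>.\<close>

definition mdiff :: "real \<Rightarrow> (real \<Rightarrow> real option \<times> real option \<Rightarrow> real) \<Rightarrow> bool" where
  "mdiff C g \<longleftrightarrow> C \<ge> 0 \<and> (\<lambda>(x, v). g x v) \<in> borel_measurable (borel \<Otimes>\<^sub>M (Sbar \<Otimes>\<^sub>M Sbar)) \<and>
     (\<forall>x e. \<bar>g x (offspring P (Some x) e)\<bar> \<le> C * (1 + x\<^sup>2) * (nsize e)\<^sup>2) \<and>
     (\<forall>x. (\<integral>e. g x (offspring P (Some x) e) \<partial>noise P) = 0)"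

definition D :: "(real \<Rightarrow> real option \<times> real option \<Rightarrow> real) \<Rightarrow> nat \<Rightarrow> 'a \<Rightarrow> real" where
  "D g k \<omega> = (\<Sum>i\<in>gen k. gext g (X i \<omega>) (V i \<omega>))"

lemma measurable_gext_past:
  assumes "i \<in> gen k" "(\<lambda>(x, v). g x v) \<in> borel_measurable (borel \<Otimes>\<^sub>M (Sbar \<Otimes>\<^sub>M Sbar))"
  shows "(\<lambda>(\<omega>, v). gext g (X i \<omega>) v) \<in> borel_measurable (F k \<Otimes>\<^sub>M (Sbar \<Otimes>\<^sub>M Sbar))"
proof -
  have "(\<lambda>w. (X i (fst w), snd w)) \<in> measurable (F k \<Otimes>\<^sub>M (Sbar \<Otimes>\<^sub>M Sbar)) (Sbar \<Otimes>\<^sub>M (Sbar \<Otimes>\<^sub>M Sbar))"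
    using assms(1) by measurable
  from measurable_compose[OF this measurable_gext[OF assms(2)]] show ?thesis by (simp add: split_beta')
qed

lemma measurable_D_past:
  assumes g: "(\<lambda>(x, v). g x v) \<in> borel_measurable (borel \<Otimes>\<^sub>M (Sbar \<Otimes>\<^sub>M Sbar))" and "k < l"
  shows "D g k \<in> borel_measurable (F l)"
  unfolding D_def
proof (intro borel_measurable_sum)
  fix i assume "i \<in> gen k"
  then have "(\<lambda>\<omega>. (X i \<omega>, V i \<omega>)) \<in> measurable (F l) (Sbar \<Otimes>\<^sub>M (Sbar \<Otimes>\<^sub>M Sbar))"
    using \<open>k < l\<close> by (intro measurable_Pair X_measurable_past) (auto simp: gen_def)
  from measurable_compose[OF this measurable_gext[OF g]]
  show "(\<lambda>\<omega>. gext g (X i \<omega>) (V i \<omega>)) \<in> borel_measurable (F l)" by simp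
qed

lemma measurable_D:
  assumes g: "(\<lambda>(x, v). g x v) \<in> borel_measurable (borel \<Otimes>\<^sub>M (Sbar \<Otimes>\<^sub>M Sbar))"
  shows "D g k \<in> borel_measurable M"
  by (rule past_measurable[OF measurable_D_past[OF g lessI]])

lemma measurable_offspring_noise: "(\<lambda>e. offspring P s e) \<in> measurable (noise P) (Sbar \<Otimes>\<^sub>M Sbar)"
  by (rule measurable_compose[OF _ measurable_offspring, of "\<lambda>e. (s, e)", simplified])
    (auto intro!: measurable_Pair simp: measurable_ident_sets[OF sets_noise])

lemma measurable_g_noise:
  assumes g: "(\<lambda>(x, v). g x v) \<in> borel_measurable (borel \<Otimes>\<^sub>M (Sbar \<Otimes>\<^sub>M Sbar))"
  shows "(\<lambda>e. g x (offspring P (Some x) e)) \<in> borel_measurable (noise P)"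
  using measurable_compose[OF measurable_Pair[OF measurable_const measurable_offspring_noise] g, of x "Some x"] by simp

lemma nsize_pow_mono: "a \<le> b \<Longrightarrow> nsize e ^ a \<le> nsize e ^ b"
  by (rule power_increasing) (use nsize_ge_1 in auto)

lemma mdiff_integrable:
  assumes "mdiff C g"
  shows "integrable (noise P) (\<lambda>e. gext g s (offspring P s e))"
proof (cases s)
  case (Some x)
  have "integrable (noise P) (\<lambda>e. g x (offspring P (Some x) e))"
  proof (rule integrable_noise_bounded[where C = "C * (1 + x\<^sup>2)"])
    show "(\<lambda>e. g x (offspring P (Some x) e)) \<in> borel_measurable (noise P)"
      by (rule measurable_g_noise) (use assms in \<open>simp add: mdiff_def\<close>)
    fix e
    have "norm (g x (offspring P (Some x) e)) \<le> C * (1 + x\<^sup>2) * (nsize e)\<^sup>2" using assms unfolding mdiff_def real_norm_def by blast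
    also have "\<dots> \<le> C * (1 + x\<^sup>2) * nsize e ^ 4"
      using assms by (intro mult_left_mono nsize_pow_mono) (auto simp: mdiff_def)
    finally show "norm (g x (offspring P (Some x) e)) \<le> C * (1 + x\<^sup>2) * nsize e ^ 4" .
  qed
  then show ?thesis by (simp add: Some)
qed simp

lemma mdiff_mean_0: "mdiff C g \<Longrightarrow> (\<integral>e. gext g s (offspring P s e) \<partial>noise P) = 0"
  by (cases s) (auto simp: mdiff_def)

text \<open>Distinct cells are orthogonal given the past, so only the diagonal survives, and each
  diagonal term is controlled by \<open>1 + x ^ 4\<close> at its mother. The second moment thus
  grows like the population and not like its square.\<close>

lemma D_second_moment:
  assumes g: "mdiff C g"
  shows "integrable M (\<lambda>\<omega>. (D g k \<omega>)\<^sup>2)"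
    and "(\<integral>\<omega>. (D g k \<omega>)\<^sup>2 \<partial>M) \<le> 2 * C\<^sup>2 * nmoment * K4 * m ^ k"
proof -
  let ?h = "\<lambda>i \<omega>. gext g (X i \<omega>) (V i \<omega>)"
  have C: "C \<ge> 0" and gm: "(\<lambda>(x, v). g x v) \<in> borel_measurable (borel \<Otimes>\<^sub>M (Sbar \<Otimes>\<^sub>M Sbar))"
    and gb: "\<And>x e. \<bar>g x (offspring P (Some x) e)\<bar> \<le> C * (1 + x\<^sup>2) * (nsize e)\<^sup>2"
    using g by (auto simp: mdiff_def)
  have hm [measurable]: "?h i \<in> borel_measurable M" for i
  proof -
    have "(\<lambda>\<omega>. (X i \<omega>, V i \<omega>)) \<in> measurable M (Sbar \<Otimes>\<^sub>M (Sbar \<Otimes>\<^sub>M Sbar))" by (intro measurable_Pair measurable_X)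
    from measurable_compose[OF this measurable_gext[OF gm]] show ?thesis by simp
  qed
  \<comment> \<open>\<open>nmoment\<close> integrates the noise; the factor 2 comes from
    \<open>(1 + x\<^sup>2)\<^sup>2 \<le> 2 * (1 + x ^ 4)\<close>.\<close>
  define c where "c = 2 * C\<^sup>2 * nmoment"
  have c: "c \<ge> 0" using nmoment_ge_1 by (simp add: c_def)
  have inner: "(\<integral>\<^sup>+e. ennreal ((gext g s (offspring P s e))\<^sup>2) \<partial>noise P) \<le> ennreal c * ext (\<lambda>x. ennreal (1 + x ^ 4)) s" for s
  proof (cases s)
    case (Some x)
    have "(\<integral>\<^sup>+e. ennreal ((g x (offspring P (Some x) e))\<^sup>2) \<partial>noise P) \<le> (\<integral>\<^sup>+e. ennreal (C\<^sup>2 * (1 + x\<^sup>2)\<^sup>2 * nsize e ^ 4) \<partial>noise P)"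
    proof (intro nn_integral_mono ennreal_leI)
      fix e
      have "(g x (offspring P (Some x) e))\<^sup>2 \<le> (C * (1 + x\<^sup>2) * (nsize e)\<^sup>2)\<^sup>2"
        by (rule abs_le_square_iff[THEN iffD1]) (use gb[of x e] in auto)
      then show "(g x (offspring P (Some x) e))\<^sup>2 \<le> C\<^sup>2 * (1 + x\<^sup>2)\<^sup>2 * nsize e ^ 4"
        by (simp add: power_mult_distrib flip: power_mult)
    qed
    also have "\<dots> = ennreal (C\<^sup>2 * (1 + x\<^sup>2)\<^sup>2 * nmoment)"
    proof -
      have "(\<Sum>b\<in>UNIV. pmf (surv_pmf P) b) = 1" by (intro sum_pmf_eq_1) auto
      then show ?thesis
        using noise_integral_weight_nsize[of P "\<lambda>_. C\<^sup>2 * (1 + x\<^sup>2)\<^sup>2"] nsize_ge_1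
        by (subst nn_integral_eq_integral) (auto simp: sum_distrib_right[symmetric] intro!: AE_I2)
    qed
    also have "\<dots> \<le> ennreal (c * (1 + x ^ 4))"
    proof (intro ennreal_leI)
      have "(1 + x\<^sup>2)\<^sup>2 \<le> 2 * (1 + x ^ 4)" using zero_le_power2[of "x\<^sup>2 - 1"] by (simp add: power2_eq_square algebra_simps power4_eq_xxxx)
      then have "(C\<^sup>2 * nmoment) * (1 + x\<^sup>2)\<^sup>2 \<le> (C\<^sup>2 * nmoment) * (2 * (1 + x ^ 4))"
        using nmoment_ge_1 by (intro mult_left_mono) auto
      then show "C\<^sup>2 * (1 + x\<^sup>2)\<^sup>2 * nmoment \<le> c * (1 + x ^ 4)" by (simp add: c_def algebra_simps)
    qed
    finally show ?thesis using c by (simp add: Some ennreal_mult)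
  qed simp
  have one: "(\<integral>\<^sup>+\<omega>. ennreal ((?h i \<omega>)\<^sup>2) \<partial>M) \<le> ennreal c * (\<integral>\<^sup>+\<omega>. ext (\<lambda>x. ennreal (1 + x ^ 4)) (X i \<omega>) \<partial>M)" if i: "i \<in> gen k" for i
  proof -
    have "(\<lambda>(\<omega>, v). ennreal ((gext g (X i \<omega>) v)\<^sup>2)) \<in> borel_measurable (F k \<Otimes>\<^sub>M (Sbar \<Otimes>\<^sub>M Sbar))"
      using measurable_gext_past[OF i gm] by (simp add: split_beta')
    from nn_integral_past[OF i this]
    have "(\<integral>\<^sup>+\<omega>. ennreal ((?h i \<omega>)\<^sup>2) \<partial>M) = (\<integral>\<^sup>+\<omega>. \<integral>\<^sup>+e. ennreal ((gext g (X i \<omega>) (offspring P (X i \<omega>) e))\<^sup>2) \<partial>noise P \<partial>M)" .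
    also have "\<dots> \<le> (\<integral>\<^sup>+\<omega>. ennreal c * ext (\<lambda>x. ennreal (1 + x ^ 4)) (X i \<omega>) \<partial>M)"
      by (intro nn_integral_mono inner)
    finally show ?thesis by (subst (asm) nn_integral_cmult) auto
  qed
  have "(\<Sum>i\<in>gen k. \<integral>\<^sup>+\<omega>. ennreal ((?h i \<omega>)\<^sup>2) \<partial>M) \<le> (\<Sum>i\<in>gen k. ennreal c * (\<integral>\<^sup>+\<omega>. ext (\<lambda>x. ennreal (1 + x ^ 4)) (X i \<omega>) \<partial>M))"
    by (intro sum_mono one)
  also have "\<dots> = ennreal c * (\<integral>\<^sup>+\<omega>. (\<Sum>i\<in>gen k. ext (\<lambda>x. ennreal (1 + x ^ 4)) (X i \<omega>)) \<partial>M)"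
    by (subst nn_integral_sum) (auto simp: sum_distrib_left)
  also have "\<dots> \<le> ennreal c * ennreal (K4 * m ^ k)" by (intro mult_left_mono K4) auto
  also have "\<dots> = ennreal (c * K4 * m ^ k)" using c K4(1) by (simp add: ennreal_mult mult.assoc)
  finally have tot: "(\<Sum>i\<in>gen k. \<integral>\<^sup>+\<omega>. ennreal ((?h i \<omega>)\<^sup>2) \<partial>M) \<le> ennreal (c * K4 * m ^ k)" .
  have sqi: "integrable M (\<lambda>\<omega>. (?h i \<omega>)\<^sup>2)" if i: "i \<in> gen k" for i
  proof (rule integrableI_bounded)
    have "(\<integral>\<^sup>+\<omega>. ennreal ((?h i \<omega>)\<^sup>2) \<partial>M) \<le> (\<Sum>i\<in>gen k. \<integral>\<^sup>+\<omega>. ennreal ((?h i \<omega>)\<^sup>2) \<partial>M)"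
      by (rule member_le_sum[OF i]) auto
    then show "(\<integral>\<^sup>+\<omega>. ennreal (norm ((?h i \<omega>)\<^sup>2)) \<partial>M) < \<infinity>" using le_less_trans[OF order_trans[OF _ tot] ennreal_less_top] by simp
  qed simp
  \<comment> \<open>Cross products must be integrable before linearity of the integral may split the
    square.\<close>
  have cri: "integrable M (\<lambda>\<omega>. ?h i \<omega> * ?h j \<omega>)" if "i \<in> gen k" "j \<in> gen k" for i j
  proof (rule Bochner_Integration.integrable_bound)
    show "integrable M (\<lambda>\<omega>. (?h i \<omega>)\<^sup>2 + (?h j \<omega>)\<^sup>2)" using sqi that by simp
    have "\<bar>a * b\<bar> \<le> a\<^sup>2 + b\<^sup>2" for a b :: real
      using zero_le_power2[of "\<bar>a\<bar> - \<bar>b\<bar>"] zero_le_power2[of a] zero_le_power2[of b]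
        mult_nonneg_nonneg[OF abs_ge_zero[of a] abs_ge_zero[of b]]
      unfolding power2_diff abs_mult power2_abs by linarith
    then show "AE \<omega> in M. norm (?h i \<omega> * ?h j \<omega>) \<le> norm ((?h i \<omega>)\<^sup>2 + (?h j \<omega>)\<^sup>2)" by auto
  qed simp
  have ex: "(D g k \<omega>)\<^sup>2 = (\<Sum>i\<in>gen k. \<Sum>j\<in>gen k. ?h i \<omega> * ?h j \<omega>)" for \<omega>
    unfolding D_def power2_eq_square by (rule sum_product)
  show "integrable M (\<lambda>\<omega>. (D g k \<omega>)\<^sup>2)" unfolding ex using cri by simp
  have off: "(\<integral>\<omega>. ?h i \<omega> * ?h j \<omega> \<partial>M) = 0" if "i \<in> gen k" "j \<in> gen k" "i \<noteq> j" for i j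
    using integral_pair_past_eq_0[OF that measurable_gext_past[OF that(1) gm] measurable_gext_past[OF that(2) gm] cri[OF that(1,2)]]
      mdiff_integrable[OF g] mdiff_mean_0[OF g] by blast
  have "(\<integral>\<omega>. (D g k \<omega>)\<^sup>2 \<partial>M) = (\<Sum>i\<in>gen k. \<Sum>j\<in>gen k. \<integral>\<omega>. ?h i \<omega> * ?h j \<omega> \<partial>M)"
    unfolding ex using cri by (simp add: Bochner_Integration.integral_sum)
  also have "\<dots> = (\<Sum>i\<in>gen k. \<integral>\<omega>. ?h i \<omega> * ?h i \<omega> \<partial>M)"
  proof (intro sum.cong refl)
    fix i assume i: "i \<in> gen k"
    have "(\<Sum>j\<in>gen k. \<integral>\<omega>. ?h i \<omega> * ?h j \<omega> \<partial>M) = (\<Sum>j\<in>{i}. \<integral>\<omega>. ?h i \<omega> * ?h j \<omega> \<partial>M)"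
      using i off by (intro sum.mono_neutral_right) auto
    then show "(\<Sum>j\<in>gen k. \<integral>\<omega>. ?h i \<omega> * ?h j \<omega> \<partial>M) = (\<integral>\<omega>. ?h i \<omega> * ?h i \<omega> \<partial>M)" by simp
  qed
  also have "\<dots> = (\<Sum>i\<in>gen k. \<integral>\<omega>. (?h i \<omega>)\<^sup>2 \<partial>M)" by (simp add: power2_eq_square)
  also have "ennreal \<dots> = (\<Sum>i\<in>gen k. \<integral>\<^sup>+\<omega>. ennreal ((?h i \<omega>)\<^sup>2) \<partial>M)"
    using sqi by (simp add: nn_integral_eq_integral sum_ennreal)
  finally have "ennreal (\<integral>\<omega>. (D g k \<omega>)\<^sup>2 \<partial>M) \<le> ennreal (c * K4 * m ^ k)" using tot by simp
  then show "(\<integral>\<omega>. (D g k \<omega>)\<^sup>2 \<partial>M) \<le> 2 * C\<^sup>2 * nmoment * K4 * m ^ k"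
    using c K4(1) by (subst (asm) ennreal_le_iff) (auto simp: c_def)
qed

abbreviation "q \<equiv> sqrt m"

lemma q: "q > 1" "q > 0" "q * q = m" "q\<^sup>2 = m"
  using super by (auto simp: power2_eq_square)

text \<open>After division by \<open>m ^ k\<close> the variance is of order \<open>m\<close> to the
  power \<open>-k\<close>. Spending half of this decay on the weight \<open>q ^ k\<close> still
  leaves a convergent series of expectations, and the weight converts square summability into
  absolute summability.\<close>

lemma AE_D_small:
  assumes g: "mdiff C g"
  shows "AE \<omega> in M. (\<lambda>k. D g k \<omega> / m ^ k) \<longlonglongrightarrow> 0 \<and> summable (\<lambda>k. \<bar>D g k \<omega> / m ^ k\<bar>)"
proof -
  define c where "c = 2 * C\<^sup>2 * nmoment * K4"
  have c: "c \<ge> 0" using nmoment_ge_1 K4(1) by (simp add: c_def)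
  have gm: "(\<lambda>(x, v). g x v) \<in> borel_measurable (borel \<Otimes>\<^sub>M (Sbar \<Otimes>\<^sub>M Sbar))"
    using g by (auto simp: mdiff_def)
  note [measurable] = measurable_D[OF gm]
  have geo: "summable (\<lambda>k. (1 / q) ^ k)" using q by (intro summable_geometric) simp
  have "AE \<omega> in M. summable (\<lambda>k. q ^ k * (D g k \<omega> / m ^ k)\<^sup>2)"
  proof (rule AE_summable_of_nn_integral)
    show "(\<integral>\<^sup>+\<omega>. ennreal (q ^ k * (D g k \<omega> / m ^ k)\<^sup>2) \<partial>M) \<le> ennreal (c * (1 / q) ^ k)" for k
    proof -
      have "(\<integral>\<^sup>+\<omega>. ennreal (q ^ k * (D g k \<omega> / m ^ k)\<^sup>2) \<partial>M) = (\<integral>\<^sup>+\<omega>. ennreal (q ^ k / (m ^ k)\<^sup>2 * (D g k \<omega>)\<^sup>2) \<partial>M)"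
        by (simp add: power_divide)
      also have "\<dots> = ennreal (q ^ k / (m ^ k)\<^sup>2 * (\<integral>\<omega>. (D g k \<omega>)\<^sup>2 \<partial>M))"
        using D_second_moment(1)[OF g] q by (subst nn_integral_eq_integral) auto
      also have "\<dots> \<le> ennreal (q ^ k / (m ^ k)\<^sup>2 * (c * m ^ k))"
        using D_second_moment(2)[OF g] q unfolding c_def by (intro ennreal_leI mult_left_mono) auto
      also have "q ^ k / (m ^ k)\<^sup>2 * (c * m ^ k) = c * (1 / q) ^ k"
      proof -
        have "m ^ k = q ^ k * q ^ k" by (simp add: q(3) flip: power_mult_distrib)
        then show ?thesis using q by (simp add: power2_eq_square power_divide field_simps)
      qed
      finally show ?thesis .
    qed
    show "summable (\<lambda>k. c * (1 / q) ^ k)" by (intro summable_mult geo)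
  qed (use q c in auto)
  then show ?thesis
  proof eventually_elim
    case (elim \<omega>)
    have "summable (\<lambda>k. \<bar>D g k \<omega> / m ^ k\<bar>)"
    proof (rule summable_comparison_test')
      show "summable (\<lambda>k. q ^ k * (D g k \<omega> / m ^ k)\<^sup>2 + (1 / q) ^ k)" by (intro summable_add elim geo)
      fix k
      let ?d = "\<bar>D g k \<omega> / m ^ k\<bar>"
      from le_mult_square_add_inverse[of "q ^ k" ?d] show "norm ?d \<le> q ^ k * (D g k \<omega> / m ^ k)\<^sup>2 + (1 / q) ^ k"
        using q by (simp add: power_divide power2_abs)
    qed
    moreover from summable_LIMSEQ_zero[OF this] have "(\<lambda>k. D g k \<omega> / m ^ k) \<longlonglongrightarrow> 0"
      by (rule tendsto_rabs_zero_cancel)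
    ultimately show ?case by blast
  qed
qed

text \<open>The process is given through conditional laws, so absorption at the cemetery point holds
  almost surely and has to be read off from the kernel. The tree is countable, which merges the null
  sets.\<close>

lemma AE_dead: "AE \<omega> in M. \<forall>i. X i \<omega> = None \<longrightarrow> V i \<omega> = (None, None)"
proof (subst AE_all_countable, intro allI)
  fix i
  let ?A = "\<lambda>s v. s = (None :: real option) \<and> v \<noteq> (None :: real option, None :: real option)"
  have i: "i \<in> gen (length i)" by (simp add: gen_def)
  let ?g = "\<lambda>\<omega> v. (if ?A (X i \<omega>) v then 1 else 0) :: ennreal"
  have [measurable]: "(\<lambda>v. v \<noteq> (None :: real option, None :: real option)) \<in> measurable (Sbar \<Otimes>\<^sub>M Sbar) (count_space UNIV)"
    unfolding prod_eq_iff fst_conv snd_conv by measurable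
  have gm: "(\<lambda>(\<omega>, v). ?g \<omega> v) \<in> borel_measurable (F (length i) \<Otimes>\<^sub>M (Sbar \<Otimes>\<^sub>M Sbar))"
    unfolding split_beta' using i by measurable
  have "(\<integral>\<^sup>+\<omega>. ?g \<omega> (V i \<omega>) \<partial>M) = (\<integral>\<^sup>+\<omega>. \<integral>\<^sup>+e. ?g \<omega> (offspring P (X i \<omega>) e) \<partial>noise P \<partial>M)"
    by (rule nn_integral_past[OF i gm])
  also have "\<dots> = (\<integral>\<^sup>+\<omega>. 0 \<partial>M)"
  proof (intro nn_integral_cong)
    fix \<omega>
    show "(\<integral>\<^sup>+e. ?g \<omega> (offspring P (X i \<omega>) e) \<partial>noise P) = 0"
      by (cases "X i \<omega>") (simp_all add: offspring_None)
  qed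
  finally have "(\<integral>\<^sup>+\<omega>. ?g \<omega> (V i \<omega>) \<partial>M) = 0" by simp
  moreover have "(\<lambda>\<omega>. ?g \<omega> (V i \<omega>)) \<in> borel_measurable M" by measurable
  ultimately have "AE \<omega> in M. ?g \<omega> (V i \<omega>) = 0"
    by (simp add: nn_integral_0_iff_AE)
  then show "AE \<omega> in M. X i \<omega> = None \<longrightarrow> V i \<omega> = (None, None)"
    by eventually_elim (auto split: if_splits)
qed

end

section \<open>Quadratic functionals and their almost sure limits\<close>

definition quad :: "real \<Rightarrow> real \<Rightarrow> real \<Rightarrow> real \<Rightarrow> real" where
  "quad c0 c1 c2 x = c0 + c1 * x + c2 * x\<^sup>2"

lemma measurable_quad [measurable]: "quad c0 c1 c2 \<in> borel_measurable borel"
  unfolding quad_def by measurable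

lemma quad_bound: "\<bar>quad c0 c1 c2 x\<bar> \<le> (\<bar>c0\<bar> + \<bar>c1\<bar> + \<bar>c2\<bar>) * (1 + x\<^sup>2)"
proof -
  have x: "\<bar>x\<bar> \<le> 1 + x\<^sup>2" using sum_squares_bound[of "\<bar>x\<bar>" 1] abs_ge_zero[of x] unfolding power2_abs by simp
  have "\<bar>quad c0 c1 c2 x\<bar> \<le> \<bar>c0\<bar> + \<bar>c1\<bar> * \<bar>x\<bar> + \<bar>c2\<bar> * x\<^sup>2"
    unfolding quad_def using abs_triangle_ineq[of "c0 + c1 * x" "c2 * x\<^sup>2"] abs_triangle_ineq[of c0 "c1 * x"]
    by (simp add: abs_mult)
  also have "\<dots> \<le> \<bar>c0\<bar> * (1 + x\<^sup>2) + \<bar>c1\<bar> * (1 + x\<^sup>2) + \<bar>c2\<bar> * (1 + x\<^sup>2)"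
    using x by (intro add_mono mult_left_mono) (auto simp: distrib_left)
  finally show ?thesis by (simp add: algebra_simps)
qed

lemma summable_to_convergent:
  fixes a :: "nat \<Rightarrow> real"
  assumes "summable (\<lambda>k. a (Suc k) - a k)"
  shows "convergent a"
proof -
  have "(\<lambda>n. \<Sum>k<n. a (Suc k) - a k) \<longlonglongrightarrow> (\<Sum>k. a (Suc k) - a k)"
    by (rule summable_LIMSEQ[OF assms])
  then have "(\<lambda>n. (a n - a 0) + a 0) \<longlonglongrightarrow> (\<Sum>k. a (Suc k) - a k) + a 0"
    unfolding sum_lessThan_telescope by (intro tendsto_add tendsto_const)
  then show ?thesis by (auto simp: convergent_def)
qed

context bar_super
begin

lemma eps_var: "(eps1 P b \<delta>)\<^sup>2 + (eps2 P b \<delta>)\<^sup>2 = (if fst b \<and> snd b then (sd P)\<^sup>2 else (sd' P \<delta>)\<^sup>2)"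
proof -
  have "(rho P)\<^sup>2 \<le> 1" using adm by (auto simp: admissible_def abs_square_le_1 abs_le_iff)
  then show ?thesis by (auto simp: eps1_def eps2_def power_mult_distrib algebra_simps)
qed

lemma daughter_quad_gauss2:
  fixes x :: real
  defines "u \<equiv> \<lambda>b \<delta>. slope P b \<delta> * x + icpt P b \<delta>"
  shows "integrable gauss2 (\<lambda>z. ext (quad c0 c1 c2) (daughter P (Some x) (b, z) \<delta>))"
    and "(\<integral>z. ext (quad c0 c1 c2) (daughter P (Some x) (b, z) \<delta>) \<partial>gauss2) =
      of_bool (survives b \<delta>) * (c0 + c1 * u b \<delta> + c2 * ((u b \<delta>)\<^sup>2 + ((eps1 P b \<delta>)\<^sup>2 + (eps2 P b \<delta>)\<^sup>2)))"
proof -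
  let ?u = "u b \<delta>" and ?a = "eps1 P b \<delta>" and ?b = "eps2 P b \<delta>"
  have e: "quad c0 c1 c2 (?u + (?a * fst z + ?b * snd z)) =
    (c0 + c1 * ?u + c2 * ?u\<^sup>2) + (c1 * ?a + 2 * c2 * ?u * ?a) * fst z + (c1 * ?b + 2 * c2 * ?u * ?b) * snd z
    + (c2 * ?a\<^sup>2) * (fst z)\<^sup>2 + (2 * c2 * ?a * ?b) * (fst z * snd z) + (c2 * ?b\<^sup>2) * (snd z)\<^sup>2" for z
    by (simp add: quad_def power2_eq_square algebra_simps)
  have f: "ext (quad c0 c1 c2) (daughter P (Some x) (b, z) \<delta>) =
     of_bool (survives b \<delta>) * quad c0 c1 c2 (?u + (?a * fst z + ?b * snd z))" for z
    by (auto simp: daughter_def cell_val_def eps_eq u_def)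
  show "integrable gauss2 (\<lambda>z. ext (quad c0 c1 c2) (daughter P (Some x) (b, z) \<delta>))"
    unfolding f e by (intro integrable_mult_right gauss2_quadratic)
  show "(\<integral>z. ext (quad c0 c1 c2) (daughter P (Some x) (b, z) \<delta>) \<partial>gauss2) =
      of_bool (survives b \<delta>) * (c0 + c1 * ?u + c2 * (?u\<^sup>2 + (?a\<^sup>2 + ?b\<^sup>2)))"
    unfolding f e by (simp only: integral_mult_right_zero gauss2_quadratic) (simp add: algebra_simps)
qed

lemma m_offspring_avg: "m * offspring_avg P f g = p_both P * (f False + f True) + p_only P False * g False + p_only P True * g True"
  by (simp add: offspring_avg_def)

text \<open>Quadratics are closed under the mean over the daughters. On the basis \<open>1\<close>,
  \<open>x\<close>, \<open>x\<^sup>2\<close> this operator is \<open>m\<close> times a triangular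
  matrix with diagonal \<open>1\<close>, \<open>alpha_bar P\<close>, \<open>alpha2_bar P\<close>:
  the first entry drives the growth, the other two contract.\<close>

lemma daughter_quad_mean:
  shows "integrable (noise P) (\<lambda>e. ext (quad c0 c1 c2) (daughter P (Some x) e False) + ext (quad c0 c1 c2) (daughter P (Some x) e True))"
    and "(\<integral>e. ext (quad c0 c1 c2) (daughter P (Some x) e False) + ext (quad c0 c1 c2) (daughter P (Some x) e True) \<partial>noise P)
    = m * quad (c0 + c1 * beta_bar P + c2 * (beta2_bar P + sigma2_bar P)) (c1 * alpha_bar P + 2 * c2 * alphabeta_bar P) (c2 * alpha2_bar P) x"
proof -
  note q = daughter_quad_gauss2[of c0 c1 c2 x]
  show "integrable (noise P) (\<lambda>e. ext (quad c0 c1 c2) (daughter P (Some x) e False) + ext (quad c0 c1 c2) (daughter P (Some x) e True))"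
    using q(1) by (intro noise_integral(1)) simp
  have "(\<integral>e. ext (quad c0 c1 c2) (daughter P (Some x) e False) + ext (quad c0 c1 c2) (daughter P (Some x) e True) \<partial>noise P)
    = c0 * m + c1 * (m * alpha_bar P * x + m * beta_bar P)
     + c2 * (m * alpha2_bar P * x\<^sup>2 + 2 * (m * alphabeta_bar P) * x + m * beta2_bar P + m * sigma2_bar P)"
    using q
    by (subst noise_integral(2))
      (simp_all add: sum_bool_pair pmf_surv' survives_def slope_def icpt_def eps_var alpha_bar_def beta_bar_def alpha2_bar_def
        alphabeta_bar_def beta2_bar_def sigma2_bar_def m_offspring_avg,
       simp add: mean_offspring_def power2_eq_square algebra_simps)
  also have "\<dots> = m * quad (c0 + c1 * beta_bar P + c2 * (beta2_bar P + sigma2_bar P)) (c1 * alpha_bar P + 2 * c2 * alphabeta_bar P) (c2 * alpha2_bar P) x"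
    by (simp add: quad_def algebra_simps)
  finally show "(\<integral>e. ext (quad c0 c1 c2) (daughter P (Some x) e False) + ext (quad c0 c1 c2) (daughter P (Some x) e True) \<partial>noise P)
    = m * quad (c0 + c1 * beta_bar P + c2 * (beta2_bar P + sigma2_bar P)) (c1 * alpha_bar P + 2 * c2 * alphabeta_bar P) (c2 * alpha2_bar P) x" .
qed

text \<open>The compensated sum over the daughters: its conditional mean vanishes by
  \<open>daughter_quad_mean\<close>.\<close>

definition gq :: "real \<Rightarrow> real \<Rightarrow> real \<Rightarrow> real \<Rightarrow> real option \<times> real option \<Rightarrow> real" where
  "gq c0 c1 c2 x v = ext (quad c0 c1 c2) (fst v) + ext (quad c0 c1 c2) (snd v)
     - m * quad (c0 + c1 * beta_bar P + c2 * (beta2_bar P + sigma2_bar P)) (c1 * alpha_bar P + 2 * c2 * alphabeta_bar P) (c2 * alpha2_bar P) x"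

lemma ext_quad_daughter_bound:
  "\<bar>ext (quad c0 c1 c2) (daughter P (Some x) e \<delta>)\<bar> \<le> (\<bar>c0\<bar> + \<bar>c1\<bar> + \<bar>c2\<bar>) * (2 + 2 * noiseC\<^sup>2) * (1 + x\<^sup>2) * (nsize e)\<^sup>2"
proof (cases "daughter P (Some x) e \<delta>")
  case (Some y)
  let ?n = "nsize e"
  have n: "1 \<le> ?n\<^sup>2" using nsize_ge_1[of e] by (rule one_le_power)
  have "\<bar>y\<bar> \<le> \<bar>x\<bar> + noiseC * ?n"
    using daughter_bound[OF Some] \<kappa>(2) mult_right_mono[of \<kappa> 1 "\<bar>x\<bar>"] by simp
  then have "y\<^sup>2 \<le> (\<bar>x\<bar> + noiseC * ?n)\<^sup>2" by (rule abs_le_square_iff[THEN iffD1, OF order_trans]) simp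
  also have "\<dots> \<le> 2 * x\<^sup>2 + 2 * noiseC\<^sup>2 * ?n\<^sup>2"
    using sum_squares_bound[of "\<bar>x\<bar>" "noiseC * ?n"] by (simp add: power2_sum power_mult_distrib)
  finally have "1 + y\<^sup>2 \<le> 2 * (1 + x\<^sup>2) * 1 + 2 * noiseC\<^sup>2 * 1 * ?n\<^sup>2" by simp
  also have "\<dots> \<le> 2 * (1 + x\<^sup>2) * ?n\<^sup>2 + 2 * noiseC\<^sup>2 * (1 + x\<^sup>2) * ?n\<^sup>2"
    using n by (intro add_mono mult_mono) auto
  finally have "1 + y\<^sup>2 \<le> (2 + 2 * noiseC\<^sup>2) * (1 + x\<^sup>2) * ?n\<^sup>2" by (simp add: algebra_simps)
  then have "(\<bar>c0\<bar> + \<bar>c1\<bar> + \<bar>c2\<bar>) * (1 + y\<^sup>2) \<le> (\<bar>c0\<bar> + \<bar>c1\<bar> + \<bar>c2\<bar>) * ((2 + 2 * noiseC\<^sup>2) * (1 + x\<^sup>2) * ?n\<^sup>2)"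
    by (rule mult_left_mono) simp
  then show ?thesis using quad_bound[of c0 c1 c2 y] by (simp add: Some mult.assoc)
qed simp

lemma mdiff_gq: "\<exists>C. mdiff C (gq c0 c1 c2)"
proof -
  define c where "c = (\<bar>c0\<bar> + \<bar>c1\<bar> + \<bar>c2\<bar>) * (2 + 2 * noiseC\<^sup>2)"
  define d0 d1 d2 where "d0 = c0 + c1 * beta_bar P + c2 * (beta2_bar P + sigma2_bar P)" and "d1 = c1 * alpha_bar P + 2 * c2 * alphabeta_bar P"
    and "d2 = c2 * alpha2_bar P"
  define d where "d = m * (\<bar>d0\<bar> + \<bar>d1\<bar> + \<bar>d2\<bar>)"
  have gq: "gq c0 c1 c2 x (offspring P (Some x) e) =
    ext (quad c0 c1 c2) (daughter P (Some x) e False) + ext (quad c0 c1 c2) (daughter P (Some x) e True) - m * quad d0 d1 d2 x" for x e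
    by (simp add: gq_def offspring_def d0_def d1_def d2_def)
  have "mdiff (2 * c + d) (gq c0 c1 c2)"
    unfolding mdiff_def
  proof (intro conjI allI)
    show "0 \<le> 2 * c + d" by (simp add: c_def d_def)
    show "(\<lambda>(x, v). gq c0 c1 c2 x v) \<in> borel_measurable (borel \<Otimes>\<^sub>M (Sbar \<Otimes>\<^sub>M Sbar))"
      unfolding gq_def split_beta' by measurable
    fix x
    show "(\<integral>e. gq c0 c1 c2 x (offspring P (Some x) e) \<partial>noise P) = 0"
    proof -
      interpret N: prob_space "noise P" by (rule prob_space_noise)
      show ?thesis
        using daughter_quad_mean[of c0 c1 c2 x] N.prob_space
        unfolding gq by (subst Bochner_Integration.integral_diff) (auto simp: d0_def d1_def d2_def)
    qed
    fix e
    have "m * \<bar>quad d0 d1 d2 x\<bar> \<le> d * (1 + x\<^sup>2) * 1"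
      using mult_left_mono[OF quad_bound, of m] by (simp add: d_def mult.assoc)
    also have "\<dots> \<le> d * (1 + x\<^sup>2) * (nsize e)\<^sup>2"
      using one_le_power[OF nsize_ge_1[of e], of 2] by (intro mult_left_mono) (auto simp: d_def)
    finally have "m * \<bar>quad d0 d1 d2 x\<bar> \<le> d * (1 + x\<^sup>2) * (nsize e)\<^sup>2" .
    then show "\<bar>gq c0 c1 c2 x (offspring P (Some x) e)\<bar> \<le> (2 * c + d) * (1 + x\<^sup>2) * (nsize e)\<^sup>2"
    proof -
      let ?A = "ext (quad c0 c1 c2) (daughter P (Some x) e False)" and ?B = "ext (quad c0 c1 c2) (daughter P (Some x) e True)"
        and ?Q = "m * quad d0 d1 d2 x" and ?t = "(1 + x\<^sup>2) * (nsize e)\<^sup>2"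
      assume Q: "m * \<bar>quad d0 d1 d2 x\<bar> \<le> d * (1 + x\<^sup>2) * (nsize e)\<^sup>2"
      have "\<bar>?A + ?B - ?Q\<bar> \<le> \<bar>?A\<bar> + \<bar>?B\<bar> + \<bar>?Q\<bar>" by linarith
      also have "\<bar>?Q\<bar> = m * \<bar>quad d0 d1 d2 x\<bar>" by (simp add: abs_mult)
      also have "\<bar>?A\<bar> + \<bar>?B\<bar> + m * \<bar>quad d0 d1 d2 x\<bar> \<le> c * ?t + c * ?t + d * ?t"
        using Q ext_quad_daughter_bound[of c0 c1 c2 x e False] ext_quad_daughter_bound[of c0 c1 c2 x e True]
        unfolding c_def[symmetric] mult.assoc by (intro add_mono)
      finally show ?thesis unfolding gq by (simp only: distrib_right mult.assoc mult_2)
    qed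
  qed
  then show ?thesis by blast
qed

text \<open>One step of the Doob decomposition: innovation plus conditional mean. The hypothesis on
  dead cells removes their daughters on the left, where \<open>ext\<close> tests the daughters
  only.\<close>

lemma S_Suc:
  assumes "\<forall>i. X i \<omega> = None \<longrightarrow> V i \<omega> = (None, None)"
  shows "S (quad c0 c1 c2) (Suc k) \<omega> = D (gq c0 c1 c2) k \<omega> +
    m * S (quad (c0 + c1 * beta_bar P + c2 * (beta2_bar P + sigma2_bar P)) (c1 * alpha_bar P + 2 * c2 * alphabeta_bar P) (c2 * alpha2_bar P)) k \<omega>"
proof -
  have "ext (quad c0 c1 c2) (X (i @ [False]) \<omega>) + ext (quad c0 c1 c2) (X (i @ [True]) \<omega>) =
    gext (gq c0 c1 c2) (X i \<omega>) (V i \<omega>) + m * ext (quad (c0 + c1 * beta_bar P + c2 * (beta2_bar P + sigma2_bar P))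
      (c1 * alpha_bar P + 2 * c2 * alphabeta_bar P) (c2 * alpha2_bar P)) (X i \<omega>)" for i
    using assms by (cases "X i \<omega>") (auto simp: gq_def)
  then show ?thesis
    unfolding S_def D_def sum_gen_Suc by (simp add: sum.distrib sum_distrib_left)
qed

text \<open>The transformed coefficients enter through equations, so that a simplified form such as
  that of \<open>mu_fixpoint\<close> can be supplied.\<close>

lemma S_Suc':
  assumes "\<forall>i. X i \<omega> = None \<longrightarrow> V i \<omega> = (None, None)"
    and "d0 = c0 + c1 * beta_bar P + c2 * (beta2_bar P + sigma2_bar P)"
    and "d1 = c1 * alpha_bar P + 2 * c2 * alphabeta_bar P" and "d2 = c2 * alpha2_bar P"
  shows "S (quad c0 c1 c2) (Suc k) \<omega> = D (gq c0 c1 c2) k \<omega> + m * S (quad d0 d1 d2) k \<omega>"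
  using S_Suc[OF assms(1)] unfolding assms(2-) .

lemma S_quad: "S (quad c0 c1 c2) k \<omega> = c0 * S (quad 1 0 0) k \<omega> + c1 * S (quad 0 1 0) k \<omega> + c2 * S (quad 0 0 1) k \<omega>"
proof -
  have "ext (quad c0 c1 c2) s = c0 * ext (quad 1 0 0) s + c1 * ext (quad 0 1 0) s + c2 * ext (quad 0 0 1) s" for s
    by (cases s) (auto simp: quad_def)
  then show ?thesis unfolding S_def by (simp add: sum.distrib sum_distrib_left)
qed

lemma offspring_avg_abs_le:
  assumes "\<And>\<delta>. \<bar>f \<delta>\<bar> \<le> c" "\<And>\<delta>. \<bar>g \<delta>\<bar> \<le> c"
  shows "\<bar>offspring_avg P f g\<bar> \<le> c"
proof -
  have p: "p_both P \<ge> 0" "p_only P False \<ge> 0" "p_only P True \<ge> 0" using adm by (auto simp: admissible_def)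
  have "\<bar>m * offspring_avg P f g\<bar> \<le> p_both P * (c + c) + p_only P False * c + p_only P True * c"
    unfolding m_offspring_avg
  proof -
    have "\<bar>f False + f True\<bar> \<le> c + c" using assms(1)[of False] assms(1)[of True] by linarith
    then show "\<bar>p_both P * (f False + f True) + p_only P False * g False + p_only P True * g True\<bar>
      \<le> p_both P * (c + c) + p_only P False * c + p_only P True * c"
      using p assms by (intro order_trans[OF abs_triangle_ineq] add_mono) (auto simp: abs_mult intro!: mult_left_mono)
  qed
  also have "\<dots> = m * c" by (simp add: mean_offspring_def algebra_simps)
  finally show ?thesis by (simp add: abs_mult)
qed

lemma alpha_bar_lt: "\<bar>alpha_bar P\<bar> < 1" "\<bar>alpha2_bar P\<bar> < 1"
proof -
  have a: "\<bar>alpha P \<delta>\<bar> \<le> \<kappa>" "\<bar>alpha' P \<delta>\<bar> \<le> \<kappa>" for \<delta>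
    using \<kappa>(3)[of "(True, True)" \<delta>] \<kappa>(3)[of "(True, False)" \<delta>] by (auto simp: slope_def)
  have a2: "\<bar>(alpha P \<delta>)\<^sup>2\<bar> \<le> \<kappa>\<^sup>2" "\<bar>(alpha' P \<delta>)\<^sup>2\<bar> \<le> \<kappa>\<^sup>2" for \<delta>
    using a[of \<delta>] \<kappa>(1) by (auto simp: abs_le_square_iff[symmetric])
  show "\<bar>alpha_bar P\<bar> < 1" unfolding alpha_bar_def
    by (rule le_less_trans[OF offspring_avg_abs_le \<kappa>(2)]) (rule a)+
  have "\<kappa>\<^sup>2 < 1" using \<kappa> by (simp add: power_less_one_iff)
  then show "\<bar>alpha2_bar P\<bar> < 1" unfolding alpha2_bar_def
    by (rule le_less_trans[OF offspring_avg_abs_le, rotated -1]) (rule a2)+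
qed

lemma pop_ratio_eq: "pop_ratio P X k \<omega> = S (quad 1 0 0) k \<omega> / m ^ k"
proof -
  have "ext (quad 1 0 0) s = (if s \<noteq> None then 1 else 0)" for s
    by (cases s) (simp_all add: quad_def)
  then have "S (quad 1 0 0) k \<omega> = (\<Sum>i\<in>gen k. if X i \<omega> \<noteq> None then 1 else 0)"
    unfolding S_def by (simp only:)
  also have "\<dots> = (\<Sum>i\<in>gen_alive (\<lambda>i. X i \<omega>) k. 1)"
    unfolding gen_alive_def by (rule sum.inter_filter[symmetric]) simp
  also have "\<dots> = real (card (gen_alive (\<lambda>i. X i \<omega>) k))" by simp
  finally show ?thesis by (simp only: pop_ratio_def)
qed

lemma measurable_pop_ratio [measurable]: "pop_ratio P X k \<in> borel_measurable M"
proof -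
  have "(\<lambda>\<omega>. S (quad 1 0 0) k \<omega> / m ^ k) \<in> borel_measurable M" by measurable
  then show ?thesis by (simp only: pop_ratio_eq[symmetric])
qed

lemma measurable_pop_limit [measurable]: "pop_limit P X \<in> borel_measurable M"
proof -
  have "(\<lambda>\<omega>. lim (\<lambda>k. pop_ratio P X k \<omega>)) \<in> borel_measurable M" by measurable
  then show ?thesis by (simp only: pop_limit_def[symmetric])
qed

lemma AE_pop_increment:
  "AE \<omega> in M. \<forall>k. pop_ratio P X (Suc k) \<omega> - pop_ratio P X k \<omega> = D (gq 1 0 0) k \<omega> / m ^ k / m"
  using AE_dead
proof eventually_elim
  case (elim \<omega>)
  show ?case
  proof
    fix k
    have "S (quad 1 0 0) (Suc k) \<omega> = D (gq 1 0 0) k \<omega> + m * S (quad 1 0 0) k \<omega>"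
      using S_Suc[OF elim, of 1 0 0 k] by simp
    then show "pop_ratio P X (Suc k) \<omega> - pop_ratio P X k \<omega> = D (gq 1 0 0) k \<omega> / m ^ k / m"
      unfolding pop_ratio_eq by (simp add: add_divide_distrib)
  qed
qed

text \<open>The increments of the ratio are scaled innovations, hence absolutely summable; so
  \<open>lim\<close> in \<open>pop_limit\<close> is a genuine limit.\<close>

lemma AE_pop_limit: "AE \<omega> in M. (\<lambda>k. pop_ratio P X k \<omega>) \<longlonglongrightarrow> pop_limit P X \<omega>"
proof -
  obtain C where C: "mdiff C (gq 1 0 0)" using mdiff_gq by blast
  show ?thesis using AE_D_small[OF C] AE_pop_increment
  proof eventually_elim
    case (elim \<omega>)
    have "summable (\<lambda>k. pop_ratio P X (Suc k) \<omega> - pop_ratio P X k \<omega>)"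
      using summable_divide[OF summable_rabs_cancel[OF conjunct2[OF elim(1)]], of m] elim(2) by simp
    then show ?case
      unfolding pop_limit_def by (intro convergent_LIMSEQ_iff[THEN iffD1] summable_to_convergent)
  qed
qed

text \<open>These equations make \<open>x - mu1 P\<close> and, modulo \<open>x - mu1 P\<close>, also
  \<open>x\<^sup>2 - mu2 P\<close> eigenvectors of the mean operator. The factors 0 and 1 are kept
  so that the right sides match the premise of \<open>S_Suc'\<close> literally.\<close>

lemma mu_fixpoint:
  "- (alpha_bar P * mu1 P) = - mu1 P + 1 * beta_bar P + 0 * (beta2_bar P + sigma2_bar P)"
  "- (alpha2_bar P * mu2 P) - 2 * alphabeta_bar P * mu1 P = - mu2 P + 0 * beta_bar P + 1 * (beta2_bar P + sigma2_bar P)"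
proof -
  have a: "1 - alpha_bar P \<noteq> 0" "1 - alpha2_bar P \<noteq> 0" using alpha_bar_lt by auto
  have "(1 - alpha_bar P) * mu1 P = beta_bar P" using a by (simp add: mu1_def)
  then show "- (alpha_bar P * mu1 P) = - mu1 P + 1 * beta_bar P + 0 * (beta2_bar P + sigma2_bar P)"
    unfolding left_diff_distrib by simp
  have "2 * alphabeta_bar P * mu1 P = 2 * alphabeta_bar P * beta_bar P / (1 - alpha_bar P)" by (simp add: mu1_def)
  moreover have "(1 - alpha2_bar P) * mu2 P = 2 * alphabeta_bar P * beta_bar P / (1 - alpha_bar P) + beta2_bar P + sigma2_bar P"
    using a by (simp add: mu2_def)
  ultimately have "mu2 P - alpha2_bar P * mu2 P = 2 * alphabeta_bar P * mu1 P + beta2_bar P + sigma2_bar P"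
    unfolding left_diff_distrib by simp
  moreover have "a - b = c + d + e \<Longrightarrow> - b - c = - a + 0 * z + 1 * (d + e)" for a b c d e z :: real by simp
  ultimately show "- (alpha2_bar P * mu2 P) - 2 * alphabeta_bar P * mu1 P = - mu2 P + 0 * beta_bar P + 1 * (beta2_bar P + sigma2_bar P)"
    by blast
qed

text \<open>In the basis \<open>1\<close>, \<open>x - mu1 P\<close>,
  \<open>x\<^sup>2 - mu2 P\<close> the recursions decouple up to one lower-order term. The centred
  sums contract with factors \<open>alpha_bar P\<close> and \<open>alpha2_bar P\<close> and vanish
  after normalisation; only the constant component survives, multiplied by \<open>W\<close>.\<close>

lemma AE_S_tendsto:
  "AE \<omega> in M. \<forall>c0 c1 c2. (\<lambda>k. S (quad c0 c1 c2) k \<omega> / m ^ k) \<longlonglongrightarrow> (c0 + c1 * mu1 P + c2 * mu2 P) * pop_limit P X \<omega>"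
proof -
  obtain C1 where C1: "mdiff C1 (gq (- mu1 P) 1 0)" using mdiff_gq by blast
  obtain C2 where C2: "mdiff C2 (gq (- mu2 P) 0 1)" using mdiff_gq by blast
  show ?thesis using AE_D_small[OF C1] AE_D_small[OF C2] AE_pop_limit AE_dead
  proof eventually_elim
    case (elim \<omega>)
    let ?N = "\<lambda>k. S (quad 1 0 0) k \<omega> / m ^ k" and ?A = "\<lambda>k. S (quad (- mu1 P) 1 0) k \<omega> / m ^ k"
      and ?B = "\<lambda>k. S (quad (- mu2 P) 0 1) k \<omega> / m ^ k"
    have N: "?N \<longlonglongrightarrow> pop_limit P X \<omega>" using elim(3) by (simp add: pop_ratio_eq)
    have A: "?A \<longlonglongrightarrow> 0"
    proof (rule linear_recursion_tendsto_0[OF alpha_bar_lt(1)])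
      have e1: "S (quad (- mu1 P) 1 0) (Suc k) \<omega> = D (gq (- mu1 P) 1 0) k \<omega> + m * S (quad (- (alpha_bar P * mu1 P)) (alpha_bar P) 0) k \<omega>" for k
        by (rule S_Suc'[OF elim(4) mu_fixpoint(1)]) simp_all
      have e2: "S (quad (- mu1 P) 1 0) (Suc k) \<omega> = D (gq (- mu1 P) 1 0) k \<omega> + m * (alpha_bar P * S (quad (- mu1 P) 1 0) k \<omega>)" for k
        unfolding e1 S_quad[of "- (alpha_bar P * mu1 P)" "alpha_bar P" 0 k] S_quad[of "- mu1 P" 1 0 k] by (simp add: algebra_simps)
      show "?A (Suc k) = alpha_bar P * ?A k + D (gq (- mu1 P) 1 0) k \<omega> / m ^ k / m" for k
        unfolding e2 by (simp add: add_divide_distrib)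
      show "(\<lambda>k. D (gq (- mu1 P) 1 0) k \<omega> / m ^ k / m) \<longlonglongrightarrow> 0"
        using tendsto_divide[OF conjunct1[OF elim(1)] tendsto_const[of m]] by simp
    qed
    \<comment> \<open>The recursion for \<open>?B\<close> has \<open>?A\<close> as an additional
      input, so the linear case comes first.\<close>
    have B: "?B \<longlonglongrightarrow> 0"
    proof (rule linear_recursion_tendsto_0[OF alpha_bar_lt(2)])
      have e1: "S (quad (- mu2 P) 0 1) (Suc k) \<omega> = D (gq (- mu2 P) 0 1) k \<omega> +
        m * S (quad (- (alpha2_bar P * mu2 P) - 2 * alphabeta_bar P * mu1 P) (2 * alphabeta_bar P) (alpha2_bar P)) k \<omega>" for k
        by (rule S_Suc'[OF elim(4) mu_fixpoint(2)]) simp_all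
      have e2: "S (quad (- mu2 P) 0 1) (Suc k) \<omega> = D (gq (- mu2 P) 0 1) k \<omega> +
        m * (alpha2_bar P * S (quad (- mu2 P) 0 1) k \<omega> + 2 * alphabeta_bar P * S (quad (- mu1 P) 1 0) k \<omega>)" for k
        unfolding e1 S_quad[of "- (alpha2_bar P * mu2 P) - 2 * alphabeta_bar P * mu1 P" "2 * alphabeta_bar P" "alpha2_bar P" k]
          S_quad[of "- mu1 P" 1 0 k] S_quad[of "- mu2 P" 0 1 k] by (simp add: algebra_simps)
      show "?B (Suc k) = alpha2_bar P * ?B k + (D (gq (- mu2 P) 0 1) k \<omega> / m ^ k / m + 2 * alphabeta_bar P * ?A k)" for k
        unfolding e2 by (simp add: add_divide_distrib)
      show "(\<lambda>k. D (gq (- mu2 P) 0 1) k \<omega> / m ^ k / m + 2 * alphabeta_bar P * ?A k) \<longlonglongrightarrow> 0"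
        using tendsto_add[OF tendsto_divide[OF conjunct1[OF elim(2)] tendsto_const[of m]] tendsto_mult[OF tendsto_const A]] by simp
    qed
    show ?case
    proof (intro allI)
      fix c0 c1 c2
      have "S (quad c0 c1 c2) k \<omega> = (c0 + c1 * mu1 P + c2 * mu2 P) * S (quad 1 0 0) k \<omega>
          + c1 * S (quad (- mu1 P) 1 0) k \<omega> + c2 * S (quad (- mu2 P) 0 1) k \<omega>" for k
        unfolding S_quad[of c0 c1 c2 k] S_quad[of "- mu1 P" 1 0 k] S_quad[of "- mu2 P" 0 1 k] by (simp add: algebra_simps)
      then have "S (quad c0 c1 c2) k \<omega> / m ^ k = (c0 + c1 * mu1 P + c2 * mu2 P) * ?N k + c1 * ?A k + c2 * ?B k" for k
        by (simp add: add_divide_distrib)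
      moreover have "(\<lambda>k. (c0 + c1 * mu1 P + c2 * mu2 P) * ?N k + c1 * ?A k + c2 * ?B k) \<longlonglongrightarrow>
        (c0 + c1 * mu1 P + c2 * mu2 P) * pop_limit P X \<omega> + c1 * 0 + c2 * 0"
        by (intro tendsto_intros N A B)
      ultimately show "(\<lambda>k. S (quad c0 c1 c2) k \<omega> / m ^ k) \<longlonglongrightarrow> (c0 + c1 * mu1 P + c2 * mu2 P) * pop_limit P X \<omega>"
        by simp
    qed
  qed
qed

text \<open>Cauchy-Schwarz over the generations with free weights. Since the second moments grow
  geometrically, suitable geometric weights \<open>w\<close> lose only a constant factor.\<close>

lemma D_sum_second_moment:
  assumes g: "mdiff C g" and A: "finite A"
  defines "c \<equiv> 2 * C\<^sup>2 * nmoment * K4"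
  assumes w: "\<And>k. k \<in> A \<Longrightarrow> w k > 0"
  shows "integrable M (\<lambda>\<omega>. (\<Sum>k\<in>A. a k * D g k \<omega>)\<^sup>2)"
    and "(\<integral>\<omega>. (\<Sum>k\<in>A. a k * D g k \<omega>)\<^sup>2 \<partial>M) \<le> (\<Sum>k\<in>A. w k) * (\<Sum>k\<in>A. (a k)\<^sup>2 * c * m ^ k / w k)"
proof -
  have gm: "(\<lambda>(x, v). g x v) \<in> borel_measurable (borel \<Otimes>\<^sub>M (Sbar \<Otimes>\<^sub>M Sbar))"
    using g by (auto simp: mdiff_def)
  note [measurable] = measurable_D[OF gm]
  let ?R = "\<lambda>\<omega>. (\<Sum>k\<in>A. w k) * (\<Sum>k\<in>A. (a k)\<^sup>2 / w k * (D g k \<omega>)\<^sup>2)"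
  have R: "integrable M ?R" using D_second_moment(1)[OF g] by simp
  have le: "(\<Sum>k\<in>A. a k * D g k \<omega>)\<^sup>2 \<le> ?R \<omega>" for \<omega>
    using weighted_Cauchy_Schwarz[of A w "\<lambda>k. a k * D g k \<omega>"] w by (simp add: power_mult_distrib)
  show i: "integrable M (\<lambda>\<omega>. (\<Sum>k\<in>A. a k * D g k \<omega>)\<^sup>2)"
  proof (rule Bochner_Integration.integrable_bound[OF R])
    show "AE \<omega> in M. norm ((\<Sum>k\<in>A. a k * D g k \<omega>)\<^sup>2) \<le> norm (?R \<omega>)"
    proof (rule AE_I2)
      fix \<omega>
      have "norm ((\<Sum>k\<in>A. a k * D g k \<omega>)\<^sup>2) = (\<Sum>k\<in>A. a k * D g k \<omega>)\<^sup>2" by simp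
      also have "\<dots> \<le> ?R \<omega>" by (rule le)
      also have "\<dots> \<le> norm (?R \<omega>)" by (simp only: real_norm_def abs_ge_self)
      finally show "norm ((\<Sum>k\<in>A. a k * D g k \<omega>)\<^sup>2) \<le> norm (?R \<omega>)" .
    qed
  qed measurable
  have "(\<integral>\<omega>. (\<Sum>k\<in>A. a k * D g k \<omega>)\<^sup>2 \<partial>M) \<le> (\<integral>\<omega>. ?R \<omega> \<partial>M)"
    by (intro integral_mono i R le)
  also have "\<dots> = (\<Sum>k\<in>A. w k) * (\<Sum>k\<in>A. (a k)\<^sup>2 / w k * (\<integral>\<omega>. (D g k \<omega>)\<^sup>2 \<partial>M))"
    using D_second_moment(1)[OF g] by simp
  also have "\<dots> \<le> (\<Sum>k\<in>A. w k) * (\<Sum>k\<in>A. (a k)\<^sup>2 / w k * (c * m ^ k))"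
    using D_second_moment(2)[OF g] w unfolding c_def
    by (intro mult_left_mono sum_mono sum_nonneg) (auto simp: less_imp_le)
  finally show "(\<integral>\<omega>. (\<Sum>k\<in>A. a k * D g k \<omega>)\<^sup>2 \<partial>M) \<le> (\<Sum>k\<in>A. w k) * (\<Sum>k\<in>A. (a k)\<^sup>2 * c * m ^ k / w k)"
    by (simp add: mult.assoc)
qed

end

section \<open>Extinction\<close>

lemma prod_gen_Suc: "(\<Prod>j\<in>gen (Suc k). h j) = (\<Prod>i\<in>gen k. h (i @ [False]) * h (i @ [True]))"
  for h :: "bool list \<Rightarrow> 'b::comm_monoid_mult"
proof -
  have "(\<Prod>j\<in>gen (Suc k). h j) = (\<Prod>j\<in>(\<lambda>i. i @ [False]) ` gen k. h j) * (\<Prod>j\<in>(\<lambda>i. i @ [True]) ` gen k. h j)"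
    unfolding gen_Suc by (rule prod.union_disjoint) auto
  also have "\<dots> = (\<Prod>i\<in>gen k. h (i @ [False]) * h (i @ [True]))"
    by (simp add: prod.reindex inj_on_def prod.distrib)
  finally show ?thesis .
qed

section \<open>Mean square convergence of the population size\<close>

context bar_super
begin

lemma geometric_sum_le:
  assumes "0 < s" "s < (1::real)"
  shows "(\<Sum>k\<in>{a..<b}. s ^ k) \<le> s ^ a / (1 - s)"
proof -
  have "(1 - s) * (\<Sum>k\<in>{a..<b}. s ^ k) \<le> s ^ a"
  proof (cases "a \<le> b")
    case True
    then have "(1 - s) * (\<Sum>k\<in>{a..<b}. s ^ k) = s ^ a - s ^ b"
    proof (induction b rule: dec_induct)
      case (step n)
      have "(1 - s) * (\<Sum>k\<in>{a..<Suc n}. s ^ k) = (1 - s) * (\<Sum>k\<in>{a..<n}. s ^ k) + (1 - s) * s ^ n"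
        using step by (simp add: distrib_left)
      then show ?case unfolding step.IH by (simp add: algebra_simps)
    qed simp
    then show ?thesis using assms by simp
  qed (use assms in simp)
  then show ?thesis using assms by (simp add: field_simps)
qed

lemma AE_pop_ratio_diff:
  "AE \<omega> in M. \<forall>a b. a \<le> b \<longrightarrow> pop_ratio P X b \<omega> - pop_ratio P X a \<omega> = (\<Sum>k\<in>{a..<b}. 1 / m ^ Suc k * D (gq 1 0 0) k \<omega>)"
  using AE_pop_increment
proof eventually_elim
  case (elim \<omega>)
  have "pop_ratio P X b \<omega> - pop_ratio P X a \<omega> = (\<Sum>k\<in>{a..<b}. 1 / m ^ Suc k * D (gq 1 0 0) k \<omega>)" if "a \<le> b" for a b
    using that
  proof (induction b rule: dec_induct)
    case (step b)
    then show ?case using elim[rule_format, of b] by (simp add: mult.commute)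
  qed simp
  then show ?case by blast
qed

text \<open>The increments after generation \<open>a\<close> are bounded in mean square uniformly in
  the end point \<open>b\<close>; Fatou's lemma then replaces the end point by the almost sure
  limit.\<close>

lemma pop_ratio_L2: "(\<lambda>k. \<integral>\<^sup>+\<omega>. ennreal ((pop_ratio P X k \<omega> - pop_limit P X \<omega>)\<^sup>2) \<partial>M) \<longlonglongrightarrow> 0"
proof -
  obtain C where g: "mdiff C (gq 1 0 0)" using mdiff_gq by blast
  define c where "c = 2 * C\<^sup>2 * nmoment * K4"
  have c: "c \<ge> 0" using nmoment_ge_1 K4(1) by (simp add: c_def)
  \<comment> \<open>With \<open>s * s * m = 1\<close> the weights \<open>s ^ k\<close> turn both
    Cauchy-Schwarz sums into the same geometric series.\<close>
  define s where "s = 1 / q"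
  have s: "0 < s" "s < 1" using q by (auto simp: s_def)
  have ss: "s * s * m = 1" using q(2,3) by (simp add: s_def field_simps)
  have le: "(\<integral>\<^sup>+\<omega>. ennreal ((pop_ratio P X a \<omega> - pop_ratio P X b \<omega>)\<^sup>2) \<partial>M) \<le> ennreal (c * (s ^ a / (1 - s))\<^sup>2)" if ab: "a \<le> b" for a b
  proof -
    have "(\<integral>\<^sup>+\<omega>. ennreal ((pop_ratio P X a \<omega> - pop_ratio P X b \<omega>)\<^sup>2) \<partial>M) =
      (\<integral>\<^sup>+\<omega>. ennreal ((\<Sum>k\<in>{a..<b}. 1 / m ^ Suc k * D (gq 1 0 0) k \<omega>)\<^sup>2) \<partial>M)"
    proof (rule nn_integral_cong_AE)
      show "AE \<omega> in M. ennreal ((pop_ratio P X a \<omega> - pop_ratio P X b \<omega>)\<^sup>2) = ennreal ((\<Sum>k\<in>{a..<b}. 1 / m ^ Suc k * D (gq 1 0 0) k \<omega>)\<^sup>2)"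
        using AE_pop_ratio_diff
      proof eventually_elim
        case (elim \<omega>)
        show ?case unfolding elim[rule_format, OF ab, symmetric] by (simp add: power2_commute)
      qed
    qed
    also have "\<dots> = ennreal (\<integral>\<omega>. (\<Sum>k\<in>{a..<b}. 1 / m ^ Suc k * D (gq 1 0 0) k \<omega>)\<^sup>2 \<partial>M)"
      using D_sum_second_moment(1)[OF g, of "{a..<b}" "\<lambda>k. s ^ k" "\<lambda>k. 1 / m ^ Suc k"] s
      by (intro nn_integral_eq_integral) auto
    also have "\<dots> \<le> ennreal ((\<Sum>k\<in>{a..<b}. s ^ k) * (\<Sum>k\<in>{a..<b}. (1 / m ^ Suc k)\<^sup>2 * c * m ^ k / s ^ k))"
      using D_sum_second_moment(2)[OF g, of "{a..<b}" "\<lambda>k. s ^ k" "\<lambda>k. 1 / m ^ Suc k"] s unfolding c_def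
      by (intro ennreal_leI) auto
    also have "\<dots> \<le> ennreal ((\<Sum>k\<in>{a..<b}. s ^ k) * (c * (\<Sum>k\<in>{a..<b}. s ^ k)))"
    proof (intro ennreal_leI mult_left_mono)
      have "(1 / m ^ Suc k)\<^sup>2 * c * m ^ k / s ^ k \<le> c * s ^ k" for k
      proof -
        have "s ^ k * s ^ k * m ^ k = 1" unfolding power_mult_distrib[symmetric] ss by simp
        then have "1 / s ^ k = s ^ k * m ^ k" using s by (simp add: field_simps)
        then have "(1 / m ^ Suc k)\<^sup>2 * c * m ^ k / s ^ k = (1 / m ^ Suc k)\<^sup>2 * c * m ^ k * (s ^ k * m ^ k)"
          by (metis divide_inverse inverse_eq_divide)
        also have "\<dots> = c * s ^ k * (1 / m\<^sup>2)" by (simp add: power2_eq_square field_simps)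
        also have "\<dots> \<le> c * s ^ k * 1" using m_gt_1 c s by (intro mult_left_mono) (auto simp: one_le_power)
        finally show ?thesis by simp
      qed
      then show "(\<Sum>k\<in>{a..<b}. (1 / m ^ Suc k)\<^sup>2 * c * m ^ k / s ^ k) \<le> c * (\<Sum>k\<in>{a..<b}. s ^ k)"
        unfolding sum_distrib_left by (intro sum_mono)
    qed (use s in \<open>auto intro!: sum_nonneg\<close>)
    also have "\<dots> \<le> ennreal (c * (s ^ a / (1 - s))\<^sup>2)"
    proof (intro ennreal_leI)
      have "(\<Sum>k\<in>{a..<b}. s ^ k)\<^sup>2 \<le> (s ^ a / (1 - s))\<^sup>2"
        using geometric_sum_le[OF s] s by (intro power_mono) (auto intro!: sum_nonneg)
      then have "c * (\<Sum>k\<in>{a..<b}. s ^ k)\<^sup>2 \<le> c * (s ^ a / (1 - s))\<^sup>2" using c by (rule mult_left_mono)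
      then show "(\<Sum>k\<in>{a..<b}. s ^ k) * (c * (\<Sum>k\<in>{a..<b}. s ^ k)) \<le> c * (s ^ a / (1 - s))\<^sup>2"
        by (simp add: power2_eq_square mult.left_commute)
    qed
    finally show ?thesis .
  qed
  \<comment> \<open>Fatou in \<open>b\<close>: the Cauchy bound holds for all
    \<open>b \<ge> a\<close> and does not depend on \<open>b\<close>.\<close>
  have le2: "(\<integral>\<^sup>+\<omega>. ennreal ((pop_ratio P X a \<omega> - pop_limit P X \<omega>)\<^sup>2) \<partial>M) \<le> ennreal (c * (s ^ a / (1 - s))\<^sup>2)" for a
  proof -
    have "(\<integral>\<^sup>+\<omega>. ennreal ((pop_ratio P X a \<omega> - pop_limit P X \<omega>)\<^sup>2) \<partial>M) =
      (\<integral>\<^sup>+\<omega>. liminf (\<lambda>b. ennreal ((pop_ratio P X a \<omega> - pop_ratio P X b \<omega>)\<^sup>2)) \<partial>M)"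
    proof (rule nn_integral_cong_AE)
      show "AE \<omega> in M. ennreal ((pop_ratio P X a \<omega> - pop_limit P X \<omega>)\<^sup>2) = liminf (\<lambda>b. ennreal ((pop_ratio P X a \<omega> - pop_ratio P X b \<omega>)\<^sup>2))"
        using AE_pop_limit
      proof eventually_elim
        case (elim \<omega>)
        have "(\<lambda>b. ennreal ((pop_ratio P X a \<omega> - pop_ratio P X b \<omega>)\<^sup>2)) \<longlonglongrightarrow> ennreal ((pop_ratio P X a \<omega> - pop_limit P X \<omega>)\<^sup>2)"
          by (intro tendsto_ennrealI tendsto_intros elim)
        then show ?case by (intro lim_imp_Liminf[symmetric]) auto
      qed
    qed
    also have "\<dots> \<le> liminf (\<lambda>b. \<integral>\<^sup>+\<omega>. ennreal ((pop_ratio P X a \<omega> - pop_ratio P X b \<omega>)\<^sup>2) \<partial>M)"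
      by (intro nn_integral_liminf) measurable
    also have "\<dots> \<le> limsup (\<lambda>b. \<integral>\<^sup>+\<omega>. ennreal ((pop_ratio P X a \<omega> - pop_ratio P X b \<omega>)\<^sup>2) \<partial>M)"
      by (intro Liminf_le_Limsup) simp
    also have "\<dots> \<le> ennreal (c * (s ^ a / (1 - s))\<^sup>2)"
      using le by (intro Limsup_bounded) (auto simp: eventually_sequentially intro!: exI[of _ a])
    finally show ?thesis .
  qed
  have "(\<lambda>a. c * (s ^ a / (1 - s))\<^sup>2) \<longlonglongrightarrow> c * (0 / (1 - s))\<^sup>2"
    using s by (intro tendsto_intros LIMSEQ_power_zero) auto
  then have "(\<lambda>a. ennreal (c * (s ^ a / (1 - s))\<^sup>2)) \<longlonglongrightarrow> 0"
    using tendsto_ennrealI by force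
  from tendsto_sandwich[OF _ _ tendsto_const this] le2 show ?thesis by auto
qed

section \<open>Generating functions and the extinction probability\<close>

definition gen_fun :: "real \<Rightarrow> real" where
  "gen_fun s = (1 - p_both P - p_only P False - p_only P True) + (p_only P False + p_only P True) * s + p_both P * s\<^sup>2"

text \<open>The root of \<open>gen_fun s = s\<close> other than 1: the product of the two roots is
  the constant coefficient divided by the leading one.\<close>

definition ext_prob :: real where
  "ext_prob = (1 - p_both P - p_only P False - p_only P True) / p_both P"

text \<open>With at most one living daughter per mother the mean offspring could not exceed 1, so
  super-criticality forces \<open>p_both P\<close> to be positive.\<close>

lemma p_bounds: "p_both P > 0" "p_only P \<delta> \<ge> 0" "1 - p_both P - p_only P False - p_only P True \<ge> 0"
proof -
  show 1: "p_only P \<delta> \<ge> 0" "1 - p_both P - p_only P False - p_only P True \<ge> 0" using adm by (auto simp: admissible_def)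
  show "p_both P > 0" using super 1(2) by (simp add: mean_offspring_def)
qed

text \<open>The bound \<open>ext_prob < 1\<close> is super-criticality in disguise: clearing the
  denominator gives \<open>1 < m\<close>.\<close>

lemma ext_prob: "0 \<le> ext_prob" "ext_prob < 1"
  using p_bounds super by (auto simp: ext_prob_def mean_offspring_def)

lemma gen_fun_minus: "gen_fun s - s = p_both P * ((1 - s) * (ext_prob - s))"
proof -
  have "p_both P * ext_prob = 1 - p_both P - p_only P False - p_only P True" using p_bounds by (simp add: ext_prob_def)
  then have "gen_fun s = p_both P * ext_prob + (1 - p_both P - p_both P * ext_prob) * s + p_both P * s\<^sup>2"
    unfolding gen_fun_def by simp
  then show ?thesis by (simp add: algebra_simps power2_eq_square)
qed

lemma gen_fun_fixpoint: "gen_fun s = s \<Longrightarrow> s \<noteq> 1 \<Longrightarrow> s = ext_prob"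
  using gen_fun_minus[of s] p_bounds(1) by simp

lemma gen_fun_mono: "0 \<le> s \<Longrightarrow> s \<le> t \<Longrightarrow> gen_fun s \<le> gen_fun t"
  unfolding gen_fun_def using p_bounds by (intro add_mono mult_left_mono power_mono) auto

lemma gen_fun_range: assumes "0 \<le> s" "s \<le> 1" shows "0 \<le> gen_fun s" "gen_fun s \<le> 1"
  using gen_fun_mono[OF order_refl assms(1)] gen_fun_mono[OF assms] p_bounds gen_fun_minus[of 1]
  by (auto simp: gen_fun_def)

lemma gen_fun_tendsto: "(f \<longlongrightarrow> a) G \<Longrightarrow> ((\<lambda>x. gen_fun (f x)) \<longlongrightarrow> gen_fun a) G"
  unfolding gen_fun_def by (intro tendsto_intros)

text \<open>By monotonicity the iterates of 0 increase and stay below the fixed point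
  \<open>ext_prob\<close>; their limit is a fixed point below 1, and there is only one.\<close>

lemma gen_fun_iter_0: "(\<lambda>k. (gen_fun ^^ k) 0) \<longlonglongrightarrow> ext_prob"
proof -
  have b: "0 \<le> (gen_fun ^^ k) 0 \<and> (gen_fun ^^ k) 0 \<le> ext_prob" for k
  proof (induction k)
    case (Suc k)
    have "gen_fun ext_prob = ext_prob" using gen_fun_minus[of ext_prob] by simp
    then show ?case using Suc ext_prob gen_fun_mono[of "(gen_fun ^^ k) 0" ext_prob] gen_fun_range[of "(gen_fun ^^ k) 0"] by simp
  qed (use ext_prob in simp)
  have "incseq (\<lambda>k. (gen_fun ^^ k) 0)"
  proof (rule incseq_SucI)
    fix k
    have "0 \<le> p_both P * ((1 - (gen_fun ^^ k) 0) * (ext_prob - (gen_fun ^^ k) 0))"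
      using b[of k] ext_prob p_bounds(1) by (intro mult_nonneg_nonneg) auto
    then show "(gen_fun ^^ k) 0 \<le> (gen_fun ^^ Suc k) 0" using gen_fun_minus[of "(gen_fun ^^ k) 0"] by simp
  qed
  then obtain L where L: "(\<lambda>k. (gen_fun ^^ k) 0) \<longlonglongrightarrow> L"
    using incseq_convergent[of "\<lambda>k. (gen_fun ^^ k) 0" ext_prob] b by blast
  have "L \<le> ext_prob" by (rule LIMSEQ_le_const2[OF L]) (use b in blast)
  have "(\<lambda>k. gen_fun ((gen_fun ^^ k) 0)) \<longlonglongrightarrow> gen_fun L"
    by (intro gen_fun_tendsto L)
  moreover have "(\<lambda>k. gen_fun ((gen_fun ^^ k) 0)) \<longlonglongrightarrow> L" using LIMSEQ_Suc[OF L] by simp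
  ultimately have "gen_fun L = L" by (rule LIMSEQ_unique)
  then have "L = ext_prob" using gen_fun_fixpoint[of L] \<open>L \<le> ext_prob\<close> ext_prob(2) by simp
  with L show ?thesis by simp
qed

abbreviation N1 :: "nat \<Rightarrow> 'a \<Rightarrow> real" where "N1 k \<omega> \<equiv> S (quad 1 0 0) k \<omega>"

lemma N1_eq: "N1 k \<omega> = real (card (gen_alive (\<lambda>i. X i \<omega>) k))"
  using pop_ratio_eq[of k \<omega>] by (simp add: pop_ratio_def)

lemma root_alive: "AE \<omega> in M. X [] \<omega> \<noteq> None"
  using proc by (simp add: bar_process_def)

text \<open>Conditioning on the mothers of the last generation replaces \<open>s\<close> by
  \<open>gen_fun s\<close>, hence \<open>s\<close> is arbitrary in the induction. For
  \<open>s = 0\<close> the left side is the probability of extinction by time \<open>k\<close>,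
  because \<open>0 ^ 0 = 1\<close>.\<close>

lemma expectation_gen_fun:
  assumes "0 \<le> s" "s \<le> 1"
  shows "(\<integral>\<omega>. s ^ card (gen_alive (\<lambda>i. X i \<omega>) k) \<partial>M) = (gen_fun ^^ k) s"
proof -
  let ?h = "\<lambda>s (v :: real option). if v = None then 1 else (s::real)"
  have hm [measurable]: "?h s \<in> borel_measurable Sbar" for s by measurable
  have hb: "0 \<le> ?h s v" "?h s v \<le> 1" if "0 \<le> s" "s \<le> 1" for s v using that by auto
  have pw: "(\<Prod>i\<in>gen k. ?h s (X i \<omega>)) = s ^ card (gen_alive (\<lambda>i. X i \<omega>) k)" for s \<omega> k
  proof -
    have "(\<Prod>i\<in>gen k. ?h s (X i \<omega>)) = (\<Prod>i\<in>gen_alive (\<lambda>i. X i \<omega>) k. ?h s (X i \<omega>))"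
      unfolding gen_alive_def by (rule prod.mono_neutral_right) auto
    also have "\<dots> = (\<Prod>i\<in>gen_alive (\<lambda>i. X i \<omega>) k. s)"
      by (rule prod.cong) (auto simp: gen_alive_def)
    finally show ?thesis by simp
  qed
  have "(\<integral>\<omega>. (\<Prod>i\<in>gen k. ?h s (X i \<omega>)) \<partial>M) = (gen_fun ^^ k) s"
    using assms
  proof (induction k arbitrary: s)
    case 0
    have "(\<integral>\<omega>. (\<Prod>i\<in>gen 0. ?h s (X i \<omega>)) \<partial>M) = (\<integral>\<omega>. s \<partial>M)"
    proof (rule integral_cong_AE)
      show "AE \<omega> in M. (\<Prod>i\<in>gen 0. ?h s (X i \<omega>)) = s"
        using root_alive by eventually_elim (auto simp: gen_0)
    qed measurable
    then show ?case by (simp add: prob_space)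
  next
    case (Suc k)
    let ?g = "\<lambda>(i::bool list) (\<omega>::'a) (v :: real option \<times> real option). ?h s (fst v) * ?h s (snd v)"
    have gb: "0 \<le> ?g i \<omega> v" "?g i \<omega> v \<le> 1" for i :: "bool list" and \<omega> :: 'a and v
      using Suc.prems by (auto intro: mult_le_one)
    have g: "(\<integral>e. ?g i \<omega> (offspring P t e) \<partial>noise P) = ?h (gen_fun s) t" for i :: "bool list" and \<omega> :: 'a and t
    proof (cases t)
      case None
      interpret N: prob_space "noise P" by (rule prob_space_noise)
      show ?thesis using N.prob_space by (simp add: None offspring_None)
    next
      case (Some x)
      let ?w = "\<lambda>b. (if survives b False then s else 1) * (if survives b True then s else 1)"
      have "(\<integral>e. ?g i \<omega> (offspring P t e) \<partial>noise P) = (\<integral>e. ?w (fst e) \<partial>noise P)"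
        by (intro Bochner_Integration.integral_cong) (auto simp: Some offspring_def daughter_None_iff)
      also have "\<dots> = (\<Sum>b\<in>UNIV. pmf (surv_pmf P) b * ?w b)" by (rule noise_integral_weight(2))
      also have "\<dots> = gen_fun s"
        by (simp add: sum_bool_pair pmf_surv' survives_def gen_fun_def power2_eq_square algebra_simps)
      finally show ?thesis by (simp add: Some)
    qed
    have "(\<integral>\<omega>. (\<Prod>i\<in>gen (Suc k). ?h s (X i \<omega>)) \<partial>M) = (\<integral>\<omega>. 1 * (\<Prod>i\<in>gen k. ?g i \<omega> (V i \<omega>)) \<partial>M)"
      unfolding prod_gen_Suc by simp
    also have "\<dots> = (\<integral>\<omega>. 1 * (\<Prod>i\<in>gen k. \<integral>e. ?g i \<omega> (offspring P (X i \<omega>) e) \<partial>noise P) \<partial>M)"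
    proof (rule integral_prod_past)
      show "case_prod (?g i) \<in> borel_measurable (F k \<Otimes>\<^sub>M (Sbar \<Otimes>\<^sub>M Sbar))" for i
        unfolding split_beta' by measurable
      show "integrable M (\<lambda>\<omega>. 1 * (\<Prod>i\<in>gen k. ?g i \<omega> (V i \<omega>)))"
      proof (rule integrable_const_bound[where B = 1])
        show "AE \<omega> in M. norm (1 * (\<Prod>i\<in>gen k. ?g i \<omega> (V i \<omega>))) \<le> 1"
        proof (rule AE_I2)
          fix \<omega>
          have "0 \<le> (\<Prod>i\<in>gen k. ?g i \<omega> (V i \<omega>))" "(\<Prod>i\<in>gen k. ?g i \<omega> (V i \<omega>)) \<le> 1"
            by (intro prod_nonneg prod_le_1 conjI gb ballI)+
          then show "norm (1 * (\<Prod>i\<in>gen k. ?g i \<omega> (V i \<omega>))) \<le> 1" by simp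
        qed
        show "(\<lambda>\<omega>. 1 * (\<Prod>i\<in>gen k. ?g i \<omega> (V i \<omega>))) \<in> borel_measurable M" by measurable
      qed
      fix i \<omega>
      have m: "(\<lambda>e. ?g i \<omega> (offspring P (X i \<omega>) e)) \<in> borel_measurable (noise P)"
        by (rule measurable_compose[OF measurable_offspring_noise]) measurable
      show "integrable (noise P) (\<lambda>e. ?g i \<omega> (offspring P (X i \<omega>) e))"
      proof (rule integrable_noise_bounded[OF m, where C = 1])
        fix e
        have "norm (?g i \<omega> (offspring P (X i \<omega>) e)) \<le> 1" using gb by simp
        also have "1 \<le> 1 * nsize e ^ 4" using one_le_power[OF nsize_ge_1[of e], of 4] by simp
        finally show "norm (?g i \<omega> (offspring P (X i \<omega>) e)) \<le> 1 * nsize e ^ 4" .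
      qed
    qed simp
    also have "\<dots> = (\<integral>\<omega>. (\<Prod>i\<in>gen k. ?h (gen_fun s) (X i \<omega>)) \<partial>M)" unfolding g by simp
    also have "\<dots> = (gen_fun ^^ k) (gen_fun s)" by (rule Suc.IH) (use gen_fun_range Suc.prems in auto)
    finally show ?case by (simp add: funpow_swap1)
  qed
  then show ?thesis unfolding pw .
qed

lemma AE_pop_limit_nonneg: "AE \<omega> in M. pop_limit P X \<omega> \<ge> 0"
  using AE_pop_limit
proof eventually_elim
  case (elim \<omega>)
  show ?case by (rule LIMSEQ_le_const[OF elim]) (auto simp: pop_ratio_def)
qed

text \<open>The ratio has mean 1, and \<open>x \<le> x\<^sup>2 + 1 / 4\<close>. Any positive bound
  uniform in \<open>k\<close> would serve: the point is to exclude convergence to 0 in mean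
  square.\<close>

lemma expectation_pop_ratio_sq: "(\<integral>\<^sup>+\<omega>. ennreal ((pop_ratio P X k \<omega>)\<^sup>2) \<partial>M) \<ge> ennreal (3 / 4)"
proof -
  have one: "(\<integral>\<^sup>+\<omega>. (\<Sum>i\<in>gen k. ext (\<lambda>x. ennreal 1) (X i \<omega>)) \<partial>M) = ennreal (m ^ k)" for k
  proof (induction k)
    case 0
    have "(\<integral>\<^sup>+\<omega>. (\<Sum>i\<in>gen 0. ext (\<lambda>x. ennreal 1) (X i \<omega>)) \<partial>M) = (\<integral>\<^sup>+\<omega>. 1 \<partial>M)"
    proof (rule nn_integral_cong_AE)
      show "AE \<omega> in M. (\<Sum>i\<in>gen 0. ext (\<lambda>x. ennreal 1) (X i \<omega>)) = 1"
        using root_alive by eventually_elim (auto simp: gen_0)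
    qed
    then show ?case by (simp add: emeasure_space_1)
  next
    case (Suc k)
    have 1: "(\<integral>\<^sup>+e. ext (\<lambda>x. ennreal 1) (daughter P (Some x) e False) + ext (\<lambda>x. ennreal 1) (daughter P (Some x) e True) \<partial>noise P) = ennreal m" for x
    proof -
      have "ext (\<lambda>x. ennreal 1) (daughter P (Some x) e \<delta>) = ennreal (of_bool (survives (fst e) \<delta>))" for e \<delta>
        using daughter_None_iff[of x e \<delta>] by (cases "daughter P (Some x) e \<delta>") auto
      then have "(\<integral>\<^sup>+e. ext (\<lambda>x. ennreal 1) (daughter P (Some x) e False) + ext (\<lambda>x. ennreal 1) (daughter P (Some x) e True) \<partial>noise P)
        = (\<integral>\<^sup>+e. ennreal (nsurv (fst e)) \<partial>noise P)"
        by (simp only: nsurv_def) (intro nn_integral_cong, subst ennreal_plus[symmetric], auto)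
      also have "\<dots> = ennreal (\<integral>e. nsurv (fst e) \<partial>noise P)"
        by (intro nn_integral_eq_integral noise_integral_weight) (auto simp: nsurv_def)
      finally show ?thesis by (simp add: noise_integral_weight mean_nsurv)
    qed
    have 2: "ext (\<lambda>x. ennreal m) s = ennreal m * ext (\<lambda>x. ennreal 1) s" for s by (cases s) auto
    have "(\<integral>\<^sup>+\<omega>. (\<Sum>i\<in>gen (Suc k). ext (\<lambda>x. ennreal 1) (X i \<omega>)) \<partial>M)
      = (\<integral>\<^sup>+\<omega>. ennreal m * (\<Sum>i\<in>gen k. ext (\<lambda>x. ennreal 1) (X i \<omega>)) \<partial>M)"
      by (subst nn_integral_gen_Suc) (simp_all only: 1 2 sum_distrib_left measurable_const space_borel UNIV_I)
    also have "\<dots> = ennreal m * ennreal (m ^ k)" unfolding Suc[symmetric] by (rule nn_integral_cmult) simp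
    finally show ?case by (simp add: ennreal_mult)
  qed
  have e: "(\<Sum>i\<in>gen k. ext (\<lambda>x. ennreal 1) (X i \<omega>)) = ennreal (N1 k \<omega>)" for \<omega>
  proof -
    have "ext (\<lambda>x. ennreal 1) s = ennreal (ext (quad 1 0 0) s)" "0 \<le> ext (quad 1 0 0) s" for s by (cases s; simp add: quad_def)+
    then show ?thesis by (simp add: S_def sum_ennreal)
  qed
  have N: "N1 k \<omega> \<ge> 0" for \<omega> by (simp add: N1_eq)
  have "1 = ennreal (1 / m ^ k) * (\<integral>\<^sup>+\<omega>. ennreal (N1 k \<omega>) \<partial>M)"
    using one[of k] unfolding e by (simp add: ennreal_mult[symmetric])
  also have "\<dots> = (\<integral>\<^sup>+\<omega>. ennreal (pop_ratio P X k \<omega>) \<partial>M)"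
    using N by (subst nn_integral_cmult[symmetric]) (auto simp: pop_ratio_eq ennreal_mult[symmetric])
  also have "\<dots> \<le> (\<integral>\<^sup>+\<omega>. ennreal ((pop_ratio P X k \<omega>)\<^sup>2) + ennreal (1 / 4) \<partial>M)"
  proof (rule nn_integral_mono)
    fix \<omega>
    have "x \<le> x\<^sup>2 + 1 / 4" for x :: real using sum_squares_bound[of x "1 / 2"] by (simp add: power2_eq_square)
    then have "ennreal (pop_ratio P X k \<omega>) \<le> ennreal ((pop_ratio P X k \<omega>)\<^sup>2 + 1 / 4)" by (rule ennreal_leI)
    also have "\<dots> = ennreal ((pop_ratio P X k \<omega>)\<^sup>2) + ennreal (1 / 4)" by (rule ennreal_plus) auto
    finally show "ennreal (pop_ratio P X k \<omega>) \<le> ennreal ((pop_ratio P X k \<omega>)\<^sup>2) + ennreal (1 / 4)" .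
  qed
  also have "\<dots> = (\<integral>\<^sup>+\<omega>. ennreal ((pop_ratio P X k \<omega>)\<^sup>2) \<partial>M) + ennreal (1 / 4)"
    by (subst nn_integral_add) (auto simp: emeasure_space_1)
  finally have "1 \<le> (\<integral>\<^sup>+\<omega>. ennreal ((pop_ratio P X k \<omega>)\<^sup>2) \<partial>M) + ennreal (1 / 4)" .
  then show ?thesis
  proof (cases "\<integral>\<^sup>+\<omega>. ennreal ((pop_ratio P X k \<omega>)\<^sup>2) \<partial>M")
    case (real r)
    assume "1 \<le> (\<integral>\<^sup>+\<omega>. ennreal ((pop_ratio P X k \<omega>)\<^sup>2) \<partial>M) + ennreal (1 / 4)"
    then have "ennreal 1 \<le> ennreal (r + 1 / 4)" using real by (simp add: ennreal_plus[symmetric] del: ennreal_plus)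
    then have "1 \<le> r + 1 / 4" using real(1) by (subst (asm) ennreal_le_iff) auto
    then show ?thesis unfolding real(2) by (intro ennreal_leI) simp
  qed simp
qed

lemma prob_pop_limit_0_neq_1: "prob {\<omega>\<in>space M. pop_limit P X \<omega> = 0} \<noteq> 1"
proof
  assume "prob {\<omega>\<in>space M. pop_limit P X \<omega> = 0} = 1"
  then have ae: "AE \<omega> in M. pop_limit P X \<omega> = 0" by (subst (asm) prob_Collect_eq_1) auto
  have "(\<integral>\<^sup>+\<omega>. ennreal ((pop_ratio P X k \<omega> - pop_limit P X \<omega>)\<^sup>2) \<partial>M) = (\<integral>\<^sup>+\<omega>. ennreal ((pop_ratio P X k \<omega>)\<^sup>2) \<partial>M)" for k
    by (rule nn_integral_cong_AE) (use ae in eventually_elim, simp)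
  then have "(\<lambda>k. \<integral>\<^sup>+\<omega>. ennreal ((pop_ratio P X k \<omega>)\<^sup>2) \<partial>M) \<longlonglongrightarrow> 0" using pop_ratio_L2 by simp
  then have "ennreal (3 / 4) \<le> 0" by (rule LIMSEQ_le_const) (use expectation_pop_ratio_sq in blast)
  then show False by simp
qed

text \<open>The Laplace transform of \<open>W\<close> satisfies
  \<open>\<phi> (m * t) = gen_fun (\<phi> t)\<close>. Along \<open>t = m ^ n\<close> it converges to
  the probability of \<open>W = 0\<close>, which is thus a fixed point of \<open>gen_fun\<close>; it
  differs from 1, so it is the other root.\<close>

lemma prob_pop_limit_0: "prob {\<omega>\<in>space M. pop_limit P X \<omega> = 0} = ext_prob"
proof -
  define \<phi> where "\<phi> t = (\<integral>\<omega>. exp (- t * pop_limit P X \<omega>) \<partial>M)" for t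
  \<comment> \<open>The transform of the ratio at \<open>t\<close> is the \<open>k\<close>-fold
    iterate of \<open>gen_fun\<close> at \<open>exp (- t / m ^ k)\<close>; dominated convergence
    passes to \<open>W\<close>.\<close>
  have lap: "(\<lambda>k. (gen_fun ^^ k) (exp (- t / m ^ k))) \<longlonglongrightarrow> \<phi> t" if l: "t \<ge> 0" for t
  proof -
    have "(\<lambda>k. \<integral>\<omega>. exp (- t * pop_ratio P X k \<omega>) \<partial>M) \<longlonglongrightarrow> \<phi> t"
      unfolding \<phi>_def
    proof (rule integral_dominated_convergence[where w = "\<lambda>_. 1"])
      show "AE \<omega> in M. (\<lambda>k. exp (- t * pop_ratio P X k \<omega>)) \<longlonglongrightarrow> exp (- t * pop_limit P X \<omega>)"
        using AE_pop_limit by eventually_elim (intro tendsto_intros)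
      show "AE \<omega> in M. norm (exp (- t * pop_ratio P X k \<omega>)) \<le> 1" for k
        using l by (auto simp: pop_ratio_def)
    qed simp_all
    moreover have "(\<integral>\<omega>. exp (- t * pop_ratio P X k \<omega>) \<partial>M) = (gen_fun ^^ k) (exp (- t / m ^ k))" for k
    proof -
      have "exp (- t * pop_ratio P X k \<omega>) = exp (- t / m ^ k) ^ card (gen_alive (\<lambda>i. X i \<omega>) k)" for \<omega>
        by (simp add: pop_ratio_def exp_of_nat_mult[symmetric])
      then show ?thesis using l by (subst expectation_gen_fun[symmetric]) auto
    qed
    ultimately show ?thesis by simp
  qed
  have pattern_fun: "\<phi> (m * t) = gen_fun (\<phi> t)" if l: "t \<ge> 0" for t
  proof (rule LIMSEQ_unique)
    have "(\<lambda>k. (gen_fun ^^ Suc k) (exp (- (m * t) / m ^ Suc k))) \<longlonglongrightarrow> \<phi> (m * t)"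
      using l by (intro LIMSEQ_Suc lap) auto
    then show "(\<lambda>k. gen_fun ((gen_fun ^^ k) (exp (- t / m ^ k)))) \<longlonglongrightarrow> \<phi> (m * t)" by simp
    show "(\<lambda>k. gen_fun ((gen_fun ^^ k) (exp (- t / m ^ k)))) \<longlonglongrightarrow> gen_fun (\<phi> t)"
      by (intro gen_fun_tendsto lap[OF l])
  qed
  let ?p = "prob {\<omega>\<in>space M. pop_limit P X \<omega> = 0}"
  have "(\<lambda>n. \<phi> (m ^ n)) \<longlonglongrightarrow> (\<integral>\<omega>. indicator {\<omega>\<in>space M. pop_limit P X \<omega> = 0} \<omega> \<partial>M)"
    unfolding \<phi>_def
  proof (rule integral_dominated_convergence[where w = "\<lambda>_. 1"])
    show "AE \<omega> in M. norm (exp (- (m ^ n) * pop_limit P X \<omega>)) \<le> 1" for n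
      using AE_pop_limit_nonneg by eventually_elim simp
    show "AE \<omega> in M. (\<lambda>n. exp (- (m ^ n) * pop_limit P X \<omega>)) \<longlonglongrightarrow> indicator {\<omega>\<in>space M. pop_limit P X \<omega> = 0} \<omega>"
      using AE_pop_limit_nonneg AE_space
    proof eventually_elim
      case (elim \<omega>)
      show ?case
      proof (cases "pop_limit P X \<omega> = 0")
        case False
        then have pos: "pop_limit P X \<omega> > 0" using elim by simp
        have "filterlim (\<lambda>n. m ^ n) at_top sequentially"
          unfolding filterlim_at_top eventually_sequentially
        proof
          fix Z
          obtain N where N: "Z < m ^ N" using real_arch_pow[OF m_gt_1] by blast
          show "\<exists>N. \<forall>n\<ge>N. Z \<le> m ^ n"
          proof (intro exI allI impI)
            fix n assume "n \<ge> N"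
            then have "m ^ N \<le> m ^ n" using m_gt_1 by (intro power_increasing) auto
            then show "Z \<le> m ^ n" using N by simp
          qed
        qed
        then have "filterlim (\<lambda>n. pop_limit P X \<omega> * m ^ n) at_top sequentially"
          by (rule filterlim_tendsto_pos_mult_at_top[OF tendsto_const pos])
        then have "(\<lambda>n. exp (- (pop_limit P X \<omega> * m ^ n))) \<longlonglongrightarrow> 0"
          by (intro filterlim_compose[OF exp_at_bot] filterlim_uminus_at_bot[THEN iffD2]) simp
        then show ?thesis using False by (simp add: mult.commute)
      qed (use elim in simp)
    qed
  qed simp_all
  then have lim: "(\<lambda>n. \<phi> (m ^ n)) \<longlonglongrightarrow> ?p" by simp
  have "(\<lambda>n. gen_fun (\<phi> (m ^ n))) \<longlonglongrightarrow> gen_fun ?p"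
    by (intro gen_fun_tendsto lim)
  moreover have "(\<lambda>n. gen_fun (\<phi> (m ^ n))) \<longlonglongrightarrow> ?p"
    using LIMSEQ_Suc[OF lim] by (simp add: pattern_fun)
  ultimately have "gen_fun ?p = ?p" by (rule LIMSEQ_unique)
  then show ?thesis using gen_fun_fixpoint prob_pop_limit_0_neq_1 by blast
qed

lemma AE_extinct_mono: "AE \<omega> in M. \<forall>k l. k \<le> l \<longrightarrow> N1 k \<omega> = 0 \<longrightarrow> N1 l \<omega> = 0"
  using AE_dead
proof eventually_elim
  case (elim \<omega>)
  have st: "N1 (Suc k) \<omega> = 0" if "N1 k \<omega> = 0" for k
  proof -
    have "\<forall>i\<in>gen k. X i \<omega> = None"
      using that unfolding N1_eq by (auto simp: gen_alive_def)
    then have "\<forall>i\<in>gen (Suc k). X i \<omega> = None" using elim unfolding gen_Suc by auto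
    then show ?thesis unfolding N1_eq gen_alive_def by auto
  qed
  have "N1 l \<omega> = 0" if "k \<le> l" "N1 k \<omega> = 0" for k l
    using that by (induction l rule: dec_induct) (auto intro: st)
  then show ?case by blast
qed

text \<open>One inclusion is clear, since an extinct population stays extinct. The other follows by
  comparing probabilities: extinction has at least the limit \<open>ext_prob\<close> of the
  iterates, and \<open>W = 0\<close> has exactly this probability.\<close>

lemma AE_extinct: "AE \<omega> in M. pop_limit P X \<omega> = 0 \<longleftrightarrow> (\<exists>k. N1 k \<omega> = 0)"
proof -
  let ?W = "{\<omega>\<in>space M. pop_limit P X \<omega> = 0}" and ?E = "\<lambda>k. {\<omega>\<in>space M. N1 k \<omega> = 0}"
  have sub: "AE \<omega> in M. (\<exists>k. N1 k \<omega> = 0) \<longrightarrow> pop_limit P X \<omega> = 0"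
    using AE_extinct_mono AE_pop_limit
  proof eventually_elim
    case (elim \<omega>)
    show ?case
    proof
      assume "\<exists>k. N1 k \<omega> = 0"
      then obtain k where "N1 k \<omega> = 0" ..
      then have "\<forall>\<^sub>F l in sequentially. pop_ratio P X l \<omega> = 0"
        using elim(1) unfolding eventually_sequentially by (intro exI[of _ k]) (auto simp: pop_ratio_eq)
      then have "(\<lambda>l. pop_ratio P X l \<omega>) \<longlonglongrightarrow> 0" by (rule tendsto_eventually)
      then show "pop_limit P X \<omega> = 0" using elim(2) LIMSEQ_unique by blast
    qed
  qed
  have m1 [measurable]: "?W \<in> sets M" "?E k \<in> sets M" for k by measurable
  have pE: "prob (?E k) = (gen_fun ^^ k) 0" for k
  proof -
    have "(\<integral>\<omega>. (0::real) ^ card (gen_alive (\<lambda>i. X i \<omega>) k) \<partial>M) = (\<integral>\<omega>. indicator (?E k) \<omega> \<partial>M)"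
      by (intro Bochner_Integration.integral_cong) (auto simp: N1_eq power_0_left indicator_def)
    then show ?thesis using expectation_gen_fun[of 0 k] by simp
  qed
  let ?U = "\<Union>k. ?E k"
  have mU: "?U \<in> sets M" by measurable
  have "ext_prob \<le> prob ?U"
  proof (rule LIMSEQ_le_const2[OF gen_fun_iter_0], intro exI allI impI)
    show "(gen_fun ^^ k) 0 \<le> prob ?U" for k
      unfolding pE[symmetric] by (rule finite_measure_mono) (use mU in auto)
  qed
  moreover have "prob ?U = prob (?U \<inter> ?W)"
    by (rule finite_measure_eq_AE) (use sub mU m1 in \<open>auto\<close>)
  moreover have "prob (?W - ?U) = prob ?W - prob (?U \<inter> ?W)"
    using finite_measure_Diff'[OF m1(1) mU] by (simp add: Int_commute)
  ultimately have "prob (?W - ?U) \<le> 0" using prob_pop_limit_0 by simp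
  then have "prob (?W - ?U) = 0" using measure_nonneg[of M "?W - ?U"] by linarith
  then have "AE \<omega> in M. \<omega> \<notin> ?W - ?U"
    using mU m1 by (intro AE_not_in) (auto simp: emeasure_eq_measure null_sets_def)
  then show ?thesis using sub AE_space by eventually_elim auto
qed

end

section \<open>Central limit theorem for sums over the tree\<close>

lemma exp_minus_approx:
  fixes u :: real
  assumes "u \<ge> 0"
  shows "\<bar>exp (- u) - (1 - u)\<bar> \<le> u\<^sup>2"
proof -
  have "1 - u \<le> exp (- u)" using exp_ge_add_one_self[of "- u"] by simp
  moreover have "exp (- u) \<le> 1 - u + u\<^sup>2"
  proof -
    \<comment> \<open>The product equals \<open>1 + u ^ 3\<close>, so the upper bound follows from
      \<open>1 + u \<le> exp u\<close>.\<close>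
    have "1 \<le> (1 + u) * (1 - u + u\<^sup>2)" using assms by (simp add: algebra_simps power2_eq_square)
    also have "\<dots> \<le> exp u * (1 - u + u\<^sup>2)"
    proof (rule mult_right_mono)
      show "1 + u \<le> exp u" by (rule exp_ge_add_one_self)
      have "0 \<le> (u - 1 / 2)\<^sup>2 + 3 / 4" by simp
      then show "0 \<le> 1 - u + u\<^sup>2" using sum_squares_bound[of u "1/2"] by (simp add: power2_eq_square)
    qed
    finally have "exp (- u) * 1 \<le> exp (- u) * (exp u * (1 - u + u\<^sup>2))" by (intro mult_left_mono) auto
    then show ?thesis by (simp add: exp_minus field_simps)
  qed
  ultimately show ?thesis by (simp add: abs_le_iff)
qed

lemma one_add_abs_pow4: "(1 + \<bar>x::real\<bar>) ^ 4 \<le> 8 * (1 + x ^ 4)"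
proof -
  have sq: "(a + b)\<^sup>2 \<le> 2 * (a\<^sup>2 + b\<^sup>2)" for a b :: real
    using sum_squares_bound[of a b] by (simp add: power2_sum)
  have "(1 + \<bar>x\<bar>) ^ 4 = ((1 + \<bar>x\<bar>)\<^sup>2)\<^sup>2" by simp
  also have "\<dots> \<le> (2 * (1\<^sup>2 + \<bar>x\<bar>\<^sup>2))\<^sup>2" by (rule power_mono[OF sq]) simp
  also have "\<dots> = 4 * (1 + x\<^sup>2)\<^sup>2" by (simp only: power_mult_distrib power2_abs) simp
  also have "\<dots> \<le> 4 * (2 * (1\<^sup>2 + (x\<^sup>2)\<^sup>2))" using sq[of 1 "x\<^sup>2"] by simp
  finally show ?thesis by simp
qed

lemma cmod_iexp [simp]: "cmod (iexp x) = 1"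
  by (rule norm_exp_i_times)

context bar_super
begin

text \<open>A strengthening of \<open>mdiff\<close>: linear growth in the value and in the noise, so
  that third powers still fit the fourth moment bound, and a quadratic conditional variance, whose
  sums over generations have known limits.\<close>

definition score :: "real \<Rightarrow> (real \<Rightarrow> real option \<times> real option \<Rightarrow> real) \<Rightarrow> real \<Rightarrow> real \<Rightarrow> real \<Rightarrow> bool" where
  "score C g v0 v1 v2 \<longleftrightarrow> C \<ge> 0 \<and> (\<lambda>(x, v). g x v) \<in> borel_measurable (borel \<Otimes>\<^sub>M (Sbar \<Otimes>\<^sub>M Sbar)) \<and>
     (\<forall>x e. \<bar>g x (offspring P (Some x) e)\<bar> \<le> C * (1 + \<bar>x\<bar>) * nsize e) \<and>
     (\<forall>x. (\<integral>e. g x (offspring P (Some x) e) \<partial>noise P) = 0) \<and>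
     (\<forall>x. (\<integral>e. (g x (offspring P (Some x) e))\<^sup>2 \<partial>noise P) = quad v0 v1 v2 x)"

lemma score_mdiff: assumes "score C g v0 v1 v2" shows "mdiff (2 * C) g"
  unfolding mdiff_def
proof (intro conjI allI)
  have s: "C \<ge> 0" "(\<lambda>(x, v). g x v) \<in> borel_measurable (borel \<Otimes>\<^sub>M (Sbar \<Otimes>\<^sub>M Sbar))"
    "\<And>x e. \<bar>g x (offspring P (Some x) e)\<bar> \<le> C * (1 + \<bar>x\<bar>) * nsize e" "\<And>x. (\<integral>e. g x (offspring P (Some x) e) \<partial>noise P) = 0"
    using assms unfolding score_def by blast+
  show "2 * C \<ge> 0" using s(1) by simp
  show "(\<lambda>(x, v). g x v) \<in> borel_measurable (borel \<Otimes>\<^sub>M (Sbar \<Otimes>\<^sub>M Sbar))" by fact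
  fix x
  show "(\<integral>e. g x (offspring P (Some x) e) \<partial>noise P) = 0" by fact
  fix e
  have "\<bar>x\<bar> \<le> 1 + x\<^sup>2" using sum_squares_bound[of "\<bar>x\<bar>" 1] abs_ge_zero[of x] unfolding power2_abs by simp
  then have "1 + \<bar>x\<bar> \<le> 2 * (1 + x\<^sup>2)" using zero_le_power2[of x] unfolding distrib_left by linarith
  then have "C * (1 + \<bar>x\<bar>) * nsize e \<le> C * (2 * (1 + x\<^sup>2)) * (nsize e)\<^sup>2"
    using s(1) nsize_ge_1[of e] nsize_pow_mono[of 1 2 e] by (intro mult_mono) auto
  then show "\<bar>g x (offspring P (Some x) e)\<bar> \<le> 2 * C * (1 + x\<^sup>2) * (nsize e)\<^sup>2"
    using s(3)[of x e] by (simp add: mult.assoc mult.left_commute)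
qed

lemma score_measurable: "score C g v0 v1 v2 \<Longrightarrow> (\<lambda>(x, v). g x v) \<in> borel_measurable (borel \<Otimes>\<^sub>M (Sbar \<Otimes>\<^sub>M Sbar))"
  by (simp add: score_def)

lemma noise_integral_nsize: "integrable (noise P) (\<lambda>e. a * nsize e ^ 4)" "(\<integral>e. a * nsize e ^ 4 \<partial>noise P) = a * nmoment"
proof -
  have "(\<Sum>b\<in>UNIV. pmf (surv_pmf P) b) = 1" by (intro sum_pmf_eq_1) auto
  then show "integrable (noise P) (\<lambda>e. a * nsize e ^ 4)" "(\<integral>e. a * nsize e ^ 4 \<partial>noise P) = a * nmoment"
    using noise_integral_weight_nsize[of P "\<lambda>_. a"] by (auto simp: sum_distrib_right[symmetric])
qed

text \<open>Taylor expansion to second order: the linear term has mean 0, the quadratic one yields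
  the conditional variance, and third powers control the rest. For
  \<open>\<bar>s\<bar> \<le> 1\<close> the fourth-order error of the exponential is absorbed into
  the cubic one.\<close>

lemma score_char:
  assumes sc: "score C g v0 v1 v2"
  shows "\<exists>K\<ge>0. \<forall>x s. \<bar>s\<bar> \<le> 1 \<longrightarrow>
    cmod ((\<integral>e. iexp (s * g x (offspring P (Some x) e)) \<partial>noise P) - complex_of_real (exp (- (s\<^sup>2 / 2 * quad v0 v1 v2 x)))) \<le> K * \<bar>s\<bar> ^ 3 * (1 + x ^ 4)"
proof -
  have C: "C \<ge> 0" and gm: "(\<lambda>(x, v). g x v) \<in> borel_measurable (borel \<Otimes>\<^sub>M (Sbar \<Otimes>\<^sub>M Sbar))"
    and gb: "\<And>x e. \<bar>g x (offspring P (Some x) e)\<bar> \<le> C * (1 + \<bar>x\<bar>) * nsize e"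
    and g0: "\<And>x. (\<integral>e. g x (offspring P (Some x) e) \<partial>noise P) = 0"
    and g2: "\<And>x. (\<integral>e. (g x (offspring P (Some x) e))\<^sup>2 \<partial>noise P) = quad v0 v1 v2 x"
    using sc unfolding score_def by blast+
  interpret N: prob_space "noise P" by (rule prob_space_noise)
  \<comment> \<open>First summand: Taylor remainder of the characteristic function. Second summand:
    error of \<open>exp (- u)\<close> against \<open>1 - u\<close>. The factor 8 is that of
    \<open>one_add_abs_pow4\<close>.\<close>
  define K where "K = 8 * (C ^ 3 * nmoment + C ^ 4 * nmoment\<^sup>2)"
  have nm: "nmoment \<ge> 0" using nmoment_ge_1 by simp
  have K: "K \<ge> 0" unfolding K_def using C nm by simp
  have "cmod ((\<integral>e. iexp (s * g x (offspring P (Some x) e)) \<partial>noise P) - complex_of_real (exp (- (s\<^sup>2 / 2 * quad v0 v1 v2 x)))) \<le> K * \<bar>s\<bar> ^ 3 * (1 + x ^ 4)"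
    if s: "\<bar>s\<bar> \<le> 1" for x s
  proof -
    define G where "G e = g x (offspring P (Some x) e)" for e
    define y where "y = 1 + \<bar>x\<bar>"
    define v where "v = quad v0 v1 v2 x"
    have y: "y \<ge> 1" "y ^ 4 \<le> 8 * (1 + x ^ 4)" using one_add_abs_pow4 by (auto simp: y_def)
    have Gm [measurable]: "G \<in> borel_measurable (noise P)" unfolding G_def by (rule measurable_g_noise[OF gm])
    have Gb: "\<bar>G e\<bar> \<le> C * y * nsize e" for e using gb by (simp add: G_def y_def)
    have Gp: "\<bar>G e\<bar> ^ n \<le> C ^ n * y ^ n * nsize e ^ 4" if "n \<le> 4" for n e
    proof -
      have "\<bar>G e\<bar> ^ n \<le> (C * y * nsize e) ^ n" by (rule power_mono[OF Gb]) simp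
      also have "\<dots> = C ^ n * y ^ n * nsize e ^ n" by (simp add: power_mult_distrib)
      also have "\<dots> \<le> C ^ n * y ^ n * nsize e ^ 4" using that C y by (intro mult_left_mono nsize_pow_mono) auto
      finally show ?thesis .
    qed
    have Gi: "integrable (noise P) (\<lambda>e. G e ^ n)" if "n \<le> 4" for n
      using Gp[OF that] by (intro integrable_noise_bounded[where C = "C ^ n * y ^ n"]) (auto simp: power_abs)
    have G1: "integrable (noise P) G" "(\<integral>e. G e \<partial>noise P) = 0" using Gi[of 1] g0[of x] unfolding G_def[symmetric] by simp_all
    have G2: "integrable (noise P) (\<lambda>e. (G e)\<^sup>2)" "(\<integral>e. (G e)\<^sup>2 \<partial>noise P) = v" using Gi[of 2] g2[of x] unfolding G_def[symmetric] v_def by simp_all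
    have v: "0 \<le> v" "v \<le> C\<^sup>2 * y\<^sup>2 * nmoment"
    proof -
      show "0 \<le> v" unfolding G2(2)[symmetric] by simp
      have "v \<le> (\<integral>e. C\<^sup>2 * y\<^sup>2 * nsize e ^ 4 \<partial>noise P)"
        unfolding G2(2)[symmetric] using Gp[of 2] by (intro integral_mono G2 noise_integral_nsize) simp
      then show "v \<le> C\<^sup>2 * y\<^sup>2 * nmoment" by (simp only: noise_integral_nsize)
    qed
    let ?T = "\<lambda>e. 1 + \<i> * complex_of_real (s * G e) - complex_of_real (s\<^sup>2 / 2 * (G e)\<^sup>2)"
    have ie: "integrable (noise P) (\<lambda>e. iexp (s * G e))" by (rule N.integrable_iexp[OF _ Im_complex_of_real]) measurable
    have a1: "integrable (noise P) (\<lambda>e. \<i> * complex_of_real (s * G e))"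
      by (intro integrable_mult_right integrable_of_real G1(1))
    have a2: "integrable (noise P) (\<lambda>e. complex_of_real (s\<^sup>2 / 2 * (G e)\<^sup>2))"
      by (intro integrable_mult_right integrable_of_real G2(1))
    have a01: "integrable (noise P) (\<lambda>e. 1 + \<i> * complex_of_real (s * G e))"
      by (rule Bochner_Integration.integrable_add[OF _ a1]) simp
    have iT: "integrable (noise P) ?T" by (rule Bochner_Integration.integrable_diff[OF a01 a2])
    have v1: "(\<integral>e. \<i> * complex_of_real (s * G e) \<partial>noise P) = 0"
      by (simp only: integral_mult_right_zero integral_complex_of_real G1(2) mult_zero_right of_real_0)
    have v2: "(\<integral>e. complex_of_real (s\<^sup>2 / 2 * (G e)\<^sup>2) \<partial>noise P) = complex_of_real (s\<^sup>2 / 2 * v)"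
      by (simp only: integral_mult_right_zero integral_complex_of_real G2(2))
    have v01: "(\<integral>e. 1 + \<i> * complex_of_real (s * G e) \<partial>noise P) = 1"
    proof -
      have "(\<integral>e. 1 + \<i> * complex_of_real (s * G e) \<partial>noise P) = (\<integral>e. 1 \<partial>noise P) + (\<integral>e. \<i> * complex_of_real (s * G e) \<partial>noise P)"
        by (rule Bochner_Integration.integral_add[OF _ a1]) simp
      then show ?thesis unfolding v1 using N.prob_space by simp
    qed
    have vT: "(\<integral>e. ?T e \<partial>noise P) = 1 - complex_of_real (s\<^sup>2 / 2 * v)"
      unfolding Bochner_Integration.integral_diff[OF a01 a2] v01 v2 ..
    have "cmod ((\<integral>e. iexp (s * G e) \<partial>noise P) - (1 - complex_of_real (s\<^sup>2 / 2 * v))) = cmod (\<integral>e. iexp (s * G e) - ?T e \<partial>noise P)"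
      unfolding Bochner_Integration.integral_diff[OF ie iT] vT ..
    also have "\<dots> \<le> (\<integral>e. cmod (iexp (s * G e) - ?T e) \<partial>noise P)" by (rule integral_norm_bound)
    also have "\<dots> \<le> (\<integral>e. \<bar>s\<bar> ^ 3 * (C ^ 3 * y ^ 4) * nsize e ^ 4 \<partial>noise P)"
    proof (rule integral_mono)
      show "integrable (noise P) (\<lambda>e. cmod (iexp (s * G e) - ?T e))" by (rule integrable_norm[OF Bochner_Integration.integrable_diff[OF ie iT]])
      show "integrable (noise P) (\<lambda>e. \<bar>s\<bar> ^ 3 * (C ^ 3 * y ^ 4) * nsize e ^ 4)" by (rule noise_integral_nsize)
      fix e
      have "(\<Sum>k\<le>2. (\<i> * complex_of_real (s * G e)) ^ k / fact k) = ?T e"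
        by (simp add: eval_nat_numeral power2_eq_square complex_eq_iff)
      then have "cmod (iexp (s * G e) - ?T e) \<le> \<bar>s * G e\<bar> ^ Suc 2 / fact (Suc 2)"
        using iexp_approx1[of "s * G e" 2] by simp
      also have "\<dots> \<le> \<bar>s * G e\<bar> ^ 3"
      proof -
        have "\<bar>s * G e\<bar> ^ Suc 2 / fact (Suc 2) = \<bar>s * G e\<bar> ^ 3 / 6" by (simp add: eval_nat_numeral)
        moreover have "0 \<le> \<bar>s * G e\<bar> ^ 3" by simp
        ultimately show ?thesis by linarith
      qed
      also have "\<dots> = \<bar>s\<bar> ^ 3 * \<bar>G e\<bar> ^ 3" by (simp add: abs_mult power_mult_distrib)
      also have "\<dots> \<le> \<bar>s\<bar> ^ 3 * (C ^ 3 * y ^ 3 * nsize e ^ 4)" using Gp[of 3 e] by (intro mult_left_mono) auto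
      also have "\<dots> \<le> \<bar>s\<bar> ^ 3 * (C ^ 3 * y ^ 4 * nsize e ^ 4)"
        using C y nsize_ge_1[of e] by (intro mult_left_mono mult_right_mono power_increasing) auto
      finally show "cmod (iexp (s * G e) - ?T e) \<le> \<bar>s\<bar> ^ 3 * (C ^ 3 * y ^ 4) * nsize e ^ 4" by (simp add: mult.assoc)
    qed
    also have "\<dots> = \<bar>s\<bar> ^ 3 * (C ^ 3 * nmoment) * y ^ 4" unfolding noise_integral_nsize by (simp add: algebra_simps)
    finally have 1: "cmod ((\<integral>e. iexp (s * G e) \<partial>noise P) - (1 - complex_of_real (s\<^sup>2 / 2 * v))) \<le> \<bar>s\<bar> ^ 3 * (C ^ 3 * nmoment) * y ^ 4" .
    have "cmod ((1 - complex_of_real (s\<^sup>2 / 2 * v)) - complex_of_real (exp (- (s\<^sup>2 / 2 * v)))) = \<bar>exp (- (s\<^sup>2 / 2 * v)) - (1 - s\<^sup>2 / 2 * v)\<bar>"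
    proof -
      have "(1 - complex_of_real a) - complex_of_real b = complex_of_real ((1 - a) - b)" for a b by simp
      then show ?thesis by (simp only: norm_of_real abs_minus_commute)
    qed
    also have "\<dots> \<le> (s\<^sup>2 / 2 * v)\<^sup>2" using v(1) by (intro exp_minus_approx) simp
    also have "\<dots> \<le> (s\<^sup>2 * (C\<^sup>2 * y\<^sup>2 * nmoment))\<^sup>2"
      using v by (intro power_mono mult_mono) auto
    also have "\<dots> = \<bar>s\<bar> ^ 4 * (C ^ 4 * nmoment\<^sup>2) * y ^ 4"
      by (simp add: power_mult_distrib)
    also have "\<dots> \<le> \<bar>s\<bar> ^ 3 * (C ^ 4 * nmoment\<^sup>2) * y ^ 4"
      using s C y by (intro mult_right_mono power_decreasing) auto
    finally have 2: "cmod ((1 - complex_of_real (s\<^sup>2 / 2 * v)) - complex_of_real (exp (- (s\<^sup>2 / 2 * v)))) \<le> \<bar>s\<bar> ^ 3 * (C ^ 4 * nmoment\<^sup>2) * y ^ 4" .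
    have "cmod ((\<integral>e. iexp (s * G e) \<partial>noise P) - complex_of_real (exp (- (s\<^sup>2 / 2 * v)))) \<le>
      \<bar>s\<bar> ^ 3 * (C ^ 3 * nmoment) * y ^ 4 + \<bar>s\<bar> ^ 3 * (C ^ 4 * nmoment\<^sup>2) * y ^ 4"
      by (rule norm_diff_triangle_le[OF 1 2])
    also have "\<dots> = \<bar>s\<bar> ^ 3 * (C ^ 3 * nmoment + C ^ 4 * nmoment\<^sup>2) * y ^ 4" by (simp add: algebra_simps)
    also have "\<dots> \<le> \<bar>s\<bar> ^ 3 * (C ^ 3 * nmoment + C ^ 4 * nmoment\<^sup>2) * (8 * (1 + x ^ 4))"
      using C nm y by (intro mult_left_mono) auto
    also have "\<dots> = K * \<bar>s\<bar> ^ 3 * (1 + x ^ 4)" unfolding K_def by (simp only: mult_ac)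
    finally show ?thesis unfolding G_def v_def .
  qed
  with K show ?thesis by blast
qed

text \<open>The expectations are of order \<open>m ^ k\<close>; the additional factor
  \<open>q ^ k\<close> makes the series converge. The cube of the norming factor provides just this
  scale, since \<open>q ^ (3 * k) = q ^ k * m ^ k\<close>.\<close>

lemma AE_S4_small: "AE \<omega> in M. (\<lambda>k. S (\<lambda>x. 1 + x ^ 4) k \<omega> / (q ^ k * m ^ k)) \<longlonglongrightarrow> 0"
proof -
  have nn: "S (\<lambda>x. 1 + x ^ 4) k \<omega> \<ge> 0" for k \<omega>
    unfolding S_def by (intro sum_nonneg) (auto simp: ext_def split: option.split)
  have e: "(\<Sum>i\<in>gen k. ext (\<lambda>x. ennreal (1 + x ^ 4)) (X i \<omega>)) = ennreal (S (\<lambda>x. 1 + x ^ 4) k \<omega>)" for k \<omega>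
  proof -
    have "ext (\<lambda>x. ennreal (1 + x ^ 4)) s = ennreal (ext (\<lambda>x. 1 + x ^ 4) s)" "0 \<le> ext (\<lambda>x. 1 + x ^ 4 :: real) s" for s by (cases s; simp)+
    then show ?thesis by (simp add: S_def sum_ennreal)
  qed
  have "AE \<omega> in M. summable (\<lambda>k. S (\<lambda>x. 1 + x ^ 4) k \<omega> / (q ^ k * m ^ k))"
  proof (rule AE_summable_of_nn_integral)
    show "(\<integral>\<^sup>+\<omega>. ennreal (S (\<lambda>x. 1 + x ^ 4) k \<omega> / (q ^ k * m ^ k)) \<partial>M) \<le> ennreal (K4 * (1 / q) ^ k)" for k
    proof -
      have "(\<integral>\<^sup>+\<omega>. ennreal (S (\<lambda>x. 1 + x ^ 4) k \<omega> / (q ^ k * m ^ k)) \<partial>M) =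
        (\<integral>\<^sup>+\<omega>. ennreal (1 / (q ^ k * m ^ k)) * ennreal (S (\<lambda>x. 1 + x ^ 4) k \<omega>) \<partial>M)"
        using nn q by (intro nn_integral_cong) (subst ennreal_mult[symmetric], auto)
      also have "\<dots> = ennreal (1 / (q ^ k * m ^ k)) * (\<integral>\<^sup>+\<omega>. ennreal (S (\<lambda>x. 1 + x ^ 4) k \<omega>) \<partial>M)"
        by (rule nn_integral_cmult) measurable
      also have "\<dots> \<le> ennreal (1 / (q ^ k * m ^ k)) * ennreal (K4 * m ^ k)"
        using K4(2)[of k] unfolding e by (intro mult_left_mono) auto
      also have "\<dots> = ennreal (K4 * (1 / q) ^ k)"
        using K4(1) q by (subst ennreal_mult[symmetric]) (auto simp: power_divide)
      finally show ?thesis .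
    qed
    show "summable (\<lambda>k. K4 * (1 / q) ^ k)" using q by (intro summable_mult summable_geometric) simp
    show "(\<lambda>\<omega>. S (\<lambda>x. 1 + x ^ 4) k \<omega> / (q ^ k * m ^ k)) \<in> borel_measurable M" for k by measurable
  qed (use nn q K4(1) in auto)
  then show ?thesis by eventually_elim (rule summable_LIMSEQ_zero)
qed

text \<open>For an extinct generation the root is 0, and the quotient is 0 by convention.\<close>

definition scl :: "real \<Rightarrow> nat \<Rightarrow> 'a \<Rightarrow> real" where
  "scl c l \<omega> = 1 / sqrt (c * N1 l \<omega>)"

text \<open>The normalisation at generation \<open>l\<close> and the event on which it is controlled are both known at time \<open>l\<close>.\<close>

definition Ev :: "real \<Rightarrow> nat \<Rightarrow> 'a set" where
  "Ev \<delta> l = {\<omega>\<in>space M. \<delta> * m ^ l \<le> N1 l \<omega>}"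

text \<open>\<open>l\<close> fixes the norming and \<open>k\<close> the number of generations
  summed; keeping them apart allows conditioning on each generation from \<open>l\<close>
  on.\<close>

definition \<Theta> :: "(real \<Rightarrow> real option \<times> real option \<Rightarrow> real) \<Rightarrow> real \<Rightarrow> nat \<Rightarrow> nat \<Rightarrow> 'a \<Rightarrow> complex" where
  "\<Theta> g c l k \<omega> = iexp (scl c l \<omega> * (\<Sum>j<k. D g j \<omega>))"

text \<open>The conditional characteristic function of the contribution of generation
  \<open>k\<close>, given the past up to \<open>k\<close>.\<close>

definition \<Phi> :: "(real \<Rightarrow> real option \<times> real option \<Rightarrow> real) \<Rightarrow> real \<Rightarrow> nat \<Rightarrow> nat \<Rightarrow> 'a \<Rightarrow> complex" where
  "\<Phi> g c l k \<omega> = (\<Prod>i\<in>gen k. \<integral>e. iexp (scl c l \<omega> * gext g (X i \<omega>) (offspring P (X i \<omega>) e)) \<partial>noise P)"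

lemma measurable_scl_past: "l \<le> k \<Longrightarrow> scl c l \<in> borel_measurable (F k)"
  unfolding scl_def[abs_def] using measurable_S_past[of "quad 1 0 0" l k] by simp

lemma Ev_sets_past: "l \<le> k \<Longrightarrow> Ev \<delta> l \<in> sets (F k)"
proof -
  assume "l \<le> k"
  note [measurable] = measurable_S_past[OF measurable_quad this, of 1 0 0]
  have "{\<omega>\<in>space (F k). \<delta> * m ^ l \<le> N1 l \<omega>} \<in> sets (F k)" by measurable
  then show ?thesis by (simp add: Ev_def)
qed

lemma Ev_sets [measurable]: "Ev \<delta> l \<in> sets M"
  using Ev_sets_past[OF order_refl] subalg by (auto simp: subalgebra_def)

lemma measurable_scl [measurable]: "scl c l \<in> borel_measurable M"
  by (rule past_measurable[OF measurable_scl_past[OF order_refl]])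

lemma measurable_\<Theta>_past:
  assumes g: "(\<lambda>(x, v). g x v) \<in> borel_measurable (borel \<Otimes>\<^sub>M (Sbar \<Otimes>\<^sub>M Sbar))" and "l \<le> k"
  shows "\<Theta> g c l k \<in> borel_measurable (F k)"
proof -
  have [measurable]: "(\<lambda>\<omega>. \<Sum>j<k. D g j \<omega>) \<in> borel_measurable (F k)"
    by (intro borel_measurable_sum measurable_D_past[OF g]) simp
  note [measurable] = measurable_scl_past[OF assms(2)]
  show ?thesis unfolding \<Theta>_def[abs_def] by measurable
qed

lemma \<Phi>_bound: "cmod (\<integral>e. iexp (s * gext g t (offspring P t e)) \<partial>noise P) \<le> 1"
proof -
  interpret N: prob_space "noise P" by (rule prob_space_noise)
  have "cmod (\<integral>e. iexp (s * gext g t (offspring P t e)) \<partial>noise P) \<le> (\<integral>e. cmod (iexp (s * gext g t (offspring P t e))) \<partial>noise P)"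
    by (rule integral_norm_bound)
  then show ?thesis using N.prob_space by simp
qed

lemma measurable_\<Phi>:
  assumes g: "(\<lambda>(x, v). g x v) \<in> borel_measurable (borel \<Otimes>\<^sub>M (Sbar \<Otimes>\<^sub>M Sbar))" and "l \<le> k"
  shows "\<Phi> g c l k \<in> borel_measurable M"
proof -
  interpret N: prob_space "noise P" by (rule prob_space_noise)
  have "\<Phi> g c l k \<in> borel_measurable (F k)"
    unfolding \<Phi>_def[abs_def]
  proof (intro borel_measurable_prod N.borel_measurable_lebesgue_integral)
    fix i assume i: "i \<in> gen k"
    note [measurable] = measurable_scl_past[OF assms(2)] measurable_noise_arg[OF i measurable_gext_past[OF i g]]
    show "(\<lambda>(\<omega>, e). iexp (scl c l \<omega> * gext g (X i \<omega>) (offspring P (X i \<omega>) e))) \<in> borel_measurable (F k \<Otimes>\<^sub>M noise P)"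
      unfolding split_beta' by measurable
  qed
  then show ?thesis by (rule past_measurable)
qed

text \<open>For \<open>l \<le> k\<close> the event, the norming and the earlier sum all belong to
  the past of generation \<open>k\<close>; only the contribution of generation \<open>k\<close>
  itself is averaged.\<close>

lemma \<Theta>_step:
  assumes g: "score C g v0 v1 v2" and "l \<le> k"
  shows "(\<integral>\<omega>. indicator (Ev \<delta> l) \<omega> * \<Theta> g c l (Suc k) \<omega> \<partial>M) = (\<integral>\<omega>. indicator (Ev \<delta> l) \<omega> * \<Theta> g c l k \<omega> * \<Phi> g c l k \<omega> \<partial>M)"
proof -
  note gm = score_measurable[OF g]
  interpret N: prob_space "noise P" by (rule prob_space_noise)
  let ?g = "\<lambda>i \<omega> v. iexp (scl c l \<omega> * gext g (X i \<omega>) v)"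
  let ?Z = "\<lambda>\<omega>. indicator (Ev \<delta> l) \<omega> * \<Theta> g c l k \<omega>"
  have e: "indicator (Ev \<delta> l) \<omega> * \<Theta> g c l (Suc k) \<omega> = ?Z \<omega> * (\<Prod>i\<in>gen k. ?g i \<omega> (V i \<omega>))" for \<omega>
  proof -
    have "(\<Prod>i\<in>gen k. ?g i \<omega> (V i \<omega>)) = iexp (scl c l \<omega> * D g k \<omega>)"
      unfolding D_def by (simp add: exp_sum[symmetric] sum_distrib_left)
    then show ?thesis by (simp add: \<Theta>_def exp_add[symmetric] distrib_left)
  qed
  have \<Theta>M [measurable]: "\<Theta> g c l k \<in> borel_measurable M" "\<Theta> g c l (Suc k) \<in> borel_measurable M"
    using measurable_\<Theta>_past[OF gm, of l k c] measurable_\<Theta>_past[OF gm, of l "Suc k" c] \<open>l \<le> k\<close> by (auto intro: past_measurable)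
  have "(\<integral>\<omega>. ?Z \<omega> * (\<Prod>i\<in>gen k. ?g i \<omega> (V i \<omega>)) \<partial>M) = (\<integral>\<omega>. ?Z \<omega> * (\<Prod>i\<in>gen k. \<integral>e. ?g i \<omega> (offspring P (X i \<omega>) e) \<partial>noise P) \<partial>M)"
  proof (rule integral_prod_past)
    show "?Z \<in> borel_measurable (F k)"
      using measurable_\<Theta>_past[OF gm \<open>l \<le> k\<close>] Ev_sets_past[OF \<open>l \<le> k\<close>] by (intro borel_measurable_times borel_measurable_indicator)
    show "integrable M (\<lambda>\<omega>. ?Z \<omega> * (\<Prod>i\<in>gen k. ?g i \<omega> (V i \<omega>)))"
      unfolding e[symmetric]
    proof (rule integrable_const_bound[where B = 1])
      have "cmod (\<Theta> g c l (Suc k) \<omega>) = 1" for \<omega> unfolding \<Theta>_def by (rule cmod_iexp)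
      then show "AE \<omega> in M. cmod (indicator (Ev \<delta> l) \<omega> * \<Theta> g c l (Suc k) \<omega>) \<le> 1" by (simp add: norm_mult indicator_def)
    qed measurable
    fix i assume i: "i \<in> gen k"
    note [measurable] = measurable_scl_past[OF \<open>l \<le> k\<close>, of c] measurable_gext_past[OF i gm, unfolded split_beta']
    show "case_prod (?g i) \<in> borel_measurable (F k \<Otimes>\<^sub>M (Sbar \<Otimes>\<^sub>M Sbar))"
      unfolding split_beta' by measurable
    fix \<omega>
    have "(\<lambda>e. gext g (X i \<omega>) (offspring P (X i \<omega>) e)) \<in> borel_measurable (noise P)"
      by (rule borel_measurable_integrable[OF mdiff_integrable[OF score_mdiff[OF g]]])
    then have "(\<lambda>e. complex_of_real (scl c l \<omega> * gext g (X i \<omega>) (offspring P (X i \<omega>) e))) \<in> borel_measurable (noise P)"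
      by measurable
    then show "integrable (noise P) (\<lambda>e. ?g i \<omega> (offspring P (X i \<omega>) e))"
      by (rule N.integrable_iexp) (rule Im_complex_of_real)
  qed
  then show ?thesis unfolding e \<Phi>_def .
qed

text \<open>All factors lie in the unit disc, so two products differ by at most the sum of the
  differences of their factors, each of which is bounded by the expansion of one cell.\<close>

lemma \<Phi>_approx:
  assumes K: "\<And>x s. \<bar>s\<bar> \<le> 1 \<Longrightarrow>
    cmod ((\<integral>e. iexp (s * g x (offspring P (Some x) e)) \<partial>noise P) - complex_of_real (exp (- (s\<^sup>2 / 2 * quad v0 v1 v2 x)))) \<le> K * \<bar>s\<bar> ^ 3 * (1 + x ^ 4)"
    and v: "\<And>x. quad v0 v1 v2 x \<ge> 0"
    and s: "\<bar>scl c l \<omega>\<bar> \<le> 1"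
  shows "cmod (\<Phi> g c l k \<omega> - complex_of_real (exp (- ((scl c l \<omega>)\<^sup>2 / 2 * S (quad v0 v1 v2) k \<omega>)))) \<le> K * \<bar>scl c l \<omega>\<bar> ^ 3 * S (\<lambda>x. 1 + x ^ 4) k \<omega>"
proof -
  interpret N: prob_space "noise P" by (rule prob_space_noise)
  let ?s = "scl c l \<omega>"
  let ?w = "\<lambda>i. complex_of_real (exp (- (?s\<^sup>2 / 2 * ext (quad v0 v1 v2) (X i \<omega>))))"
  have "complex_of_real (exp (- (?s\<^sup>2 / 2 * S (quad v0 v1 v2) k \<omega>))) = (\<Prod>i\<in>gen k. ?w i)"
    unfolding S_def by (simp add: exp_sum[symmetric] sum_distrib_left sum_negf flip: of_real_prod)
  then have "cmod (\<Phi> g c l k \<omega> - complex_of_real (exp (- (?s\<^sup>2 / 2 * S (quad v0 v1 v2) k \<omega>))))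
    \<le> (\<Sum>i\<in>gen k. cmod ((\<integral>e. iexp (?s * gext g (X i \<omega>) (offspring P (X i \<omega>) e)) \<partial>noise P) - ?w i))"
    unfolding \<Phi>_def
  proof (simp only:, intro norm_prod_diff \<Phi>_bound)
    fix i
    have "ext (quad v0 v1 v2) (X i \<omega>) \<ge> 0" using v by (cases "X i \<omega>") auto
    then show "cmod (?w i) \<le> 1" by (simp only: norm_of_real abs_exp_cancel exp_le_one_iff) simp
  qed
  also have "\<dots> \<le> (\<Sum>i\<in>gen k. K * \<bar>?s\<bar> ^ 3 * ext (\<lambda>x. 1 + x ^ 4) (X i \<omega>))"
  proof (rule sum_mono)
    fix i
    show "cmod ((\<integral>e. iexp (?s * gext g (X i \<omega>) (offspring P (X i \<omega>) e)) \<partial>noise P) - ?w i) \<le> K * \<bar>?s\<bar> ^ 3 * ext (\<lambda>x. 1 + x ^ 4) (X i \<omega>)"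
    proof (cases "X i \<omega>")
      case None
      then show ?thesis using N.prob_space by simp
    next
      case (Some x)
      then show ?thesis using K[OF s, of x] by simp
    qed
  qed
  finally show ?thesis by (simp add: S_def sum_distrib_left)
qed

end

section \<open>Gaussian factors of the generations\<close>

context bar_super
begin

text \<open>With weights \<open>q ^ k\<close> the sum over all generations before \<open>l\<close>
  is, in mean square, of the order of its last term.\<close>

lemma D_sum_L2:
  assumes g: "mdiff C g"
  shows "\<exists>B>0. \<forall>l. integrable M (\<lambda>\<omega>. (\<Sum>k<l. D g k \<omega>)\<^sup>2) \<and> (\<integral>\<omega>. (\<Sum>k<l. D g k \<omega>)\<^sup>2 \<partial>M) \<le> B\<^sup>2 * m ^ l"
proof -
  define c where "c = 2 * C\<^sup>2 * nmoment * K4"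
  have c: "c \<ge> 0" using nmoment_ge_1 K4(1) by (simp add: c_def)
  \<comment> \<open>The summand 1 keeps \<open>B\<close> positive also if
    \<open>c = 0\<close>.\<close>
  define B where "B = (sqrt c + 1) / (q - 1)"
  have B: "B > 0" using q c by (simp add: B_def add_nonneg_pos)
  have geo: "(\<Sum>k<l. q ^ k) \<le> q ^ l / (q - 1)" for l
    using q by (simp add: geometric_sum divide_right_mono)
  have "integrable M (\<lambda>\<omega>. (\<Sum>k<l. D g k \<omega>)\<^sup>2) \<and> (\<integral>\<omega>. (\<Sum>k<l. D g k \<omega>)\<^sup>2 \<partial>M) \<le> B\<^sup>2 * m ^ l" for l
  proof
    show "integrable M (\<lambda>\<omega>. (\<Sum>k<l. D g k \<omega>)\<^sup>2)"
      using D_sum_second_moment(1)[OF g finite_lessThan[of l], of "\<lambda>k. q ^ k" "\<lambda>_. 1"] q by simp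
    have "(\<integral>\<omega>. (\<Sum>k<l. D g k \<omega>)\<^sup>2 \<partial>M) \<le> (\<Sum>k<l. q ^ k) * (\<Sum>k<l. c * m ^ k / q ^ k)"
      using D_sum_second_moment(2)[OF g finite_lessThan[of l], of "\<lambda>k. q ^ k" "\<lambda>_. 1"] q by (simp add: c_def)
    also have "(\<Sum>k<l. c * m ^ k / q ^ k) = c * (\<Sum>k<l. q ^ k)"
      unfolding sum_distrib_left
    proof (rule sum.cong)
      fix k
      have "m ^ k = q ^ k * q ^ k" by (simp add: q(3) flip: power_mult_distrib)
      then show "c * m ^ k / q ^ k = c * q ^ k" using q by simp
    qed simp
    also have "(\<Sum>k<l. q ^ k) * (c * (\<Sum>k<l. q ^ k)) = c * (\<Sum>k<l. q ^ k)\<^sup>2" by (simp add: power2_eq_square)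
    also have "\<dots> \<le> (sqrt c + 1)\<^sup>2 * (q ^ l / (q - 1))\<^sup>2"
    proof (rule mult_mono)
      have "(sqrt c)\<^sup>2 \<le> (sqrt c + 1)\<^sup>2" using c by (intro power_mono) auto
      then show "c \<le> (sqrt c + 1)\<^sup>2" using c by simp
      show "(\<Sum>k<l. q ^ k)\<^sup>2 \<le> (q ^ l / (q - 1))\<^sup>2" using geo q by (intro power_mono sum_nonneg) auto
    qed auto
    also have "\<dots> = B\<^sup>2 * m ^ l"
    proof -
      have "m ^ l = (q ^ l)\<^sup>2" by (simp only: power2_eq_square power_mult_distrib[symmetric] q(3))
      then show ?thesis by (simp add: B_def power_divide)
    qed
    finally show "(\<integral>\<omega>. (\<Sum>k<l. D g k \<omega>)\<^sup>2 \<partial>M) \<le> B\<^sup>2 * m ^ l" .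
  qed
  with B show ?thesis by blast
qed

lemma AE_scl_limit:
  assumes c: "c > 0"
  shows "AE \<omega> in M. pop_limit P X \<omega> \<noteq> 0 \<longrightarrow> (\<lambda>l. scl c l \<omega> * q ^ l) \<longlonglongrightarrow> 1 / sqrt (c * pop_limit P X \<omega>)"
  using AE_pop_limit AE_pop_limit_nonneg
proof eventually_elim
  case (elim \<omega>)
  show ?case
  proof
    assume "pop_limit P X \<omega> \<noteq> 0"
    then have W: "pop_limit P X \<omega> > 0" using elim by simp
    have "scl c l \<omega> * q ^ l = 1 / sqrt (c * pop_ratio P X l \<omega>)" for l
    proof -
      have "sqrt (c * N1 l \<omega>) = sqrt (c * pop_ratio P X l \<omega>) * q ^ l"
        by (simp add: pop_ratio_eq real_sqrt_mult real_sqrt_divide real_sqrt_power)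
      then show ?thesis using q by (simp add: scl_def)
    qed
    moreover have "(\<lambda>l. 1 / sqrt (c * pop_ratio P X l \<omega>)) \<longlonglongrightarrow> 1 / sqrt (c * pop_limit P X \<omega>)"
      using c W by (intro tendsto_intros elim) auto
    ultimately show "(\<lambda>l. scl c l \<omega> * q ^ l) \<longlonglongrightarrow> 1 / sqrt (c * pop_limit P X \<omega>)" by simp
  qed
qed

text \<open>On extinction every integrand that carries the indicator of the cut-off event eventually
  vanishes, so limits have to be examined on survival only.\<close>

lemma AE_Ev_extinct:
  assumes "\<delta> > 0"
  shows "AE \<omega> in M. pop_limit P X \<omega> = 0 \<longrightarrow> (\<forall>\<^sub>F l in sequentially. \<omega> \<notin> Ev \<delta> l \<and> N1 l \<omega> = 0)"
  using AE_extinct AE_extinct_mono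
proof eventually_elim
  case (elim \<omega>)
  show ?case
  proof
    assume "pop_limit P X \<omega> = 0"
    then obtain k where "N1 k \<omega> = 0" using elim by blast
    then have "\<omega> \<notin> Ev \<delta> l \<and> N1 l \<omega> = 0" if "l \<ge> k" for l
    proof -
      have "N1 l \<omega> = 0" using elim(2) that \<open>N1 k \<omega> = 0\<close> by blast
      moreover have "0 < \<delta> * m ^ l" using assms by simp
      ultimately show ?thesis by (auto simp: Ev_def)
    qed
    then show "\<forall>\<^sub>F l in sequentially. \<omega> \<notin> Ev \<delta> l \<and> N1 l \<omega> = 0" unfolding eventually_sequentially by blast
  qed
qed

text \<open>On survival \<open>(scl c l \<omega>)\<^sup>2\<close> times the conditional variance of
  generation \<open>l + j\<close> tends to \<open>vr * m ^ j / c\<close>: the random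
  \<open>W\<close> cancels between norming and sum. This is why the Gaussian factor is deterministic
  and, in the end, why \<open>G\<close> is independent of \<open>W\<close>.\<close>

lemma AE_\<Phi>_limit:
  assumes g: "score C g v0 v1 v2" and v: "\<And>x. quad v0 v1 v2 x \<ge> 0" and c: "c > 0" and \<delta>: "\<delta> > 0"
  defines "vr \<equiv> v0 + v1 * mu1 P + v2 * mu2 P"
  shows "AE \<omega> in M. (\<lambda>l. indicator (Ev \<delta> l) \<omega> * cmod (\<Phi> g c l (l + j) \<omega> - complex_of_real (exp (- (vr * m ^ j / (2 * c)))))) \<longlonglongrightarrow> 0"
proof -
  obtain K where K: "K \<ge> 0" "\<And>x s. \<bar>s\<bar> \<le> 1 \<Longrightarrow>
    cmod ((\<integral>e. iexp (s * g x (offspring P (Some x) e)) \<partial>noise P) - complex_of_real (exp (- (s\<^sup>2 / 2 * quad v0 v1 v2 x)))) \<le> K * \<bar>s\<bar> ^ 3 * (1 + x ^ 4)"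
    using score_char[OF g] by blast
  show ?thesis
    using AE_scl_limit[OF c] AE_Ev_extinct[OF \<delta>] AE_S_tendsto AE_S4_small AE_pop_limit_nonneg
  proof eventually_elim
    case (elim \<omega>)
    let ?r = "exp (- (vr * m ^ j / (2 * c)))" and ?W = "pop_limit P X \<omega>" and ?s = "\<lambda>l. scl c l \<omega>"
    let ?S4 = "\<lambda>k. S (\<lambda>x. 1 + x ^ 4) k \<omega>"
    show ?case
    proof (cases "?W = 0")
      case True
      then have "\<forall>\<^sub>F l in sequentially. indicator (Ev \<delta> l) \<omega> * cmod (\<Phi> g c l (l + j) \<omega> - complex_of_real ?r) = 0"
        using elim(2) by (auto elim!: eventually_mono)
      then show ?thesis by (rule tendsto_eventually)
    next
      case False
      with elim(5) have W: "?W > 0" by simp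
      have a: "(\<lambda>l. ?s l * q ^ l) \<longlonglongrightarrow> 1 / sqrt (c * ?W)" using elim(1) False by simp
      have qi: "(\<lambda>l. (1 / q) ^ l) \<longlonglongrightarrow> 0" using q by (intro LIMSEQ_power_zero) simp
      have "(\<lambda>l. ?s l * q ^ l * (1 / q) ^ l) \<longlonglongrightarrow> 1 / sqrt (c * ?W) * 0" by (intro tendsto_mult a qi)
      then have s0: "?s \<longlonglongrightarrow> 0" using q by (simp add: power_divide)
      have mq: "m ^ l = q ^ l * q ^ l" for l by (simp add: q(3) flip: power_mult_distrib)
      have t1: "(\<lambda>l. (?s l)\<^sup>2 / 2 * S (quad v0 v1 v2) (l + j) \<omega>) \<longlonglongrightarrow> vr * m ^ j / (2 * c)"
      proof -
        have e1: "(?s l)\<^sup>2 / 2 * S (quad v0 v1 v2) (l + j) \<omega> = (?s l * q ^ l)\<^sup>2 / 2 * m ^ j * (S (quad v0 v1 v2) (l + j) \<omega> / m ^ (l + j))" for l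
          using q by (simp add: mq power2_eq_square power_add)
        moreover have "(\<lambda>l. (?s l * q ^ l)\<^sup>2 / 2 * m ^ j * (S (quad v0 v1 v2) (l + j) \<omega> / m ^ (l + j))) \<longlonglongrightarrow>
          (1 / sqrt (c * ?W))\<^sup>2 / 2 * m ^ j * (vr * ?W)"
          unfolding vr_def using elim(3) by (intro tendsto_intros a LIMSEQ_ignore_initial_segment) auto
        moreover have "(1 / sqrt (c * ?W))\<^sup>2 / 2 * m ^ j * (vr * ?W) = vr * m ^ j / (2 * c)"
          using c W by (simp add: power_divide field_simps)
        ultimately show ?thesis unfolding e1 by (simp only:)
      qed
      \<comment> \<open>Powers of \<open>q\<close> balance: the cube of the norming removes
        \<open>q ^ (3 * l)\<close>, which is \<open>q ^ l * m ^ l\<close>, the scale of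
        \<open>AE_S4_small\<close>.\<close>
      have t2: "(\<lambda>l. K * \<bar>?s l\<bar> ^ 3 * ?S4 (l + j)) \<longlonglongrightarrow> 0"
      proof -
        have e1: "K * \<bar>?s l\<bar> ^ 3 * ?S4 (l + j) = K * \<bar>?s l * q ^ l\<bar> ^ 3 * q ^ (3 * j) * (?S4 (l + j) / (q ^ (l + j) * m ^ (l + j)))" for l
        proof -
          have "q ^ (l + j) * m ^ (l + j) = q ^ (3 * l) * q ^ (3 * j)" unfolding mq power_add[symmetric] by (rule arg_cong[of _ _ "(^) q"]) simp
          moreover have "\<bar>?s l * q ^ l\<bar> ^ 3 = \<bar>?s l\<bar> ^ 3 * q ^ (3 * l)"
            using q by (simp add: abs_mult power_mult_distrib power_mult mult.commute power_commutes flip: power_mult)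
          ultimately show ?thesis using q by simp
        qed
        moreover have "(\<lambda>l. K * \<bar>?s l * q ^ l\<bar> ^ 3 * q ^ (3 * j) * (?S4 (l + j) / (q ^ (l + j) * m ^ (l + j)))) \<longlonglongrightarrow>
          K * \<bar>1 / sqrt (c * ?W)\<bar> ^ 3 * q ^ (3 * j) * 0"
          by (intro tendsto_intros a LIMSEQ_ignore_initial_segment elim(4))
        ultimately show ?thesis unfolding e1 by (simp only: mult_zero_right)
      qed
      have t3: "(\<lambda>l. \<bar>exp (- ((?s l)\<^sup>2 / 2 * S (quad v0 v1 v2) (l + j) \<omega>)) - ?r\<bar>) \<longlonglongrightarrow> \<bar>?r - ?r\<bar>"
        by (intro tendsto_intros t1)
      have t: "(\<lambda>l. K * \<bar>?s l\<bar> ^ 3 * ?S4 (l + j) + \<bar>exp (- ((?s l)\<^sup>2 / 2 * S (quad v0 v1 v2) (l + j) \<omega>)) - ?r\<bar>) \<longlonglongrightarrow> 0"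
        using tendsto_add[OF t2 t3] by simp
      have s1: "\<forall>\<^sub>F l in sequentially. \<bar>?s l\<bar> \<le> 1"
        using order_tendstoD(2)[OF tendsto_rabs_zero[OF s0], of 1] by (auto elim: eventually_mono)
      show ?thesis
      proof (rule tendsto_sandwich[OF _ _ tendsto_const t])
        show "\<forall>\<^sub>F l in sequentially. indicator (Ev \<delta> l) \<omega> * cmod (\<Phi> g c l (l + j) \<omega> - complex_of_real ?r)
          \<le> K * \<bar>?s l\<bar> ^ 3 * ?S4 (l + j) + \<bar>exp (- ((?s l)\<^sup>2 / 2 * S (quad v0 v1 v2) (l + j) \<omega>)) - ?r\<bar>"
          using s1
        proof eventually_elim
          case (elim l)
          let ?u = "exp (- ((?s l)\<^sup>2 / 2 * S (quad v0 v1 v2) (l + j) \<omega>))"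
          have "indicator (Ev \<delta> l) \<omega> * cmod (\<Phi> g c l (l + j) \<omega> - complex_of_real ?r) \<le> cmod (\<Phi> g c l (l + j) \<omega> - complex_of_real ?r)"
            by (simp add: indicator_def)
          also have "\<dots> \<le> cmod (\<Phi> g c l (l + j) \<omega> - complex_of_real ?u) + cmod (complex_of_real ?u - complex_of_real ?r)"
            using norm_triangle_ineq[of "\<Phi> g c l (l + j) \<omega> - complex_of_real ?u" "complex_of_real ?u - complex_of_real ?r"] by simp
          also have "cmod (complex_of_real ?u - complex_of_real ?r) = \<bar>?u - ?r\<bar>"
            by (simp only: of_real_diff[symmetric] norm_of_real)
          also have "cmod (\<Phi> g c l (l + j) \<omega> - complex_of_real ?u) \<le> K * \<bar>?s l\<bar> ^ 3 * ?S4 (l + j)"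
            by (rule \<Phi>_approx[OF K(2) v elim])
          finally show ?case by simp
        qed
      qed simp
    qed
  qed
qed

lemma \<Theta>_integrable:
  assumes g: "score C g v0 v1 v2" and "l \<le> k"
  shows "integrable M (\<lambda>\<omega>. indicator (Ev \<delta> l) \<omega> * \<Theta> g c l k \<omega>)"
proof (rule integrable_const_bound[where B = 1])
  have "cmod (\<Theta> g c l k \<omega>) = 1" for \<omega> unfolding \<Theta>_def by (rule cmod_iexp)
  then show "AE \<omega> in M. cmod (indicator (Ev \<delta> l) \<omega> * \<Theta> g c l k \<omega>) \<le> 1" by (simp add: norm_mult indicator_def)
  have [measurable]: "\<Theta> g c l k \<in> borel_measurable M"
    by (rule past_measurable[OF measurable_\<Theta>_past[OF score_measurable[OF g] assms(2)]])
  show "(\<lambda>\<omega>. indicator (Ev \<delta> l) \<omega> * \<Theta> g c l k \<omega>) \<in> borel_measurable M" by measurable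
qed

lemma \<Phi>_norm_le: "cmod (\<Phi> g c l k \<omega>) \<le> 1"
  unfolding \<Phi>_def prod_norm[symmetric] by (intro prod_le_1 conjI norm_ge_zero \<Phi>_bound)

text \<open>Replaces the conditional factor by its limit. Two numbers of the unit disc differ by at
  most 2, which permits dominated convergence, and \<open>\<Theta>\<close> has modulus 1 and drops
  out of the estimate.\<close>

lemma \<Theta>_step_limit:
  assumes g: "score C g v0 v1 v2" and v: "\<And>x. quad v0 v1 v2 x \<ge> 0" and c: "c > 0" and \<delta>: "\<delta> > 0"
  defines "vr \<equiv> v0 + v1 * mu1 P + v2 * mu2 P"
  assumes vr: "vr \<ge> 0"
  shows "(\<lambda>l. (\<integral>\<omega>. indicator (Ev \<delta> l) \<omega> * \<Theta> g c l (l + Suc j) \<omega> \<partial>M)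
     - complex_of_real (exp (- (vr * m ^ j / (2 * c)))) * (\<integral>\<omega>. indicator (Ev \<delta> l) \<omega> * \<Theta> g c l (l + j) \<omega> \<partial>M)) \<longlonglongrightarrow> 0"
proof -
  let ?r = "complex_of_real (exp (- (vr * m ^ j / (2 * c))))"
  note gm = score_measurable[OF g]
  have r: "cmod ?r \<le> 1"
  proof -
    have "0 \<le> vr * m ^ j / (2 * c)" using vr c by simp
    then show ?thesis by (simp only: norm_of_real abs_exp_cancel exp_le_one_iff neg_le_0_iff_le)
  qed
  have [measurable]: "\<Phi> g c l (l + j) \<in> borel_measurable M" "\<Theta> g c l (l + j) \<in> borel_measurable M" for l
    using measurable_\<Phi>[OF gm, of l "l + j" c] past_measurable[OF measurable_\<Theta>_past[OF gm, of l "l + j" c]] by auto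
  have "(\<lambda>l. \<integral>\<omega>. indicator (Ev \<delta> l) \<omega> * cmod (\<Phi> g c l (l + j) \<omega> - ?r) \<partial>M) \<longlonglongrightarrow> (\<integral>\<omega>. 0 \<partial>M)"
  proof (rule integral_dominated_convergence[where w = "\<lambda>_. 2"])
    show "AE \<omega> in M. (\<lambda>l. indicator (Ev \<delta> l) \<omega> * cmod (\<Phi> g c l (l + j) \<omega> - ?r)) \<longlonglongrightarrow> 0"
      unfolding vr_def by (rule AE_\<Phi>_limit[OF g v c \<delta>])
    fix l
    have "cmod (\<Phi> g c l (l + j) \<omega> - ?r) \<le> 2" for \<omega>
      using norm_triangle_ineq4[of "\<Phi> g c l (l + j) \<omega>" ?r] \<Phi>_norm_le[of g c l "l + j" \<omega>] r by linarith
    then show "AE \<omega> in M. norm (indicator (Ev \<delta> l) \<omega> * cmod (\<Phi> g c l (l + j) \<omega> - ?r)) \<le> 2" by (auto simp: indicator_def)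
  qed simp_all
  then have lim: "(\<lambda>l. \<integral>\<omega>. indicator (Ev \<delta> l) \<omega> * cmod (\<Phi> g c l (l + j) \<omega> - ?r) \<partial>M) \<longlonglongrightarrow> 0" by simp
  show ?thesis
  proof (rule Lim_null_comparison[OF _ lim], rule always_eventually, rule allI)
    fix l
    let ?I = "\<lambda>\<omega>. indicator (Ev \<delta> l) \<omega> :: complex" and ?T = "\<Theta> g c l (l + j)" and ?F = "\<Phi> g c l (l + j)"
    have nT: "cmod (?T \<omega>) = 1" for \<omega> unfolding \<Theta>_def by (rule cmod_iexp)
    have i1: "integrable M (\<lambda>\<omega>. ?I \<omega> * ?T \<omega> * ?F \<omega>)"
      by (rule integrable_const_bound[where B = 1]) (auto simp: norm_mult nT indicator_def \<Phi>_norm_le)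
    have i2: "integrable M (\<lambda>\<omega>. ?I \<omega> * ?T \<omega>)" by (rule \<Theta>_integrable[OF g]) simp
    have "(\<integral>\<omega>. ?I \<omega> * \<Theta> g c l (l + Suc j) \<omega> \<partial>M) - ?r * (\<integral>\<omega>. ?I \<omega> * ?T \<omega> \<partial>M)
      = (\<integral>\<omega>. ?I \<omega> * ?T \<omega> * ?F \<omega> \<partial>M) - (\<integral>\<omega>. ?r * (?I \<omega> * ?T \<omega>) \<partial>M)"
      using \<Theta>_step[OF g, of l "l + j" \<delta> c] by simp
    also have "\<dots> = (\<integral>\<omega>. ?I \<omega> * ?T \<omega> * ?F \<omega> - ?r * (?I \<omega> * ?T \<omega>) \<partial>M)"
      by (rule Bochner_Integration.integral_diff[symmetric, OF i1 integrable_mult_right[OF i2]])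
    finally have e: "(\<integral>\<omega>. ?I \<omega> * \<Theta> g c l (l + Suc j) \<omega> \<partial>M) - ?r * (\<integral>\<omega>. ?I \<omega> * ?T \<omega> \<partial>M) =
      (\<integral>\<omega>. ?I \<omega> * ?T \<omega> * ?F \<omega> - ?r * (?I \<omega> * ?T \<omega>) \<partial>M)" .
    have "norm ((\<integral>\<omega>. ?I \<omega> * \<Theta> g c l (l + Suc j) \<omega> \<partial>M) - ?r * (\<integral>\<omega>. ?I \<omega> * ?T \<omega> \<partial>M))
      \<le> (\<integral>\<omega>. cmod (?I \<omega> * ?T \<omega> * ?F \<omega> - ?r * (?I \<omega> * ?T \<omega>)) \<partial>M)"
      unfolding e by (rule integral_norm_bound)
    also have "\<dots> = (\<integral>\<omega>. indicator (Ev \<delta> l) \<omega> * cmod (?F \<omega> - ?r) \<partial>M)"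
    proof (intro Bochner_Integration.integral_cong refl)
      fix \<omega>
      have "?I \<omega> * ?T \<omega> * ?F \<omega> - ?r * (?I \<omega> * ?T \<omega>) = ?I \<omega> * ?T \<omega> * (?F \<omega> - ?r)"
      proof -
        have "a * b * d - r * (a * b) = a * b * (d - r)" for a b d r :: complex by (simp add: algebra_simps)
        then show ?thesis .
      qed
      then have "cmod (?I \<omega> * ?T \<omega> * ?F \<omega> - ?r * (?I \<omega> * ?T \<omega>)) = cmod (?I \<omega>) * cmod (?T \<omega>) * cmod (?F \<omega> - ?r)"
        by (simp only: norm_mult)
      then show "cmod (?I \<omega> * ?T \<omega> * ?F \<omega> - ?r * (?I \<omega> * ?T \<omega>)) = indicator (Ev \<delta> l) \<omega> * cmod (?F \<omega> - ?r)"
        unfolding nT by (simp add: indicator_def)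
    qed
    finally show "norm ((\<integral>\<omega>. ?I \<omega> * \<Theta> g c l (l + Suc j) \<omega> \<partial>M) - ?r * (\<integral>\<omega>. ?I \<omega> * ?T \<omega> \<partial>M))
      \<le> (\<integral>\<omega>. indicator (Ev \<delta> l) \<omega> * cmod (?F \<omega> - ?r) \<partial>M)" .
  qed
qed

text \<open>\<open>j\<close> is fixed while \<open>l\<close> grows, so the errors of finitely many
  steps add up to a null sequence; the exponents add up to a geometric sum.\<close>

lemma \<Theta>_telescope:
  assumes g: "score C g v0 v1 v2" and v: "\<And>x. quad v0 v1 v2 x \<ge> 0" and c: "c > 0" and \<delta>: "\<delta> > 0"
  defines "vr \<equiv> v0 + v1 * mu1 P + v2 * mu2 P"
  assumes vr: "vr \<ge> 0"
  shows "(\<lambda>l. (\<integral>\<omega>. indicator (Ev \<delta> l) \<omega> * \<Theta> g c l (l + j) \<omega> \<partial>M)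
     - complex_of_real (exp (- (vr * (\<Sum>i<j. m ^ i) / (2 * c)))) * (\<integral>\<omega>. indicator (Ev \<delta> l) \<omega> * \<Theta> g c l l \<omega> \<partial>M)) \<longlonglongrightarrow> 0"
proof (induction j)
  case (Suc j)
  let ?r = "complex_of_real (exp (- (vr * m ^ j / (2 * c))))" and ?R = "complex_of_real (exp (- (vr * (\<Sum>i<j. m ^ i) / (2 * c))))"
  let ?A = "\<lambda>j l. \<integral>\<omega>. indicator (Ev \<delta> l) \<omega> * \<Theta> g c l (l + j) \<omega> \<partial>M"
  have e: "complex_of_real (exp (- (vr * (\<Sum>i<Suc j. m ^ i) / (2 * c)))) = ?r * ?R"
  proof -
    have "exp (- (vr * (\<Sum>i<Suc j. m ^ i) / (2 * c))) = exp (- (vr * m ^ j / (2 * c))) * exp (- (vr * (\<Sum>i<j. m ^ i) / (2 * c)))"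
      unfolding exp_add[symmetric] by (simp add: distrib_left add_divide_distrib)
    then show ?thesis by simp
  qed
  have "(\<lambda>l. (?A (Suc j) l - ?r * ?A j l) + ?r * (?A j l - ?R * ?A 0 l)) \<longlonglongrightarrow> 0 + ?r * 0"
    using \<Theta>_step_limit[OF g v c \<delta> vr[unfolded vr_def], of j] Suc unfolding vr_def[symmetric]
    by (intro tendsto_add tendsto_mult tendsto_const) auto
  then show ?case unfolding e by (simp add: algebra_simps)
qed simp

text \<open>The pointwise bound \<open>\<bar>y\<bar> \<le> y\<^sup>2 / b + b\<close> stands in for
  Cauchy-Schwarz and costs the factor 2.\<close>

lemma expectation_abs_le:
  fixes Y :: "'a \<Rightarrow> real"
  assumes "integrable M (\<lambda>\<omega>. (Y \<omega>)\<^sup>2)" "Y \<in> borel_measurable M" and le: "(\<integral>\<omega>. (Y \<omega>)\<^sup>2 \<partial>M) \<le> b\<^sup>2" and b: "b > 0"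
  shows "integrable M Y" "(\<integral>\<omega>. \<bar>Y \<omega>\<bar> \<partial>M) \<le> 2 * b"
proof -
  have p: "\<bar>Y \<omega>\<bar> \<le> 1 / b * (Y \<omega>)\<^sup>2 + b" for \<omega>
    using le_mult_square_add_inverse[of "1 / b" "\<bar>Y \<omega>\<bar>"] b by simp
  have i: "integrable M (\<lambda>\<omega>. 1 / b * (Y \<omega>)\<^sup>2 + b)" using assms by simp
  show Y: "integrable M Y"
  proof (rule Bochner_Integration.integrable_bound[OF i assms(2)], rule AE_I2)
    show "norm (Y \<omega>) \<le> norm (1 / b * (Y \<omega>)\<^sup>2 + b)" for \<omega>
      using p[of \<omega>] abs_ge_self[of "1 / b * (Y \<omega>)\<^sup>2 + b"] unfolding real_norm_def by linarith
  qed
  have "(\<integral>\<omega>. \<bar>Y \<omega>\<bar> \<partial>M) \<le> (\<integral>\<omega>. 1 / b * (Y \<omega>)\<^sup>2 + b \<partial>M)" by (intro integral_mono i integrable_abs Y p)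
  also have "\<dots> = 1 / b * (\<integral>\<omega>. (Y \<omega>)\<^sup>2 \<partial>M) + b" using assms(1) by (simp add: prob_space)
  also have "\<dots> \<le> 1 / b * b\<^sup>2 + b" using le b by (intro add_right_mono mult_left_mono) auto
  also have "\<dots> = 2 * b" using b by (simp add: power2_eq_square)
  finally show "(\<integral>\<omega>. \<bar>Y \<omega>\<bar> \<partial>M) \<le> 2 * b" .
qed

lemma Ev_scl_bound:
  assumes "c > 0" "\<delta> > 0" "\<omega> \<in> Ev \<delta> l"
  shows "\<bar>scl c l \<omega>\<bar> \<le> 1 / (sqrt (c * \<delta>) * q ^ l)"
proof -
  have "c * (\<delta> * m ^ l) \<le> c * N1 l \<omega>" using assms by (intro mult_left_mono) (auto simp: Ev_def)
  then have "sqrt (c * \<delta>) * q ^ l \<le> sqrt (c * N1 l \<omega>)"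
    by (simp add: real_sqrt_mult[symmetric] real_sqrt_power[symmetric] mult.assoc)
  moreover have "0 < sqrt (c * \<delta>) * q ^ l" using assms q by simp
  ultimately have "1 / sqrt (c * N1 l \<omega>) \<le> 1 / (sqrt (c * \<delta>) * q ^ l)"
    by (intro frac_le) auto
  moreover have "0 \<le> c * N1 l \<omega>" using assms by (simp add: N1_eq)
  ultimately show ?thesis by (simp add: scl_def)
qed

text \<open>The generations before \<open>l\<close> have size at most \<open>B * q ^ l\<close> in
  mean square, while on \<open>Ev \<delta> l\<close> the norming is of order
  \<open>1 / q ^ l\<close>. The powers cancel and leave a bound uniform in \<open>l\<close>, small
  as soon as \<open>c\<close> is large.\<close>

lemma \<Theta>_early:
  assumes g: "score C g v0 v1 v2"
  shows "\<exists>B>0. \<forall>c>0. \<forall>\<delta>>0. \<forall>l. cmod ((\<integral>\<omega>. indicator (Ev \<delta> l) \<omega> * \<Theta> g c l l \<omega> \<partial>M) - complex_of_real (prob (Ev \<delta> l))) \<le> B / sqrt (c * \<delta>)"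
proof -
  obtain B where B: "B > 0" "\<And>l. integrable M (\<lambda>\<omega>. (\<Sum>k<l. D g k \<omega>)\<^sup>2)" "\<And>l. (\<integral>\<omega>. (\<Sum>k<l. D g k \<omega>)\<^sup>2 \<partial>M) \<le> B\<^sup>2 * m ^ l"
    using D_sum_L2[OF score_mdiff[OF g]] by blast
  note gm = score_measurable[OF g]
  have "cmod ((\<integral>\<omega>. indicator (Ev \<delta> l) \<omega> * \<Theta> g c l l \<omega> \<partial>M) - complex_of_real (prob (Ev \<delta> l))) \<le> 2 * B / sqrt (c * \<delta>)"
    if c: "c > 0" and \<delta>: "\<delta> > 0" for c \<delta> l
  proof -
    let ?I = "\<lambda>\<omega>. indicator (Ev \<delta> l) \<omega> :: complex" and ?Y = "\<lambda>\<omega>. \<Sum>k<l. D g k \<omega>"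
    have mY [measurable]: "?Y \<in> borel_measurable M" using measurable_D[OF gm] by measurable
    have "m ^ l = (q ^ l)\<^sup>2" by (simp only: power2_eq_square power_mult_distrib[symmetric] q(3))
    then have le: "(\<integral>\<omega>. (?Y \<omega>)\<^sup>2 \<partial>M) \<le> (B * q ^ l)\<^sup>2" using B(3)[of l] by (simp add: power_mult_distrib)
    have Bq: "B * q ^ l > 0" using B(1) q by simp
    note Y = expectation_abs_le[OF B(2) mY le Bq]
    have i1: "integrable M (\<lambda>\<omega>. ?I \<omega> * \<Theta> g c l l \<omega>)" by (rule \<Theta>_integrable[OF g]) simp
    have i2: "integrable M ?I" by (intro integrable_const_bound[where B = 1]) (auto simp: indicator_def)
    have "(\<integral>\<omega>. ?I \<omega> \<partial>M) = (\<integral>\<omega>. complex_of_real (indicator (Ev \<delta> l) \<omega>) \<partial>M)"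
      by (intro Bochner_Integration.integral_cong) (auto simp: indicator_def)
    also have "\<dots> = complex_of_real (prob (Ev \<delta> l))" by (subst integral_complex_of_real) simp
    finally have "(\<integral>\<omega>. ?I \<omega> \<partial>M) = complex_of_real (prob (Ev \<delta> l))" .
    then have e: "(\<integral>\<omega>. ?I \<omega> * \<Theta> g c l l \<omega> \<partial>M) - complex_of_real (prob (Ev \<delta> l)) = (\<integral>\<omega>. ?I \<omega> * \<Theta> g c l l \<omega> - ?I \<omega> \<partial>M)"
      unfolding Bochner_Integration.integral_diff[OF i1 i2] by (simp only:)
    have "cmod ((\<integral>\<omega>. ?I \<omega> * \<Theta> g c l l \<omega> \<partial>M) - complex_of_real (prob (Ev \<delta> l))) \<le> (\<integral>\<omega>. cmod (?I \<omega> * \<Theta> g c l l \<omega> - ?I \<omega>) \<partial>M)"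
      unfolding e by (rule integral_norm_bound)
    also have "\<dots> \<le> (\<integral>\<omega>. 1 / (sqrt (c * \<delta>) * q ^ l) * \<bar>?Y \<omega>\<bar> \<partial>M)"
    proof (rule integral_mono)
      show "integrable M (\<lambda>\<omega>. cmod (?I \<omega> * \<Theta> g c l l \<omega> - ?I \<omega>))" using i1 i2 by (intro integrable_norm Bochner_Integration.integrable_diff)
      show "integrable M (\<lambda>\<omega>. 1 / (sqrt (c * \<delta>) * q ^ l) * \<bar>?Y \<omega>\<bar>)" using Y(1) by (intro integrable_mult_right integrable_abs)
      fix \<omega>
      show "cmod (?I \<omega> * \<Theta> g c l l \<omega> - ?I \<omega>) \<le> 1 / (sqrt (c * \<delta>) * q ^ l) * \<bar>?Y \<omega>\<bar>"
      proof (cases "\<omega> \<in> Ev \<delta> l")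
        case True
        then have "cmod (?I \<omega> * \<Theta> g c l l \<omega> - ?I \<omega>) = cmod (iexp (scl c l \<omega> * ?Y \<omega>) - 1)" by (simp add: \<Theta>_def)
        also have "\<dots> \<le> \<bar>scl c l \<omega> * ?Y \<omega>\<bar>" using iexp_approx1[of "scl c l \<omega> * ?Y \<omega>" 0] by simp
        also have "\<dots> \<le> 1 / (sqrt (c * \<delta>) * q ^ l) * \<bar>?Y \<omega>\<bar>"
          unfolding abs_mult by (intro mult_right_mono Ev_scl_bound[OF c \<delta> True]) simp
        finally show ?thesis .
      next
        case False
        then show ?thesis using c \<delta> q by simp
      qed
    qed
    also have "\<dots> \<le> 1 / (sqrt (c * \<delta>) * q ^ l) * (2 * (B * q ^ l))"
      using Y(2) c \<delta> q by (simp only: integral_mult_right_zero) (intro mult_left_mono, auto)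
    also have "\<dots> = 2 * B / sqrt (c * \<delta>)" using q by simp
    finally show ?thesis .
  qed
  then show ?thesis using B(1) by (intro exI[of _ "2 * B"]) auto
qed

text \<open>With this normalisation, \<open>norm_c r * N1 l\<close> is asymptotically the number of living cells of the
  first \<open>l + r\<close> generations when the population survives.\<close>

definition norm_c :: "nat \<Rightarrow> real" where
  "norm_c r = m ^ Suc r / (m - 1)"

lemma norm_c_pos: "norm_c r > 0"
  using m_gt_1 by (simp add: norm_c_def)

text \<open>Order of the limits: \<open>r\<close> is fixed first, large enough to make the early
  generations and the missing part of the variance small; then \<open>l\<close> grows.\<close>

lemma CLT_char:
  assumes g: "score C g v0 v1 v2" and v: "\<And>x. quad v0 v1 v2 x \<ge> 0"
  defines "vr \<equiv> v0 + v1 * mu1 P + v2 * mu2 P"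
  assumes vr: "vr \<ge> 0" and \<delta>: "\<delta> > 0" and \<epsilon>: "\<epsilon> > 0"
  shows "\<forall>\<^sub>F r in sequentially. \<forall>\<^sub>F l in sequentially.
    cmod ((\<integral>\<omega>. indicator (Ev \<delta> l) \<omega> * \<Theta> g (norm_c r) l (l + Suc r) \<omega> \<partial>M) - complex_of_real (exp (- vr / 2) * prob (Ev \<delta> l))) \<le> \<epsilon>"
proof -
  obtain B where B: "B > 0" "\<And>c \<delta> l. c > 0 \<Longrightarrow> \<delta> > 0 \<Longrightarrow>
     cmod ((\<integral>\<omega>. indicator (Ev \<delta> l) \<omega> * \<Theta> g c l l \<omega> \<partial>M) - complex_of_real (prob (Ev \<delta> l))) \<le> B / sqrt (c * \<delta>)"
    using \<Theta>_early[OF g] by blast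
  let ?e = "\<lambda>r. exp (- (vr * (\<Sum>i<Suc r. m ^ i) / (2 * norm_c r)))"
  have mi: "(\<lambda>r. (1 / m) ^ Suc r) \<longlonglongrightarrow> 0" using m_gt_1 by (intro LIMSEQ_Suc LIMSEQ_power_zero) simp
  \<comment> \<open>The share of the variance carried by the generations \<open>l\<close> to
    \<open>l + r\<close>: all but \<open>(1 / m) ^ Suc r\<close>.\<close>
  have er: "?e r = exp (- (vr / 2 * (1 - (1 / m) ^ Suc r)))" for r
  proof -
    have "(\<Sum>i<Suc r. m ^ i) = (m ^ Suc r - 1) / (m - 1)" using m_gt_1 by (intro geometric_sum) simp
    then have "(\<Sum>i<Suc r. m ^ i) / norm_c r = 1 - (1 / m) ^ Suc r"
    proof -
      have "(a - 1) / b / (a / b) = 1 - 1 / a" if "b \<noteq> 0" "a \<noteq> 0" for a b :: real using that by (simp add: field_simps)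
      then show ?thesis
        using m_gt_1 \<open>(\<Sum>i<Suc r. m ^ i) = (m ^ Suc r - 1) / (m - 1)\<close> unfolding norm_c_def power_one_over by (simp add: diff_divide_distrib)
    qed
    then show ?thesis by (simp only: times_divide_times_eq[symmetric])
  qed
  have "(\<lambda>r. exp (- (vr / 2 * (1 - (1 / m) ^ Suc r)))) \<longlonglongrightarrow> exp (- (vr / 2 * (1 - 0)))"
    by (intro tendsto_intros mi)
  then have e: "?e \<longlonglongrightarrow> exp (- vr / 2)" unfolding er by simp
  have b: "(\<lambda>r. B / sqrt (norm_c r * \<delta>)) \<longlonglongrightarrow> 0"
  proof -
    have "B / sqrt (norm_c r * \<delta>) = B * sqrt ((m - 1) / \<delta>) * sqrt ((1 / m) ^ Suc r)" for r
      using m_gt_1 by (simp add: norm_c_def real_sqrt_mult[symmetric] real_sqrt_divide power_divide)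
    moreover have "(\<lambda>r. B * sqrt ((m - 1) / \<delta>) * sqrt ((1 / m) ^ Suc r)) \<longlonglongrightarrow> B * sqrt ((m - 1) / \<delta>) * sqrt 0"
      by (intro tendsto_intros mi)
    ultimately show ?thesis by simp
  qed
  have "\<forall>\<^sub>F r in sequentially. B / sqrt (norm_c r * \<delta>) < \<epsilon> / 3" 
    by (rule order_tendstoD(2)[OF b]) (use \<epsilon> in simp)
  moreover have "\<forall>\<^sub>F r in sequentially. \<bar>?e r - exp (- vr / 2)\<bar> < \<epsilon> / 3"
    unfolding dist_real_def[symmetric] by (rule tendstoD[OF e]) (use \<epsilon> in simp)
  ultimately show ?thesis
  proof eventually_elim
    case (elim r)
    let ?A = "\<lambda>j l. \<integral>\<omega>. indicator (Ev \<delta> l) \<omega> * \<Theta> g (norm_c r) l (l + j) \<omega> \<partial>M"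
    have "\<forall>\<^sub>F l in sequentially. cmod (?A (Suc r) l - complex_of_real (?e r) * ?A 0 l) < \<epsilon> / 3"
      using tendstoD[OF \<Theta>_telescope[OF g v norm_c_pos \<delta> vr[unfolded vr_def], of r "Suc r"], of "\<epsilon> / 3"] \<epsilon> unfolding vr_def[symmetric]
      by (simp add: dist_norm)
    then show ?case
    proof eventually_elim
      case (elim l)
      let ?p = "complex_of_real (prob (Ev \<delta> l))" and ?R = "complex_of_real (?e r)" and ?R' = "complex_of_real (exp (- vr / 2))"
      have R1: "cmod ?R \<le> 1"
      proof -
        have "0 \<le> vr * (\<Sum>i<Suc r. m ^ i) / (2 * norm_c r)" using vr norm_c_pos[of r] by (intro divide_nonneg_nonneg mult_nonneg_nonneg sum_nonneg) auto
        then show ?thesis by (simp only: norm_of_real abs_exp_cancel exp_le_one_iff neg_le_0_iff_le)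
      qed
      \<comment> \<open>Three errors: replacement of the conditional factors, the early generations,
        and the missing variance.\<close>
      have e: "?A (Suc r) l - complex_of_real (exp (- vr / 2) * prob (Ev \<delta> l)) = (?A (Suc r) l - ?R * ?A 0 l) + ?R * (?A 0 l - ?p) + (?R - ?R') * ?p"
      proof -
        have "a - r' * p = (a - r * b) + r * (b - p) + (r - r') * p" for a b p r r' :: complex by (simp add: algebra_simps)
        then show ?thesis by (simp only: of_real_mult)
      qed
      have "cmod (?A (Suc r) l - complex_of_real (exp (- vr / 2) * prob (Ev \<delta> l))) \<le> cmod (?A (Suc r) l - ?R * ?A 0 l) + cmod (?R * (?A 0 l - ?p)) + cmod ((?R - ?R') * ?p)"
        unfolding e by (rule order_trans[OF norm_triangle_ineq add_right_mono[OF norm_triangle_ineq]])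
      also have "\<dots> \<le> \<epsilon> / 3 + \<epsilon> / 3 + \<epsilon> / 3"
      proof (intro add_mono)
        show "cmod (?A (Suc r) l - ?R * ?A 0 l) \<le> \<epsilon> / 3" using elim by simp
        have "cmod (?R * (?A 0 l - ?p)) \<le> 1 * (B / sqrt (norm_c r * \<delta>))"
          unfolding norm_mult using R1 B(2)[OF norm_c_pos \<delta>, of l r] by (intro mult_mono) auto
        then show "cmod (?R * (?A 0 l - ?p)) \<le> \<epsilon> / 3" using \<open>B / sqrt (norm_c r * \<delta>) < \<epsilon> / 3\<close> by linarith
        have "cmod ((?R - ?R') * ?p) = \<bar>?e r - exp (- vr / 2)\<bar> * prob (Ev \<delta> l)"
          unfolding norm_mult of_real_diff[symmetric] norm_of_real by simp
        also have "\<dots> \<le> \<epsilon> / 3 * 1" using \<open>\<bar>?e r - exp (- vr / 2)\<bar> < \<epsilon> / 3\<close> \<epsilon> by (intro mult_mono) auto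
        finally show "cmod ((?R - ?R') * ?p) \<le> \<epsilon> / 3" unfolding mult_1_right .
      qed
      finally show ?case by simp
    qed
  qed
qed

end

section \<open>Convergence of characteristic functions\<close>

text \<open>The real span of the real and imaginary parts of characters. Product formulas make it an
  algebra, as Stone-Weierstrass demands, while linearity transfers the convergence of characteristic
  functions to all of it.\<close>

inductive_set trig :: "('a::euclidean_space \<Rightarrow> real) set" where
  trig_cos: "(\<lambda>x. c * cos (t \<bullet> x)) \<in> trig"
| trig_sin: "(\<lambda>x. c * sin (t \<bullet> x)) \<in> trig"
| trig_add: "f \<in> trig \<Longrightarrow> g \<in> trig \<Longrightarrow> (\<lambda>x. f x + g x) \<in> trig"

lemma trig_const: "(\<lambda>x. c) \<in> trig"
  using trig_cos[of c 0] by simp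

lemma trig_mult_cos:
  assumes "f \<in> trig" shows "(\<lambda>x. f x * (d * cos (s \<bullet> x))) \<in> trig"
  using assms
proof induction
  case (trig_cos c t)
  have "(\<lambda>x. c * cos (t \<bullet> x) * (d * cos (s \<bullet> x))) = (\<lambda>x. (c * d / 2) * cos ((t - s) \<bullet> x) + (c * d / 2) * cos ((t + s) \<bullet> x))"
    by (simp add: inner_diff_left inner_add_left cos_add cos_diff algebra_simps)
  then show ?case by (simp only:) (intro trig.intros)
next
  case (trig_sin c t)
  have "(\<lambda>x. c * sin (t \<bullet> x) * (d * cos (s \<bullet> x))) = (\<lambda>x. (c * d / 2) * sin ((t - s) \<bullet> x) + (c * d / 2) * sin ((t + s) \<bullet> x))"
    by (simp add: inner_diff_left inner_add_left sin_add sin_diff algebra_simps)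
  then show ?case by (simp only:) (intro trig.intros)
next
  case (trig_add f g)
  then show ?case by (simp add: distrib_right trig.trig_add)
qed

lemma trig_mult_sin:
  assumes "f \<in> trig" shows "(\<lambda>x. f x * (d * sin (s \<bullet> x))) \<in> trig"
  using assms
proof induction
  case (trig_cos c t)
  have "(\<lambda>x. c * cos (t \<bullet> x) * (d * sin (s \<bullet> x))) = (\<lambda>x. (c * d / 2) * sin ((s - t) \<bullet> x) + (c * d / 2) * sin ((s + t) \<bullet> x))"
    by (simp add: inner_diff_left inner_add_left sin_add sin_diff algebra_simps)
  then show ?case by (simp only:) (intro trig.intros)
next
  case (trig_sin c t)
  have "(\<lambda>x. c * sin (t \<bullet> x) * (d * sin (s \<bullet> x))) = (\<lambda>x. (c * d / 2) * cos ((t - s) \<bullet> x) + (- c * d / 2) * cos ((t + s) \<bullet> x))"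
    by (simp add: inner_diff_left inner_add_left cos_add cos_diff algebra_simps)
  then show ?case by (simp only:) (intro trig.intros)
next
  case (trig_add f g)
  then show ?case by (simp add: distrib_right trig.trig_add)
qed

lemma trig_mult:
  assumes "f \<in> trig" "g \<in> trig" shows "(\<lambda>x. f x * g x) \<in> trig"
  using assms(2)
proof induction
  case (trig_add g h)
  then show ?case by (simp add: distrib_left trig.trig_add)
qed (use assms(1) in \<open>auto intro: trig_mult_cos trig_mult_sin\<close>)

lemma trig_continuous: "f \<in> trig \<Longrightarrow> continuous_on A f"
  by (induction rule: trig.induct) (auto intro!: continuous_intros)

lemma trig_bounded: "f \<in> trig \<Longrightarrow> \<exists>B. \<forall>x. \<bar>f x\<bar> \<le> B"
proof (induction rule: trig.induct)
  case (trig_cos c t)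
  have "\<bar>c * cos (t \<bullet> x)\<bar> \<le> \<bar>c\<bar>" for x using mult_left_mono[OF abs_cos_le_one, of "\<bar>c\<bar>"] by (simp add: abs_mult)
  then show ?case by blast
next
  case (trig_sin c t)
  have "\<bar>c * sin (t \<bullet> x)\<bar> \<le> \<bar>c\<bar>" for x using mult_left_mono[OF abs_sin_le_one, of "\<bar>c\<bar>"] by (simp add: abs_mult)
  then show ?case by blast
next
  case (trig_add f g)
  then obtain B C where "\<And>x. \<bar>f x\<bar> \<le> B" "\<And>x. \<bar>g x\<bar> \<le> C" by blast
  then have "\<bar>f x + g x\<bar> \<le> B + C" for x using abs_triangle_ineq[of "f x" "g x"] by (meson add_mono order_trans)
  then show ?case by blast
qed

text \<open>Scaling to \<open>u \<bullet> (x - y) = 1\<close> keeps the angle difference inside one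
  period, so equal sine and cosine at both points would give \<open>cos 1 = 1\<close>.\<close>

lemma trig_separates:
  fixes x y :: "'a::euclidean_space"
  assumes "x \<noteq> y" shows "\<exists>f\<in>trig. f x \<noteq> f y"
proof (rule ccontr)
  assume "\<not> ?thesis"
  then have eq: "f x = f y" if "f \<in> trig" for f using that by blast
  define u where "u = (1 / ((x - y) \<bullet> (x - y))) *\<^sub>R (x - y)"
  have "u \<bullet> x - u \<bullet> y = u \<bullet> (x - y)" by (simp add: inner_diff_right)
  also have "\<dots> = 1" using assms by (simp add: u_def)
  finally have u: "u \<bullet> x - u \<bullet> y = 1" .
  have "cos (u \<bullet> x - u \<bullet> y) = cos (u \<bullet> x) * cos (u \<bullet> y) + sin (u \<bullet> x) * sin (u \<bullet> y)" by (rule cos_diff)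
  also have "\<dots> = cos (u \<bullet> y) * cos (u \<bullet> y) + sin (u \<bullet> y) * sin (u \<bullet> y)"
    using eq[OF trig_cos[of 1 u]] eq[OF trig_sin[of 1 u]] by simp
  also have "\<dots> = 1" using sin_cos_squared_add3[of "u \<bullet> y"] by simp
  finally have "cos 1 = (1::real)" unfolding u .
  moreover have "cos 1 < cos (0::real)" using pi_gt3 by (intro cos_monotone_0_pi) auto
  ultimately show False by simp
qed

lemma trig_polynomial:
  fixes p :: "real \<Rightarrow> real"
  assumes "real_polynomial_function p" "f \<in> trig"
  shows "(\<lambda>x. p (f x)) \<in> trig"
  using assms(1)
proof (induction rule: real_polynomial_function.induct)
  case (linear p)
  then have "p y = y * p 1" for y using linear_cmul[OF bounded_linear.linear, of p y 1] by simp
  then have "(\<lambda>x. p (f x)) = (\<lambda>x. f x * p 1)" by (intro HOL.ext)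
  then show ?case using trig_mult[OF assms(2) trig_const] by (simp only:)
qed (auto intro: trig_const trig_mult trig.trig_add)

text \<open>Composing with a polynomial approximation of the truncation at level \<open>B\<close> keeps the global bound
  independent of \<open>K\<close>, which Stone--Weierstrass alone does not.\<close>

lemma trig_approx:
  fixes f :: "'a::euclidean_space \<Rightarrow> real"
  assumes f: "continuous_on K f" "\<And>x. \<bar>f x\<bar> \<le> B" and K: "compact K" and e: "e > 0"
  shows "\<exists>h\<in>trig. (\<forall>x\<in>K. \<bar>f x - h x\<bar> \<le> 2 * e) \<and> (\<forall>x. \<bar>h x\<bar> \<le> B + e)"
proof -
  have B: "B \<ge> 0" using f(2)[of undefined] by linarith
  interpret function_ring_on trig K
    by unfold_locales (use K trig_continuous trig.trig_add trig_mult trig_const trig_separates in auto)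
  obtain T where T: "T \<in> trig" "\<And>x. x \<in> K \<Longrightarrow> \<bar>f x - T x\<bar> < e"
    using Stone_Weierstrass_basic[OF f(1) e] by blast
  obtain C where C: "\<And>x. \<bar>T x\<bar> \<le> C" using trig_bounded[OF T(1)] by blast
  \<comment> \<open>Truncation at level \<open>B\<close> is 1-Lipschitz and fixes the values of
    \<open>f\<close>, so it preserves the closeness of \<open>T\<close> to \<open>f\<close> on
    \<open>K\<close>.\<close>
  define cl where "cl y = max (- B) (min B y)" for y
  have cl: "\<bar>cl y\<bar> \<le> B" "\<bar>cl y - cl z\<bar> \<le> \<bar>y - z\<bar>" "\<bar>y\<bar> \<le> B \<Longrightarrow> cl y = y" for y z
    using B by (auto simp: cl_def max_def min_def)
  have "continuous_on {- C..C} cl" unfolding cl_def by (intro continuous_intros)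
  then obtain p where p: "real_polynomial_function p" "\<And>y. y \<in> {- C..C} \<Longrightarrow> \<bar>cl y - p y\<bar> < e"
    using Stone_Weierstrass_real_polynomial_function[OF compact_Icc _ e] by blast
  have pT: "\<bar>cl (T x) - p (T x)\<bar> < e" for x using C[of x] by (intro p(2)) auto
  have "\<bar>f x - p (T x)\<bar> \<le> 2 * e" if "x \<in> K" for x
    using cl(2)[of "f x" "T x"] pT[of x] T(2)[OF that] unfolding cl(3)[OF f(2)] by linarith
  moreover have "\<bar>p (T x)\<bar> \<le> B + e" for x
    using pT[of x] cl(1)[of "T x"] by linarith
  ultimately show ?thesis by (intro bexI[OF _ trig_polynomial[OF p(1) T(1)]]) simp
qed

text \<open>Trigonometric approximation works on compact sets. The mass outside a cube is controlled
  one coordinate at a time by the one-dimensional continuity theorem, applied to the projections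
  \<open>b \<bullet> Z n\<close>.\<close>

lemma char_convergence_imp_bounded_continuous:
  fixes Z :: "nat \<Rightarrow> 'a \<Rightarrow> 'c::euclidean_space" and Y :: "'b \<Rightarrow> 'c" and f :: "'c \<Rightarrow> real"
  assumes M: "prob_space M" and N: "prob_space N"
    and Z [measurable]: "\<And>n. Z n \<in> borel_measurable M" and Y [measurable]: "Y \<in> borel_measurable N"
    and conv: "\<And>t. (\<lambda>n. \<integral>\<omega>. iexp (t \<bullet> Z n \<omega>) \<partial>M) \<longlonglongrightarrow> (\<integral>\<omega>. iexp (t \<bullet> Y \<omega>) \<partial>N)"
    and f: "continuous_on UNIV f" "bounded (range f)"
  shows "(\<lambda>n. \<integral>\<omega>. f (Z n \<omega>) \<partial>M) \<longlonglongrightarrow> (\<integral>\<omega>. f (Y \<omega>) \<partial>N)"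
proof -
  interpret M: prob_space M by fact
  interpret N: prob_space N by fact
  have trigm: "h \<in> borel_measurable borel" if "h \<in> trig" for h :: "'c \<Rightarrow> real"
    by (rule borel_measurable_continuous_onI[OF trig_continuous[OF that]])
  have trigM: "integrable M (\<lambda>\<omega>. h (Z n \<omega>))" if h: "h \<in> trig" for h :: "'c \<Rightarrow> real" and n
  proof -
    obtain B where "\<And>x. \<bar>h x\<bar> \<le> B" using trig_bounded[OF h] by blast
    then show ?thesis using measurable_compose[OF Z trigm[OF h]] by (intro M.integrable_const_bound[where B = B]) auto
  qed
  have trigN: "integrable N (\<lambda>\<omega>. h (Y \<omega>))" if h: "h \<in> trig" for h :: "'c \<Rightarrow> real"
  proof -
    obtain B where "\<And>x. \<bar>h x\<bar> \<le> B" using trig_bounded[OF h] by blast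
    then show ?thesis using measurable_compose[OF Y trigm[OF h]] by (intro N.integrable_const_bound[where B = B]) auto
  qed
  have iM: "integrable M (\<lambda>\<omega>. iexp (t \<bullet> Z n \<omega>))" for t n
    by (rule M.integrable_const_bound[where B = 1]) auto
  have iN: "integrable N (\<lambda>\<omega>. iexp (t \<bullet> Y \<omega>))" for t
    by (rule N.integrable_const_bound[where B = 1]) auto
  have trig_conv: "(\<lambda>n. \<integral>\<omega>. h (Z n \<omega>) \<partial>M) \<longlonglongrightarrow> (\<integral>\<omega>. h (Y \<omega>) \<partial>N)" if "h \<in> trig" for h
    using that
  proof induction
    case (trig_cos c t)
    have "(\<lambda>n. c * Re (\<integral>\<omega>. iexp (t \<bullet> Z n \<omega>) \<partial>M)) \<longlonglongrightarrow> c * Re (\<integral>\<omega>. iexp (t \<bullet> Y \<omega>) \<partial>N)"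
      by (intro tendsto_intros conv)
    then show ?case by (simp add: integral_Re[OF iM, symmetric] integral_Re[OF iN, symmetric] Re_exp)
  next
    case (trig_sin c t)
    have "(\<lambda>n. c * Im (\<integral>\<omega>. iexp (t \<bullet> Z n \<omega>) \<partial>M)) \<longlonglongrightarrow> c * Im (\<integral>\<omega>. iexp (t \<bullet> Y \<omega>) \<partial>N)"
      by (intro tendsto_intros conv)
    then show ?case by (simp add: integral_Im[OF iM, symmetric] integral_Im[OF iN, symmetric] Im_exp)
  next
    case (trig_add h k)
    then show ?case using trigM[of h] trigM[of k] trigN[of h] trigN[of k] by (simp add: tendsto_add)
  qed
  \<comment> \<open>A continuous tail indicator: 0 on \<open>[- L, L]\<close> and 1 beyond
    \<open>L + 1\<close>, so that weak convergence applies to it directly.\<close>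
  define g where "g L x = min 1 (max 0 (\<bar>x\<bar> - L))" for L x :: real
  have gb: "0 \<le> g L x" "g L x \<le> 1" for L x by (auto simp: g_def)
  have gc: "continuous_on A (g L)" for A L unfolding g_def by (intro continuous_intros)
  have gm [measurable]: "g L \<in> borel_measurable borel" for L by (rule borel_measurable_continuous_onI[OF gc])
  have g_conv: "(\<lambda>n. \<integral>\<omega>. g L (b \<bullet> Z n \<omega>) \<partial>M) \<longlonglongrightarrow> (\<integral>\<omega>. g L (b \<bullet> Y \<omega>) \<partial>N)" for b L
  proof -
    let ?M = "\<lambda>n. distr M borel (\<lambda>\<omega>. b \<bullet> Z n \<omega>)" and ?N = "distr N borel (\<lambda>\<omega>. b \<bullet> Y \<omega>)"
    have rd: "real_distribution (?M n)" "real_distribution ?N" for n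
      by (intro M.real_distribution_distr N.real_distribution_distr; measurable)+
    have "weak_conv_m ?M ?N"
    proof (rule levy_continuity[OF rd])
      fix t
      have "char (?M n) t = (\<integral>\<omega>. iexp ((t *\<^sub>R b) \<bullet> Z n \<omega>) \<partial>M)" for n
        unfolding char_def by (subst integral_distr) auto
      moreover have "char ?N t = (\<integral>\<omega>. iexp ((t *\<^sub>R b) \<bullet> Y \<omega>) \<partial>N)"
        unfolding char_def by (subst integral_distr) auto
      ultimately show "(\<lambda>n. char (?M n) t) \<longlonglongrightarrow> char ?N t" using conv[of "t *\<^sub>R b"] by (simp only:)
    qed
    then have "(\<lambda>n. integral\<^sup>L (?M n) (g L)) \<longlonglongrightarrow> integral\<^sup>L ?N (g L)"
    proof (rule weak_conv_imp_integral_bdd_continuous_conv[OF rd, where B = 1])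
      show "isCont (g L) x" for x using gc[of UNIV L] by (simp add: continuous_on_eq_continuous_at)
      show "norm (g L x) \<le> 1" for x using gb[of L x] by simp
    qed
    then show ?thesis by (simp add: integral_distr)
  qed
  obtain B where B: "\<And>x. \<bar>f x\<bar> \<le> B" using f(2) unfolding bounded_iff by auto
  have B0: "B \<ge> 0" using B[of undefined] by linarith
  have fm [measurable]: "f \<in> borel_measurable borel" by (rule borel_measurable_continuous_onI[OF f(1)])
  show ?thesis
  proof (rule LIMSEQ_I)
    fix r :: real assume r: "r > 0"
    \<comment> \<open>Solves for the final budget: two approximation errors
      \<open>(2 + (2 * B + 1)) * e\<close>, one on each space, plus one \<open>e\<close> for the
      trigonometric integrals. The bound \<open>e \<le> 1\<close> keeps the approximant below
      \<open>B + 1\<close>.\<close>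
    define e where "e = min 1 (r / (2 * (2 + (2 * B + 1)) + 1))"
    have e: "e > 0" "e \<le> 1" "e * (2 * (2 + (2 * B + 1)) + 1) \<le> r"
    proof -
      have d: "2 * (2 + (2 * B + 1)) + 1 > 0" using B0 by simp
      show "e > 0" "e \<le> 1" using r d by (auto simp: e_def)
      have "e \<le> r / (2 * (2 + (2 * B + 1)) + 1)" by (simp add: e_def)
      then show "e * (2 * (2 + (2 * B + 1)) + 1) \<le> r" using d by (simp add: pos_le_divide_eq)
    qed
    let ?G = "\<lambda>L x. \<Sum>b\<in>Basis. g L (b \<bullet> x)"
    have "(\<lambda>k. \<Sum>b\<in>Basis. \<integral>\<omega>. g (real k) (b \<bullet> Y \<omega>) \<partial>N) \<longlonglongrightarrow> (\<Sum>b\<in>(Basis::'c set). \<integral>\<omega>. 0 \<partial>N)"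
    proof (intro tendsto_sum integral_dominated_convergence[where w = "\<lambda>_. 1"] AE_I2)
      fix b :: 'c and \<omega>
      obtain k0 :: nat where "\<bar>b \<bullet> Y \<omega>\<bar> \<le> real k0" using real_arch_simple by blast
      then have "\<forall>\<^sub>F k in sequentially. g (real k) (b \<bullet> Y \<omega>) = 0"
        unfolding eventually_sequentially by (intro exI[of _ k0]) (auto simp: g_def)
      then show "(\<lambda>k. g (real k) (b \<bullet> Y \<omega>)) \<longlonglongrightarrow> 0" by (rule tendsto_eventually)
      show "norm (g (real k) (b \<bullet> Y \<omega>)) \<le> 1" for k using gb[of "real k" "b \<bullet> Y \<omega>"] by simp
    qed simp_all
    then have "(\<lambda>k. \<Sum>b\<in>Basis. \<integral>\<omega>. g (real k) (b \<bullet> Y \<omega>) \<partial>N) \<longlonglongrightarrow> 0" by simp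
    from order_tendstoD(2)[OF this e(1)] obtain k where k: "(\<Sum>b\<in>Basis. \<integral>\<omega>. g (real k) (b \<bullet> Y \<omega>) \<partial>N) < e"
      unfolding eventually_sequentially by blast
    let ?L = "real k"
    \<comment> \<open>Outside this cube some coordinate exceeds \<open>L + 1\<close> in modulus,
      where the tail indicator has already reached 1.\<close>
    define K :: "'c set" where "K = cbox (\<Sum>b\<in>Basis. - (?L + 1) *\<^sub>R b) (\<Sum>b\<in>Basis. (?L + 1) *\<^sub>R b)"
    have Kin: "?G ?L x \<ge> 1" if "x \<notin> K" for x
    proof -
      have "\<exists>b\<in>Basis. \<not> (- (?L + 1) \<le> x \<bullet> b \<and> x \<bullet> b \<le> ?L + 1)"
        using that unfolding K_def mem_box by simp
      then obtain b where b: "b \<in> Basis" "\<bar>b \<bullet> x\<bar> > ?L + 1" unfolding inner_commute[of x] by force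
      then have "1 \<le> g ?L (b \<bullet> x)" by (simp add: g_def)
      also have "\<dots> \<le> ?G ?L x" by (rule member_le_sum[OF b(1)]) (auto simp: gb)
      finally show ?thesis .
    qed
    obtain h where h: "h \<in> trig" "\<And>x. x \<in> K \<Longrightarrow> \<bar>f x - h x\<bar> \<le> 2 * e" "\<And>x. \<bar>h x\<bar> \<le> B + e"
      using trig_approx[OF continuous_on_subset[OF f(1) subset_UNIV] B _ e(1), of K] unfolding K_def by auto
    have G0: "0 \<le> ?G ?L x" for x by (intro sum_nonneg gb)
    have pw: "\<bar>f x - h x\<bar> \<le> 2 * e + (2 * B + 1) * ?G ?L x" for x
    proof (cases "x \<in> K")
      case True
      have "0 \<le> (2 * B + 1) * ?G ?L x" by (intro mult_nonneg_nonneg G0) (use B0 in simp)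
      then show ?thesis using h(2)[OF True] by linarith
    next
      case False
      have "\<bar>f x - h x\<bar> \<le> (2 * B + 1) * 1" using B[of x] h(3)[of x] e(2) by simp
      also have "\<dots> \<le> (2 * B + 1) * ?G ?L x" using Kin[OF False] B0 by (intro mult_left_mono) auto
      finally show ?thesis using e(1) by simp
    qed
    have hm [measurable]: "h \<in> borel_measurable borel" by (rule trigm[OF h(1)])
    have bd: "\<bar>(\<integral>\<omega>. f (W \<omega>) \<partial>R) - (\<integral>\<omega>. h (W \<omega>) \<partial>R)\<bar> \<le> 2 * e + (2 * B + 1) * (\<Sum>b\<in>Basis. \<integral>\<omega>. g ?L (b \<bullet> W \<omega>) \<partial>R)"
      if R: "prob_space R" and W [measurable]: "W \<in> borel_measurable R" for R :: "'d measure" and W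
    proof -
      interpret R: prob_space R by fact
      have i1: "integrable R (\<lambda>\<omega>. f (W \<omega>))" by (rule R.integrable_const_bound[where B = B]) (use B in auto)
      have i2: "integrable R (\<lambda>\<omega>. h (W \<omega>))" by (rule R.integrable_const_bound[where B = "B + e"]) (use h in auto)
      have i3: "integrable R (\<lambda>\<omega>. g ?L (b \<bullet> W \<omega>))" for b by (rule R.integrable_const_bound[where B = 1]) (use gb in auto)
      have "\<bar>(\<integral>\<omega>. f (W \<omega>) \<partial>R) - (\<integral>\<omega>. h (W \<omega>) \<partial>R)\<bar> = \<bar>\<integral>\<omega>. f (W \<omega>) - h (W \<omega>) \<partial>R\<bar>" using i1 i2 by simp
      also have "\<dots> \<le> (\<integral>\<omega>. \<bar>f (W \<omega>) - h (W \<omega>)\<bar> \<partial>R)" by (rule integral_abs_bound)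
      also have "\<dots> \<le> (\<integral>\<omega>. 2 * e + (2 * B + 1) * ?G ?L (W \<omega>) \<partial>R)"
        using i1 i2 i3 pw by (intro integral_mono) auto
      also have "\<dots> = 2 * e + (2 * B + 1) * (\<Sum>b\<in>Basis. \<integral>\<omega>. g ?L (b \<bullet> W \<omega>) \<partial>R)"
        using i3 by (simp add: R.prob_space)
      finally show ?thesis .
    qed
    have "(\<lambda>n. \<Sum>b\<in>Basis. \<integral>\<omega>. g ?L (b \<bullet> Z n \<omega>) \<partial>M) \<longlonglongrightarrow> (\<Sum>b\<in>Basis. \<integral>\<omega>. g ?L (b \<bullet> Y \<omega>) \<partial>N)"
      by (intro tendsto_sum g_conv)
    from order_tendstoD(2)[OF this k] have ev1: "\<forall>\<^sub>F n in sequentially. (\<Sum>b\<in>Basis. \<integral>\<omega>. g ?L (b \<bullet> Z n \<omega>) \<partial>M) < e" .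
    have ev2: "\<forall>\<^sub>F n in sequentially. dist (\<integral>\<omega>. h (Z n \<omega>) \<partial>M) (\<integral>\<omega>. h (Y \<omega>) \<partial>N) < e"
      by (rule tendstoD[OF trig_conv[OF h(1)] e(1)])
    have "\<forall>\<^sub>F n in sequentially. norm ((\<integral>\<omega>. f (Z n \<omega>) \<partial>M) - (\<integral>\<omega>. f (Y \<omega>) \<partial>N)) < r"
      using ev1 ev2
    proof eventually_elim
      case (elim n)
      have "(2 * B + 1) * (\<Sum>b\<in>Basis. \<integral>\<omega>. g ?L (b \<bullet> Z n \<omega>) \<partial>M) \<le> (2 * B + 1) * e"
        "(2 * B + 1) * (\<Sum>b\<in>Basis. \<integral>\<omega>. g ?L (b \<bullet> Y \<omega>) \<partial>N) \<le> (2 * B + 1) * e"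
        using elim(1) k B0 by (auto intro!: mult_left_mono)
      then have "\<bar>(\<integral>\<omega>. f (Z n \<omega>) \<partial>M) - (\<integral>\<omega>. h (Z n \<omega>) \<partial>M)\<bar> \<le> 2 * e + (2 * B + 1) * e"
        "\<bar>(\<integral>\<omega>. f (Y \<omega>) \<partial>N) - (\<integral>\<omega>. h (Y \<omega>) \<partial>N)\<bar> \<le> 2 * e + (2 * B + 1) * e"
        using bd[OF M Z, of n] bd[OF N Y] by linarith+
      then have "\<bar>(\<integral>\<omega>. f (Z n \<omega>) \<partial>M) - (\<integral>\<omega>. f (Y \<omega>) \<partial>N)\<bar> < 2 * (2 * e + (2 * B + 1) * e) + e"
        using elim(2) unfolding dist_real_def mult_2 by linarith
      also have "\<dots> = e * (2 * (2 + (2 * B + 1)) + 1)" by (simp add: algebra_simps)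
      finally show ?case using e(3) by simp
    qed
    then show "\<exists>no. \<forall>n\<ge>no. norm ((\<integral>\<omega>. f (Z n \<omega>) \<partial>M) - (\<integral>\<omega>. f (Y \<omega>) \<partial>N)) < r"
      by (simp add: eventually_sequentially)
  qed
qed

section \<open>The limiting Gaussian vector\<close>

text \<open>In the numeral type \<open>11\<close> the residue 0 is the same element as
  \<open>11\<close>, which serves as the last index.\<close>

lemma UNIV_11: "(UNIV :: 11 set) = {1, 2, 3, 4, 5, 6, 7, 8, 9, 10, 11}"
proof -
  have "x \<in> {1, 2, 3, 4, 5, 6, 7, 8, 9, 10, 11}" for x :: 11
  proof (induct x)
    case (of_int z)
    then have "0 \<le> z" "z < 11" by simp_all
    then have "z = 0 \<or> z = 1 \<or> z = 2 \<or> z = 3 \<or> z = 4 \<or> z = 5 \<or> z = 6 \<or> z = 7 \<or> z = 8 \<or> z = 9 \<or> z = 10" by arith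
    then show ?case by auto
  qed
  then show ?thesis by blast
qed

lemma sum_11: "sum f (UNIV :: 11 set) = f 1 + f 2 + f 3 + f 4 + f 5 + f 6 + f 7 + f 8 + f 9 + f 10 + f 11"
  unfolding UNIV_11 by (simp add: ac_simps)

lemma vector_11:
  fixes a1 a2 a3 a4 a5 a6 a7 a8 a9 a10 a11 :: "'a::zero"
  defines "w \<equiv> (vector [a1, a2, a3, a4, a5, a6, a7, a8, a9, a10, a11] :: 'a ^ 11)"
  shows "w $ 1 = a1" "w $ 2 = a2" "w $ 3 = a3" "w $ 4 = a4" "w $ 5 = a5" "w $ 6 = a6" "w $ 7 = a7" "w $ 8 = a8"
    "w $ 9 = a9" "w $ 10 = a10" "w $ 11 = a11"
  unfolding w_def vector_def by simp_all

lemma inner_11: "(t :: real ^ 11) \<bullet> x = t $ 1 * x $ 1 + t $ 2 * x $ 2 + t $ 3 * x $ 3 + t $ 4 * x $ 4 + t $ 5 * x $ 5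
    + t $ 6 * x $ 6 + t $ 7 * x $ 7 + t $ 8 * x $ 8 + t $ 9 * x $ 9 + t $ 10 * x $ 10 + t $ 11 * x $ 11"
  by (simp add: inner_vec_def sum_11)

lemma mult_vec_11: "((A :: real ^ 11 ^ 11) *v x) $ i = A $ i $ 1 * x $ 1 + A $ i $ 2 * x $ 2 + A $ i $ 3 * x $ 3 + A $ i $ 4 * x $ 4
    + A $ i $ 5 * x $ 5 + A $ i $ 6 * x $ 6 + A $ i $ 7 * x $ 7 + A $ i $ 8 * x $ 8 + A $ i $ 9 * x $ 9 + A $ i $ 10 * x $ 10 + A $ i $ 11 * x $ 11"
  by (simp add: matrix_vector_mult_def sum_11)

text \<open>The quadratic form of the covariance as a sum of squares. The blocks \<open>K\<close>
  are diagonalised by \<open>t $ i - mu1 P * t $ j\<close> and \<open>t $ j\<close>, the correlation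
  \<open>r\<close> by a triangular step. The block \<Gamma> is the variance of a function on the
  four survival patterns that is 0 on the pattern without survivors and has mean
  \<open>\<tau>\<close>.\<close>

definition cov_form :: "bar_params \<Rightarrow> real ^ 11 \<Rightarrow> real" where
  "cov_form P t = (let d = mu2 P - (mu1 P)\<^sup>2; r = rho P; s = (sd P)\<^sup>2 / p_both P;
       u = (sd' P False)\<^sup>2 / p_only P False; v = (sd' P True)\<^sup>2 / p_only P True;
       a = (\<lambda>i j. t $ i - mu1 P * t $ j);
       \<tau> = p_both P * t $ 9 + p_only P False * t $ 10 + p_only P True * t $ 11 in
     s / d * (a 1 2 + r * a 3 4)\<^sup>2 + s * (1 - r\<^sup>2) / d * (a 3 4)\<^sup>2 + s * (t $ 2 + r * t $ 4)\<^sup>2 + s * (1 - r\<^sup>2) * (t $ 4)\<^sup>2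
     + u / d * (a 5 6)\<^sup>2 + u * (t $ 6)\<^sup>2 + v / d * (a 7 8)\<^sup>2 + v * (t $ 8)\<^sup>2
     + p_both P * (t $ 9 - \<tau>)\<^sup>2 + p_only P False * (t $ 10 - \<tau>)\<^sup>2 + p_only P True * (t $ 11 - \<tau>)\<^sup>2
     + (1 - p_both P - p_only P False - p_only P True) * \<tau>\<^sup>2)"

text \<open>Completion of the square with \<open>m2 = d + m1\<^sup>2\<close>, polarised so that it
  also covers the off-diagonal blocks.\<close>

lemma K_form_eq:
  fixes d s m1 m2 a b a' b' :: real
  assumes "d \<noteq> 0" "m2 = d + m1\<^sup>2" "k11 = 1 / d" "k12 = - m1 / d" "k22 = m2 / d"
  shows "c * (k11 * a * a' + k12 * a * b' + k12 * b * a' + k22 * b * b') = c / d * ((a - m1 * b) * (a' - m1 * b')) + c * (b * b')"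
  unfolding assms(2-) using assms(1) by (simp add: field_simps power2_eq_square)

lemma asym_cov_quadratic:
  assumes d: "mu2 P - (mu1 P)\<^sup>2 \<noteq> 0"
  shows "t \<bullet> (asym_cov P *v t) = cov_form P t"
proof -
  define m1 where "m1 = mu1 P"
  define m2 where "m2 = mu2 P"
  define r where "r = rho P"
  define p p0 p1 where "p = p_both P" and "p0 = p_only P False" and "p1 = p_only P True"
  define d where "d = m2 - m1\<^sup>2"
  define s where "s = (sd P)\<^sup>2 / p"
  define u where "u = (sd' P False)\<^sup>2 / p0"
  define v where "v = (sd' P True)\<^sup>2 / p1"
  define k11 k12 k22 where "k11 = 1 / d" and "k12 = - m1 / d" and "k22 = m2 / d"
  have dd: "d \<noteq> 0" "m2 = d + m1\<^sup>2" using d by (simp_all add: d_def m1_def m2_def)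
  note folds = m1_def[symmetric] m2_def[symmetric] r_def[symmetric] p_def[symmetric] p0_def[symmetric] p1_def[symmetric]
     d_def[symmetric] s_def[symmetric] u_def[symmetric] v_def[symmetric]
  note K = K_form_eq[OF dd k11_def k12_def k22_def]
  let ?K = "\<lambda>c a b a' b'. c * (k11 * a * a' + k12 * a * b' + k12 * b * a' + k22 * b * b')"
  obtain t1 t2 t3 t4 t5 t6 t7 t8 t9 t10 t11 where t: "t $ 1 = t1" "t $ 2 = t2" "t $ 3 = t3" "t $ 4 = t4" "t $ 5 = t5" "t $ 6 = t6"
    "t $ 7 = t7" "t $ 8 = t8" "t $ 9 = t9" "t $ 10 = t10" "t $ 11 = t11" by blast
  have "t \<bullet> (asym_cov P *v t) = (?K s t1 t2 t1 t2 + ?K (r * s) t1 t2 t3 t4 + ?K (r * s) t3 t4 t1 t2 + ?K s t3 t4 t3 t4 + ?K u t5 t6 t5 t6 + ?K v t7 t8 t7 t8)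
    + (p * (1 - p) * t9 * t9 - 2 * p0 * p * t9 * t10 - 2 * p1 * p * t9 * t11 + p0 * (1 - p0) * t10 * t10
       - 2 * p0 * p1 * t10 * t11 + p1 * (1 - p1) * t11 * t11)"
    unfolding asym_cov_def Let_def inner_11 mult_vec_11 vector_11 t folds k11_def[symmetric] k12_def[symmetric] k22_def[symmetric]
    by algebra
  also have "\<dots> = (s / d) * ((t1 - m1 * t2) * (t1 - m1 * t2)) + s * (t2 * t2) + 2 * (r * (s / d) * ((t1 - m1 * t2) * (t3 - m1 * t4)) + r * s * (t2 * t4))
     + (s / d) * ((t3 - m1 * t4) * (t3 - m1 * t4)) + s * (t4 * t4) + (u / d) * ((t5 - m1 * t6) * (t5 - m1 * t6)) + u * (t6 * t6)
     + (v / d) * ((t7 - m1 * t8) * (t7 - m1 * t8)) + v * (t8 * t8)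
     + (p * (1 - p) * t9 * t9 - 2 * p0 * p * t9 * t10 - 2 * p1 * p * t9 * t11 + p0 * (1 - p0) * t10 * t10
       - 2 * p0 * p1 * t10 * t11 + p1 * (1 - p1) * t11 * t11)"
    unfolding K times_divide_eq_right[symmetric, of r s d] by algebra
  also have "\<dots> = cov_form P t"
  proof -
    define sd ud vd where "sd = s / d" and "ud = u / d" and "vd = v / d"
    have e: "s * (1 - r\<^sup>2) / d = sd * (1 - r\<^sup>2)" by (simp add: sd_def)
    show ?thesis
      unfolding cov_form_def Let_def t folds e sd_def[symmetric] ud_def[symmetric] vd_def[symmetric] by algebra
  qed
  finally show ?thesis .
qed

lemma transpose_asym_cov: "transpose (asym_cov P) = asym_cov P"
proof -
  have "asym_cov P $ i $ j = asym_cov P $ j $ i" if "i \<in> {1, 2, 3, 4, 5, 6, 7, 8, 9, 10, 11}" "j \<in> {1, 2, 3, 4, 5, 6, 7, 8, 9, 10, 11}" for i j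
    using that unfolding asym_cov_def Let_def
    by (elim insertE emptyE; simp only: vector_11)
  then show ?thesis using UNIV_11 by (simp add: transpose_def vec_eq_iff)
qed

text \<open>The columns of a square root of \<open>asym_cov P\<close>, read off from the sum of squares \<open>cov_form\<close>.\<close>

definition cov_factor :: "bar_params \<Rightarrow> nat \<Rightarrow> real ^ 11" where
  "cov_factor P j = (let d = mu2 P - (mu1 P)\<^sup>2; r = rho P; s = (sd P)\<^sup>2 / p_both P; m1 = mu1 P;
       u = (sd' P False)\<^sup>2 / p_only P False; v = (sd' P True)\<^sup>2 / p_only P True;
       p = p_both P; p0 = p_only P False; p1 = p_only P True in
     [sqrt (s / d) *\<^sub>R vector [1, - m1, r, - (r * m1), 0, 0, 0, 0, 0, 0, 0],
      sqrt (s * (1 - r\<^sup>2) / d) *\<^sub>R vector [0, 0, 1, - m1, 0, 0, 0, 0, 0, 0, 0],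
      sqrt s *\<^sub>R vector [0, 1, 0, r, 0, 0, 0, 0, 0, 0, 0],
      sqrt (s * (1 - r\<^sup>2)) *\<^sub>R vector [0, 0, 0, 1, 0, 0, 0, 0, 0, 0, 0],
      sqrt (u / d) *\<^sub>R vector [0, 0, 0, 0, 1, - m1, 0, 0, 0, 0, 0],
      sqrt u *\<^sub>R vector [0, 0, 0, 0, 0, 1, 0, 0, 0, 0, 0],
      sqrt (v / d) *\<^sub>R vector [0, 0, 0, 0, 0, 0, 1, - m1, 0, 0, 0],
      sqrt v *\<^sub>R vector [0, 0, 0, 0, 0, 0, 0, 1, 0, 0, 0],
      sqrt p *\<^sub>R vector [0, 0, 0, 0, 0, 0, 0, 0, 1 - p, - p0, - p1],
      sqrt p0 *\<^sub>R vector [0, 0, 0, 0, 0, 0, 0, 0, - p, 1 - p0, - p1],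
      sqrt p1 *\<^sub>R vector [0, 0, 0, 0, 0, 0, 0, 0, - p, - p0, 1 - p1],
      sqrt (1 - p - p0 - p1) *\<^sub>R vector [0, 0, 0, 0, 0, 0, 0, 0, p, p0, p1]] ! j)"

text \<open>The twelve squares of \<open>cov_form\<close> match the columns one by one;
  admissibility makes the weights under the roots nonnegative.\<close>

lemma cov_form_factor:
  assumes adm: "admissible P" and d: "mu2 P - (mu1 P)\<^sup>2 > 0"
  shows "cov_form P t = (\<Sum>j<12. (t \<bullet> cov_factor P j)\<^sup>2)"
proof -
  have a: "p_both P \<ge> 0" "p_only P False \<ge> 0" "p_only P True \<ge> 0" "1 - p_both P - p_only P False - p_only P True \<ge> 0"
    using adm by (auto simp: admissible_def)
  have r: "1 - (rho P)\<^sup>2 \<ge> 0" using adm by (auto simp: admissible_def abs_square_le_1 abs_le_iff)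
  have sq: "(t \<bullet> (sqrt c *\<^sub>R w))\<^sup>2 = c * (t \<bullet> w)\<^sup>2" if "c \<ge> 0" for c w
    using that by (simp add: power_mult_distrib)
  have s: "(\<Sum>j<12. f j) = f 0 + f 1 + f 2 + f 3 + f 4 + f 5 + f 6 + f 7 + f 8 + f 9 + f 10 + f (11::nat)" for f :: "nat \<Rightarrow> real"
    by (simp add: eval_nat_numeral)
  have nn: "(sd P)\<^sup>2 / p_both P \<ge> 0" "(sd' P False)\<^sup>2 / p_only P False \<ge> 0" "(sd' P True)\<^sup>2 / p_only P True \<ge> 0"
    "(sd P)\<^sup>2 / p_both P / (mu2 P - (mu1 P)\<^sup>2) \<ge> 0" "(sd' P False)\<^sup>2 / p_only P False / (mu2 P - (mu1 P)\<^sup>2) \<ge> 0"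
    "(sd' P True)\<^sup>2 / p_only P True / (mu2 P - (mu1 P)\<^sup>2) \<ge> 0"
    "(sd P)\<^sup>2 / p_both P * (1 - (rho P)\<^sup>2) \<ge> 0" "(sd P)\<^sup>2 / p_both P * (1 - (rho P)\<^sup>2) / (mu2 P - (mu1 P)\<^sup>2) \<ge> 0"
    using a d r by (auto intro!: divide_nonneg_nonneg mult_nonneg_nonneg)
  have nthl: "[x0, x1, x2, x3, x4, x5, x6, x7, x8, x9, x10, x11] ! 0 = x0" "[x0, x1, x2, x3, x4, x5, x6, x7, x8, x9, x10, x11] ! 1 = x1"
    "[x0, x1, x2, x3, x4, x5, x6, x7, x8, x9, x10, x11] ! 2 = x2" "[x0, x1, x2, x3, x4, x5, x6, x7, x8, x9, x10, x11] ! 3 = x3"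
    "[x0, x1, x2, x3, x4, x5, x6, x7, x8, x9, x10, x11] ! 4 = x4" "[x0, x1, x2, x3, x4, x5, x6, x7, x8, x9, x10, x11] ! 5 = x5"
    "[x0, x1, x2, x3, x4, x5, x6, x7, x8, x9, x10, x11] ! 6 = x6" "[x0, x1, x2, x3, x4, x5, x6, x7, x8, x9, x10, x11] ! 7 = x7"
    "[x0, x1, x2, x3, x4, x5, x6, x7, x8, x9, x10, x11] ! 8 = x8" "[x0, x1, x2, x3, x4, x5, x6, x7, x8, x9, x10, x11] ! 9 = x9"
    "[x0, x1, x2, x3, x4, x5, x6, x7, x8, x9, x10, x11] ! 10 = x10" "[x0, x1, x2, x3, x4, x5, x6, x7, x8, x9, x10, x11] ! 11 = x11"
    for x0 x1 x2 x3 x4 x5 x6 x7 x8 x9 x10 x11 :: "real ^ 11" by simp_all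
  have inn: "t \<bullet> vector [1, - m1, r, - (r * m1), 0, 0, 0, 0, 0, 0, 0] = (t $ 1 - m1 * t $ 2) + r * (t $ 3 - m1 * t $ 4)"
    "t \<bullet> vector [0, 0, 1, - m1, 0, 0, 0, 0, 0, 0, 0] = t $ 3 - m1 * t $ 4"
    "t \<bullet> vector [0, 1, 0, r, 0, 0, 0, 0, 0, 0, 0] = t $ 2 + r * t $ 4"
    "t \<bullet> vector [0, 0, 0, 1, 0, 0, 0, 0, 0, 0, 0] = t $ 4"
    "t \<bullet> vector [0, 0, 0, 0, 1, - m1, 0, 0, 0, 0, 0] = t $ 5 - m1 * t $ 6"
    "t \<bullet> vector [0, 0, 0, 0, 0, 1, 0, 0, 0, 0, 0] = t $ 6"
    "t \<bullet> vector [0, 0, 0, 0, 0, 0, 1, - m1, 0, 0, 0] = t $ 7 - m1 * t $ 8"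
    "t \<bullet> vector [0, 0, 0, 0, 0, 0, 0, 1, 0, 0, 0] = t $ 8"
    "t \<bullet> vector [0, 0, 0, 0, 0, 0, 0, 0, 1 - p, - p0, - p1] = t $ 9 - (p * t $ 9 + p0 * t $ 10 + p1 * t $ 11)"
    "t \<bullet> vector [0, 0, 0, 0, 0, 0, 0, 0, - p, 1 - p0, - p1] = t $ 10 - (p * t $ 9 + p0 * t $ 10 + p1 * t $ 11)"
    "t \<bullet> vector [0, 0, 0, 0, 0, 0, 0, 0, - p, - p0, 1 - p1] = t $ 11 - (p * t $ 9 + p0 * t $ 10 + p1 * t $ 11)" for m1 r p p0 p1 :: real
    unfolding inner_11 vector_11 by (simp_all add: algebra_simps)
  have inn': "t \<bullet> vector [0, 0, 0, 0, 0, 0, 0, 0, p, p0, p1] = p * t $ 9 + p0 * t $ 10 + p1 * t $ 11" for p p0 p1 :: real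
    unfolding inner_11 vector_11 by (simp add: algebra_simps)
  show ?thesis
    unfolding s cov_factor_def Let_def nthl sq[OF nn(1)] sq[OF nn(2)] sq[OF nn(3)] sq[OF nn(4)] sq[OF nn(5)] sq[OF nn(6)] sq[OF nn(7)]
      sq[OF nn(8)] sq[OF a(1)] sq[OF a(2)] sq[OF a(3)] sq[OF a(4)] inn
    unfolding inn' cov_form_def Let_def ..
qed

text \<open>The law of a linear image of i.i.d. normals. It exists for singular covariances too,
  which occur when the survival probabilities add up to 1.\<close>

definition gauss_law :: "nat \<Rightarrow> (nat \<Rightarrow> real ^ 'n) \<Rightarrow> (real ^ 'n) measure" where
  "gauss_law K v = distr (PiM {..<K} (\<lambda>_. std_normal_distribution)) borel (\<lambda>\<xi>. \<Sum>j<K. \<xi> j *\<^sub>R v j)"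

lemma measurable_gauss_law:
  fixes v :: "nat \<Rightarrow> real ^ 'n"
  shows "(\<lambda>\<xi>. \<Sum>j<K. \<xi> j *\<^sub>R v j) \<in> borel_measurable (PiM {..<K} (\<lambda>_. std_normal_distribution))"
proof (intro borel_measurable_sum)
  fix j assume [measurable]: "j \<in> {..<K}"
  show "(\<lambda>\<xi>. \<xi> j *\<^sub>R v j) \<in> borel_measurable (PiM {..<K} (\<lambda>_. std_normal_distribution))" by measurable
qed

lemma sets_gauss_law [measurable_cong, simp]: "sets (gauss_law K v) = sets borel"
  by (simp add: gauss_law_def)

lemma prob_space_gauss_law: "prob_space (gauss_law K v)"
  unfolding gauss_law_def
  by (intro prob_space.prob_space_distr measurable_gauss_law prob_space_PiM prob_space_std_normal)

lemma char_gauss_law: "(\<integral>x. iexp (t \<bullet> x) \<partial>gauss_law K v) = complex_of_real (exp (- (\<Sum>j<K. (t \<bullet> v j)\<^sup>2) / 2))"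
proof -
  interpret S: prob_space std_normal_distribution by (rule prob_space_std_normal)
  interpret PS: product_prob_space "\<lambda>_::nat. std_normal_distribution" "{..<K}" ..
  have i: "integrable std_normal_distribution (\<lambda>x. iexp ((t \<bullet> v j) * x))" for j
    by (rule S.integrable_iexp[OF _ Im_complex_of_real]) simp
  have "(\<integral>x. iexp (t \<bullet> x) \<partial>gauss_law K v) = (\<integral>\<xi>. iexp (t \<bullet> (\<Sum>j<K. \<xi> j *\<^sub>R v j)) \<partial>PiM {..<K} (\<lambda>_. std_normal_distribution))"
    unfolding gauss_law_def by (rule integral_distr[OF measurable_gauss_law]) measurable
  also have "\<dots> = (\<integral>\<xi>. (\<Prod>j<K. iexp ((t \<bullet> v j) * \<xi> j)) \<partial>PiM {..<K} (\<lambda>_. std_normal_distribution))"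
    by (intro Bochner_Integration.integral_cong refl)
      (simp add: exp_sum[symmetric] inner_sum_right sum_distrib_left mult.commute mult.left_commute)
  also have "\<dots> = (\<Prod>j<K. \<integral>x. iexp ((t \<bullet> v j) * x) \<partial>std_normal_distribution)"
    by (rule PS.product_integral_prod[OF finite_lessThan i])
  also have "\<dots> = (\<Prod>j<K. complex_of_real (exp (- ((t \<bullet> v j)\<^sup>2) / 2)))"
    using char_std_normal_distribution unfolding char_def fun_eq_iff by (simp only:)
  also have "\<dots> = complex_of_real (exp (- (\<Sum>j<K. (t \<bullet> v j)\<^sup>2) / 2))"
    by (simp only: of_real_prod[symmetric] exp_sum[symmetric, OF finite_lessThan]) (simp add: sum_negf sum_divide_distrib)
  finally show ?thesis .
qed

lemma char_centered_normal:
  assumes "s > 0"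
  shows "char (centered_normal s) x = complex_of_real (exp (- (x * s)\<^sup>2 / 2))"
proof -
  interpret S: prob_space std_normal_distribution by (rule prob_space_std_normal)
  have "distr gauss2 std_normal_distribution fst = std_normal_distribution"
    by (rule prob_space.distr_pair_fst[OF prob_space_std_normal])
  have "char (centered_normal s) x = (\<integral>z. iexp (x * (s * fst z)) \<partial>gauss2)"
    unfolding centered_normal_eq_distr[OF assms] char_def by (subst integral_distr) auto
  also have "\<dots> = (\<integral>y. iexp ((x * s) * y) \<partial>distr gauss2 std_normal_distribution fst)"
    by (subst integral_distr) (auto simp: mult.assoc)
  also have "\<dots> = char std_normal_distribution (x * s)"
    unfolding prob_space.distr_pair_fst[OF prob_space_std_normal] char_def ..
  finally show ?thesis by (simp only: char_std_normal_distribution)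
qed

text \<open>Both laws have the same characteristic function, and the positive variance makes the
  right side a density.\<close>

lemma gauss_law_linear:
  assumes "(\<Sum>j<K. (t \<bullet> v j)\<^sup>2) > 0"
  shows "distr (gauss_law K v) borel (\<lambda>x. t \<bullet> x) = centered_normal (sqrt (\<Sum>j<K. (t \<bullet> v j)\<^sup>2))"
proof (rule Levy_uniqueness)
  interpret G: prob_space "gauss_law K v" by (rule prob_space_gauss_law)
  show "real_distribution (distr (gauss_law K v) borel (\<lambda>x. t \<bullet> x))"
    by (rule G.real_distribution_distr) measurable
  show "real_distribution (centered_normal (sqrt (\<Sum>j<K. (t \<bullet> v j)\<^sup>2)))"
    unfolding real_distribution_def real_distribution_axioms_def using assms by (auto intro: prob_space_normal_density)
  show "char (distr (gauss_law K v) borel (\<lambda>x. t \<bullet> x)) = char (centered_normal (sqrt (\<Sum>j<K. (t \<bullet> v j)\<^sup>2)))"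
  proof
    fix x
    have "char (distr (gauss_law K v) borel (\<lambda>x. t \<bullet> x)) x = (\<integral>y. iexp ((x *\<^sub>R t) \<bullet> y) \<partial>gauss_law K v)"
      unfolding char_def by (subst integral_distr) auto
    also have "\<dots> = complex_of_real (exp (- (x * sqrt (\<Sum>j<K. (t \<bullet> v j)\<^sup>2))\<^sup>2 / 2))"
      unfolding char_gauss_law using assms by (simp add: power_mult_distrib sum_distrib_left less_imp_le)
    also have "\<dots> = char (centered_normal (sqrt (\<Sum>j<K. (t \<bullet> v j)\<^sup>2))) x"
      using assms by (subst char_centered_normal) auto
    finally show "char (distr (gauss_law K v) borel (\<lambda>x. t \<bullet> x)) x = char (centered_normal (sqrt (\<Sum>j<K. (t \<bullet> v j)\<^sup>2))) x" .
  qed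
qed

lemma distr_pair_snd:
  assumes "prob_space M" "prob_space N" shows "distr (M \<Otimes>\<^sub>M N) N snd = N"
proof -
  interpret M: prob_space M by fact
  interpret N: prob_space N by fact
  interpret MN: pair_prob_space M N ..
  show ?thesis
  proof (rule measure_eqI)
    fix A assume "A \<in> sets (distr (M \<Otimes>\<^sub>M N) N snd)"
    then have A: "A \<in> sets N" by simp
    have "emeasure (distr (M \<Otimes>\<^sub>M N) N snd) A = emeasure (M \<Otimes>\<^sub>M N) (space M \<times> A)"
      using A sets.sets_into_space[OF A] by (auto simp: emeasure_distr space_pair_measure intro!: arg_cong[where f = "emeasure (M \<Otimes>\<^sub>M N)"])
    then show "emeasure (distr (M \<Otimes>\<^sub>M N) N snd) A = emeasure N A"
      using A by (simp add: N.emeasure_pair_measure_Times M.emeasure_space_1)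
  qed simp
qed

text \<open>On a product space the second projection is independent of everything read through the
  first. Given the first coordinate, the characteristic function is 1 where \<open>W = 0\<close> and
  Gaussian elsewhere, which yields the mixture in the last claim.\<close>

lemma gaussian_extension:
  fixes M :: "'a measure" and v :: "nat \<Rightarrow> real ^ 'n" and W :: "'a \<Rightarrow> real"
  assumes M: "prob_space M" and W [measurable]: "W \<in> borel_measurable M" and S: "transpose S = S" "\<And>t. t \<bullet> (S *v t) = (\<Sum>j<K. (t \<bullet> v j)\<^sup>2)"
  defines "N \<equiv> M \<Otimes>\<^sub>M gauss_law K v"
  shows "prob_extension M N" "independent_rvs N (\<lambda>\<omega>. W (fst \<omega>)) snd" "gaussian_vector N snd S"
    and "(\<lambda>\<omega>. of_bool (W (fst \<omega>) \<noteq> 0) *\<^sub>R snd \<omega>) \<in> borel_measurable N"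
    and "(\<integral>\<omega>. iexp (t \<bullet> (of_bool (W (fst \<omega>) \<noteq> 0) *\<^sub>R snd \<omega>)) \<partial>N) =
      complex_of_real (measure M {\<omega>\<in>space M. W \<omega> = 0} + measure M {\<omega>\<in>space M. W \<omega> \<noteq> 0} * exp (- (t \<bullet> (S *v t)) / 2))"
proof -
  let ?G = "gauss_law K v"
  interpret M: prob_space M by fact
  interpret G: prob_space ?G by (rule prob_space_gauss_law)
  interpret MG: pair_prob_space M ?G ..
  interpret N: prob_space N unfolding N_def by (rule MG.prob_space_axioms)
  have fstN [measurable]: "fst \<in> measurable N M" and sndN: "snd \<in> measurable N ?G" by (auto simp: N_def)
  have sndB [measurable]: "snd \<in> borel_measurable N" using sndN by (simp cong: measurable_cong_sets)
  have spN: "space N = space M \<times> space ?G" by (simp add: N_def space_pair_measure)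
  have "distr N M fst = M" unfolding N_def by (rule prob_space.distr_pair_fst[OF prob_space_gauss_law])
  then show "prob_extension M N" by (simp add: prob_extension_def N.prob_space_axioms)
  show "independent_rvs N (\<lambda>\<omega>. W (fst \<omega>)) snd"
    unfolding independent_rvs_def N.indep_sets2_eq
  proof (intro conjI ballI)
    fix a b assume "a \<in> {(\<lambda>\<omega>. W (fst \<omega>)) -` A \<inter> space N |A. A \<in> sets borel}" "b \<in> {snd -` B \<inter> space N |B. B \<in> sets borel}"
    then obtain A B where A: "a = (\<lambda>\<omega>. W (fst \<omega>)) -` A \<inter> space N" "A \<in> sets borel" and B: "b = snd -` B \<inter> space N" "B \<in> sets borel"
      by blast
    let ?A = "W -` A \<inter> space M" and ?B = "B \<inter> space ?G"
    have sets: "?A \<in> sets M" "?B \<in> sets ?G" using A B measurable_sets[OF W] by auto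
    have e: "a = ?A \<times> space ?G" "b = space M \<times> ?B" "a \<inter> b = ?A \<times> ?B" unfolding A(1) B(1) spN by auto
    show "N.prob (a \<inter> b) = N.prob a * N.prob b"
      unfolding e(3) unfolding e(1,2) N_def using sets
      by (simp add: measure_def G.emeasure_pair_measure_Times enn2real_mult M.emeasure_space_1 G.emeasure_space_1 del: sets_gauss_law)
  qed (auto intro!: measurable_sets)
  show "gaussian_vector N snd S"
    unfolding gaussian_vector_def Let_def
  proof (intro conjI allI)
    fix t
    show "t \<bullet> (S *v t) = 0 \<and> (AE \<omega> in N. t \<bullet> snd \<omega> = 0) \<or>
         0 < t \<bullet> (S *v t) \<and> distributed N lborel (\<lambda>\<omega>. t \<bullet> snd \<omega>) (normal_density 0 (sqrt (t \<bullet> (S *v t))))"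
    proof (cases "t \<bullet> (S *v t) = 0")
      \<comment> \<open>A vanishing variance makes \<open>t\<close> orthogonal to every column, so
        the projection is 0 at every value of the generating normals.\<close>
      case True
      then have "t \<bullet> v j = 0" if "j < K" for j
        using that unfolding S(2) by (subst (asm) sum_nonneg_eq_0_iff) auto
      then have 0: "t \<bullet> (\<Sum>j<K. \<xi> j *\<^sub>R v j) = 0" for \<xi> by (simp add: inner_sum_right)
      have "AE x in ?G. t \<bullet> x = 0"
        unfolding gauss_law_def by (subst AE_distr_iff[OF measurable_gauss_law]) (auto simp: 0)
      then have "AE x in distr N ?G snd. t \<bullet> x = 0"
        unfolding N_def distr_pair_snd[OF M prob_space_gauss_law] .
      then have "AE \<omega> in N. t \<bullet> snd \<omega> = 0" by (subst (asm) AE_distr_iff[OF sndN]) auto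
      with True show ?thesis by simp
    next
      case False
      then have pos: "(\<Sum>j<K. (t \<bullet> v j)\<^sup>2) > 0" unfolding S(2) by (simp add: sum_nonneg less_le)
      have "distr N lborel (\<lambda>\<omega>. t \<bullet> snd \<omega>) = distr N borel (\<lambda>\<omega>. t \<bullet> snd \<omega>)" by (rule distr_cong) auto
      also have "\<dots> = distr (distr N ?G snd) borel (\<lambda>x. t \<bullet> x)" by (subst distr_distr[OF _ sndN]) (auto simp: comp_def)
      also have "\<dots> = centered_normal (sqrt (\<Sum>j<K. (t \<bullet> v j)\<^sup>2))"
        unfolding N_def distr_pair_snd[OF M prob_space_gauss_law] by (rule gauss_law_linear[OF pos])
      finally show ?thesis using pos by (simp add: distributed_def S(2))
    qed
  qed (use S in auto)
  show m: "(\<lambda>\<omega>. of_bool (W (fst \<omega>) \<noteq> 0) *\<^sub>R snd \<omega>) \<in> borel_measurable N" by measurable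
  let ?e = "complex_of_real (exp (- (t \<bullet> (S *v t)) / 2))"
  let ?f = "\<lambda>\<omega>. iexp (t \<bullet> (of_bool (W (fst \<omega>) \<noteq> 0) *\<^sub>R snd \<omega>))"
  have i: "integrable N ?f"
  proof (rule N.integrable_iexp[OF _ Im_complex_of_real])
    show "(\<lambda>\<omega>. complex_of_real (t \<bullet> (of_bool (W (fst \<omega>) \<noteq> 0) *\<^sub>R snd \<omega>))) \<in> borel_measurable N" using m by measurable
  qed
  have "(\<integral>\<omega>. ?f \<omega> \<partial>N) = (\<integral>\<omega>. \<integral>x. ?f (\<omega>, x) \<partial>?G \<partial>M)"
    using i unfolding N_def by (rule MG.integral_fst'[symmetric])
  also have "\<dots> = (\<integral>\<omega>. complex_of_real (indicator {\<omega>\<in>space M. W \<omega> = 0} \<omega> + indicator {\<omega>\<in>space M. W \<omega> \<noteq> 0} \<omega> * exp (- (t \<bullet> (S *v t)) / 2)) \<partial>M)"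
  proof (intro Bochner_Integration.integral_cong refl)
    fix \<omega> assume w: "\<omega> \<in> space M"
    show "(\<integral>x. ?f (\<omega>, x) \<partial>?G) = complex_of_real (indicator {\<omega>\<in>space M. W \<omega> = 0} \<omega> + indicator {\<omega>\<in>space M. W \<omega> \<noteq> 0} \<omega> * exp (- (t \<bullet> (S *v t)) / 2))"
    proof (cases "W \<omega> = 0")
      case True then show ?thesis using w by (simp add: G.prob_space)
    next
      case False
      then have "(\<integral>x. ?f (\<omega>, x) \<partial>?G) = ?e" using char_gauss_law[where t = t and K = K and v = v] S(2)[of t] by simp
      then show ?thesis using w False by simp
    qed
  qed
  also have "\<dots> = complex_of_real (\<integral>\<omega>. indicator {\<omega>\<in>space M. W \<omega> = 0} \<omega> + indicator {\<omega>\<in>space M. W \<omega> \<noteq> 0} \<omega> * exp (- (t \<bullet> (S *v t)) / 2) \<partial>M)"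
    by (rule integral_complex_of_real)
  also have "(\<integral>\<omega>. indicator {\<omega>\<in>space M. W \<omega> = 0} \<omega> + indicator {\<omega>\<in>space M. W \<omega> \<noteq> 0} \<omega> * exp (- (t \<bullet> (S *v t)) / 2) \<partial>M)
    = measure M {\<omega>\<in>space M. W \<omega> = 0} + measure M {\<omega>\<in>space M. W \<omega> \<noteq> 0} * exp (- (t \<bullet> (S *v t)) / 2)"
    by (subst Bochner_Integration.integral_add) (auto simp: M.emeasure_eq_measure intro!: integrable_mult_left integrable_real_indicator)
  finally show "(\<integral>\<omega>. ?f \<omega> \<partial>N) = complex_of_real (measure M {\<omega>\<in>space M. W \<omega> = 0} + measure M {\<omega>\<in>space M. W \<omega> \<noteq> 0} * exp (- (t \<bullet> (S *v t)) / 2))" .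
qed

section \<open>Scores and the linearised estimators\<close>

text \<open>Recovers the survival pattern from the observed daughters; see
  \<open>alive_pair_offspring\<close>.\<close>

definition alive_pair :: "real option \<times> real option \<Rightarrow> bool \<times> bool" where
  "alive_pair v = (fst v \<noteq> None, snd v \<noteq> None)"

lemma measurable_alive_pair: "alive_pair \<in> measurable (Sbar \<Otimes>\<^sub>M Sbar) (count_space UNIV)"
proof -
  have [measurable]: "Measurable.pred (Sbar \<Otimes>\<^sub>M Sbar) (\<lambda>v. fst v = None)" "Measurable.pred (Sbar \<Otimes>\<^sub>M Sbar) (\<lambda>v. snd v = None)"
    by (rule measurable_compose[OF measurable_fst measurable_is_None] measurable_compose[OF measurable_snd measurable_is_None])+
  have "Measurable.pred (Sbar \<Otimes>\<^sub>M Sbar) (\<lambda>v. alive_pair v = c)" for c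
    unfolding alive_pair_def prod_eq_iff fst_conv snd_conv by measurable
  then show ?thesis
    by (subst measurable_count_space_eq2) (auto simp: space_pair_measure vimage_def pred_def Int_def)
qed

lemma measurable_alive_pair_fun [measurable]: "(\<lambda>v. h (alive_pair v)) \<in> borel_measurable (Sbar \<Otimes>\<^sub>M Sbar)" for h :: "bool \<times> bool \<Rightarrow> real"
  by (rule measurable_compose[OF measurable_alive_pair]) simp

context bar_super
begin

text \<open>The Gaussian innovation of a daughter, recovered with the true parameters. At a dead
  daughter the value is junk, hence the factors \<open>survives\<close> wherever it is
  summed.\<close>

definition residual :: "real \<Rightarrow> real option \<times> real option \<Rightarrow> bool \<Rightarrow> real" where
  "residual x v \<delta> = cell_val (if \<delta> then snd v else fst v) - slope P (alive_pair v) \<delta> * x - icpt P (alive_pair v) \<delta>"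

text \<open>The general form of a linearised estimation error: \<open>u\<close> and \<open>w\<close>
  weight the residuals and their products with \<open>x\<close>, and \<open>k\<close> weights the
  survival patterns. One family for all eleven coordinates leaves a single scalar limit theorem to
  apply.\<close>

definition score_fun :: "(bool \<times> bool \<Rightarrow> bool \<Rightarrow> real) \<Rightarrow> (bool \<times> bool \<Rightarrow> bool \<Rightarrow> real) \<Rightarrow> (bool \<times> bool \<Rightarrow> real) \<Rightarrow>
    real \<Rightarrow> real option \<times> real option \<Rightarrow> real" where
  "score_fun u w k x v = (\<Sum>\<delta>\<in>UNIV. of_bool (survives (alive_pair v) \<delta>) * (u (alive_pair v) \<delta> + w (alive_pair v) \<delta> * x) * residual x v \<delta>) + k (alive_pair v)"

lemma measurable_residual: "(\<lambda>(x, v). residual x v \<delta>) \<in> borel_measurable (borel \<Otimes>\<^sub>M (Sbar \<Otimes>\<^sub>M Sbar))"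
proof -
  have [measurable]: "(\<lambda>v. slope P (alive_pair v) \<delta>) \<in> borel_measurable (Sbar \<Otimes>\<^sub>M Sbar)" "(\<lambda>v. icpt P (alive_pair v) \<delta>) \<in> borel_measurable (Sbar \<Otimes>\<^sub>M Sbar)"
    by (rule measurable_alive_pair_fun)+
  show ?thesis unfolding residual_def by (cases \<delta>) (simp_all, measurable)
qed

lemma measurable_score_fun: "(\<lambda>(x, v). score_fun u w k x v) \<in> borel_measurable (borel \<Otimes>\<^sub>M (Sbar \<Otimes>\<^sub>M Sbar))"
proof -
  have h: "(\<lambda>y. h (alive_pair (snd y))) \<in> borel_measurable (borel \<Otimes>\<^sub>M (Sbar \<Otimes>\<^sub>M Sbar))" for h :: "bool \<times> bool \<Rightarrow> real"
    by (rule measurable_compose[OF measurable_snd measurable_alive_pair_fun])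
  show ?thesis
    unfolding score_fun_def split_beta'
    by (intro borel_measurable_add borel_measurable_sum borel_measurable_times h measurable_fst measurable_residual[unfolded split_beta']
      h[of "\<lambda>c. of_bool (survives c _)"] h[of "\<lambda>c. u c _"] h[of "\<lambda>c. w c _"])
qed

lemma alive_pair_offspring: "alive_pair (offspring P (Some x) (b, z)) = b"
  by (auto simp: alive_pair_def offspring_def daughter_None_iff survives_def prod_eq_iff)

lemma residual_offspring: "survives b \<delta> \<Longrightarrow> residual x (offspring P (Some x) (b, z)) \<delta> = eps P b z \<delta>"
  unfolding residual_def alive_pair_offspring by (cases \<delta>) (simp_all add: offspring_def daughter_def cell_val_def)

text \<open>Coefficient of the first normal in a weighted sum of residuals, \<open>lin2\<close>
  being that of the second; the correlation \<open>rho P\<close> is absorbed here.\<close>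

definition lin1 :: "(bool \<times> bool \<Rightarrow> bool \<Rightarrow> real) \<Rightarrow> bool \<times> bool \<Rightarrow> real" where
  "lin1 u b = (\<Sum>\<delta>\<in>UNIV. of_bool (survives b \<delta>) * u b \<delta> * eps1 P b \<delta>)"

definition lin2 :: "(bool \<times> bool \<Rightarrow> bool \<Rightarrow> real) \<Rightarrow> bool \<times> bool \<Rightarrow> real" where
  "lin2 u b = (\<Sum>\<delta>\<in>UNIV. of_bool (survives b \<delta>) * u b \<delta> * eps2 P b \<delta>)"

lemma score_fun_offspring: "score_fun u w k x (offspring P (Some x) (b, z)) = k b + (lin1 u b + lin1 w b * x) * fst z + (lin2 u b + lin2 w b * x) * snd z"
proof -
  have "score_fun u w k x (offspring P (Some x) (b, z)) = (\<Sum>\<delta>\<in>UNIV. of_bool (survives b \<delta>) * (u b \<delta> + w b \<delta> * x) * eps P b z \<delta>) + k b"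
    unfolding score_fun_def alive_pair_offspring by (intro arg_cong2[where f = "(+)"] sum.cong refl) (auto simp: residual_offspring)
  also have "\<dots> = k b + (lin1 u b + lin1 w b * x) * fst z + (lin2 u b + lin2 w b * x) * snd z"
    unfolding eps_eq lin1_def lin2_def by (simp add: UNIV_bool algebra_simps)
  finally show ?thesis .
qed

text \<open>Given the pattern, the score is affine in two independent normals, so its second moment
  is the sum of the squares of its coefficients. The last claim evaluates the quadratic at a first
  moment \<open>y\<close> and a second moment \<open>z\<close>, separating the value at the mean
  from the variance \<open>z - y\<^sup>2\<close>.\<close>

lemma score_fun_score:
  assumes k: "(\<Sum>b\<in>UNIV. pmf (surv_pmf P) b * k b) = 0"
  obtains C v0 v1 v2 where "score C (score_fun u w k) v0 v1 v2"
    and "\<And>x. quad v0 v1 v2 x = (\<Sum>b\<in>UNIV. pmf (surv_pmf P) b * ((k b)\<^sup>2 + (lin1 u b + lin1 w b * x)\<^sup>2 + (lin2 u b + lin2 w b * x)\<^sup>2))"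
    and "\<And>y z. v0 + v1 * y + v2 * z = (\<Sum>b\<in>UNIV. pmf (surv_pmf P) b * ((k b)\<^sup>2 + (lin1 u b + lin1 w b * y)\<^sup>2 + (lin2 u b + lin2 w b * y)\<^sup>2
        + (z - y\<^sup>2) * ((lin1 w b)\<^sup>2 + (lin2 w b)\<^sup>2)))"
proof -
  let ?p = "pmf (surv_pmf P)"
  define v0 where "v0 = (\<Sum>b\<in>UNIV. ?p b * ((k b)\<^sup>2 + (lin1 u b)\<^sup>2 + (lin2 u b)\<^sup>2))"
  define v1 where "v1 = (\<Sum>b\<in>UNIV. ?p b * (2 * lin1 u b * lin1 w b + 2 * lin2 u b * lin2 w b))"
  define v2 where "v2 = (\<Sum>b\<in>UNIV. ?p b * ((lin1 w b)\<^sup>2 + (lin2 w b)\<^sup>2))"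
  define A where "A = (\<lambda>b. \<bar>k b\<bar> + \<bar>lin1 u b\<bar> + \<bar>lin1 w b\<bar> + \<bar>lin2 u b\<bar> + \<bar>lin2 w b\<bar>)"
  define C where "C = (\<Sum>b\<in>UNIV. A b)"
  have A: "A b \<ge> 0" for b by (simp add: A_def)
  have AC: "A b \<le> C" for b unfolding C_def by (rule member_le_sum) (auto simp: A)
  have v: "v0 + v1 * y + v2 * z = (\<Sum>b\<in>UNIV. ?p b * ((k b)\<^sup>2 + (lin1 u b + lin1 w b * y)\<^sup>2 + (lin2 u b + lin2 w b * y)\<^sup>2
        + (z - y\<^sup>2) * ((lin1 w b)\<^sup>2 + (lin2 w b)\<^sup>2)))" for y z
    unfolding v0_def v1_def v2_def sum_distrib_right sum.distrib[symmetric]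
    by (intro sum.cong refl) algebra
  have q: "quad v0 v1 v2 x = (\<Sum>b\<in>UNIV. ?p b * ((k b)\<^sup>2 + (lin1 u b + lin1 w b * x)\<^sup>2 + (lin2 u b + lin2 w b * x)\<^sup>2))" for x
    unfolding quad_def v by simp
  have lin: "c0 + c1 * fst z + c2 * snd z = c0 + c1 * fst z + c2 * snd z + 0 * (fst z)\<^sup>2 + 0 * (fst z * snd z) + 0 * (snd z)\<^sup>2"
    for c0 c1 c2 :: real and z by simp
  have sq: "(c0 + c1 * fst z + c2 * snd z)\<^sup>2 = c0\<^sup>2 + (2 * c0 * c1) * fst z + (2 * c0 * c2) * snd z + c1\<^sup>2 * (fst z)\<^sup>2 + (2 * c1 * c2) * (fst z * snd z) + c2\<^sup>2 * (snd z)\<^sup>2"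
    for c0 c1 c2 :: real and z by algebra
  have "score C (score_fun u w k) v0 v1 v2"
    unfolding score_def
  proof (intro conjI allI measurable_score_fun)
    show "C \<ge> 0" using A[of "(True, True)"] AC[of "(True, True)"] by linarith
    fix x
    have "(\<integral>e. score_fun u w k x (offspring P (Some x) e) \<partial>noise P) = (\<Sum>b\<in>UNIV. ?p b *\<^sub>R (\<integral>z. score_fun u w k x (offspring P (Some x) (b, z)) \<partial>gauss2))"
      by (rule noise_integral(2), unfold score_fun_offspring, subst lin, rule gauss2_quadratic(1))
    also have "\<dots> = (\<Sum>b\<in>UNIV. ?p b * k b)"
      by (intro sum.cong refl) (unfold score_fun_offspring, subst lin, unfold gauss2_quadratic(2), simp)
    finally show "(\<integral>e. score_fun u w k x (offspring P (Some x) e) \<partial>noise P) = 0" using k by simp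
    have "(\<integral>e. (score_fun u w k x (offspring P (Some x) e))\<^sup>2 \<partial>noise P) = (\<Sum>b\<in>UNIV. ?p b *\<^sub>R (\<integral>z. (score_fun u w k x (offspring P (Some x) (b, z)))\<^sup>2 \<partial>gauss2))"
      by (rule noise_integral(2)) (unfold score_fun_offspring sq, rule gauss2_quadratic(1))
    also have "\<dots> = quad v0 v1 v2 x"
      unfolding q by (intro sum.cong refl) (unfold score_fun_offspring sq gauss2_quadratic(2), simp)
    finally show "(\<integral>e. (score_fun u w k x (offspring P (Some x) e))\<^sup>2 \<partial>noise P) = quad v0 v1 v2 x" .
    fix e :: "(bool \<times> bool) \<times> real \<times> real"
    obtain b z where e: "e = (b, z)" by (cases e) blast
    have "\<bar>score_fun u w k x (offspring P (Some x) e)\<bar> \<le> \<bar>k b\<bar> * (1 * 1) + (\<bar>lin1 u b\<bar> * (1 * \<bar>fst z\<bar>) + \<bar>lin1 w b\<bar> * (\<bar>x\<bar> * \<bar>fst z\<bar>))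
        + (\<bar>lin2 u b\<bar> * (1 * \<bar>snd z\<bar>) + \<bar>lin2 w b\<bar> * (\<bar>x\<bar> * \<bar>snd z\<bar>))"
    proof -
      have "\<bar>(s + t * x) * y\<bar> \<le> \<bar>s\<bar> * (1 * \<bar>y\<bar>) + \<bar>t\<bar> * (\<bar>x\<bar> * \<bar>y\<bar>)" for s t y :: real
        using abs_triangle_ineq[of "s * y" "t * (x * y)"] by (simp add: abs_mult algebra_simps)
      note t = this
      have tri: "\<bar>a1 + a2 + a3\<bar> \<le> b1 + b2 + b3" if "\<bar>a1\<bar> \<le> b1" "\<bar>a2\<bar> \<le> b2" "\<bar>a3\<bar> \<le> b3" for a1 a2 a3 b1 b2 b3 :: real
        using that by linarith
      show ?thesis unfolding e score_fun_offspring by (rule tri[OF _ t t]) simp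
    qed
    also have "\<dots> \<le> \<bar>k b\<bar> * ((1 + \<bar>x\<bar>) * nsize e) + (\<bar>lin1 u b\<bar> * ((1 + \<bar>x\<bar>) * nsize e) + \<bar>lin1 w b\<bar> * ((1 + \<bar>x\<bar>) * nsize e))
        + (\<bar>lin2 u b\<bar> * ((1 + \<bar>x\<bar>) * nsize e) + \<bar>lin2 w b\<bar> * ((1 + \<bar>x\<bar>) * nsize e))"
      by (intro add_mono mult_left_mono mult_mono) (auto simp: nsize_def e)
    also have "\<dots> = A b * ((1 + \<bar>x\<bar>) * nsize e)" by (simp add: A_def algebra_simps)
    also have "\<dots> \<le> C * ((1 + \<bar>x\<bar>) * nsize e)" using nsize_ge_1[of e] by (intro mult_right_mono AC) auto
    finally show "\<bar>score_fun u w k x (offspring P (Some x) e)\<bar> \<le> C * (1 + \<bar>x\<bar>) * nsize e" by (simp add: mult.assoc)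
  qed
  from that[OF this q v] show ?thesis .
qed

lemma D_linear: "D (\<lambda>x v. a * g x v) k \<omega> = a * D g k \<omega>" "D (\<lambda>x v. g x v + h x v) k \<omega> = D g k \<omega> + D h k \<omega>"
  "D (\<lambda>x v. g x v - h x v) k \<omega> = D g k \<omega> - D h k \<omega>"
  unfolding D_def gext_def sum_distrib_left sum.distrib[symmetric] sum_subtractf[symmetric] by (auto intro!: sum.cong split: option.split)

lemma D_sum: "D (\<lambda>x v. \<Sum>i\<in>I. g i x v) k \<omega> = (\<Sum>i\<in>I. D (g i) k \<omega>)"
  unfolding D_def by (subst sum.swap) (auto intro!: sum.cong simp: gext_def split: option.split)

section \<open>Elementary tree functionals: moments, residuals, patterns\<close>

definition moment_fun :: "bool \<times> bool \<Rightarrow> nat \<Rightarrow> real \<Rightarrow> real option \<times> real option \<Rightarrow> real" where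
  "moment_fun c j x v = of_bool (alive_pair v = c) * x ^ j"

definition residual_fun :: "bool \<times> bool \<Rightarrow> bool \<Rightarrow> nat \<Rightarrow> real \<Rightarrow> real option \<times> real option \<Rightarrow> real" where
  "residual_fun c \<delta> j x v = of_bool (survives c \<delta> \<and> alive_pair v = c) * residual x v \<delta> * x ^ j"

definition pattern_fun :: "bool \<times> bool \<Rightarrow> real \<Rightarrow> real option \<times> real option \<Rightarrow> real" where
  "pattern_fun c x v = of_bool (alive_pair v = c) - pmf (surv_pmf P) c"

lemma measurable_moment_fun: "(\<lambda>(x, v). moment_fun c j x v) \<in> borel_measurable (borel \<Otimes>\<^sub>M (Sbar \<Otimes>\<^sub>M Sbar))"
  unfolding moment_fun_def split_beta'
  by (intro borel_measurable_times borel_measurable_power measurable_fst measurable_compose[OF measurable_snd measurable_alive_pair_fun])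

lemma sum_alive_pair: "(\<Sum>c\<in>UNIV. of_bool (alive_pair v = c) * h c) = (h (alive_pair v) :: real)"
  by (simp add: sum.If_cases of_bool_def if_distrib[of "\<lambda>t. t * _"] cong: if_cong)

text \<open>Exactly one pattern occurs, so \<open>a\<close> may be summed against indicators, and
  centring the indicators amounts to centring \<open>a\<close>.\<close>

lemma score_fun_decomp:
  assumes k: "\<And>c. k c = a c - (\<Sum>b\<in>UNIV. pmf (surv_pmf P) b * a b)"
  shows "score_fun u w k x v = (\<Sum>c\<in>UNIV. (\<Sum>\<delta>\<in>UNIV. u c \<delta> * residual_fun c \<delta> 0 x v + w c \<delta> * residual_fun c \<delta> 1 x v) + a c * pattern_fun c x v)"
proof -
  have "(\<Sum>c\<in>UNIV. (\<Sum>\<delta>\<in>UNIV. u c \<delta> * residual_fun c \<delta> 0 x v + w c \<delta> * residual_fun c \<delta> 1 x v) + a c * pattern_fun c x v)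
    = (\<Sum>c\<in>UNIV. of_bool (alive_pair v = c) * ((\<Sum>\<delta>\<in>UNIV. of_bool (survives c \<delta>) * (u c \<delta> + w c \<delta> * x) * residual x v \<delta>) + a c)) - (\<Sum>b\<in>UNIV. pmf (surv_pmf P) b * a b)"
    unfolding sum_subtractf[symmetric]
    by (intro sum.cong refl) (auto simp: residual_fun_def pattern_fun_def UNIV_bool algebra_simps)
  also have "\<dots> = score_fun u w k x v" unfolding sum_alive_pair score_fun_def k by simp
  finally show ?thesis ..
qed

text \<open>A single residual is a \<open>score_fun\<close> with one nonzero weight.\<close>

lemma residual_fun_mdiff: "\<exists>C. mdiff C (residual_fun c \<delta> j)" if "j \<le> 1" for j
proof -
  let ?u = "\<lambda>n c' \<delta>'. of_bool (j = n \<and> c' = c \<and> \<delta>' = \<delta>) :: real"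
  have "residual_fun c \<delta> j = score_fun (?u 0) (?u 1) (\<lambda>_. 0)"
    using that unfolding residual_fun_def score_fun_def fun_eq_iff by (cases j) (auto simp: UNIV_bool)
  moreover obtain C v0 v1 v2 where "score C (score_fun (?u 0) (?u 1) (\<lambda>_. 0)) v0 v1 v2" by (rule score_fun_score[of "\<lambda>_. 0"]) auto
  ultimately show ?thesis using score_mdiff by metis
qed

lemma pmf_sum_1: "(\<Sum>b\<in>UNIV. pmf (surv_pmf P) b) = 1"
  by (rule sum_pmf_eq_1) auto

text \<open>The survival pattern is independent of the value of the mother, so subtracting its
  probability from the indicator centres the product with \<open>x ^ j\<close>.\<close>

lemma moment_fun_mdiff: "\<exists>C. mdiff C (\<lambda>x v. moment_fun c j x v - pmf (surv_pmf P) c * x ^ j)" if "j \<le> 2" for j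
proof (intro exI[of _ 1])
  let ?p = "pmf (surv_pmf P)"
  have eq: "moment_fun c j x (offspring P (Some x) e) - ?p c * x ^ j = (of_bool (fst e = c) - ?p c) * x ^ j" for x e
    by (cases e) (simp add: moment_fun_def alive_pair_offspring algebra_simps)
  show "mdiff 1 (\<lambda>x v. moment_fun c j x v - ?p c * x ^ j)"
    unfolding mdiff_def eq
  proof (intro conjI allI)
    show "(\<lambda>(x, v). moment_fun c j x v - ?p c * x ^ j) \<in> borel_measurable (borel \<Otimes>\<^sub>M (Sbar \<Otimes>\<^sub>M Sbar))"
      using measurable_moment_fun[of c j] unfolding split_beta' by measurable
    fix x :: real
    have "(\<integral>e. (of_bool (fst e = c) - ?p c) * x ^ j \<partial>noise P) = (\<Sum>b\<in>UNIV. ?p b * ((of_bool (b = c) - ?p c) * x ^ j))"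
      by (rule noise_integral_weight(2))
    also have "\<dots> = ((\<Sum>b\<in>UNIV. of_bool (b = c) * ?p b) - (\<Sum>b\<in>UNIV. ?p b) * ?p c) * x ^ j"
      unfolding sum_distrib_right sum_subtractf[symmetric] by (intro sum.cong refl) algebra
    also have "(\<Sum>b\<in>UNIV. of_bool (b = c) * ?p b) = ?p c" by (simp add: of_bool_def if_distrib[of "\<lambda>t. t * _"] cong: if_cong)
    finally show "(\<integral>e. (of_bool (fst e = c) - ?p c) * x ^ j \<partial>noise P) = 0" by (simp add: pmf_sum_1)
    fix e :: "(bool \<times> bool) \<times> real \<times> real"
    have "\<bar>of_bool (fst e = c) - ?p c\<bar> \<le> 1" using pmf_nonneg[of "surv_pmf P" c] pmf_le_1[of "surv_pmf P" c] by auto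
    moreover have "\<bar>x ^ j\<bar> \<le> 1 + x\<^sup>2"
    proof -
      consider "j = 0" | "j = 1" | "j = 2" using \<open>j \<le> 2\<close> by linarith
      then show ?thesis
      proof cases
        case 2 then show ?thesis using sum_squares_bound[of "\<bar>x\<bar>" 1] by simp
      qed auto
    qed
    ultimately have "\<bar>(of_bool (fst e = c) - ?p c) * x ^ j\<bar> \<le> 1 * (1 + x\<^sup>2)" unfolding abs_mult by (intro mult_mono) auto
    also have "\<dots> \<le> 1 * (1 + x\<^sup>2) * (nsize e)\<^sup>2"
      using nsize_ge_1[of e] mult_left_mono[of 1 "(nsize e)\<^sup>2" "1 + x\<^sup>2"] by (simp add: one_le_power)
    finally show "\<bar>(of_bool (fst e = c) - ?p c) * x ^ j\<bar> \<le> 1 * (1 + x\<^sup>2) * (nsize e)\<^sup>2" .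
  qed simp
qed

lemma pattern_fun_mdiff: "\<exists>C. mdiff C (pattern_fun c)"
  using moment_fun_mdiff[of 0 c] by (simp add: moment_fun_def pattern_fun_def[abs_def])

text \<open>Variance balance for a typical cell:
  \<open>(mu2 P - (mu1 P)\<^sup>2) * (1 - alpha2_bar P)\<close> is the spread of the conditional
  means of the daughters of a cell at \<open>mu1 P\<close> around \<open>mu1 P\<close>, plus the
  mean noise variance. The latter is positive, and \<open>alpha2_bar P < 1\<close>.\<close>

lemma variance_pos: "mu2 P - (mu1 P)\<^sup>2 > 0"
proof -
  note avg = offspring_avg_def alpha_bar_def beta_bar_def alpha2_bar_def beta2_bar_def alphabeta_bar_def sigma2_bar_def
  define p p0 p1 where "p = p_both P" and "p0 = p_only P False" and "p1 = p_only P True"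
  define y where "y = mu1 P"
  have p: "p > 0" "p0 \<ge> 0" "p1 \<ge> 0" using p_bounds unfolding p_def p0_def p1_def by auto
  have mm: "m = 2 * p + p0 + p1" by (simp add: mean_offspring_def p_def p0_def p1_def)
  have l: "alpha_bar P < 1" "alpha2_bar P < 1" using alpha_bar_lt by auto
  have m1: "y * (1 - alpha_bar P) = beta_bar P" using l by (simp add: y_def mu1_def)
  have m2: "mu2 P * (1 - alpha2_bar P) = 2 * alphabeta_bar P * y + beta2_bar P + sigma2_bar P"
    using l by (simp add: mu2_def mu1_def y_def)
  note e = m_offspring_avg[of "alpha P" "alpha' P", folded alpha_bar_def] m_offspring_avg[of "beta P" "beta' P", folded beta_bar_def]
    m_offspring_avg[of "\<lambda>\<delta>. (alpha P \<delta>)\<^sup>2" "\<lambda>\<delta>. (alpha' P \<delta>)\<^sup>2", folded alpha2_bar_def] m_offspring_avg[of "\<lambda>\<delta>. (beta P \<delta>)\<^sup>2" "\<lambda>\<delta>. (beta' P \<delta>)\<^sup>2", folded beta2_bar_def]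
    m_offspring_avg[of "\<lambda>\<delta>. alpha P \<delta> * beta P \<delta>" "\<lambda>\<delta>. alpha' P \<delta> * beta' P \<delta>", folded alphabeta_bar_def]
  have "m * ((mu2 P - y\<^sup>2) * (1 - alpha2_bar P)) = m * alpha2_bar P * y\<^sup>2 + 2 * (m * alphabeta_bar P) * y + m * beta2_bar P - m * y\<^sup>2 + m * sigma2_bar P"
    using m2 by algebra
  \<comment> \<open>Zero is added in the form of the fixed point equation for the mean, so that
    squares can be completed.\<close>
  also have "\<dots> = m * alpha2_bar P * y\<^sup>2 + 2 * (m * alphabeta_bar P) * y + m * beta2_bar P
     - 2 * y * ((m * alpha_bar P) * y + m * beta_bar P) + m * y\<^sup>2 + m * sigma2_bar P"
  proof -
    have "alpha_bar P * y + beta_bar P = y" using m1 by (simp add: algebra_simps)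
    moreover have "y * ((m * alpha_bar P) * y + m * beta_bar P) = m * y * (alpha_bar P * y + beta_bar P)" by algebra
    ultimately have "2 * y * ((m * alpha_bar P) * y + m * beta_bar P) = 2 * (m * y\<^sup>2)" by (simp add: power2_eq_square)
    then show ?thesis by linarith
  qed
  also have "\<dots> = p * ((alpha P False * y + beta P False - y)\<^sup>2 + (alpha P True * y + beta P True - y)\<^sup>2)
     + p0 * (alpha' P False * y + beta' P False - y)\<^sup>2 + p1 * (alpha' P True * y + beta' P True - y)\<^sup>2 + m * sigma2_bar P"
    unfolding e unfolding mm p_def[symmetric] p0_def[symmetric] p1_def[symmetric] by algebra
  also have "\<dots> \<ge> m * sigma2_bar P" using p by simp
  finally have "m * ((mu2 P - y\<^sup>2) * (1 - alpha2_bar P)) \<ge> m * sigma2_bar P" .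
  moreover have "m * sigma2_bar P > 0"
  proof -
    have "m * sigma2_bar P = p * ((sd P)\<^sup>2 + (sd P)\<^sup>2) + p0 * (sd' P False)\<^sup>2 + p1 * (sd' P True)\<^sup>2"
      unfolding sigma2_bar_def m_offspring_avg p_def p0_def p1_def ..
    also have "\<dots> > 0" using p adm by (intro add_pos_nonneg mult_pos_pos) (auto simp: admissible_def intro!: add_pos_pos)
    finally show ?thesis .
  qed
  ultimately have "0 < m * ((mu2 P - y\<^sup>2) * (1 - alpha2_bar P))" by linarith
  then show ?thesis using l m_gt_1 by (simp add: y_def zero_less_mult_iff)
qed

end

section \<open>Totals over the tree and a Slutsky argument\<close>

context bar_super
begin

text \<open>\<open>Suc n\<close> because generation \<open>n\<close> is included; its summand looks
  at the daughters in generation \<open>n + 1\<close>, as the estimators do.\<close>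

definition tree_total :: "(real \<Rightarrow> real option \<times> real option \<Rightarrow> real) \<Rightarrow> nat \<Rightarrow> 'a \<Rightarrow> real" where
  "tree_total f n \<omega> = (\<Sum>k<Suc n. D f k \<omega>)"

lemma measurable_tree_total:
  "(\<lambda>(x, v). f x v) \<in> borel_measurable (borel \<Otimes>\<^sub>M (Sbar \<Otimes>\<^sub>M Sbar)) \<Longrightarrow> tree_total f n \<in> borel_measurable M"
  unfolding tree_total_def by (intro borel_measurable_sum measurable_D)

lemma tree_total_linear: "tree_total (\<lambda>x v. a * g x v) n \<omega> = a * tree_total g n \<omega>" "tree_total (\<lambda>x v. g x v + h x v) n \<omega> = tree_total g n \<omega> + tree_total h n \<omega>"
  "tree_total (\<lambda>x v. g x v - h x v) n \<omega> = tree_total g n \<omega> - tree_total h n \<omega>"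
  unfolding tree_total_def D_linear sum_distrib_left sum.distrib sum_subtractf by simp_all

lemma tree_total_sum: "tree_total (\<lambda>x v. \<Sum>i\<in>I. g i x v) n \<omega> = (\<Sum>i\<in>I. tree_total (g i) n \<omega>)"
  unfolding tree_total_def D_sum by (rule sum.swap)

lemma tree_total_tendsto:
  assumes "(\<lambda>k. D f k \<omega> / m ^ k) \<longlonglongrightarrow> L"
  shows "(\<lambda>n. tree_total f n \<omega> / m ^ n) \<longlonglongrightarrow> L * m / (m - 1)"
proof -
  have "tree_total f n \<omega> = (\<Sum>k\<le>n. m ^ k * (D f k \<omega> / m ^ k))" for n
    unfolding tree_total_def lessThan_Suc_atMost by simp
  then show ?thesis using geometric_average_tendsto[OF m_gt_1 assms] by simp
qed

definition limit_moment :: "nat \<Rightarrow> real" where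
  "limit_moment j = (if j = 0 then 1 else if j = 1 then mu1 P else mu2 P)"

text \<open>Survival ignores the value of the mother, so pattern frequency and moment factorise in
  the limit; \<open>m / (m - 1)\<close> is the factor that leads from the last generation to the
  tree.\<close>

lemma AE_tree_total_moment:
  "AE \<omega> in M. \<forall>c. \<forall>j\<le>2. (\<lambda>n. tree_total (moment_fun c j) n \<omega> / m ^ n) \<longlonglongrightarrow> pmf (surv_pmf P) c * limit_moment j * (pop_limit P X \<omega> * m / (m - 1))"
proof -
  let ?p = "pmf (surv_pmf P)"
  have *: "AE \<omega> in M. (\<lambda>n. tree_total (moment_fun c j) n \<omega> / m ^ n) \<longlonglongrightarrow> ?p c * limit_moment j * (pop_limit P X \<omega> * m / (m - 1))" if j: "j \<le> 2" for c j
  proof -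
    obtain C where C: "mdiff C (\<lambda>x v. moment_fun c j x v - ?p c * x ^ j)" using moment_fun_mdiff[OF j] by blast
    define q0 q1 q2 :: real where "q0 = of_bool (j = 0)" and "q1 = of_bool (j = 1)" and "q2 = of_bool (j = 2)"
    have qx: "quad q0 q1 q2 x = x ^ j" for x
    proof -
      consider "j = 0" | "j = 1" | "j = 2" using j by linarith
      then show ?thesis by cases (simp_all add: quad_def q0_def q1_def q2_def)
    qed
    have mj: "q0 + q1 * mu1 P + q2 * mu2 P = limit_moment j" using j by (auto simp: limit_moment_def q0_def q1_def q2_def)
    have S: "S (quad q0 q1 q2) k \<omega> = D (\<lambda>x v. x ^ j) k \<omega>" for k \<omega>
      unfolding S_def D_def ext_def gext_def qx ..
    from AE_D_small[OF C] AE_S_tendsto show ?thesis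
    proof eventually_elim
      case (elim \<omega>)
      have "(\<lambda>k. S (quad q0 q1 q2) k \<omega> / m ^ k) \<longlonglongrightarrow> (q0 + q1 * mu1 P + q2 * mu2 P) * pop_limit P X \<omega>" using elim(2) by blast
      then have "(\<lambda>k. D (\<lambda>x v. x ^ j) k \<omega> / m ^ k) \<longlonglongrightarrow> limit_moment j * pop_limit P X \<omega>" unfolding S mj .
      from tendsto_add[OF conjunct1[OF elim(1)] tendsto_mult_left[OF this, of "?p c"]]
      have "(\<lambda>k. D (moment_fun c j) k \<omega> / m ^ k) \<longlonglongrightarrow> ?p c * (limit_moment j * pop_limit P X \<omega>)"
        unfolding D_linear by (simp add: diff_divide_distrib)
      from tree_total_tendsto[OF this] show ?case by (simp add: mult.assoc)
    qed
  qed
  have "AE \<omega> in M. \<forall>c\<in>UNIV. \<forall>j\<in>{..2}. (\<lambda>n. tree_total (moment_fun c j) n \<omega> / m ^ n) \<longlonglongrightarrow> ?p c * limit_moment j * (pop_limit P X \<omega> * m / (m - 1))"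
    by (intro AE_finite_allI *) auto
  then show ?thesis by eventually_elim blast
qed

lemma tree_total_one: "(\<Sum>c\<in>UNIV. tree_total (moment_fun c 0) n \<omega>) = tree_total (\<lambda>x v. 1) n \<omega>"
proof -
  have "(\<Sum>c\<in>UNIV. moment_fun c 0 x v) = 1" for x v
    unfolding moment_fun_def using sum_alive_pair[of v "\<lambda>_. 1"] by simp
  then show ?thesis unfolding tree_total_sum[symmetric] by simp
qed

text \<open>A vanishing coefficient times a sum bounded in mean square tends to 0 in probability,
  here in the form of a truncated mean on the cut-off event. Large values of the sum are handled by
  Chebyshev, the others by dominated convergence.\<close>

lemma Slutsky_remainder:
  assumes f: "mdiff C f" and d: "\<And>l. d l \<in> borel_measurable M" and lim: "AE \<omega> in M. pop_limit P X \<omega> \<noteq> 0 \<longrightarrow> (\<lambda>l. d l \<omega>) \<longlonglongrightarrow> 0"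
    and c: "c > 0" and \<delta>: "\<delta> > 0"
  shows "(\<lambda>l. \<integral>\<omega>. indicator (Ev \<delta> l) \<omega> * min 2 (\<bar>d l \<omega>\<bar> * \<bar>scl c l \<omega> * tree_total f (l + r) \<omega>\<bar>) \<partial>M) \<longlonglongrightarrow> 0"
proof (rule LIMSEQ_I)
  fix e :: real assume e: "e > 0"
  obtain B where B: "B > 0" "\<And>l. integrable M (\<lambda>\<omega>. (\<Sum>k<l. D f k \<omega>)\<^sup>2)" "\<And>l. (\<integral>\<omega>. (\<Sum>k<l. D f k \<omega>)\<^sup>2 \<partial>M) \<le> B\<^sup>2 * m ^ l"
    using D_sum_L2[OF f] by blast
  have fm: "(\<lambda>(x, v). f x v) \<in> borel_measurable (borel \<Otimes>\<^sub>M (Sbar \<Otimes>\<^sub>M Sbar))" using f by (simp add: mdiff_def)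
  note [measurable] = measurable_tree_total[OF fm] d
  \<comment> \<open>Bounds the mean square of the normalised sum on \<open>Ev \<delta> l\<close>;
    the powers \<open>m ^ l\<close> of norming and sum have cancelled.\<close>
  define G where "G = B\<^sup>2 * m ^ Suc r / (c * \<delta>)"
  have G: "G \<ge> 0" using c \<delta> by (simp add: G_def)
  \<comment> \<open>Makes the Chebyshev part \<open>2 / K\<^sup>2 * G\<close> at most
    \<open>e / 2\<close>; \<open>G + 1\<close> keeps \<open>K\<close> positive.\<close>
  define K where "K = sqrt (4 * (G + 1) / e)"
  have K: "K > 0" "K\<^sup>2 = 4 * (G + 1) / e" using G e by (simp_all add: K_def)
  let ?V = "\<lambda>l \<omega>. scl c l \<omega> * tree_total f (l + r) \<omega>"
  have VI: "integrable M (\<lambda>\<omega>. indicator (Ev \<delta> l) \<omega> * (?V l \<omega>)\<^sup>2)" and VE: "(\<integral>\<omega>. indicator (Ev \<delta> l) \<omega> * (?V l \<omega>)\<^sup>2 \<partial>M) \<le> G" for l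
  proof -
    have bd: "indicator (Ev \<delta> l) \<omega> * (?V l \<omega>)\<^sup>2 \<le> 1 / (c * \<delta> * m ^ l) * (\<Sum>k<Suc (l + r). D f k \<omega>)\<^sup>2" for \<omega>
    proof (cases "\<omega> \<in> Ev \<delta> l")
      case True
      have "(scl c l \<omega>)\<^sup>2 \<le> (1 / (sqrt (c * \<delta>) * q ^ l))\<^sup>2"
        using Ev_scl_bound[OF c \<delta> True] power_mono[of "\<bar>scl c l \<omega>\<bar>" _ 2] by simp
      also have "\<dots> = 1 / (c * \<delta> * m ^ l)"
        using c \<delta> by (simp add: power_mult_distrib power_divide power_mult[symmetric] mult.commute[of l 2])
          (simp add: power_mult q)
      finally have "(scl c l \<omega>)\<^sup>2 \<le> 1 / (c * \<delta> * m ^ l)" .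
      from mult_right_mono[OF this zero_le_power2[of "tree_total f (l + r) \<omega>"]] show ?thesis
        using True by (simp add: power_mult_distrib tree_total_def del: sum.lessThan_Suc)
    qed (use c \<delta> in simp)
    have I: "integrable M (\<lambda>\<omega>. 1 / (c * \<delta> * m ^ l) * (\<Sum>k<Suc (l + r). D f k \<omega>)\<^sup>2)" by (intro integrable_mult_right B)
    show VI: "integrable M (\<lambda>\<omega>. indicator (Ev \<delta> l) \<omega> * (?V l \<omega>)\<^sup>2)"
    proof (rule Bochner_Integration.integrable_bound[OF I])
      show "AE \<omega> in M. norm (indicator (Ev \<delta> l) \<omega> * (?V l \<omega>)\<^sup>2) \<le> norm (1 / (c * \<delta> * m ^ l) * (\<Sum>k<Suc (l + r). D f k \<omega>)\<^sup>2)"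
        using bd by (intro AE_I2) (metis abs_ge_self indicator_pos_le abs_of_nonneg mult_nonneg_nonneg order_trans real_norm_def zero_le_power2)
    qed measurable
    have "(\<integral>\<omega>. indicator (Ev \<delta> l) \<omega> * (?V l \<omega>)\<^sup>2 \<partial>M) \<le> (\<integral>\<omega>. 1 / (c * \<delta> * m ^ l) * (\<Sum>k<Suc (l + r). D f k \<omega>)\<^sup>2 \<partial>M)"
      by (rule integral_mono[OF VI I bd])
    also have "\<dots> \<le> 1 / (c * \<delta> * m ^ l) * (B\<^sup>2 * m ^ Suc (l + r))"
      unfolding integral_mult_right_zero using c \<delta> by (intro mult_left_mono B) auto
    also have "\<dots> = G" by (simp add: G_def power_add field_simps)
    finally show "(\<integral>\<omega>. indicator (Ev \<delta> l) \<omega> * (?V l \<omega>)\<^sup>2 \<partial>M) \<le> G" .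
  qed
  let ?m = "\<lambda>l \<omega>. indicator (Ev \<delta> l) \<omega> * min 2 (K * \<bar>d l \<omega>\<bar>) :: real"
  have mb: "norm (?m l \<omega>) \<le> 2" for l \<omega> using K by (auto simp: indicator_def)
  have mI: "integrable M (?m l)" for l
    by (rule integrable_const_bound[of _ 2]) (use mb in auto)
  have "(\<lambda>l. \<integral>\<omega>. ?m l \<omega> \<partial>M) \<longlonglongrightarrow> (\<integral>\<omega>. 0 \<partial>M)"
  proof (rule integral_dominated_convergence[where w = "\<lambda>_. 2"])
    show "AE \<omega> in M. (\<lambda>l. ?m l \<omega>) \<longlonglongrightarrow> 0"
      using lim AE_Ev_extinct[OF \<delta>]
    proof eventually_elim
      case (elim \<omega>)
      show ?case
      proof (cases "pop_limit P X \<omega> = 0")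
        case True
        then have "\<forall>\<^sub>F l in sequentially. ?m l \<omega> = 0" using elim(2) by (auto elim: eventually_mono)
        then show ?thesis by (rule tendsto_eventually)
      next
        case False
        then have "(\<lambda>l. K * \<bar>d l \<omega>\<bar>) \<longlonglongrightarrow> 0" using elim(1) by (intro tendsto_mult_right_zero tendsto_rabs_zero) auto
        then show ?thesis
        proof (rule Lim_null_comparison[rotated], intro always_eventually allI)
          fix l show "norm (?m l \<omega>) \<le> K * \<bar>d l \<omega>\<bar>" using K by (auto simp: indicator_def)
        qed
      qed
    qed
  qed (use mb in auto)
  then obtain n0 where n0: "\<And>l. l \<ge> n0 \<Longrightarrow> \<bar>\<integral>\<omega>. ?m l \<omega> \<partial>M\<bar> < e / 2"
    using LIMSEQ_D[of "\<lambda>l. \<integral>\<omega>. ?m l \<omega> \<partial>M" 0 "e / 2"] e by auto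
  show "\<exists>n0. \<forall>l\<ge>n0. norm ((\<integral>\<omega>. indicator (Ev \<delta> l) \<omega> * min 2 (\<bar>d l \<omega>\<bar> * \<bar>?V l \<omega>\<bar>) \<partial>M) - 0) < e"
  proof (intro exI[of _ n0] allI impI)
    fix l assume l: "l \<ge> n0"
    let ?L = "\<lambda>\<omega>. indicator (Ev \<delta> l) \<omega> * min 2 (\<bar>d l \<omega>\<bar> * \<bar>?V l \<omega>\<bar>) :: real"
    let ?R = "\<lambda>\<omega>. ?m l \<omega> + 2 / K\<^sup>2 * (indicator (Ev \<delta> l) \<omega> * (?V l \<omega>)\<^sup>2)"
    have L0: "?L \<omega> \<ge> 0" "?L \<omega> \<le> 2" for \<omega> by (auto simp: indicator_def)
    have LI: "integrable M ?L"
      by (rule integrable_const_bound[of _ 2]) (use L0 in auto)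
    have LR: "?L \<omega> \<le> ?R \<omega>" for \<omega>
    proof (cases "\<omega> \<in> Ev \<delta> l")
      case True
      show ?thesis
      proof (cases "\<bar>?V l \<omega>\<bar> \<le> K")
        case True
        then have "min 2 (\<bar>d l \<omega>\<bar> * \<bar>?V l \<omega>\<bar>) \<le> min 2 (K * \<bar>d l \<omega>\<bar>)"
          using mult_right_mono[OF True abs_ge_zero[of "d l \<omega>"]] by (intro min.mono order_refl) (simp only: mult.commute)
        moreover have "0 \<le> 2 / K\<^sup>2 * (?V l \<omega>)\<^sup>2" by simp
        ultimately have "min 2 (\<bar>d l \<omega>\<bar> * \<bar>?V l \<omega>\<bar>) \<le> min 2 (K * \<bar>d l \<omega>\<bar>) + 2 / K\<^sup>2 * (?V l \<omega>)\<^sup>2" by linarith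
        then show ?thesis using \<open>\<omega> \<in> Ev \<delta> l\<close> by (simp del: min_less_iff_conj)
      next
        case False
        then have "K\<^sup>2 \<le> (?V l \<omega>)\<^sup>2" using power_mono[of K "\<bar>?V l \<omega>\<bar>" 2] K by simp
        then have "2 \<le> 2 / K\<^sup>2 * (?V l \<omega>)\<^sup>2" using K(1) by (simp add: field_simps)
        moreover have "min 2 (K * \<bar>d l \<omega>\<bar>) \<ge> 0" using K by simp
        ultimately show ?thesis using \<open>\<omega> \<in> Ev \<delta> l\<close> by simp
      qed
    qed simp
    have "(\<integral>\<omega>. ?L \<omega> \<partial>M) \<le> (\<integral>\<omega>. ?R \<omega> \<partial>M)"
      by (rule integral_mono[OF LI Bochner_Integration.integrable_add[OF mI integrable_mult_right[OF VI]] LR])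
    also have "\<dots> = (\<integral>\<omega>. ?m l \<omega> \<partial>M) + 2 / K\<^sup>2 * (\<integral>\<omega>. indicator (Ev \<delta> l) \<omega> * (?V l \<omega>)\<^sup>2 \<partial>M)"
      unfolding Bochner_Integration.integral_add[OF mI integrable_mult_right[OF VI]] integral_mult_right_zero ..
    also have "\<dots> \<le> (\<integral>\<omega>. ?m l \<omega> \<partial>M) + 2 / K\<^sup>2 * G"
      by (intro add_left_mono mult_left_mono VE) simp
    also have "2 / K\<^sup>2 * G \<le> e / 2" unfolding K(2) using G e by (simp add: field_simps)
    also have "(\<integral>\<omega>. ?m l \<omega> \<partial>M) < e / 2" using n0[OF l] by linarith
    finally have "(\<integral>\<omega>. ?L \<omega> \<partial>M) < e" by simp
    moreover have "(\<integral>\<omega>. ?L \<omega> \<partial>M) \<ge> 0" by (intro integral_nonneg_AE AE_I2 L0)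
    ultimately show "norm ((\<integral>\<omega>. ?L \<omega> \<partial>M) - 0) < e" by simp
  qed
qed

end

section \<open>Estimators as functions of tree totals\<close>

definition tree_case :: "bool \<times> bool \<Rightarrow> (bool list \<Rightarrow> real option) \<Rightarrow> nat \<Rightarrow> bool list set" where
  "tree_case c x n = {i \<in> tree_alive x n. alive_pair (x (i @ [False]), x (i @ [True])) = c}"

lemma tree_case_eq:
  "tree_both x n = tree_case (True, True) x n" "tree_only False x n = tree_case (True, False) x n"
  "tree_only True x n = tree_case (False, True) x n"
  by (auto simp: tree_both_def tree_only_def tree_case_def alive_pair_def)

lemma tree_upto_eq: "tree_upto n = (\<Union>k<Suc n. gen k)"
  by (auto simp: tree_upto_def gen_def)

lemma finite_tree_upto: "finite (tree_upto n)"
  unfolding tree_upto_eq by auto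

lemma sum_tree_upto: "(\<Sum>i\<in>tree_upto n. f i) = (\<Sum>k<Suc n. \<Sum>i\<in>gen k. f i)"
  unfolding tree_upto_eq by (rule sum.UNION_disjoint) (auto simp: gen_def intro: finite_gen[unfolded gen_def])

text \<open>Exact algebra of least squares: once the true regression line is inserted, the errors
  are linear in the two noise sums \<open>E0\<close> and \<open>E1\<close>, with coefficients that
  depend on the empirical moments of the regressor only.\<close>

lemma regression_error:
  fixes N A1 A2 E0 E1 s t a b :: real
  defines "M1 \<equiv> A1 / N" and "M2 \<equiv> A2 / N"
  assumes N: "N \<noteq> 0" and V: "M2 - M1\<^sup>2 \<noteq> 0"
    and sl: "sl = ((s * A2 + t * A1 + E1) / N - M1 * ((s * A1 + t * N + E0) / N)) / (M2 - M1\<^sup>2)"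
    and ic: "ic = (s * A1 + t * N + E0) / N - sl * M1"
  shows "a * (sl - s) + b * (ic - t) = E0 / N * ((b * M2 - a * M1) / (M2 - M1\<^sup>2)) + E1 / N * ((a - b * M1) / (M2 - M1\<^sup>2))"
proof -
  define e0 e1 v where "e0 = E0 / N" and "e1 = E1 / N" and "v = M2 - M1\<^sup>2"
  have 1: "(s * A2 + t * A1 + E1) / N = s * M2 + t * M1 + e1" "(s * A1 + t * N + E0) / N = s * M1 + t + e0"
    using N by (simp_all add: add_divide_distrib M1_def M2_def e0_def e1_def)
  have v: "v \<noteq> 0" "M2 = v + M1\<^sup>2" using V by (simp_all add: v_def)
  have "sl - s = (s * v + e1 - M1 * e0) / v - s"
    unfolding sl 1 v_def[symmetric] by (rule arg_cong[where f = "\<lambda>z. z / v - s"]) (use v(2) in algebra)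
  then have d: "sl - s = (e1 - M1 * e0) / v" using v(1) by (simp add: field_simps)
  have "ic - t = e0 - (sl - s) * M1" unfolding ic 1 by algebra
  then have "a * (sl - s) + b * (ic - t) = a * ((e1 - M1 * e0) / v) + b * (e0 - (e1 - M1 * e0) / v * M1)" unfolding d by simp
  also have "\<dots> = e0 * ((b * (v + M1\<^sup>2) - a * M1) / v) + e1 * ((a - b * M1) / v)"
    using v(1) by (simp add: field_simps power2_eq_square)
  finally show ?thesis unfolding v(2)[symmetric] unfolding v_def e0_def e1_def .
qed

text \<open>The indices follow the order of \<open>theta\<close>. Values at dead daughters are junk
  and are removed by \<open>survives\<close> wherever they would enter.\<close>

definition slope_coef :: "real ^ 11 \<Rightarrow> bool \<times> bool \<Rightarrow> bool \<Rightarrow> real" where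
  "slope_coef a c \<delta> = (if c = (True, True) then (if \<delta> then a $ 3 else a $ 1) else (if \<delta> then a $ 7 else a $ 5))"

definition icpt_coef :: "real ^ 11 \<Rightarrow> bool \<times> bool \<Rightarrow> bool \<Rightarrow> real" where
  "icpt_coef a c \<delta> = (if c = (True, True) then (if \<delta> then a $ 4 else a $ 2) else (if \<delta> then a $ 8 else a $ 6))"

definition prob_coef :: "real ^ 11 \<Rightarrow> bool \<times> bool \<Rightarrow> real" where
  "prob_coef a c = (if c = (True, True) then a $ 9 else if c = (True, False) then a $ 10 else if c = (False, True) then a $ 11 else 0)"

context bar_super
begin

abbreviation "pr \<equiv> pmf (surv_pmf P)"
abbreviation "xs \<omega> \<equiv> (\<lambda>i. X i \<omega>)"
abbreviation "nT \<equiv> tree_total (\<lambda>x v. 1)"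

lemma pr_eq: "pr (True, True) = p_both P" "pr (True, False) = p_only P False" "pr (False, True) = p_only P True"
  "pr (False, False) = 1 - p_both P - p_only P False - p_only P True"
  by (simp_all add: pmf_surv')

text \<open>A sum over a random set of cells becomes a sum over the deterministic
  \<open>tree_upto n\<close>, with \<open>gext\<close> killing the dead mothers and the indicator
  selecting the pattern.\<close>

lemma tree_sum:
  "(\<Sum>i\<in>tree_case c (xs \<omega>) n. h (cell_val (X i \<omega>)) (V i \<omega>)) = tree_total (\<lambda>x v. of_bool (alive_pair v = c) * h x v) n \<omega>"
proof -
  have "(\<Sum>i\<in>tree_case c (xs \<omega>) n. h (cell_val (X i \<omega>)) (V i \<omega>)) = (\<Sum>i\<in>tree_upto n. gext (\<lambda>x v. of_bool (alive_pair v = c) * h x v) (X i \<omega>) (V i \<omega>))"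
    by (rule sum.mono_neutral_cong_left[OF finite_tree_upto])
      (auto simp: tree_case_def tree_alive_def gext_def cell_val_def split: option.splits)
  then show ?thesis unfolding sum_tree_upto tree_total_def D_def .
qed

lemma card_tree_case: "real (card (tree_case c (xs \<omega>) n)) = tree_total (moment_fun c 0) n \<omega>"
  using tree_sum[of "\<lambda>x v. 1"] by (simp add: moment_fun_def[abs_def])

lemma card_tree_alive: "real (card (tree_alive (xs \<omega>) n)) = nT n \<omega>"
proof -
  have "real (card (tree_alive (xs \<omega>) n)) = (\<Sum>i\<in>tree_alive (xs \<omega>) n. 1)" by simp
  also have "\<dots> = (\<Sum>i\<in>tree_upto n. gext (\<lambda>x v. 1) (X i \<omega>) (V i \<omega>))"
    by (rule sum.mono_neutral_cong_left[OF finite_tree_upto])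
      (auto simp: tree_alive_def gext_def split: option.splits)
  finally show ?thesis unfolding sum_tree_upto tree_total_def D_def .
qed

text \<open>Daughters are written as regression line plus residual, which separates the parameters
  from the noise totals.\<close>

lemma avg_tree_case:
  fixes c n and \<omega> :: 'a
  defines "J \<equiv> tree_case c (xs \<omega>) n"
  shows "avg J (\<lambda>i. cell_val (X i \<omega>)) = tree_total (moment_fun c 1) n \<omega> / tree_total (moment_fun c 0) n \<omega>"
    and "avg J (\<lambda>i. (cell_val (X i \<omega>))\<^sup>2) = tree_total (moment_fun c 2) n \<omega> / tree_total (moment_fun c 0) n \<omega>"
    and "survives c \<delta> \<Longrightarrow> avg J (\<lambda>i. cell_val (X (i @ [\<delta>]) \<omega>)) =
      (slope P c \<delta> * tree_total (moment_fun c 1) n \<omega> + icpt P c \<delta> * tree_total (moment_fun c 0) n \<omega> + tree_total (residual_fun c \<delta> 0) n \<omega>) / tree_total (moment_fun c 0) n \<omega>"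
    and "survives c \<delta> \<Longrightarrow> avg J (\<lambda>i. cell_val (X i \<omega>) * cell_val (X (i @ [\<delta>]) \<omega>)) =
      (slope P c \<delta> * tree_total (moment_fun c 2) n \<omega> + icpt P c \<delta> * tree_total (moment_fun c 1) n \<omega> + tree_total (residual_fun c \<delta> 1) n \<omega>) / tree_total (moment_fun c 0) n \<omega>"
proof -
  let ?y = "\<lambda>v :: real option \<times> real option. cell_val (if \<delta> then snd v else fst v)"
  have y: "cell_val (X (i @ [\<delta>]) \<omega>) = ?y (V i \<omega>)" for i by (cases \<delta>) auto
  have d0: "of_bool (alive_pair v = c) * ?y v = slope P c \<delta> * moment_fun c 1 x v + icpt P c \<delta> * moment_fun c 0 x v + residual_fun c \<delta> 0 x v"
    and d1: "of_bool (alive_pair v = c) * (x * ?y v) = slope P c \<delta> * moment_fun c 2 x v + icpt P c \<delta> * moment_fun c 1 x v + residual_fun c \<delta> 1 x v"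
    if "survives c \<delta>" for x v
    using that by (cases "alive_pair v = c"; simp add: moment_fun_def residual_fun_def residual_def algebra_simps power2_eq_square)+
  have h: "avg J (\<lambda>i. h (cell_val (X i \<omega>)) (V i \<omega>)) = tree_total (\<lambda>x v. of_bool (alive_pair v = c) * h x v) n \<omega> / tree_total (moment_fun c 0) n \<omega>" for h
    unfolding avg_def J_def tree_sum card_tree_case ..
  show "avg J (\<lambda>i. cell_val (X i \<omega>)) = tree_total (moment_fun c 1) n \<omega> / tree_total (moment_fun c 0) n \<omega>"
    using h[of "\<lambda>x v. x"] by (simp add: moment_fun_def[abs_def])
  show "avg J (\<lambda>i. (cell_val (X i \<omega>))\<^sup>2) = tree_total (moment_fun c 2) n \<omega> / tree_total (moment_fun c 0) n \<omega>"
    using h[of "\<lambda>x v. x\<^sup>2"] by (simp add: moment_fun_def[abs_def])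
  show "avg J (\<lambda>i. cell_val (X (i @ [\<delta>]) \<omega>)) =
      (slope P c \<delta> * tree_total (moment_fun c 1) n \<omega> + icpt P c \<delta> * tree_total (moment_fun c 0) n \<omega> + tree_total (residual_fun c \<delta> 0) n \<omega>) / tree_total (moment_fun c 0) n \<omega>" if s: "survives c \<delta>"
  proof -
    have "(\<lambda>x v. of_bool (alive_pair v = c) * ?y v) = (\<lambda>x v. slope P c \<delta> * moment_fun c 1 x v + icpt P c \<delta> * moment_fun c 0 x v + residual_fun c \<delta> 0 x v)"
      using d0[OF s] by (intro HOL.ext)
    then show ?thesis using h[of "\<lambda>x v. ?y v"] unfolding y by (simp only: tree_total_linear)
  qed
  show "avg J (\<lambda>i. cell_val (X i \<omega>) * cell_val (X (i @ [\<delta>]) \<omega>)) =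
      (slope P c \<delta> * tree_total (moment_fun c 2) n \<omega> + icpt P c \<delta> * tree_total (moment_fun c 1) n \<omega> + tree_total (residual_fun c \<delta> 1) n \<omega>) / tree_total (moment_fun c 0) n \<omega>" if s: "survives c \<delta>"
  proof -
    have "(\<lambda>x v. of_bool (alive_pair v = c) * (x * ?y v)) = (\<lambda>x v. slope P c \<delta> * moment_fun c 2 x v + icpt P c \<delta> * moment_fun c 1 x v + residual_fun c \<delta> 1 x v)"
      using d1[OF s] by (intro HOL.ext)
    then show ?thesis using h[of "\<lambda>x v. x * ?y v"] unfolding y by (simp only: tree_total_linear)
  qed
qed

definition mean1 :: "bool \<times> bool \<Rightarrow> nat \<Rightarrow> 'a \<Rightarrow> real" where
  "mean1 c n \<omega> = tree_total (moment_fun c 1) n \<omega> / tree_total (moment_fun c 0) n \<omega>"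

definition mean2 :: "bool \<times> bool \<Rightarrow> nat \<Rightarrow> 'a \<Rightarrow> real" where
  "mean2 c n \<omega> = tree_total (moment_fun c 2) n \<omega> / tree_total (moment_fun c 0) n \<omega>"

definition var2 :: "bool \<times> bool \<Rightarrow> nat \<Rightarrow> 'a \<Rightarrow> real" where
  "var2 c n \<omega> = mean2 c n \<omega> - (mean1 c n \<omega>)\<^sup>2"

lemma slope_est_tree_case:
  assumes "survives c \<delta>"
  shows "slope_est (xs \<omega>) \<delta> (tree_case c (xs \<omega>) n) =
    ((slope P c \<delta> * tree_total (moment_fun c 2) n \<omega> + icpt P c \<delta> * tree_total (moment_fun c 1) n \<omega> + tree_total (residual_fun c \<delta> 1) n \<omega>) / tree_total (moment_fun c 0) n \<omega>
      - mean1 c n \<omega> * ((slope P c \<delta> * tree_total (moment_fun c 1) n \<omega> + icpt P c \<delta> * tree_total (moment_fun c 0) n \<omega> + tree_total (residual_fun c \<delta> 0) n \<omega>) / tree_total (moment_fun c 0) n \<omega>))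
    / var2 c n \<omega>"
  unfolding slope_est_def avg_tree_case(1,2) avg_tree_case(3,4)[OF assms] mean1_def mean2_def var2_def ..

lemma intercept_est_tree_case:
  assumes "survives c \<delta>"
  shows "intercept_est (xs \<omega>) \<delta> (tree_case c (xs \<omega>) n) =
    (slope P c \<delta> * tree_total (moment_fun c 1) n \<omega> + icpt P c \<delta> * tree_total (moment_fun c 0) n \<omega> + tree_total (residual_fun c \<delta> 0) n \<omega>) / tree_total (moment_fun c 0) n \<omega>
      - slope_est (xs \<omega>) \<delta> (tree_case c (xs \<omega>) n) * mean1 c n \<omega>"
  unfolding intercept_est_def avg_tree_case(1,2) avg_tree_case(3,4)[OF assms] mean1_def ..

text \<open>A nonempty class and a nonzero empirical variance exclude the default values, so that
  \<open>regression_error\<close> applies.\<close>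

lemma estimation_error:
  assumes "survives c \<delta>" "tree_total (moment_fun c 0) n \<omega> \<noteq> 0" "var2 c n \<omega> \<noteq> 0"
  shows "a * (slope_est (xs \<omega>) \<delta> (tree_case c (xs \<omega>) n) - slope P c \<delta>) + b * (intercept_est (xs \<omega>) \<delta> (tree_case c (xs \<omega>) n) - icpt P c \<delta>)
    = tree_total (residual_fun c \<delta> 0) n \<omega> / tree_total (moment_fun c 0) n \<omega> * ((b * mean2 c n \<omega> - a * mean1 c n \<omega>) / var2 c n \<omega>)
    + tree_total (residual_fun c \<delta> 1) n \<omega> / tree_total (moment_fun c 0) n \<omega> * ((a - b * mean1 c n \<omega>) / var2 c n \<omega>)"
  using regression_error[OF assms(2) assms(3)[unfolded var2_def mean1_def mean2_def]
      slope_est_tree_case[OF assms(1), unfolded var2_def mean1_def mean2_def] intercept_est_tree_case[OF assms(1), unfolded mean1_def]]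
  unfolding var2_def mean1_def mean2_def .

text \<open>The eleven coordinates regrouped by survival pattern, so that one formula per pattern
  and daughter serves all regressions. The pattern without survivors contributes 0.\<close>

lemma inner_theta:
  "a \<bullet> (theta_hat (xs \<omega>) n - theta P) = (\<Sum>c\<in>UNIV. (\<Sum>\<delta>\<in>UNIV. of_bool (survives c \<delta>) *
      (slope_coef a c \<delta> * (slope_est (xs \<omega>) \<delta> (tree_case c (xs \<omega>) n) - slope P c \<delta>)
       + icpt_coef a c \<delta> * (intercept_est (xs \<omega>) \<delta> (tree_case c (xs \<omega>) n) - icpt P c \<delta>)))
    + prob_coef a c * (tree_total (moment_fun c 0) n \<omega> / nT n \<omega> - pr c))"
  unfolding inner_11 vector_minus_component theta_hat_def theta_def vector_11 tree_case_eq card_tree_case card_tree_alive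
  unfolding sum_bool_pair UNIV_bool
  by (simp add: survives_def slope_coef_def icpt_coef_def prob_coef_def slope_def icpt_def pr_eq)

text \<open>Written exactly as the sequence in the theorem, which is recovered by unfolding.\<close>

definition Zn :: "nat \<Rightarrow> 'a \<Rightarrow> real ^ 11" where
  "Zn n \<omega> = of_bool (card (gen_alive (xs \<omega>) n) > 0) *\<^sub>R (sqrt (real (card (tree_alive (xs \<omega>) n))) *\<^sub>R (theta_hat (xs \<omega>) n - theta P))"

lemma inner_Zn: "a \<bullet> Zn n \<omega> = of_bool (N1 n \<omega> > 0) * (sqrt (nT n \<omega>) * (a \<bullet> (theta_hat (xs \<omega>) n - theta P)))"
  unfolding Zn_def N1_eq card_tree_alive by simp

lemma measurable_tree_total' [measurable]:
  "tree_total (moment_fun c j) n \<in> borel_measurable M" "nT n \<in> borel_measurable M" "tree_total (residual_fun c \<delta> 0) n \<in> borel_measurable M" "tree_total (residual_fun c \<delta> 1) n \<in> borel_measurable M"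
proof -
  show "tree_total (moment_fun c j) n \<in> borel_measurable M" by (rule measurable_tree_total[OF measurable_moment_fun])
  show "nT n \<in> borel_measurable M" by (rule measurable_tree_total) simp
  show "tree_total (residual_fun c \<delta> 0) n \<in> borel_measurable M" "tree_total (residual_fun c \<delta> 1) n \<in> borel_measurable M"
    using residual_fun_mdiff[of 0 c \<delta>] residual_fun_mdiff[of 1 c \<delta>] by (auto simp: mdiff_def intro!: measurable_tree_total)
qed

lemma measurable_means [measurable]:
  "mean1 c n \<in> borel_measurable M" "mean2 c n \<in> borel_measurable M" "var2 c n \<in> borel_measurable M"
  unfolding mean1_def mean2_def var2_def by measurable

text \<open>The estimators average over random sets, but they are rational functions of tree totals,
  whence their measurability.\<close>

lemma measurable_inner_Zn: "(\<lambda>\<omega>. a \<bullet> Zn n \<omega>) \<in> borel_measurable M"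
proof -
  have m1: "(\<lambda>\<omega>. of_bool (survives c \<delta>) * (s * (slope_est (xs \<omega>) \<delta> (tree_case c (xs \<omega>) n) - slope P c \<delta>)
     + t * (intercept_est (xs \<omega>) \<delta> (tree_case c (xs \<omega>) n) - icpt P c \<delta>))) \<in> borel_measurable M" for c \<delta> s t
  proof (cases "survives c \<delta>")
    case True show ?thesis unfolding intercept_est_tree_case[OF True] slope_est_tree_case[OF True] by measurable
  qed simp
  have m2: "(\<lambda>\<omega>. prob_coef a c * (tree_total (moment_fun c 0) n \<omega> / nT n \<omega> - pr c)) \<in> borel_measurable M" for c by measurable
  have "(\<lambda>\<omega>. a \<bullet> (theta_hat (xs \<omega>) n - theta P)) \<in> borel_measurable M"
    unfolding inner_theta by (intro borel_measurable_sum borel_measurable_add m1 m2)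
  moreover have "N1 n \<in> borel_measurable M" by (rule measurable_S) measurable
  ultimately show ?thesis unfolding inner_Zn of_bool_def by measurable
qed

lemma measurable_Zn: "Zn n \<in> borel_measurable M"
  unfolding borel_measurable_euclidean_space[of "Zn n"] using measurable_inner_Zn by (simp add: inner_commute)

end

section \<open>The limiting score and exact linearisation\<close>

locale bar_full = bar_super +
  assumes only_pos: "\<And>\<delta>. p_only P \<delta> > 0"
begin

lemma pr_pos: "c \<noteq> (False, False) \<Longrightarrow> pr c > 0"
  using only_pos p_bounds(1) by (cases c) (auto simp: pmf_surv')

lemma survives_alive: "survives c \<delta> \<Longrightarrow> c \<noteq> (False, False)"
  by (cases \<delta>) (auto simp: survives_def)

abbreviation "dd \<equiv> mu2 P - (mu1 P)\<^sup>2"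

text \<open>\<open>lim_const\<close> and \<open>lim_slope\<close> are the limits of the coefficients of the residual sums and of the \<open>x\<close>-weighted residual sums
  in the linear combination with coefficients \<open>a\<close> of the estimation errors; in the notation of the paper they
  arise from \<open>K / p\<close>.\<close>

definition lim_const :: "real ^ 11 \<Rightarrow> bool \<times> bool \<Rightarrow> bool \<Rightarrow> real" where
  "lim_const a c \<delta> = of_bool (survives c \<delta>) * (1 / pr c * ((icpt_coef a c \<delta> * mu2 P - slope_coef a c \<delta> * mu1 P) / dd))"

definition lim_slope :: "real ^ 11 \<Rightarrow> bool \<times> bool \<Rightarrow> bool \<Rightarrow> real" where
  "lim_slope a c \<delta> = of_bool (survives c \<delta>) * (1 / pr c * ((slope_coef a c \<delta> - icpt_coef a c \<delta> * mu1 P) / dd))"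

text \<open>Centring gives the pattern part conditional mean 0, as \<open>score_fun_score\<close>
  demands.\<close>

definition lim_prob :: "real ^ 11 \<Rightarrow> bool \<times> bool \<Rightarrow> real" where
  "lim_prob a c = prob_coef a c - (\<Sum>b\<in>UNIV. pr b * prob_coef a b)"

lemma lim_prob_mean: "(\<Sum>b\<in>UNIV. pr b * lim_prob a b) = 0"
  unfolding lim_prob_def right_diff_distrib sum_subtractf sum_distrib_right[symmetric] pmf_sum_1 by simp

lemma lin_explicit:
  "lin1 f (True, True) = sd P * (f (True, True) False + rho P * f (True, True) True)"
  "lin2 f (True, True) = sd P * (sqrt (1 - (rho P)\<^sup>2) * f (True, True) True)"
  "lin1 f (True, False) = sd' P False * f (True, False) False" "lin2 f (True, False) = 0"
  "lin1 f (False, True) = sd' P True * f (False, True) True" "lin2 f (False, True) = 0"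
  "lin1 f (False, False) = 0" "lin2 f (False, False) = 0"
  by (simp_all add: lin1_def lin2_def UNIV_bool survives_def eps1_def eps2_def algebra_simps)

text \<open>At the mean \<open>mu1 P\<close> of the regressor the slope coefficient cancels and only
  the intercept coefficient is left. This is the usual orthogonality of the slope and the fitted
  value at the mean.\<close>

lemma lu_lw_mean: "lim_const a c \<delta> + lim_slope a c \<delta> * mu1 P = of_bool (survives c \<delta>) * (icpt_coef a c \<delta> / pr c)"
proof -
  have "(icpt_coef a c \<delta> * mu2 P - slope_coef a c \<delta> * mu1 P) / dd + (slope_coef a c \<delta> - icpt_coef a c \<delta> * mu1 P) / dd * mu1 P = icpt_coef a c \<delta>"
  proof -
    have "(icpt_coef a c \<delta> * mu2 P - slope_coef a c \<delta> * mu1 P) + (slope_coef a c \<delta> - icpt_coef a c \<delta> * mu1 P) * mu1 P = icpt_coef a c \<delta> * dd" by algebra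
    then show ?thesis using variance_pos by (simp add: add_divide_distrib[symmetric])
  qed
  then have "1 / pr c * ((icpt_coef a c \<delta> * mu2 P - slope_coef a c \<delta> * mu1 P) / dd) + 1 / pr c * ((slope_coef a c \<delta> - icpt_coef a c \<delta> * mu1 P) / dd) * mu1 P = icpt_coef a c \<delta> / pr c"
    by (simp only: mult.assoc distrib_left[symmetric]) simp
  then show ?thesis unfolding lim_const_def lim_slope_def by simp
qed

lemma lin_mean: "lin1 (lim_const a) b + lin1 (lim_slope a) b * mu1 P = lin1 (\<lambda>c \<delta>. of_bool (survives c \<delta>) * (icpt_coef a c \<delta> / pr c)) b"
  "lin2 (lim_const a) b + lin2 (lim_slope a) b * mu1 P = lin2 (\<lambda>c \<delta>. of_bool (survives c \<delta>) * (icpt_coef a c \<delta> / pr c)) b"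
  unfolding lu_lw_mean[symmetric] lin1_def lin2_def sum_distrib_right sum.distrib[symmetric]
  by (intro sum.cong refl; simp add: algebra_simps)+

text \<open>The limiting variance of the score, matched pattern by pattern with the squares of
  \<open>cov_form\<close>: frequencies, fitted values at the mean, and slopes, the last weighted by
  the variance of the regressor.\<close>

lemma score_cov_form:
  "(\<Sum>b\<in>UNIV. pr b * ((lim_prob a b)\<^sup>2 + (lin1 (lim_const a) b + lin1 (lim_slope a) b * mu1 P)\<^sup>2 + (lin2 (lim_const a) b + lin2 (lim_slope a) b * mu1 P)\<^sup>2
        + (mu2 P - (mu1 P)\<^sup>2) * ((lin1 (lim_slope a) b)\<^sup>2 + (lin2 (lim_slope a) b)\<^sup>2))) = cov_form P a"
proof -
  define d p p0 p1 r s s0 s1 where "d = dd" and "p = p_both P" and "p0 = p_only P False" and "p1 = p_only P True" and "r = rho P"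
    and "s = sd P" and "s0 = sd' P False" and "s1 = sd' P True"
  have pos: "d > 0" "p > 0" "p0 > 0" "p1 > 0" using variance_pos only_pos p_bounds(1) by (auto simp: d_def p_def p0_def p1_def)
  have r: "(sqrt (1 - r\<^sup>2))\<^sup>2 = 1 - r\<^sup>2" using adm by (auto simp: admissible_def r_def abs_square_le_1 abs_le_iff)
  \<comment> \<open>The pattern of two survivors, with \<open>u\<close> and \<open>v\<close>
    standing for the inverses of \<open>p\<close> and \<open>d\<close>; in this form the identity is
    polynomial modulo \<open>p * u = 1\<close> and \<open>d * v = 1\<close>.\<close>
  have piece2: "p * (k + (s * (x * u + r * (y * u)))\<^sup>2 + (s * (z * (y * u)))\<^sup>2 + d * ((s * (u * (A * v) + r * (u * (B * v))))\<^sup>2 + (s * (z * (u * (B * v))))\<^sup>2))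
      = p * k + s\<^sup>2 * u * v * (A + r * B)\<^sup>2 + s\<^sup>2 * u * (1 - r\<^sup>2) * v * B\<^sup>2 + s\<^sup>2 * u * (x + r * y)\<^sup>2 + s\<^sup>2 * u * (1 - r\<^sup>2) * y\<^sup>2"
    if "p * u = 1" "d * v = 1" "z\<^sup>2 = 1 - r\<^sup>2" for p u d v z k s x y A B r :: real
  proof -
    have "p * (k + (s * (x * u + r * (y * u)))\<^sup>2 + (s * (z * (y * u)))\<^sup>2 + d * ((s * (u * (A * v) + r * (u * (B * v))))\<^sup>2 + (s * (z * (u * (B * v))))\<^sup>2))
      = p * k + s\<^sup>2 * u * (p * u) * (x + r * y)\<^sup>2 + s\<^sup>2 * u * (p * u) * z\<^sup>2 * y\<^sup>2 + s\<^sup>2 * u * (p * u) * v * (d * v) * (A + r * B)\<^sup>2 + s\<^sup>2 * u * (p * u) * z\<^sup>2 * v * (d * v) * B\<^sup>2"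
      by algebra
    then show ?thesis unfolding that by simp
  qed
  have piece1: "p * (k + (s * (x * u))\<^sup>2 + 0\<^sup>2 + d * ((s * (u * (A * v)))\<^sup>2 + 0\<^sup>2)) = p * k + s\<^sup>2 * u * v * A\<^sup>2 + s\<^sup>2 * u * x\<^sup>2"
    if "p * u = 1" "d * v = 1" for p u d v k s x A :: real
  proof -
    have "p * (k + (s * (x * u))\<^sup>2 + 0\<^sup>2 + d * ((s * (u * (A * v)))\<^sup>2 + 0\<^sup>2)) = p * k + s\<^sup>2 * u * (p * u) * x\<^sup>2 + s\<^sup>2 * u * (p * u) * v * (d * v) * A\<^sup>2"
      unfolding zero_power2 add_0_right by algebra
    then show ?thesis unfolding that by simp
  qed
  have sv: "survives (True, True) \<delta> = True" "survives (True, False) False = True" "survives (False, True) True = True" for \<delta>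
    by (simp_all add: survives_def)
  have cs: "icpt_coef a (True, True) False = a $ 2" "icpt_coef a (True, True) True = a $ 4" "icpt_coef a (True, False) False = a $ 6" "icpt_coef a (False, True) True = a $ 8"
    "slope_coef a (True, True) False = a $ 1" "slope_coef a (True, True) True = a $ 3" "slope_coef a (True, False) False = a $ 5" "slope_coef a (False, True) True = a $ 7"
    "prob_coef a (True, True) = a $ 9" "prob_coef a (True, False) = a $ 10" "prob_coef a (False, True) = a $ 11" "prob_coef a (False, False) = 0"
    by (simp_all add: icpt_coef_def slope_coef_def prob_coef_def)
  have inv: "p * inverse p = 1" "p0 * inverse p0 = 1" "p1 * inverse p1 = 1" "d * inverse d = 1" using pos by auto
  show ?thesis
    unfolding sum_bool_pair lin_mean lin_explicit lim_slope_def lim_prob_def sum_bool_pair pr_eq sv cs of_bool_eq mult_1_left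
    unfolding cov_form_def Let_def d_def[symmetric] p_def[symmetric] p0_def[symmetric] p1_def[symmetric] r_def[symmetric]
      s_def[symmetric] s0_def[symmetric] s1_def[symmetric]
    unfolding divide_inverse mult_1_left piece2[OF inv(1) inv(4) r] piece1[OF inv(2) inv(4)] piece1[OF inv(3) inv(4)]
    unfolding zero_power2 mult_zero_right add_0_right diff_0 power2_minus mult.commute[of "mu1 P"]
    by (simp only: ac_simps)
qed

text \<open>The first root is the norming of the theorem, the second undoes \<open>scl\<close>;
  divided by the size of the class \<open>c\<close>, their product tends to
  \<open>1 / pr c\<close>.\<close>

definition size_ratio :: "bool \<times> bool \<Rightarrow> nat \<Rightarrow> nat \<Rightarrow> 'a \<Rightarrow> real" where
  "size_ratio c r l \<omega> = sqrt (nT (l + r) \<omega>) * sqrt (norm_c r * N1 l \<omega>) / tree_total (moment_fun c 0) (l + r) \<omega>"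

definition emp_const :: "real ^ 11 \<Rightarrow> bool \<times> bool \<Rightarrow> bool \<Rightarrow> nat \<Rightarrow> nat \<Rightarrow> 'a \<Rightarrow> real" where
  "emp_const a c \<delta> r l \<omega> = of_bool (survives c \<delta>) * (size_ratio c r l \<omega> * ((icpt_coef a c \<delta> * mean2 c (l + r) \<omega> - slope_coef a c \<delta> * mean1 c (l + r) \<omega>) / var2 c (l + r) \<omega>))"

definition emp_slope :: "real ^ 11 \<Rightarrow> bool \<times> bool \<Rightarrow> bool \<Rightarrow> nat \<Rightarrow> nat \<Rightarrow> 'a \<Rightarrow> real" where
  "emp_slope a c \<delta> r l \<omega> = of_bool (survives c \<delta>) * (size_ratio c r l \<omega> * ((slope_coef a c \<delta> - icpt_coef a c \<delta> * mean1 c (l + r) \<omega>) / var2 c (l + r) \<omega>))"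

definition emp_prob :: "real ^ 11 \<Rightarrow> bool \<times> bool \<Rightarrow> nat \<Rightarrow> nat \<Rightarrow> 'a \<Rightarrow> real" where
  "emp_prob a c r l \<omega> = prob_coef a c * (sqrt (norm_c r * N1 l \<omega>) / sqrt (nT (l + r) \<omega>))"

text \<open>Excludes the default cases: every quotient occurring in the estimators of surviving
  patterns and in the norming is then genuine.\<close>

definition good :: "nat \<Rightarrow> nat \<Rightarrow> 'a \<Rightarrow> bool" where
  "good r l \<omega> \<longleftrightarrow> N1 (l + r) \<omega> > 0 \<and> N1 l \<omega> > 0 \<and> nT (l + r) \<omega> > 0 \<and>
     (\<forall>c\<in>UNIV - {(False, False)}. tree_total (moment_fun c 0) (l + r) \<omega> \<noteq> 0 \<and> var2 c (l + r) \<omega> \<noteq> 0)"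

lemma measurable_N1 [measurable]: "N1 k \<in> borel_measurable M"
  by (rule measurable_S) measurable

lemma measurable_coefs [measurable]: "emp_const a c \<delta> r l \<in> borel_measurable M" "emp_slope a c \<delta> r l \<in> borel_measurable M" "emp_prob a c r l \<in> borel_measurable M"
  unfolding emp_const_def emp_slope_def emp_prob_def size_ratio_def by measurable

lemma measurable_good [measurable]: "Measurable.pred M (good r l)"
  unfolding good_def by measurable

text \<open>Numerators and denominators are divided by the same power of \<open>m\<close>; their
  limits share the factor \<open>L = W * m / (m - 1)\<close>, which cancels and leaves deterministic
  coefficients.\<close>

lemma AE_coef_limit:
  "AE \<omega> in M. pop_limit P X \<omega> \<noteq> 0 \<longrightarrow> (\<forall>c \<delta>. (\<lambda>l. emp_const a c \<delta> r l \<omega>) \<longlonglongrightarrow> lim_const a c \<delta> \<and> (\<lambda>l. emp_slope a c \<delta> r l \<omega>) \<longlonglongrightarrow> lim_slope a c \<delta>) \<and>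
     (\<forall>c. (\<lambda>l. emp_prob a c r l \<omega>) \<longlonglongrightarrow> prob_coef a c) \<and> (\<forall>\<^sub>F l in sequentially. good r l \<omega>)"
  using AE_tree_total_moment AE_pop_limit AE_pop_limit_nonneg
proof eventually_elim
  case (elim \<omega>)
  show ?case
  proof
    assume "pop_limit P X \<omega> \<noteq> 0"
    define W where "W = pop_limit P X \<omega>"
    define L where "L = W * m / (m - 1)"
    have W: "W > 0" using \<open>pop_limit P X \<omega> \<noteq> 0\<close> elim(3) by (simp add: W_def)
    then have L: "L > 0" using m_gt_1 by (simp add: L_def)
    have fxl: "(\<lambda>n. tree_total (moment_fun c j) n \<omega> / m ^ n) \<longlonglongrightarrow> pr c * limit_moment j * L" if "j \<le> 2" for c j
      using elim(1) that unfolding L_def W_def by blast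
    have "(\<lambda>n. \<Sum>c\<in>UNIV. tree_total (moment_fun c 0) n \<omega> / m ^ n) \<longlonglongrightarrow> (\<Sum>c\<in>UNIV. pr c * limit_moment 0 * L)"
      by (intro tendsto_sum fxl) simp
    then have T: "(\<lambda>n. nT n \<omega> / m ^ n) \<longlonglongrightarrow> L"
      unfolding sum_divide_distrib[symmetric] tree_total_one sum_distrib_right[symmetric] pmf_sum_1 by (simp add: limit_moment_def)
    have N: "(\<lambda>l. N1 l \<omega> / m ^ l) \<longlonglongrightarrow> W" using elim(2) unfolding pop_ratio_eq W_def .
    have cN: "norm_c r * N1 l \<omega> / m ^ (l + r) = N1 l \<omega> / m ^ l * m / (m - 1)" for l
      by (simp add: norm_c_def power_add mult.commute)
    have cNl: "(\<lambda>l. norm_c r * N1 l \<omega> / m ^ (l + r)) \<longlonglongrightarrow> L"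
      unfolding cN L_def using m_gt_1 by (intro tendsto_intros N) auto
    note sh = LIMSEQ_ignore_initial_segment[where k = r]
    have mean: "(\<lambda>n. mean1 c n \<omega>) \<longlonglongrightarrow> mu1 P" "(\<lambda>n. mean2 c n \<omega>) \<longlonglongrightarrow> mu2 P" "(\<lambda>n. var2 c n \<omega>) \<longlonglongrightarrow> dd"
      if c: "c \<noteq> (False, False)" for c
    proof -
      have p: "pr c * L \<noteq> 0" using pr_pos[OF c] L by simp
      have q: "(\<lambda>n. (tree_total (moment_fun c j) n \<omega> / m ^ n) / (tree_total (moment_fun c 0) n \<omega> / m ^ n)) \<longlonglongrightarrow> (pr c * limit_moment j * L) / (pr c * limit_moment 0 * L)" if "j \<le> 2" for j
        by (intro tendsto_divide fxl that) (use p in \<open>auto simp: limit_moment_def\<close>)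
      show m1: "(\<lambda>n. mean1 c n \<omega>) \<longlonglongrightarrow> mu1 P" using q[of 1] p by (simp add: mean1_def limit_moment_def)
      show m2: "(\<lambda>n. mean2 c n \<omega>) \<longlonglongrightarrow> mu2 P" using q[of 2] p by (simp add: mean2_def limit_moment_def)
      show "(\<lambda>n. var2 c n \<omega>) \<longlonglongrightarrow> dd" unfolding var2_def by (intro tendsto_intros m1 m2)
    qed
    have sq: "sqrt (x / m ^ n) = sqrt x / sqrt (m ^ n)" for x n by (rule real_sqrt_divide)
    have rtl: "(\<lambda>l. size_ratio c r l \<omega>) \<longlonglongrightarrow> 1 / pr c" if c: "c \<noteq> (False, False)" for c
    proof -
      have "(\<lambda>l. sqrt (nT (l + r) \<omega> / m ^ (l + r)) * sqrt (norm_c r * N1 l \<omega> / m ^ (l + r)) / (tree_total (moment_fun c 0) (l + r) \<omega> / m ^ (l + r)))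
        \<longlonglongrightarrow> sqrt L * sqrt L / (pr c * limit_moment 0 * L)"
        using pr_pos[OF c] L by (intro tendsto_divide tendsto_mult tendsto_real_sqrt sh[OF T] cNl sh[OF fxl]) (auto simp: limit_moment_def)
      moreover have "sqrt (nT (l + r) \<omega> / m ^ (l + r)) * sqrt (norm_c r * N1 l \<omega> / m ^ (l + r)) / (tree_total (moment_fun c 0) (l + r) \<omega> / m ^ (l + r)) = size_ratio c r l \<omega>" for l
      proof -
        have "A / s * (B / s) / (C / (s * s)) = A * B / C" if "s > 0" for A B C s :: real using that by (simp add: field_simps)
        from this[of "sqrt (m ^ (l + r))"] show ?thesis unfolding size_ratio_def sq by simp
      qed
      ultimately show ?thesis using L by (simp add: limit_moment_def)
    qed
    have "(\<lambda>l. emp_const a c \<delta> r l \<omega>) \<longlonglongrightarrow> lim_const a c \<delta> \<and> (\<lambda>l. emp_slope a c \<delta> r l \<omega>) \<longlonglongrightarrow> lim_slope a c \<delta>" for c \<delta>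
    proof (cases "survives c \<delta>")
      case True
      note c = survives_alive[OF True]
      show ?thesis
        unfolding emp_const_def lim_const_def emp_slope_def lim_slope_def using variance_pos
        by (intro conjI tendsto_mult tendsto_divide tendsto_diff tendsto_const rtl[OF c] sh[OF mean(1)[OF c]] sh[OF mean(2)[OF c]] sh[OF mean(3)[OF c]]) simp_all
    qed (simp_all add: emp_const_def lim_const_def emp_slope_def lim_slope_def)
    moreover have "(\<lambda>l. emp_prob a c r l \<omega>) \<longlonglongrightarrow> prob_coef a c" for c
    proof -
      have "(\<lambda>l. prob_coef a c * (sqrt (norm_c r * N1 l \<omega> / m ^ (l + r)) / sqrt (nT (l + r) \<omega> / m ^ (l + r)))) \<longlonglongrightarrow> prob_coef a c * (sqrt L / sqrt L)"
        using L by (intro tendsto_divide tendsto_mult tendsto_const tendsto_real_sqrt sh[OF T] cNl) auto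
      then show ?thesis using L unfolding emp_prob_def sq by simp
    qed
    moreover have "\<forall>\<^sub>F l in sequentially. good r l \<omega>"
    proof -
      have ev: "\<forall>\<^sub>F l in sequentially. f (l + r) > 0" if "(\<lambda>n. f n / m ^ n) \<longlonglongrightarrow> z" "z > 0" for f :: "nat \<Rightarrow> real" and z
        using order_tendstoD(1)[OF sh[OF that(1)] that(2)] by eventually_elim (simp only: pos_less_divide_eq zero_less_power m_pos mult_zero_left)
      have N1: "\<forall>\<^sub>F l in sequentially. N1 l \<omega> > 0"
        using order_tendstoD(1)[OF N W] by eventually_elim (simp only: pos_less_divide_eq zero_less_power m_pos mult_zero_left)
      have V: "\<forall>\<^sub>F l in sequentially. tree_total (moment_fun c 0) (l + r) \<omega> \<noteq> 0 \<and> var2 c (l + r) \<omega> \<noteq> 0" if "c \<in> UNIV - {(False, False)}" for c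
      proof -
        have c: "c \<noteq> (False, False)" using that by simp
        have "pr c * limit_moment 0 * L > 0" using pr_pos[OF c] L by (simp add: limit_moment_def)
        from ev[OF fxl[OF le0] this] order_tendstoD(1)[OF sh[OF mean(3)[OF c]] variance_pos] show ?thesis by eventually_elim auto
      qed
      have "\<forall>\<^sub>F l in sequentially. \<forall>c\<in>UNIV - {(False, False)}. tree_total (moment_fun c 0) (l + r) \<omega> \<noteq> 0 \<and> var2 c (l + r) \<omega> \<noteq> 0"
        by (rule eventually_ball_finite) (use V in auto)
      with ev[OF N W] N1 ev[OF T L] show ?thesis unfolding good_def by eventually_elim blast
    qed
    ultimately show "(\<forall>c \<delta>. (\<lambda>l. emp_const a c \<delta> r l \<omega>) \<longlonglongrightarrow> lim_const a c \<delta> \<and> (\<lambda>l. emp_slope a c \<delta> r l \<omega>) \<longlonglongrightarrow> lim_slope a c \<delta>) \<and>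
       (\<forall>c. (\<lambda>l. emp_prob a c r l \<omega>) \<longlonglongrightarrow> prob_coef a c) \<and> (\<forall>\<^sub>F l in sequentially. good r l \<omega>)" by blast
  qed
qed

abbreviation "lim_score a \<equiv> score_fun (lim_const a) (lim_slope a) (lim_prob a)"

text \<open>An exact identity and not an expansion: the only error is that of the coefficients, each
  multiplied by a normalised martingale sum, which is the form that \<open>Slutsky_remainder\<close>
  treats.\<close>

lemma linearization:
  assumes g: "good r l \<omega>"
  shows "a \<bullet> Zn (l + r) \<omega> - scl (norm_c r) l \<omega> * tree_total (lim_score a) (l + r) \<omega> =
    (\<Sum>c\<in>UNIV. (\<Sum>\<delta>\<in>UNIV. (emp_const a c \<delta> r l \<omega> - lim_const a c \<delta>) * (scl (norm_c r) l \<omega> * tree_total (residual_fun c \<delta> 0) (l + r) \<omega>)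
        + (emp_slope a c \<delta> r l \<omega> - lim_slope a c \<delta>) * (scl (norm_c r) l \<omega> * tree_total (residual_fun c \<delta> 1) (l + r) \<omega>))
      + (emp_prob a c r l \<omega> - prob_coef a c) * (scl (norm_c r) l \<omega> * tree_total (pattern_fun c) (l + r) \<omega>))"
proof -
  let ?n = "l + r" and ?s = "scl (norm_c r) l \<omega>"
  let ?S = "\<lambda>u w k. (\<Sum>c\<in>UNIV. (\<Sum>\<delta>\<in>UNIV. u c \<delta> * (?s * tree_total (residual_fun c \<delta> 0) ?n \<omega>) + w c \<delta> * (?s * tree_total (residual_fun c \<delta> 1) ?n \<omega>)) + k c * (?s * tree_total (pattern_fun c) ?n \<omega>))"
  have G: "N1 ?n \<omega> > 0" "N1 l \<omega> > 0" "nT ?n \<omega> > 0"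
    and V: "\<And>c. c \<noteq> (False, False) \<Longrightarrow> tree_total (moment_fun c 0) ?n \<omega> \<noteq> 0" "\<And>c. c \<noteq> (False, False) \<Longrightarrow> var2 c ?n \<omega> \<noteq> 0"
    using g by (auto simp: good_def)
  have s1: "sqrt (norm_c r * N1 l \<omega>) * ?s = 1" using G norm_c_pos[of r] by (simp add: scl_def)
  have "lim_score a = (\<lambda>x v. \<Sum>c\<in>UNIV. (\<Sum>\<delta>\<in>UNIV. lim_const a c \<delta> * residual_fun c \<delta> 0 x v + lim_slope a c \<delta> * residual_fun c \<delta> 1 x v) + prob_coef a c * pattern_fun c x v)"
    by (intro HOL.ext) (rule score_fun_decomp, rule lim_prob_def)
  then have "tree_total (lim_score a) ?n \<omega> = (\<Sum>c\<in>UNIV. (\<Sum>\<delta>\<in>UNIV. lim_const a c \<delta> * tree_total (residual_fun c \<delta> 0) ?n \<omega> + lim_slope a c \<delta> * tree_total (residual_fun c \<delta> 1) ?n \<omega>) + prob_coef a c * tree_total (pattern_fun c) ?n \<omega>)"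
    by (simp only: tree_total_sum tree_total_linear)
  then have S: "?s * tree_total (lim_score a) ?n \<omega> = ?S (lim_const a) (lim_slope a) (prob_coef a)"
    by (simp add: sum_distrib_left distrib_left mult.left_commute)
  have 1: "sqrt (nT ?n \<omega>) * (of_bool (survives c \<delta>) *
      (slope_coef a c \<delta> * (slope_est (xs \<omega>) \<delta> (tree_case c (xs \<omega>) ?n) - slope P c \<delta>)
       + icpt_coef a c \<delta> * (intercept_est (xs \<omega>) \<delta> (tree_case c (xs \<omega>) ?n) - icpt P c \<delta>)))
    = emp_const a c \<delta> r l \<omega> * (?s * tree_total (residual_fun c \<delta> 0) ?n \<omega>) + emp_slope a c \<delta> r l \<omega> * (?s * tree_total (residual_fun c \<delta> 1) ?n \<omega>)" for c \<delta>
  proof (cases "survives c \<delta>")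
    case True
    have "A * (E0 / N * U + E1 / N * U') = A * B / N * U * (s * E0) + A * B / N * U' * (s * E1)" if "B * s = 1" for A B E0 E1 N s U U' :: real
    proof -
      have "A * B / N * U * (s * E0) + A * B / N * U' * (s * E1) = (B * s) * (A * (E0 / N * U + E1 / N * U'))" by (simp add: algebra_simps)
      then show ?thesis using that by simp
    qed
    note K = this[OF s1]
    show ?thesis
      unfolding estimation_error[OF True V(1)[OF survives_alive[OF True]] V(2)[OF survives_alive[OF True]]] emp_const_def emp_slope_def size_ratio_def
        of_bool_def if_P[OF True] mult_1_left
      by (rule K)
  qed (simp add: emp_const_def emp_slope_def)
  have 2: "sqrt (nT ?n \<omega>) * (prob_coef a c * (tree_total (moment_fun c 0) ?n \<omega> / nT ?n \<omega> - pr c)) = emp_prob a c r l \<omega> * (?s * tree_total (pattern_fun c) ?n \<omega>)" for c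
  proof -
    have "pattern_fun c = (\<lambda>x v. moment_fun c 0 x v - pr c * 1)" by (intro HOL.ext) (simp add: pattern_fun_def moment_fun_def)
    then have "tree_total (pattern_fun c) ?n \<omega> = tree_total (moment_fun c 0) ?n \<omega> - pr c * nT ?n \<omega>" by (simp only: tree_total_linear)
    moreover have "A * (p * (N / T - q)) = p * (B / A) * (s * (N - q * T))" if "B * s = 1" "A * A = T" "A > 0" for A B N T p q s :: real
    proof -
      have "p * (B / A) * (s * (N - q * T)) = (B * s) * (p * (N - q * (A * A)) / A)" using that by simp
      also have "\<dots> = A * (p * (N / (A * A) - q))" unfolding that(1) mult_1_left using that(3) by (simp add: field_simps)
      finally show ?thesis using that by simp
    qed
    from this[OF s1, of "sqrt (nT ?n \<omega>)"] have "sqrt (nT ?n \<omega>) * (prob_coef a c * (tree_total (moment_fun c 0) ?n \<omega> / nT ?n \<omega> - pr c))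
       = prob_coef a c * (sqrt (norm_c r * N1 l \<omega>) / sqrt (nT ?n \<omega>)) * (?s * (tree_total (moment_fun c 0) ?n \<omega> - pr c * nT ?n \<omega>))"
      using G by simp
    ultimately show ?thesis unfolding emp_prob_def by simp
  qed
  have Z: "a \<bullet> Zn ?n \<omega> = ?S (\<lambda>c \<delta>. emp_const a c \<delta> r l \<omega>) (\<lambda>c \<delta>. emp_slope a c \<delta> r l \<omega>) (\<lambda>c. emp_prob a c r l \<omega>)"
    unfolding inner_Zn inner_theta 1[symmetric] 2[symmetric] using G(1) by (simp only: sum_distrib_left distrib_left of_bool_eq mult_1)
  show ?thesis
    unfolding S Z sum_subtractf[symmetric] by (simp add: left_diff_distrib sum_subtractf sum.distrib)
qed

end

section \<open>Convergence in law\<close>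

lemma cmod_iexp_diff: "cmod (iexp x - iexp y) \<le> min 2 \<bar>x - y\<bar>"
proof -
  have "iexp x - iexp y = iexp y * (iexp (x - y) - 1)"
    by (simp add: exp_diff algebra_simps)
  then have "cmod (iexp x - iexp y) = cmod (iexp (x - y) - 1)" by (simp add: norm_mult)
  also have "\<dots> \<le> \<bar>x - y\<bar>" using iexp_approx1[of "x - y" 0] by simp
  finally show ?thesis using norm_triangle_ineq4[of "iexp x" "iexp y"] by simp
qed

text \<open>Truncation at a nonnegative level keeps the modulus subadditive, so a remainder can be
  split term by term.\<close>

lemma min_abs_sum_le:
  fixes f :: "'i \<Rightarrow> real"
  assumes "finite A" "c \<ge> 0" shows "min c \<bar>\<Sum>i\<in>A. f i\<bar> \<le> (\<Sum>i\<in>A. min c \<bar>f i\<bar>)"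
  using assms(1)
proof induction
  case empty then show ?case using assms(2) by simp
next
  case (insert x F)
  have "min c \<bar>u + v\<bar> \<le> min c \<bar>u\<bar> + min c \<bar>v\<bar>" for u v :: real using assms(2) by (auto simp: min_def)
  from order_trans[OF this add_left_mono[OF insert.IH]] show ?case using insert by simp
qed

context bar_full
begin

text \<open>Complex exponentials differ by at most the truncated distance of their arguments, and
  \<open>linearization\<close> splits this distance into finitely many Slutsky terms.\<close>

lemma remainder_limit:
  assumes \<delta>: "\<delta> > 0"
  shows "(\<lambda>l. \<integral>\<omega>. indicator (Ev \<delta> l) \<omega> * cmod (iexp (a \<bullet> Zn (l + r) \<omega>) - \<Theta> (lim_score a) (norm_c r) l (l + Suc r) \<omega>) \<partial>M) \<longlonglongrightarrow> 0"
proof -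
  define b where "b = (\<lambda>f d l \<omega>. indicator (Ev \<delta> l) \<omega> * min 2 (\<bar>d l \<omega>\<bar> * \<bar>scl (norm_c r) l \<omega> * tree_total f (l + r) \<omega>\<bar>) :: real)"
  define du where "du = (\<lambda>c \<delta> l \<omega>. emp_const a c \<delta> r l \<omega> - lim_const a c \<delta>)"
  define dw where "dw = (\<lambda>c \<delta> l \<omega>. emp_slope a c \<delta> r l \<omega> - lim_slope a c \<delta>)"
  define dp where "dp = (\<lambda>c l \<omega>. emp_prob a c r l \<omega> - prob_coef a c)"
  \<comment> \<open>Covers the realisations outside \<open>good\<close>, where only the trivial
    bound 2 is available. On \<open>Ev \<delta> l\<close> they disappear in the limit.\<close>
  define n where "n = (\<lambda>l \<omega>. indicator (Ev \<delta> l) \<omega> * (2 * of_bool (\<not> good r l \<omega>)) :: real)"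
  define R where "R = (\<lambda>l \<omega>. (\<Sum>c\<in>UNIV. (\<Sum>\<delta>\<in>UNIV. b (residual_fun c \<delta> 0) (du c \<delta>) l \<omega> + b (residual_fun c \<delta> 1) (dw c \<delta>) l \<omega>) + b (pattern_fun c) (dp c) l \<omega>) + n l \<omega>)"
  have [measurable]: "du c \<delta> l \<in> borel_measurable M" "dw c \<delta> l \<in> borel_measurable M" "dp c l \<in> borel_measurable M" for c \<delta> l
    unfolding du_def dw_def dp_def by measurable
  have lim1: "AE \<omega> in M. pop_limit P X \<omega> \<noteq> 0 \<longrightarrow> (\<lambda>l. du c \<delta> l \<omega>) \<longlonglongrightarrow> 0" for c \<delta>
    using AE_coef_limit[of a r] unfolding du_def by eventually_elim (rule impI, rule LIM_zero, blast)
  have lim2: "AE \<omega> in M. pop_limit P X \<omega> \<noteq> 0 \<longrightarrow> (\<lambda>l. dw c \<delta> l \<omega>) \<longlonglongrightarrow> 0" for c \<delta>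
    using AE_coef_limit[of a r] unfolding dw_def by eventually_elim (rule impI, rule LIM_zero, blast)
  have lim3: "AE \<omega> in M. pop_limit P X \<omega> \<noteq> 0 \<longrightarrow> (\<lambda>l. dp c l \<omega>) \<longlonglongrightarrow> 0" for c
    using AE_coef_limit[of a r] unfolding dp_def by eventually_elim (rule impI, rule LIM_zero, blast)
  have bl: "integrable M (b f d l)" "(\<lambda>l. \<integral>\<omega>. b f d l \<omega> \<partial>M) \<longlonglongrightarrow> 0"
    if f: "\<exists>C. mdiff C f" and [measurable]: "\<And>l. d l \<in> borel_measurable M" and lim: "AE \<omega> in M. pop_limit P X \<omega> \<noteq> 0 \<longrightarrow> (\<lambda>l. d l \<omega>) \<longlonglongrightarrow> 0" for f d l
  proof -
    obtain C where C: "mdiff C f" using f by blast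
    then have [measurable]: "tree_total f k \<in> borel_measurable M" for k by (intro measurable_tree_total) (simp add: mdiff_def)
    show "integrable M (b f d l)"
      unfolding b_def by (rule integrable_const_bound[of _ 2]) (auto simp: indicator_def)
    show "(\<lambda>l. \<integral>\<omega>. b f d l \<omega> \<partial>M) \<longlonglongrightarrow> 0"
      unfolding b_def by (rule Slutsky_remainder[OF C _ lim norm_c_pos \<delta>]) measurable
  qed
  note fe0 = residual_fun_mdiff[of 0, OF zero_le_one] and fe1 = residual_fun_mdiff[of 1, OF order_refl]
  note b0 = bl[OF fe0 _ lim1] and b1 = bl[OF fe1 _ lim2] and bp = bl[OF pattern_fun_mdiff _ lim3]
  have nI: "integrable M (n l)" for l
    unfolding n_def by (rule integrable_const_bound[of _ 2]) (auto simp: indicator_def)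
  have nl: "(\<lambda>l. \<integral>\<omega>. n l \<omega> \<partial>M) \<longlonglongrightarrow> (\<integral>\<omega>. 0 \<partial>M)"
  proof (rule integral_dominated_convergence[where w = "\<lambda>_. 2"])
    show "AE \<omega> in M. (\<lambda>l. n l \<omega>) \<longlonglongrightarrow> 0"
      using AE_coef_limit[of a r] AE_Ev_extinct[OF \<delta>]
    proof eventually_elim
      case (elim \<omega>)
      have "\<forall>\<^sub>F l in sequentially. n l \<omega> = 0"
      proof (cases "pop_limit P X \<omega> = 0")
        case True then have "\<forall>\<^sub>F l in sequentially. \<omega> \<notin> Ev \<delta> l \<and> N1 l \<omega> = 0" using elim(2) by blast
        then show ?thesis by eventually_elim (simp add: n_def)
      next
        case False then have "\<forall>\<^sub>F l in sequentially. good r l \<omega>" using elim(1) by blast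
        then show ?thesis by eventually_elim (simp add: n_def)
      qed
      then show ?case by (rule tendsto_eventually)
    qed
  qed (auto simp: n_def indicator_def)
  have RI: "integrable M (R l)" for l
    unfolding R_def by (intro Bochner_Integration.integrable_add Bochner_Integration.integrable_sum b0(1) b1(1) bp(1) nI) measurable
  have "(\<integral>\<omega>. R l \<omega> \<partial>M) = (\<Sum>c\<in>UNIV. (\<Sum>\<delta>\<in>UNIV. (\<integral>\<omega>. b (residual_fun c \<delta> 0) (du c \<delta>) l \<omega> \<partial>M) + (\<integral>\<omega>. b (residual_fun c \<delta> 1) (dw c \<delta>) l \<omega> \<partial>M)) + (\<integral>\<omega>. b (pattern_fun c) (dp c) l \<omega> \<partial>M)) + (\<integral>\<omega>. n l \<omega> \<partial>M)" for l
  proof -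
    have i0: "integrable M (\<lambda>\<omega>. b (residual_fun c \<delta> 0) (du c \<delta>) l \<omega>)" for c \<delta> by (rule b0(1)) measurable
    have i1: "integrable M (\<lambda>\<omega>. b (residual_fun c \<delta> 1) (dw c \<delta>) l \<omega>)" for c \<delta> by (rule b1(1)) measurable
    have ip: "integrable M (\<lambda>\<omega>. b (pattern_fun c) (dp c) l \<omega>)" for c by (rule bp(1)) measurable
    show ?thesis
      unfolding R_def using i0 i1 ip nI
      by (simp only: Bochner_Integration.integral_add Bochner_Integration.integral_sum Bochner_Integration.integrable_add Bochner_Integration.integrable_sum)
  qed
  moreover have "(\<lambda>l. (\<Sum>c\<in>UNIV. (\<Sum>\<delta>\<in>UNIV. (\<integral>\<omega>. b (residual_fun c \<delta> 0) (du c \<delta>) l \<omega> \<partial>M) + (\<integral>\<omega>. b (residual_fun c \<delta> 1) (dw c \<delta>) l \<omega> \<partial>M)) + (\<integral>\<omega>. b (pattern_fun c) (dp c) l \<omega> \<partial>M)) + (\<integral>\<omega>. n l \<omega> \<partial>M))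
     \<longlonglongrightarrow> (\<Sum>c\<in>(UNIV :: (bool \<times> bool) set). (\<Sum>\<delta>\<in>(UNIV :: bool set). 0 + 0) + 0) + (\<integral>\<omega>. 0 \<partial>M)"
    by (intro tendsto_add tendsto_sum b0(2) b1(2) bp(2) nl) measurable
  ultimately have Rl: "(\<lambda>l. \<integral>\<omega>. R l \<omega> \<partial>M) \<longlonglongrightarrow> 0" by simp
  have [measurable]: "tree_total (lim_score a) k \<in> borel_measurable M" for k by (rule measurable_tree_total[OF measurable_score_fun])
  note [measurable] = measurable_Zn
  have \<Theta>: "\<Theta> (lim_score a) (norm_c r) l (l + Suc r) \<omega> = iexp (scl (norm_c r) l \<omega> * tree_total (lim_score a) (l + r) \<omega>)" for l \<omega>
    unfolding \<Theta>_def tree_total_def add_Suc_right ..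
  have b0': "b f d l \<omega> \<ge> 0" for f d l \<omega> by (simp add: b_def)
  have le: "indicator (Ev \<delta> l) \<omega> * cmod (iexp (a \<bullet> Zn (l + r) \<omega>) - \<Theta> (lim_score a) (norm_c r) l (l + Suc r) \<omega>) \<le> R l \<omega>" for l \<omega>
  proof (cases "\<omega> \<in> Ev \<delta> l")
    case False then show ?thesis by (simp add: R_def b_def n_def)
  next
    case True
    let ?V = "\<lambda>f. scl (norm_c r) l \<omega> * tree_total f (l + r) \<omega>"
    let ?y = "a \<bullet> Zn (l + r) \<omega> - ?V (lim_score a)"
    have m: "cmod (iexp (a \<bullet> Zn (l + r) \<omega>) - \<Theta> (lim_score a) (norm_c r) l (l + Suc r) \<omega>) \<le> min 2 \<bar>?y\<bar>"
      unfolding \<Theta> by (rule cmod_iexp_diff)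
    show ?thesis
    proof (cases "good r l \<omega>")
      case False
      have "R l \<omega> \<ge> n l \<omega>" unfolding R_def by (simp add: sum_nonneg b0')
      also have "n l \<omega> = 2" using True False by (simp add: n_def)
      finally show ?thesis using m True by simp
    next
      case good: True
      have t2: "min 2 \<bar>u + v\<bar> \<le> min 2 \<bar>u\<bar> + min 2 \<bar>v\<bar>" for u v :: real by (auto simp: min_def)
      have ms: "min 2 \<bar>\<Sum>i\<in>UNIV. f i\<bar> \<le> (\<Sum>i\<in>UNIV. min 2 \<bar>f i\<bar>)" for f :: "'i::finite \<Rightarrow> real" by (rule min_abs_sum_le) auto
      have bt: "min 2 \<bar>d l \<omega> * ?V f\<bar> = b f d l \<omega>" for f d using True by (simp add: b_def abs_mult)
      have "min 2 \<bar>?y\<bar> \<le> (\<Sum>c\<in>UNIV. (\<Sum>\<delta>\<in>UNIV. min 2 \<bar>du c \<delta> l \<omega> * ?V (residual_fun c \<delta> 0)\<bar> + min 2 \<bar>dw c \<delta> l \<omega> * ?V (residual_fun c \<delta> 1)\<bar>) + min 2 \<bar>dp c l \<omega> * ?V (pattern_fun c)\<bar>)"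
        unfolding linearization[OF good] du_def dw_def dp_def
        by (rule order_trans[OF ms], intro sum_mono order_trans[OF t2] add_mono order_refl,
            rule order_trans[OF ms], intro sum_mono t2)
      also have "\<dots> = R l \<omega>" unfolding bt R_def using good by (simp add: n_def)
      finally show ?thesis using order_trans[OF m] True by simp
    qed
  qed
  show ?thesis
  proof (rule tendsto_sandwich[OF _ _ tendsto_const Rl]; intro always_eventually allI)
    fix l
    show "0 \<le> (\<integral>\<omega>. indicator (Ev \<delta> l) \<omega> * cmod (iexp (a \<bullet> Zn (l + r) \<omega>) - \<Theta> (lim_score a) (norm_c r) l (l + Suc r) \<omega>) \<partial>M)"
      by (intro integral_nonneg_AE AE_I2) simp
    show "(\<integral>\<omega>. indicator (Ev \<delta> l) \<omega> * cmod (iexp (a \<bullet> Zn (l + r) \<omega>) - \<Theta> (lim_score a) (norm_c r) l (l + Suc r) \<omega>) \<partial>M) \<le> (\<integral>\<omega>. R l \<omega> \<partial>M)"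
    proof (rule integral_mono[OF _ RI le])
      show "integrable M (\<lambda>\<omega>. indicator (Ev \<delta> l) \<omega> * cmod (iexp (a \<bullet> Zn (l + r) \<omega>) - \<Theta> (lim_score a) (norm_c r) l (l + Suc r) \<omega>))"
      proof (rule Bochner_Integration.integrable_bound[OF RI[of l]])
        show "(\<lambda>\<omega>. indicator (Ev \<delta> l) \<omega> * cmod (iexp (a \<bullet> Zn (l + r) \<omega>) - \<Theta> (lim_score a) (norm_c r) l (l + Suc r) \<omega>)) \<in> borel_measurable M"
          unfolding \<Theta> by measurable
        show "AE \<omega> in M. norm (indicator (Ev \<delta> l) \<omega> * cmod (iexp (a \<bullet> Zn (l + r) \<omega>) - \<Theta> (lim_score a) (norm_c r) l (l + Suc r) \<omega>)) \<le> norm (R l \<omega>)"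
        proof (intro AE_I2)
          fix \<omega>
          have "0 \<le> indicator (Ev \<delta> l) \<omega> * cmod (iexp (a \<bullet> Zn (l + r) \<omega>) - \<Theta> (lim_score a) (norm_c r) l (l + Suc r) \<omega>)" by simp
          then show "norm (indicator (Ev \<delta> l) \<omega> * cmod (iexp (a \<bullet> Zn (l + r) \<omega>) - \<Theta> (lim_score a) (norm_c r) l (l + Suc r) \<omega>)) \<le> norm (R l \<omega>)"
            using le[of l \<omega>] unfolding real_norm_def by linarith
        qed
      qed
    qed
  qed
qed

text \<open>The events decrease to the empty set as the level tends to 0. Their probability bounds
  what the cut-off \<open>Ev \<delta> l\<close> misses in the limit.\<close>

lemma small_limit_prob:
  assumes "e > 0"
  shows "\<exists>\<delta>>0. prob {\<omega>\<in>space M. 0 < pop_limit P X \<omega> \<and> pop_limit P X \<omega> \<le> \<delta>} < e"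
proof -
  let ?A = "\<lambda>k. {\<omega>\<in>space M. 0 < pop_limit P X \<omega> \<and> pop_limit P X \<omega> \<le> 1 / real (Suc k)}"
  have "(\<lambda>k. prob (?A k)) \<longlonglongrightarrow> prob (\<Inter>k. ?A k)"
  proof (rule finite_Lim_measure_decseq)
    show "decseq ?A"
      unfolding decseq_def
    proof (intro allI impI subsetI)
      fix k l \<omega> assume kl: "k \<le> l" and w: "\<omega> \<in> ?A l"
      have "1 / real (Suc l) \<le> 1 / real (Suc k)" using kl by (simp add: frac_le)
      with w show "\<omega> \<in> ?A k" by (auto intro: order_trans)
    qed
  qed auto
  moreover have "(\<Inter>k. ?A k) = {}"
  proof (intro equals0I)
    fix \<omega> assume w: "\<omega> \<in> (\<Inter>k. ?A k)"
    then have "0 < pop_limit P X \<omega>" by simp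
    then obtain k where "1 / real (Suc k) < pop_limit P X \<omega>" using nat_approx_posE by blast
    then show False using w by (auto dest: spec[of _ k])
  qed
  ultimately have "(\<lambda>k. prob (?A k)) \<longlonglongrightarrow> 0" by simp
  from order_tendstoD(2)[OF this assms] obtain k where "prob (?A k) < e" by (auto simp: eventually_sequentially)
  then show ?thesis by (intro exI[of _ "1 / real (Suc k)"]) simp
qed

text \<open>With \<open>\<delta>\<close> and then \<open>r\<close> fixed, the integral is split by
  \<open>Ev \<delta> l\<close>. On this event the linearised sum has the Gaussian limit; off it, up
  to small probability, the population is extinct, \<open>Zn\<close> is 0 and the exponential is
  1.\<close>

lemma char_limit:
  "(\<lambda>n. \<integral>\<omega>. iexp (a \<bullet> Zn n \<omega>) \<partial>M) \<longlonglongrightarrow> complex_of_real (prob {\<omega>\<in>space M. pop_limit P X \<omega> = 0}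
     + prob {\<omega>\<in>space M. pop_limit P X \<omega> \<noteq> 0} * exp (- cov_form P a / 2))"
proof (rule LIMSEQ_I)
  fix e' :: real assume e': "e' > 0"
  \<comment> \<open>The final budget is \<open>e + t + 2 * (w + u) + u\<close> with \<open>t\<close>
    and \<open>w\<close> below \<open>e\<close> and \<open>u\<close> below \<open>2 * e\<close>,
    altogether below \<open>10 * e\<close>; the divisor 13 leaves room.\<close>
  define e where "e = e' / 13"
  have e: "e > 0" using e' by (simp add: e_def)
  obtain C v0 v1 v2 where sc: "score C (lim_score a) v0 v1 v2"
    and q: "\<And>x. quad v0 v1 v2 x = (\<Sum>b\<in>UNIV. pr b * ((lim_prob a b)\<^sup>2 + (lin1 (lim_const a) b + lin1 (lim_slope a) b * x)\<^sup>2 + (lin2 (lim_const a) b + lin2 (lim_slope a) b * x)\<^sup>2))"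
    and v: "\<And>y z. v0 + v1 * y + v2 * z = (\<Sum>b\<in>UNIV. pr b * ((lim_prob a b)\<^sup>2 + (lin1 (lim_const a) b + lin1 (lim_slope a) b * y)\<^sup>2 + (lin2 (lim_const a) b + lin2 (lim_slope a) b * y)\<^sup>2
        + (z - y\<^sup>2) * ((lin1 (lim_slope a) b)\<^sup>2 + (lin2 (lim_slope a) b)\<^sup>2)))"
    using score_fun_score[OF lim_prob_mean] by blast
  have qn: "quad v0 v1 v2 x \<ge> 0" for x unfolding q by (intro sum_nonneg mult_nonneg_nonneg) auto
  have Q: "v0 + v1 * mu1 P + v2 * mu2 P = cov_form P a" unfolding v score_cov_form ..
  have cf: "cov_form P a \<ge> 0" unfolding Q[symmetric] v using variance_pos by (intro sum_nonneg mult_nonneg_nonneg add_nonneg_nonneg) auto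
  obtain \<delta> where \<delta>: "\<delta> > 0" and small: "prob {\<omega>\<in>space M. 0 < pop_limit P X \<omega> \<and> pop_limit P X \<omega> \<le> \<delta>} < e"
    using small_limit_prob[OF e] by blast
  let ?c = "exp (- cov_form P a / 2)"
  have c1: "0 \<le> ?c" "?c \<le> 1" using cf by auto
  obtain r where r: "\<forall>\<^sub>F l in sequentially. cmod ((\<integral>\<omega>. indicator (Ev \<delta> l) \<omega> * \<Theta> (lim_score a) (norm_c r) l (l + Suc r) \<omega> \<partial>M) - complex_of_real (?c * prob (Ev \<delta> l))) \<le> e"
    using eventually_happens[OF CLT_char[OF sc qn _ \<delta> e, unfolded Q, OF cf]] by auto
  let ?W = "\<lambda>\<omega>. of_bool (pop_limit P X \<omega> \<noteq> 0) :: real"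
  let ?E = "\<lambda>l \<omega>. indicator (Ev \<delta> l) \<omega> :: real"
  let ?N = "\<lambda>l \<omega>. of_bool (N1 (l + r) \<omega> > 0) :: real"
  let ?S = "{\<omega>\<in>space M. 0 < pop_limit P X \<omega> \<and> pop_limit P X \<omega> \<le> \<delta>}"
  have [measurable]: "(\<lambda>\<omega>. ?W \<omega>) \<in> borel_measurable M" "(\<lambda>\<omega>. ?N l \<omega>) \<in> borel_measurable M" for l unfolding of_bool_def by measurable
  \<comment> \<open>Both indicators approach that of \<open>W \<noteq> 0\<close>, but the cut-off
    one only away from the set \<open>?S\<close>, where \<open>0 < W \<le> \<delta>\<close>.\<close>
  have conv: "AE \<omega> in M. (\<forall>\<^sub>F l in sequentially. ?N l \<omega> = ?W \<omega>) \<and> (\<omega> \<notin> ?S \<longrightarrow> (\<forall>\<^sub>F l in sequentially. ?E l \<omega> = ?W \<omega>))"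
    using AE_coef_limit[of a r] AE_Ev_extinct[OF \<delta>] AE_pop_limit AE_pop_limit_nonneg AE_space
  proof eventually_elim
    case (elim \<omega>)
    show ?case
    proof (cases "pop_limit P X \<omega> = 0")
      case True
      then have ev: "\<forall>\<^sub>F l in sequentially. \<omega> \<notin> Ev \<delta> l \<and> N1 l \<omega> = 0" using elim(2) by blast
      then have "\<forall>\<^sub>F l in sequentially. \<omega> \<notin> Ev \<delta> (l + r) \<and> N1 (l + r) \<omega> = 0" by (rule eventually_sequentially_seg[THEN iffD2])
      then have "\<forall>\<^sub>F l in sequentially. ?N l \<omega> = ?W \<omega>" by eventually_elim (simp add: True)
      moreover from ev have "\<forall>\<^sub>F l in sequentially. ?E l \<omega> = ?W \<omega>" by eventually_elim (simp add: True)
      ultimately show ?thesis by blast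
    next
      case False
      then have g: "\<forall>\<^sub>F l in sequentially. good r l \<omega>" using elim(1) by blast
      then have "\<forall>\<^sub>F l in sequentially. ?N l \<omega> = ?W \<omega>" by eventually_elim (simp add: False good_def)
      moreover have "\<forall>\<^sub>F l in sequentially. ?E l \<omega> = ?W \<omega>" if "\<omega> \<notin> ?S"
      proof -
        have "\<delta> < pop_limit P X \<omega>" using that elim(4,5) False by force
        from order_tendstoD(1)[OF elim(3) this] show ?thesis
        proof eventually_elim
          case (elim l)
          then have "\<delta> * m ^ l \<le> N1 l \<omega>" unfolding pop_ratio_eq by (simp add: pos_less_divide_eq)
          then show ?case using \<open>\<omega> \<in> space M\<close> False by (simp add: Ev_def)
        qed
      qed
      ultimately show ?thesis by blast
    qed
  qed
  have bI: "integrable M f" if "f \<in> borel_measurable M" "\<And>\<omega>. \<bar>f \<omega>\<bar> \<le> 1" for f :: "'a \<Rightarrow> real"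
    by (rule integrable_const_bound[of _ 1]) (use that in auto)
  have wl: "(\<lambda>l. \<integral>\<omega>. \<bar>?N l \<omega> - ?W \<omega>\<bar> \<partial>M) \<longlonglongrightarrow> (\<integral>\<omega>. 0 \<partial>M)"
  proof (rule integral_dominated_convergence[where w = "\<lambda>_. 1"])
    show "AE \<omega> in M. (\<lambda>l. \<bar>?N l \<omega> - ?W \<omega>\<bar>) \<longlonglongrightarrow> 0"
      using conv by eventually_elim (rule tendsto_eventually, drule conjunct1, erule eventually_mono, simp)
  qed (auto simp: of_bool_def)
  have ul0: "(\<lambda>l. \<integral>\<omega>. (1 - indicator ?S \<omega>) * \<bar>?E l \<omega> - ?W \<omega>\<bar> \<partial>M) \<longlonglongrightarrow> (\<integral>\<omega>. 0 \<partial>M)"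
  proof (rule integral_dominated_convergence[where w = "\<lambda>_. 1"])
    show "AE \<omega> in M. (\<lambda>l. (1 - indicator ?S \<omega>) * \<bar>?E l \<omega> - ?W \<omega>\<bar>) \<longlonglongrightarrow> 0"
      using conv
    proof eventually_elim
      case (elim \<omega>)
      show ?case
      proof (cases "\<omega> \<in> ?S")
        case False
        then have "\<forall>\<^sub>F l in sequentially. ?E l \<omega> = ?W \<omega>" using elim by blast
        then show ?thesis by (intro tendsto_eventually) (erule eventually_mono, simp)
      qed simp
    qed
  qed (auto simp: of_bool_def indicator_def)
  define u where "u = (\<lambda>l. \<integral>\<omega>. \<bar>?E l \<omega> - ?W \<omega>\<bar> \<partial>M)"
  define w where "w = (\<lambda>l. \<integral>\<omega>. \<bar>?N l \<omega> - ?W \<omega>\<bar> \<partial>M)"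
  define t where "t = (\<lambda>l. \<integral>\<omega>. ?E l \<omega> * cmod (iexp (a \<bullet> Zn (l + r) \<omega>) - \<Theta> (lim_score a) (norm_c r) l (l + Suc r) \<omega>) \<partial>M)"
  have uI: "integrable M (\<lambda>\<omega>. \<bar>?E l \<omega> - ?W \<omega>\<bar>)" and wI: "integrable M (\<lambda>\<omega>. \<bar>?N l \<omega> - ?W \<omega>\<bar>)" for l
    by (rule bI; auto simp: indicator_def of_bool_def)+
  \<comment> \<open>On \<open>?S\<close> the difference of the indicators is merely bounded by 1;
    the small probability of \<open>?S\<close> pays for it, hence the later bound
    \<open>2 * e\<close> for \<open>u\<close>.\<close>
  have uS: "u l \<le> (\<integral>\<omega>. (1 - indicator ?S \<omega>) * \<bar>?E l \<omega> - ?W \<omega>\<bar> \<partial>M) + prob ?S" for l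
  proof -
    have S: "integrable M (\<lambda>\<omega>. (1 - indicator ?S \<omega>) * \<bar>?E l \<omega> - ?W \<omega>\<bar>)" "integrable M (indicator ?S :: 'a \<Rightarrow> real)"
      by (rule bI; auto simp: indicator_def of_bool_def)+
    have "u l \<le> (\<integral>\<omega>. (1 - indicator ?S \<omega>) * \<bar>?E l \<omega> - ?W \<omega>\<bar> + indicator ?S \<omega> \<partial>M)"
      unfolding u_def by (rule integral_mono[OF uI Bochner_Integration.integrable_add[OF S]]) (auto simp: indicator_def of_bool_def)
    then show ?thesis unfolding Bochner_Integration.integral_add[OF S] by (simp add: Int_def conj_commute)
  qed
  have "\<forall>\<^sub>F l in sequentially. w l < e" "\<forall>\<^sub>F l in sequentially. t l < e"
    using order_tendstoD(2)[OF wl, of e] order_tendstoD(2)[OF remainder_limit[OF \<delta>, of a r], of e] e unfolding w_def t_def by auto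
  moreover have "\<forall>\<^sub>F l in sequentially. u l < 2 * e"
  proof -
    have "\<forall>\<^sub>F l in sequentially. (\<integral>\<omega>. (1 - indicator ?S \<omega>) * \<bar>?E l \<omega> - ?W \<omega>\<bar> \<partial>M) < e"
      using order_tendstoD(2)[OF ul0, of e] e by simp
    then show ?thesis
    proof eventually_elim
      case (elim l) then show ?case using uS[of l] small by linarith
    qed
  qed
  ultimately have "\<forall>\<^sub>F l in sequentially. cmod ((\<integral>\<omega>. iexp (a \<bullet> Zn (l + r) \<omega>) \<partial>M) - complex_of_real (prob {\<omega>\<in>space M. pop_limit P X \<omega> = 0}
     + prob {\<omega>\<in>space M. pop_limit P X \<omega> \<noteq> 0} * ?c)) < e'"
    using r
  proof eventually_elim
    case (elim l)
    let ?Z = "\<lambda>\<omega>. iexp (a \<bullet> Zn (l + r) \<omega>)" and ?T = "\<lambda>\<omega>. \<Theta> (lim_score a) (norm_c r) l (l + Suc r) \<omega>"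
    note [measurable] = measurable_Zn measurable_D[OF measurable_score_fun]
    have [measurable]: "\<Theta> (lim_score a) (norm_c r) l k \<in> borel_measurable M" for k unfolding \<Theta>_def by measurable
    have icpt_coef: "integrable M f" if "f \<in> borel_measurable M" "\<And>\<omega>. cmod (f \<omega>) \<le> 2" for f :: "'a \<Rightarrow> complex"
      by (rule integrable_const_bound[of _ 2]) (use that in auto)
    have nT1: "cmod (?T \<omega>) = 1" for \<omega> by (simp add: \<Theta>_def)
    have d2: "cmod (?Z \<omega> - ?T \<omega>) \<le> 2" "cmod (?Z \<omega> - 1) \<le> 2" for \<omega>
      using norm_triangle_ineq4[of "?Z \<omega>" "?T \<omega>"] norm_triangle_ineq4[of "?Z \<omega>" 1] nT1 by auto
    have I1: "integrable M ?Z"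
    proof (rule icpt_coef)
      show "cmod (?Z \<omega>) \<le> 2" for \<omega> by simp
    qed measurable
    have I2: "integrable M (\<lambda>\<omega>. complex_of_real (?E l \<omega>) * ?T \<omega>)"
    proof (rule icpt_coef)
      show "cmod (complex_of_real (?E l \<omega>) * ?T \<omega>) \<le> 2" for \<omega>
        by (cases "\<omega> \<in> Ev \<delta> l") (use nT1[of \<omega>] in simp_all)
    qed measurable
    have I3: "integrable M (\<lambda>\<omega>. complex_of_real (?E l \<omega>) * (?Z \<omega> - ?T \<omega>))"
    proof (rule icpt_coef)
      show "cmod (complex_of_real (?E l \<omega>) * (?Z \<omega> - ?T \<omega>)) \<le> 2" for \<omega>
        by (cases "\<omega> \<in> Ev \<delta> l") (use d2(1)[of \<omega>] in simp_all)
    qed measurable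
    have I4: "integrable M (\<lambda>\<omega>. complex_of_real (1 - ?E l \<omega>))"
    proof (rule icpt_coef)
      show "cmod (complex_of_real (1 - ?E l \<omega>)) \<le> 2" for \<omega> by (cases "\<omega> \<in> Ev \<delta> l") simp_all
    qed measurable
    have I5: "integrable M (\<lambda>\<omega>. complex_of_real (1 - ?E l \<omega>) * (?Z \<omega> - 1))"
    proof (rule icpt_coef)
      show "cmod (complex_of_real (1 - ?E l \<omega>) * (?Z \<omega> - 1)) \<le> 2" for \<omega>
        by (cases "\<omega> \<in> Ev \<delta> l") (use d2(2)[of \<omega>] in simp_all)
    qed measurable
    have "(\<integral>\<omega>. ?Z \<omega> \<partial>M) = (\<integral>\<omega>. (complex_of_real (?E l \<omega>) * ?T \<omega> + complex_of_real (?E l \<omega>) * (?Z \<omega> - ?T \<omega>)) + (complex_of_real (1 - ?E l \<omega>) + complex_of_real (1 - ?E l \<omega>) * (?Z \<omega> - 1)) \<partial>M)"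
      by (intro Bochner_Integration.integral_cong refl) (simp add: algebra_simps)
    also have "\<dots> = ((\<integral>\<omega>. complex_of_real (?E l \<omega>) * ?T \<omega> \<partial>M) + (\<integral>\<omega>. complex_of_real (?E l \<omega>) * (?Z \<omega> - ?T \<omega>) \<partial>M))
      + ((\<integral>\<omega>. complex_of_real (1 - ?E l \<omega>) \<partial>M) + (\<integral>\<omega>. complex_of_real (1 - ?E l \<omega>) * (?Z \<omega> - 1) \<partial>M))"
      using I1 I2 I3 I4 I5 by (simp only: Bochner_Integration.integral_add Bochner_Integration.integrable_add)
    finally have Z: "(\<integral>\<omega>. ?Z \<omega> \<partial>M) = ((\<integral>\<omega>. complex_of_real (?E l \<omega>) * ?T \<omega> \<partial>M) + (\<integral>\<omega>. complex_of_real (?E l \<omega>) * (?Z \<omega> - ?T \<omega>) \<partial>M))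
      + ((\<integral>\<omega>. complex_of_real (1 - ?E l \<omega>) \<partial>M) + (\<integral>\<omega>. complex_of_real (1 - ?E l \<omega>) * (?Z \<omega> - 1) \<partial>M))" .
    have A1: "cmod (\<integral>\<omega>. complex_of_real (?E l \<omega>) * (?Z \<omega> - ?T \<omega>) \<partial>M) \<le> t l"
      unfolding t_def by (rule order_trans[OF integral_norm_bound]) (simp add: norm_mult)
    have A2: "cmod (\<integral>\<omega>. complex_of_real (1 - ?E l \<omega>) * (?Z \<omega> - 1) \<partial>M) \<le> 2 * (w l + u l)"
    proof -
      have "cmod (\<integral>\<omega>. complex_of_real (1 - ?E l \<omega>) * (?Z \<omega> - 1) \<partial>M) \<le> (\<integral>\<omega>. cmod (complex_of_real (1 - ?E l \<omega>) * (?Z \<omega> - 1)) \<partial>M)"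
        by (rule integral_norm_bound)
      also have "\<dots> \<le> (\<integral>\<omega>. 2 * (\<bar>?N l \<omega> - ?W \<omega>\<bar> + \<bar>?E l \<omega> - ?W \<omega>\<bar>) \<partial>M)"
      proof (rule integral_mono[OF integrable_norm[OF I5] integrable_mult_right[OF Bochner_Integration.integrable_add[OF wI uI]]])
        fix \<omega>
        show "cmod (complex_of_real (1 - ?E l \<omega>) * (?Z \<omega> - 1)) \<le> 2 * (\<bar>?N l \<omega> - ?W \<omega>\<bar> + \<bar>?E l \<omega> - ?W \<omega>\<bar>)"
        \<comment> \<open>On \<open>Ev \<delta> l\<close> the left factor is 0, and without a living
          cell in generation \<open>l + r\<close> the vector \<open>Zn\<close> is 0. In the
          remaining case \<open>?N\<close> is 1 and \<open>?E\<close> is 0, so one of them differs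
          from \<open>?W\<close> and the right side is at least 2.\<close>
        proof (cases "\<omega> \<in> Ev \<delta> l \<or> \<not> N1 (l + r) \<omega> > 0")
          case True then show ?thesis by (cases "\<omega> \<in> Ev \<delta> l") (auto simp: inner_Zn)
        next
          case False then show ?thesis using d2(2)[of \<omega>] by (simp add: of_bool_def norm_mult)
        qed
      qed
      also have "\<dots> = 2 * (w l + u l)"
        unfolding u_def w_def integral_mult_right_zero Bochner_Integration.integral_add[OF wI uI] ..
      finally show ?thesis .
    qed
    have PE: "(\<integral>\<omega>. complex_of_real (1 - ?E l \<omega>) \<partial>M) = complex_of_real (1 - prob (Ev \<delta> l))"
    proof -
      have "(\<integral>\<omega>. 1 - ?E l \<omega> \<partial>M) = 1 - prob (Ev \<delta> l)"
        by (subst Bochner_Integration.integral_diff) (auto intro!: bI simp: prob_space)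
      then show ?thesis unfolding integral_complex_of_real by (rule arg_cong)
    qed
    have WI: "(\<integral>\<omega>. ?W \<omega> \<partial>M) = prob {\<omega>\<in>space M. pop_limit P X \<omega> \<noteq> 0}"
    proof -
      have "(\<integral>\<omega>. ?W \<omega> \<partial>M) = (\<integral>\<omega>. indicator {\<omega>\<in>space M. pop_limit P X \<omega> \<noteq> 0} \<omega> \<partial>M)"
        by (intro Bochner_Integration.integral_cong refl) (simp add: indicator_def)
      also have "\<dots> = measure M ({\<omega>\<in>space M. pop_limit P X \<omega> \<noteq> 0} \<inter> space M)" by (rule Bochner_Integration.integral_indicator)
      also have "{\<omega>\<in>space M. pop_limit P X \<omega> \<noteq> 0} \<inter> space M = {\<omega>\<in>space M. pop_limit P X \<omega> \<noteq> 0}" by blast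
      finally show ?thesis .
    qed
    have PW: "\<bar>prob (Ev \<delta> l) - prob {\<omega>\<in>space M. pop_limit P X \<omega> \<noteq> 0}\<bar> \<le> u l"
    proof -
      have "prob (Ev \<delta> l) - prob {\<omega>\<in>space M. pop_limit P X \<omega> \<noteq> 0} = (\<integral>\<omega>. ?E l \<omega> - ?W \<omega> \<partial>M)"
      proof -
        have "integrable M (?E l)" "integrable M ?W" by (rule bI; auto simp: indicator_def of_bool_def)+
        then have "(\<integral>\<omega>. ?E l \<omega> - ?W \<omega> \<partial>M) = (\<integral>\<omega>. ?E l \<omega> \<partial>M) - (\<integral>\<omega>. ?W \<omega> \<partial>M)"
          by (rule Bochner_Integration.integral_diff)
        moreover have "(\<integral>\<omega>. ?E l \<omega> \<partial>M) = prob (Ev \<delta> l)" by simp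
        ultimately show ?thesis unfolding WI by (simp only:)
      qed
      also have "\<bar>\<dots>\<bar> \<le> u l" unfolding u_def by (rule integral_abs_bound)
      finally show ?thesis .
    qed
    have P0: "prob {\<omega>\<in>space M. pop_limit P X \<omega> = 0} = 1 - prob {\<omega>\<in>space M. pop_limit P X \<omega> \<noteq> 0}"
    proof -
      have "{\<omega>\<in>space M. pop_limit P X \<omega> = 0} = space M - {\<omega>\<in>space M. pop_limit P X \<omega> \<noteq> 0}" by blast
      then show ?thesis using prob_compl[of "{\<omega>\<in>space M. pop_limit P X \<omega> \<noteq> 0}"] by simp
    qed
    define pe pw where "pe = prob (Ev \<delta> l)" and "pw = prob {\<omega>\<in>space M. pop_limit P X \<omega> \<noteq> 0}"
    define i1 i2 i3 where "i1 = (\<integral>\<omega>. complex_of_real (?E l \<omega>) * ?T \<omega> \<partial>M)" and "i2 = (\<integral>\<omega>. complex_of_real (?E l \<omega>) * (?Z \<omega> - ?T \<omega>) \<partial>M)"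
      and "i3 = (\<integral>\<omega>. complex_of_real (1 - ?E l \<omega>) * (?Z \<omega> - 1) \<partial>M)"
    \<comment> \<open>Mass missing from the cut-off event counts with value 1 instead of
      \<open>?c\<close>; this produces the last term with the factor \<open>1 - ?c\<close>.\<close>
    have eq: "(\<integral>\<omega>. ?Z \<omega> \<partial>M) - complex_of_real (prob {\<omega>\<in>space M. pop_limit P X \<omega> = 0} + pw * ?c)
       = (i1 - complex_of_real (?c * pe)) + i2 + i3 + complex_of_real ((pw - pe) * (1 - ?c))"
      unfolding Z PE P0 pe_def[symmetric] pw_def[symmetric] i1_def[symmetric] i2_def[symmetric] i3_def[symmetric]
      by (simp add: algebra_simps)
    have c4: "cmod ((z1 + z2) + z3 + z4) \<le> cmod z1 + cmod z2 + cmod z3 + cmod z4" for z1 z2 z3 z4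
      using norm_triangle_ineq[of "z1 + z2 + z3" z4] norm_triangle_ineq[of "z1 + z2" z3] norm_triangle_ineq[of z1 z2] by linarith
    have oi: "complex_of_real (?E l \<omega>) = indicator (Ev \<delta> l) \<omega>" for \<omega> by (simp add: indicator_def)
    have i1: "cmod (i1 - complex_of_real (?c * pe)) \<le> e" using elim(4) unfolding i1_def pe_def oi .
    have pc: "cmod (complex_of_real ((pw - pe) * (1 - ?c))) \<le> u l"
    proof -
      have "\<bar>(pw - pe) * (1 - ?c)\<bar> \<le> u l * 1"
        unfolding abs_mult using PW c1 by (intro mult_mono) (auto simp: pw_def pe_def abs_minus_commute)
      then show ?thesis unfolding norm_of_real by simp
    qed
    have "cmod ((\<integral>\<omega>. ?Z \<omega> \<partial>M) - complex_of_real (prob {\<omega>\<in>space M. pop_limit P X \<omega> = 0} + pw * ?c)) \<le> e + t l + 2 * (w l + u l) + u l"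
      unfolding eq by (rule order_trans[OF c4]) (intro add_mono i1 pc A1[folded i2_def] A2[folded i3_def])
    also have "\<dots> < e'"
      using elim(1,2,3) e unfolding e_def distrib_left by linarith
    finally show ?case unfolding pw_def .
  qed
  then have "\<forall>\<^sub>F n in sequentially. cmod ((\<integral>\<omega>. iexp (a \<bullet> Zn n \<omega>) \<partial>M) - complex_of_real (prob {\<omega>\<in>space M. pop_limit P X \<omega> = 0}
     + prob {\<omega>\<in>space M. pop_limit P X \<omega> \<noteq> 0} * ?c)) < e'"
    by (rule eventually_sequentially_seg[THEN iffD1])
  then show "\<exists>n0. \<forall>n\<ge>n0. norm ((\<integral>\<omega>. iexp (a \<bullet> Zn n \<omega>) \<partial>M) - complex_of_real (prob {\<omega>\<in>space M. pop_limit P X \<omega> = 0}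
     + prob {\<omega>\<in>space M. pop_limit P X \<omega> \<noteq> 0} * ?c)) < e'"
    unfolding eventually_sequentially .
qed

end

text \<open>The extension is the product of \<open>M\<close> with the Gaussian law built from twelve
  columns, and \<open>G\<close> is the second projection. The first two claims certify that
  \<open>pop_limit\<close> is the limit of the population ratio in both senses.\<close>

theorem proposition6p3:
  fixes M :: "'a measure"
    and X :: "bool list \<Rightarrow> 'a \<Rightarrow> real option"
    and P :: bar_params
  assumes "prob_space M"
    and "admissible P"
    and "bar_process P M X"
    and supercritical: "mean_offspring P > 1"
    and "p_only P False > 0" and "p_only P True > 0"
    and moments: "\<And>k::nat. integrable M (\<lambda>\<omega>. \<bar>cell_val (X [] \<omega>)\<bar> ^ k)"
  shows "(AE \<omega> in M. (\<lambda>q. pop_ratio P X q \<omega>) \<longlonglongrightarrow> pop_limit P X \<omega>) \<and>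
         (\<lambda>q. \<integral>\<^sup>+\<omega>. ennreal ((pop_ratio P X q \<omega> - pop_limit P X \<omega>)\<^sup>2) \<partial>M) \<longlonglongrightarrow> 0 \<and>
         (\<exists>(N :: ('a \<times> (real ^ 11)) measure) (G :: 'a \<times> (real ^ 11) \<Rightarrow> real ^ 11).
            prob_extension M N \<and>
            independent_rvs N (\<lambda>\<omega>. pop_limit P X (fst \<omega>)) G \<and>
            gaussian_vector N G (asym_cov P) \<and>
            converges_in_law M
              (\<lambda>n \<omega>. of_bool (card (gen_alive (\<lambda>i. X i \<omega>) n) > 0) *\<^sub>R
                 (sqrt (real (card (tree_alive (\<lambda>i. X i \<omega>) n))) *\<^sub>R
                   (theta_hat (\<lambda>i. X i \<omega>) n - theta P)))
              N
              (\<lambda>\<omega>. of_bool (pop_limit P X (fst \<omega>) \<noteq> 0) *\<^sub>R G \<omega>))"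
proof -
  interpret prob_space M by fact
  have pos: "0 < p_only P \<delta>" for \<delta> using assms(5,6) by (cases \<delta>) auto
  interpret bar_full M X P
    by unfold_locales (rule assms(2) assms(3) supercritical moments pos)+
  have S: "t \<bullet> (asym_cov P *v t) = cov_form P t" for t by (rule asym_cov_quadratic) (use variance_pos in simp)
  have F: "t \<bullet> (asym_cov P *v t) = (\<Sum>j<12. (t \<bullet> cov_factor P j)\<^sup>2)" for t
    unfolding S by (rule cov_form_factor[OF assms(2) variance_pos])
  note G = gaussian_extension[OF assms(1) measurable_pop_limit transpose_asym_cov F]
  let ?N = "M \<Otimes>\<^sub>M gauss_law 12 (cov_factor P)"
  have "converges_in_law M Zn ?N (\<lambda>\<omega>. of_bool (pop_limit P X (fst \<omega>) \<noteq> 0) *\<^sub>R snd \<omega>)"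
    unfolding converges_in_law_def
  proof (intro conjI allI impI measurable_Zn G(4))
    fix f :: "real ^ 11 \<Rightarrow> real" assume f: "continuous_on UNIV f" "bounded (range f)"
    show "(\<lambda>n. \<integral>\<omega>. f (Zn n \<omega>) \<partial>M) \<longlonglongrightarrow> (\<integral>\<omega>. f (of_bool (pop_limit P X (fst \<omega>) \<noteq> 0) *\<^sub>R snd \<omega>) \<partial>?N)"
    proof (rule char_convergence_imp_bounded_continuous[OF assms(1) _ measurable_Zn G(4) _ f])
      show "prob_space ?N" using G(1) by (simp add: prob_extension_def)
      show "(\<lambda>n. \<integral>\<omega>. iexp (t \<bullet> Zn n \<omega>) \<partial>M) \<longlonglongrightarrow> (\<integral>\<omega>. iexp (t \<bullet> (of_bool (pop_limit P X (fst \<omega>) \<noteq> 0) *\<^sub>R snd \<omega>)) \<partial>?N)" for t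
        unfolding G(5) S by (rule char_limit)
    qed
  qed
  note conv = this[unfolded Zn_def[abs_def]]
  show ?thesis
    by (rule conjI[OF AE_pop_limit conjI[OF pop_ratio_L2]], rule exI[of _ ?N], rule exI[of _ snd],
        rule conjI[OF G(1) conjI[OF G(2) conjI[OF G(3) conv]]])
qed

end
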